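(* Let $(T_0,T,\Lambda)$ be a spatial Coste context. For any $T$-modelled space $(X,P)$, the forgetful functor between slice categories $$\mathbb{A}\text{-}\mathbf{ModSp}/(X,P)\to T_0\text{-}\mathbf{ModSp}/(X,P)$$ has a right adjoint (denoted $\mathrm{Spec}$).
   Context: Logic. $\mathcal L$ is a single-sorted first-order language. Atomic formulas are $\top$, relation symbols applied to terms, and equations between terms; a Horn formula is a finite conjunction of atomic formulas. For a theory $T'$, the $T'$-cartesian formulas form the smallest class containing atomic formulas, closed under finite conjunctions, and containing $\exists v\,\varphi(\mathbf u,v)$ whenever $\varphi$ is $T'$-cartesian and $\varphi(\mathbf u,v)\wedge\varphi(\mathbf u,v')\vdash v=v'$ is provable in $T'$. A cartesian theory is a set of sequents $\varphi\vdash\psi$ admitting a well-founded partial order such that in each axiom both $\varphi$ and $\psi$ are cartesian relative to the subtheory of the axioms preceding it. $T_0\text{-}\mathbf{Mod}$ is the category of set-based $T_0$-models and homomorphisms (maps preserving functions and relations). Coste contexts. A Coste context is a triple $(T_0,T,\Lambda)$ where $T_0$ is a cartesian $\mathcal L$-theory; $\Lambda$ is a set of pairs $(\varphi(\mathbf u),\psi(\mathbf u,\mathbf v))$ of Horn $\mathcal L$-formulas with $T_0\models\psi(\mathbf u,\mathbf v)\vdash\varphi(\mathbf u)$; and $T$ is the coherent theory obtained by adding to $T_0$ some axioms of the form $\varphi(\mathbf u)\vdash\bigvee_i\exists\mathbf v_i\,\psi_i(\mathbf u,\mathbf v_i)$ for finitely many pairs $(\varphi,\psi_i)\in\Lambda$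 (the disjunction may be empty, giving $\varphi\vdash\bot$, in which case $\varphi$ need not occur in $\Lambda$). It is spatial if $T_0\models\psi(\mathbf u,\mathbf v)\wedge\psi(\mathbf u,\mathbf v')\vdash\mathbf v=\mathbf v'$ for every $(\varphi,\psi)\in\Lambda$. Admissibility. A homomorphism $\alpha:A\to B$ of $T_0$-models is admissible if for each $(\varphi,\psi)\in\Lambda$, whenever $A\models\varphi(\mathbf a)$ and $B\models\psi(\alpha(\mathbf a),\mathbf b)$, there is a unique tuple $\mathbf a'\in A$ with $A\models\psi(\mathbf a,\mathbf a')$ and $\alpha(\mathbf a')=\mathbf b$. Modelled spaces. A sheaf of $T_0$-models on a space $X$ is a functor $\mathcal O(X)^{\mathrm{op}}\to T_0\text{-}\mathbf{Mod}$ satisfying the sheaf condition (equivalently, a $T_0$-model in the topos $\mathbf{Sh}(X)$). A $T_0$-modelled space is a pair $(X,P)$ of a topological space and a sheaf of $T_0$-models on it; a morphism $(X,P)\to(Y,Q)$ is a pair $(f,f^\flat)$ with $f:X\to Y$ continuous and $f^\flat:f^*Q\to P$ a morphism of sheaves of $T_0$-models. These form $T_0\text{-}\mathbf{ModSp}$. A $T$-modelled space is a $T_0$-modelled space $(X,P)$ with $P$ a $T$-model in $\mathbf{Sh}(X)$, equivalently every stalk $P_x$ is a $T$-model. $\mathbb{A}\text{-}\mathbf{ModSp}$ is the subcategory of $T_0\text{-}\mathbf{ModSp}$ consisting of $T$-modelled spaces and morphisms $f$ such that $f^\flat$ is admissible, equivalently every stalk map $f^\flat_x:Q_{f(x)}\to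 P_x$ is admissible. *)

theory Defs
  imports "HOL-Analysis.Abstract_Topology" "HOL-Library.Equipollence"
begin

section \<open>Single-sorted first-order languages and coherent formulas\<close>

record ('f, 'r) lang =
  funs :: "'f set"
  rels :: "'r set"
  far :: "'f \<Rightarrow> nat"
  rar :: "'r \<Rightarrow> nat"

text \<open>Variables are de Bruijn indices. A formula in context \<open>n\<close> has its free variables among
  \<open>Var 0, \<dots>, Var (n - 1)\<close>; a tuple of values for the context is a list of length \<open>n\<close>.\<close>

datatype 'f tm = Var nat | Fun 'f "'f tm list"

datatype ('f, 'r) fm =
    Truth
  | Rel 'r "'f tm list"
  | Eqn "'f tm" "'f tm"
  | Conj "('f, 'r) fm" "('f, 'r) fm"
  | Exi "('f, 'r) fm"
  | Falsity
  | Disj "('f, 'r) fm" "('f, 'r) fm"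

fun wf_tm :: "('f, 'r) lang \<Rightarrow> nat \<Rightarrow> 'f tm \<Rightarrow> bool" where
  "wf_tm L n (Var i) \<longleftrightarrow> i < n"
| "wf_tm L n (Fun F ts) \<longleftrightarrow> F \<in> funs L \<and> length ts = far L F \<and> (\<forall>t\<in>set ts. wf_tm L n t)"

fun wf_fm :: "('f, 'r) lang \<Rightarrow> nat \<Rightarrow> ('f, 'r) fm \<Rightarrow> bool" where
  "wf_fm L n Truth \<longleftrightarrow> True"
| "wf_fm L n (Rel R ts) \<longleftrightarrow> R \<in> rels L \<and> length ts = rar L R \<and> (\<forall>t\<in>set ts. wf_tm L n t)"
| "wf_fm L n (Eqn s t) \<longleftrightarrow> wf_tm L n s \<and> wf_tm L n t"
| "wf_fm L n (Conj \<phi> \<psi>) \<longleftrightarrow> wf_fm L n \<phi> \<and> wf_fm L n \<psi>"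
| "wf_fm L n (Exi \<phi>) \<longleftrightarrow> wf_fm L (Suc n) \<phi>"
| "wf_fm L n Falsity \<longleftrightarrow> True"
| "wf_fm L n (Disj \<phi> \<psi>) \<longleftrightarrow> wf_fm L n \<phi> \<and> wf_fm L n \<psi>"

fun atomic :: "('f, 'r) fm \<Rightarrow> bool" where
  "atomic Truth \<longleftrightarrow> True"
| "atomic (Rel R ts) \<longleftrightarrow> True"
| "atomic (Eqn s t) \<longleftrightarrow> True"
| "atomic _ \<longleftrightarrow> False"

inductive horn :: "('f, 'r) lang \<Rightarrow> nat \<Rightarrow> ('f, 'r) fm \<Rightarrow> bool" for L n where
  horn_atomic: "atomic \<phi> \<Longrightarrow> wf_fm L n \<phi> \<Longrightarrow> horn L n \<phi>"
| horn_conj: "horn L n \<phi> \<Longrightarrow> horn L n \<psi> \<Longrightarrow> horn L n (Conj \<phi> \<psi>)"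

fun subst_tm :: "(nat \<Rightarrow> 'f tm) \<Rightarrow> 'f tm \<Rightarrow> 'f tm" where
  "subst_tm \<sigma> (Var i) = \<sigma> i"
| "subst_tm \<sigma> (Fun F ts) = Fun F (map (subst_tm \<sigma>) ts)"

definition under :: "(nat \<Rightarrow> 'f tm) \<Rightarrow> nat \<Rightarrow> 'f tm" where
  "under \<sigma> = case_nat (Var 0) (\<lambda>i. subst_tm (\<lambda>j. Var (Suc j)) (\<sigma> i))"

fun subst :: "(nat \<Rightarrow> 'f tm) \<Rightarrow> ('f, 'r) fm \<Rightarrow> ('f, 'r) fm" where
  "subst \<sigma> Truth = Truth"
| "subst \<sigma> (Rel R ts) = Rel R (map (subst_tm \<sigma>) ts)"
| "subst \<sigma> (Eqn s t) = Eqn (subst_tm \<sigma> s) (subst_tm \<sigma> t)"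
| "subst \<sigma> (Conj \<phi> \<psi>) = Conj (subst \<sigma> \<phi>) (subst \<sigma> \<psi>)"
| "subst \<sigma> (Exi \<phi>) = Exi (subst (under \<sigma>) \<phi>)"
| "subst \<sigma> Falsity = Falsity"
| "subst \<sigma> (Disj \<phi> \<psi>) = Disj (subst \<sigma> \<phi>) (subst \<sigma> \<psi>)"

definition lift :: "nat \<Rightarrow> ('f, 'r) fm \<Rightarrow> ('f, 'r) fm" where
  "lift m = subst (\<lambda>i. Var (i + m))"

definition inst :: "'f tm \<Rightarrow> ('f, 'r) fm \<Rightarrow> ('f, 'r) fm" where
  "inst t = subst (case_nat t Var)"

definition conjs :: "('f, 'r) fm list \<Rightarrow> ('f, 'r) fm" where
  "conjs \<phi>s = foldr Conj \<phi>s Truth"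

definition disjs :: "('f, 'r) fm list \<Rightarrow> ('f, 'r) fm" where
  "disjs \<phi>s = foldr Disj \<phi>s Falsity"


section \<open>Provability, cartesian formulas and cartesian theories\<close>

text \<open>The sequent \<open>(n, \<phi>, \<psi>)\<close> is \<open>\<phi> \<turnstile> \<psi>\<close> in the context of the first \<open>n\<close> variables. Contexts are
  explicit because structures may be empty.\<close>

type_synonym ('f, 'r) sequent = "nat \<times> ('f, 'r) fm \<times> ('f, 'r) fm"

text \<open>The usual sequent calculus of coherent logic (as in Johnstone's Elephant, D1.3).\<close>

inductive derives ::
  "('f, 'r) lang \<Rightarrow> ('f, 'r) sequent set \<Rightarrow> nat \<Rightarrow> ('f, 'r) fm \<Rightarrow> ('f, 'r) fm \<Rightarrow> bool"
  for L T where
  ax: "(n, \<phi>, \<psi>) \<in> T \<Longrightarrow> derives L T n \<phi> \<psi>"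
| identity: "wf_fm L n \<phi> \<Longrightarrow> derives L T n \<phi> \<phi>"
| cut: "derives L T n \<phi> \<psi> \<Longrightarrow> derives L T n \<psi> \<chi> \<Longrightarrow> derives L T n \<phi> \<chi>"
| substitution: "derives L T n \<phi> \<psi> \<Longrightarrow> (\<And>i. i < n \<Longrightarrow> wf_tm L m (\<sigma> i)) \<Longrightarrow>
    derives L T m (subst \<sigma> \<phi>) (subst \<sigma> \<psi>)"
| eq_refl: "wf_tm L n t \<Longrightarrow> derives L T n Truth (Eqn t t)"
| eq_repl: "wf_tm L n s \<Longrightarrow> wf_tm L n t \<Longrightarrow> wf_fm L (Suc n) \<phi> \<Longrightarrow>
    derives L T n (Conj (Eqn s t) (inst s \<phi>)) (inst t \<phi>)"
| truth: "wf_fm L n \<phi> \<Longrightarrow> derives L T n \<phi> Truth"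
| conj1: "wf_fm L n \<phi> \<Longrightarrow> wf_fm L n \<psi> \<Longrightarrow> derives L T n (Conj \<phi> \<psi>) \<phi>"
| conj2: "wf_fm L n \<phi> \<Longrightarrow> wf_fm L n \<psi> \<Longrightarrow> derives L T n (Conj \<phi> \<psi>) \<psi>"
| conjI: "derives L T n \<phi> \<psi> \<Longrightarrow> derives L T n \<phi> \<chi> \<Longrightarrow> derives L T n \<phi> (Conj \<psi> \<chi>)"
| falsity: "wf_fm L n \<phi> \<Longrightarrow> derives L T n Falsity \<phi>"
| disj1: "wf_fm L n \<phi> \<Longrightarrow> wf_fm L n \<psi> \<Longrightarrow> derives L T n \<phi> (Disj \<phi> \<psi>)"
| disj2: "wf_fm L n \<phi> \<Longrightarrow> wf_fm L n \<psi> \<Longrightarrow> derives L T n \<psi> (Disj \<phi> \<psi>)"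
| disjE: "derives L T n \<phi> \<chi> \<Longrightarrow> derives L T n \<psi> \<chi> \<Longrightarrow> derives L T n (Disj \<phi> \<psi>) \<chi>"
| distrib: "wf_fm L n \<phi> \<Longrightarrow> wf_fm L n \<psi> \<Longrightarrow> wf_fm L n \<chi> \<Longrightarrow>
    derives L T n (Conj \<phi> (Disj \<psi> \<chi>)) (Disj (Conj \<phi> \<psi>) (Conj \<phi> \<chi>))"
| ex_left: "wf_fm L n \<psi> \<Longrightarrow> derives L T (Suc n) \<phi> (lift 1 \<psi>) \<Longrightarrow> derives L T n (Exi \<phi>) \<psi>"
| ex_right: "wf_fm L n \<psi> \<Longrightarrow> derives L T n (Exi \<phi>) \<psi> \<Longrightarrow> derives L T (Suc n) \<phi> (lift 1 \<psi>)"
| frobenius: "wf_fm L n \<phi> \<Longrightarrow> wf_fm L (Suc n) \<psi> \<Longrightarrow>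
    derives L T n (Conj \<phi> (Exi \<psi>)) (Exi (Conj (lift 1 \<phi>) \<psi>))"

text \<open>A formula \<open>\<psi>(u, v)\<close> with \<open>v\<close> an \<open>m\<close>-tuple and \<open>u\<close> an \<open>n\<close>-tuple lives in context
  \<open>m + n\<close>: \<open>v\<close> occupies the indices below \<open>m\<close>, and \<open>u\<close> the next \<open>n\<close>, so that \<open>\<exists>v. \<psi>\<close> is
  \<open>(Exi ^^ m) \<psi>\<close>. Below, \<open>v'\<close>, \<open>v\<close>, \<open>u\<close> occupy the indices of \<open>m + (m + n)\<close> in this order.\<close>

definition provably_unique ::
  "('f, 'r) lang \<Rightarrow> ('f, 'r) sequent set \<Rightarrow> nat \<Rightarrow> nat \<Rightarrow> ('f, 'r) fm \<Rightarrow> bool" where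
  "provably_unique L T n m \<psi> \<longleftrightarrow>
     derives L T (m + (m + n))
       (Conj (lift m \<psi>) (subst (\<lambda>i. if i < m then Var i else Var (i + m)) \<psi>))
       (conjs (map (\<lambda>j. Eqn (Var (m + j)) (Var j)) [0..<m]))"

inductive cartesian_fm ::
  "('f, 'r) lang \<Rightarrow> ('f, 'r) sequent set \<Rightarrow> nat \<Rightarrow> ('f, 'r) fm \<Rightarrow> bool" for L T where
  cart_atomic: "atomic \<phi> \<Longrightarrow> wf_fm L n \<phi> \<Longrightarrow> cartesian_fm L T n \<phi>"
| cart_conj: "cartesian_fm L T n \<phi> \<Longrightarrow> cartesian_fm L T n \<psi> \<Longrightarrow> cartesian_fm L T n (Conj \<phi> \<psi>)"
| cart_ex: "cartesian_fm L T (Suc n) \<phi> \<Longrightarrow> provably_unique L T n 1 \<phi> \<Longrightarrow>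
    cartesian_fm L T n (Exi \<phi>)"

definition cartesian_theory :: "('f, 'r) lang \<Rightarrow> ('f, 'r) sequent set \<Rightarrow> bool" where
  "cartesian_theory L T \<longleftrightarrow>
     (\<exists>ord. partial_order_on T ord \<and> wf (ord - Id) \<and>
        (\<forall>(n, \<phi>, \<psi>)\<in>T.
           cartesian_fm L {s \<in> T. (s, (n, \<phi>, \<psi>)) \<in> ord - Id} n \<phi> \<and>
           cartesian_fm L {s \<in> T. (s, (n, \<phi>, \<psi>)) \<in> ord - Id} n \<psi>))"


section \<open>Set-based models\<close>

record ('f, 'r, 'a) struct =
  univ :: "'a set"
  funI :: "'f \<Rightarrow> 'a list \<Rightarrow> 'a"
  relI :: "'r \<Rightarrow> 'a list \<Rightarrow> bool"

definition tuples :: "nat \<Rightarrow> 'a set \<Rightarrow> 'a list set" where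
  "tuples n A = {xs. length xs = n \<and> set xs \<subseteq> A}"

definition is_struct :: "('f, 'r) lang \<Rightarrow> ('f, 'r, 'a) struct \<Rightarrow> bool" where
  "is_struct L M \<longleftrightarrow> (\<forall>F\<in>funs L. \<forall>xs\<in>tuples (far L F) (univ M). funI M F xs \<in> univ M)"

fun val :: "('f, 'r, 'a) struct \<Rightarrow> 'a list \<Rightarrow> 'f tm \<Rightarrow> 'a" where
  "val M xs (Var i) = xs ! i"
| "val M xs (Fun F ts) = funI M F (map (val M xs) ts)"

fun sat :: "('f, 'r, 'a) struct \<Rightarrow> 'a list \<Rightarrow> ('f, 'r) fm \<Rightarrow> bool" where
  "sat M xs Truth \<longleftrightarrow> True"
| "sat M xs (Rel R ts) \<longleftrightarrow> relI M R (map (val M xs) ts)"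
| "sat M xs (Eqn s t) \<longleftrightarrow> val M xs s = val M xs t"
| "sat M xs (Conj \<phi> \<psi>) \<longleftrightarrow> sat M xs \<phi> \<and> sat M xs \<psi>"
| "sat M xs (Exi \<phi>) \<longleftrightarrow> (\<exists>x\<in>univ M. sat M (x # xs) \<phi>)"
| "sat M xs Falsity \<longleftrightarrow> False"
| "sat M xs (Disj \<phi> \<psi>) \<longleftrightarrow> sat M xs \<phi> \<or> sat M xs \<psi>"

definition model :: "('f, 'r) lang \<Rightarrow> ('f, 'r) sequent set \<Rightarrow> ('f, 'r, 'a) struct \<Rightarrow> bool" where
  "model L T M \<longleftrightarrow> is_struct L M \<and>
     (\<forall>(n, \<phi>, \<psi>)\<in>T. \<forall>xs\<in>tuples n (univ M). sat M xs \<phi> \<longrightarrow> sat M xs \<psi>)"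

definition homom ::
  "('f, 'r) lang \<Rightarrow> ('f, 'r, 'a) struct \<Rightarrow> ('f, 'r, 'b) struct \<Rightarrow> ('a \<Rightarrow> 'b) \<Rightarrow> bool" where
  "homom L A B h \<longleftrightarrow> h ` univ A \<subseteq> univ B \<and>
     (\<forall>F\<in>funs L. \<forall>xs\<in>tuples (far L F) (univ A). h (funI A F xs) = funI B F (map h xs)) \<and>
     (\<forall>R\<in>rels L. \<forall>xs\<in>tuples (rar L R) (univ A). relI A R xs \<longrightarrow> relI B R (map h xs))"


section \<open>Coste contexts and admissible homomorphisms\<close>

text \<open>\<open>(n, \<phi>, m, \<psi>)\<close> is the pair \<open>(\<phi>(u), \<psi>(u, v))\<close> with \<open>u\<close> of length \<open>n\<close> and \<open>v\<close> of length \<open>m\<close>.\<close>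

type_synonym ('f, 'r) horn_pair = "nat \<times> ('f, 'r) fm \<times> nat \<times> ('f, 'r) fm"

text \<open>\<open>\<phi>(u) \<turnstile> \<Or>\<^sub>i \<exists>v\<^sub>i. \<psi>\<^sub>i(u, v\<^sub>i)\<close>, where the list holds the \<open>\<psi>\<^sub>i\<close> with the lengths of the \<open>v\<^sub>i\<close>.\<close>

definition cover_axiom ::
  "nat \<Rightarrow> ('f, 'r) fm \<Rightarrow> (nat \<times> ('f, 'r) fm) list \<Rightarrow> ('f, 'r) sequent" where
  "cover_axiom n \<phi> ps = (n, \<phi>, disjs (map (\<lambda>(m, \<psi>). (Exi ^^ m) \<psi>) ps))"

definition coste_context ::
  "('f, 'r) lang \<Rightarrow> ('f, 'r) sequent set \<Rightarrow> ('f, 'r) sequent set \<Rightarrow> ('f, 'r) horn_pair set \<Rightarrow> bool"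
  where
  "coste_context L T0 T \<Lambda> \<longleftrightarrow>
     cartesian_theory L T0 \<and>
     (\<forall>(n, \<phi>, m, \<psi>)\<in>\<Lambda>. horn L n \<phi> \<and> horn L (m + n) \<psi> \<and> derives L T0 (m + n) \<psi> (lift m \<phi>)) \<and>
     (\<exists>Ax. (\<forall>(n, \<phi>, ps)\<in>Ax. horn L n \<phi> \<and> (\<forall>(m, \<psi>)\<in>set ps. (n, \<phi>, m, \<psi>) \<in> \<Lambda>)) \<and>
        T = T0 \<union> (\<lambda>(n, \<phi>, ps). cover_axiom n \<phi> ps) ` Ax)"

definition spatial_coste_context ::
  "('f, 'r) lang \<Rightarrow> ('f, 'r) sequent set \<Rightarrow> ('f, 'r) sequent set \<Rightarrow> ('f, 'r) horn_pair set \<Rightarrow> bool"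
  where
  "spatial_coste_context L T0 T \<Lambda> \<longleftrightarrow>
     coste_context L T0 T \<Lambda> \<and> (\<forall>(n, \<phi>, m, \<psi>)\<in>\<Lambda>. provably_unique L T0 n m \<psi>)"

definition admissible ::
  "('f, 'r) horn_pair set \<Rightarrow> ('f, 'r, 'a) struct \<Rightarrow> ('f, 'r, 'b) struct \<Rightarrow> ('a \<Rightarrow> 'b) \<Rightarrow> bool"
  where
  "admissible \<Lambda> A B \<alpha> \<longleftrightarrow>
     (\<forall>(n, \<phi>, m, \<psi>)\<in>\<Lambda>. \<forall>a\<in>tuples n (univ A). \<forall>b\<in>tuples m (univ B).
        sat A a \<phi> \<and> sat B (b @ map \<alpha> a) \<psi> \<longrightarrow>
        (\<exists>!a'. a' \<in> tuples m (univ A) \<and> sat A (a' @ a) \<psi> \<and> map \<alpha> a' = b))"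


section \<open>Sheaves of models\<close>

text \<open>\<open>res P U V\<close> is the restriction map \<open>P(U) \<rightarrow> P(V)\<close> for \<open>V \<subseteq> U\<close>.\<close>

record ('f, 'r, 'p, 'e) presheaf =
  sec :: "'p set \<Rightarrow> ('f, 'r, 'e) struct"
  res :: "'p set \<Rightarrow> 'p set \<Rightarrow> 'e \<Rightarrow> 'e"

definition presheaf_of_models ::
  "('f, 'r) lang \<Rightarrow> ('f, 'r) sequent set \<Rightarrow> 'p topology \<Rightarrow> ('f, 'r, 'p, 'e) presheaf \<Rightarrow> bool" where
  "presheaf_of_models L T0 X P \<longleftrightarrow>
     (\<forall>U. openin X U \<longrightarrow> model L T0 (sec P U)) \<and>
     (\<forall>U V. openin X U \<and> openin X V \<and> V \<subseteq> U \<longrightarrow> homom L (sec P U) (sec P V) (res P U V)) \<and>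
     (\<forall>U. openin X U \<longrightarrow> (\<forall>s\<in>univ (sec P U). res P U U s = s)) \<and>
     (\<forall>U V W. openin X U \<and> openin X V \<and> openin X W \<and> W \<subseteq> V \<and> V \<subseteq> U \<longrightarrow>
        (\<forall>s\<in>univ (sec P U). res P V W (res P U V s) = res P U W s))"

text \<open>The sheaf condition says that \<open>P(\<Union>\<C>)\<close> is the limit, in the category of models, of the
  \<open>P(V)\<close>, \<open>V \<in> \<C>\<close>, and the \<open>P(V \<inter> W)\<close>. Limits of models are computed on underlying sets with
  relations holding componentwise, so relations are required to be local as well. The family \<open>\<C>\<close>
  may be empty.\<close>

definition sheaf_of_models ::
  "('f, 'r) lang \<Rightarrow> ('f, 'r) sequent set \<Rightarrow> 'p topology \<Rightarrow> ('f, 'r, 'p, 'e) presheaf \<Rightarrow> bool" where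
  "sheaf_of_models L T0 X P \<longleftrightarrow>
     presheaf_of_models L T0 X P \<and>
     (\<forall>\<C>. (\<forall>V\<in>\<C>. openin X V) \<longrightarrow>
        (\<forall>s. (\<forall>V\<in>\<C>. s V \<in> univ (sec P V)) \<and>
             (\<forall>V\<in>\<C>. \<forall>W\<in>\<C>. res P V (V \<inter> W) (s V) = res P W (V \<inter> W) (s W)) \<longrightarrow>
             (\<exists>!t. t \<in> univ (sec P (\<Union>\<C>)) \<and> (\<forall>V\<in>\<C>. res P (\<Union>\<C>) V t = s V))) \<and>
        (\<forall>R\<in>rels L. \<forall>ts\<in>tuples (rar L R) (univ (sec P (\<Union>\<C>))).
             (\<forall>V\<in>\<C>. relI (sec P V) R (map (res P (\<Union>\<C>) V) ts)) \<longrightarrow>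
             relI (sec P (\<Union>\<C>)) R ts))"

definition germ ::
  "'p topology \<Rightarrow> ('f, 'r, 'p, 'e) presheaf \<Rightarrow> 'p \<Rightarrow> 'p set \<Rightarrow> 'e \<Rightarrow> ('p set \<times> 'e) set" where
  "germ X P x U s =
     {(V, t). openin X V \<and> x \<in> V \<and> t \<in> univ (sec P V) \<and>
        (\<exists>W. openin X W \<and> x \<in> W \<and> W \<subseteq> U \<inter> V \<and> res P U W s = res P V W t)}"

text \<open>The stalk \<open>P\<^sub>x\<close> is the filtered colimit of the \<open>P(U)\<close>, \<open>x \<in> U\<close>: operations and relations are
  evaluated on representatives over a common neighbourhood.\<close>

definition stalk ::
  "'p topology \<Rightarrow> ('f, 'r, 'p, 'e) presheaf \<Rightarrow> 'p \<Rightarrow> ('f, 'r, ('p set \<times> 'e) set) struct" where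
  "stalk X P x =
     \<lparr> univ = {germ X P x U s | U s. openin X U \<and> x \<in> U \<and> s \<in> univ (sec P U)},
       funI = (\<lambda>F gs. THE g. \<exists>U ss. openin X U \<and> x \<in> U \<and> set ss \<subseteq> univ (sec P U) \<and>
          gs = map (germ X P x U) ss \<and> g = germ X P x U (funI (sec P U) F ss)),
       relI = (\<lambda>R gs. \<exists>U ss. openin X U \<and> x \<in> U \<and> set ss \<subseteq> univ (sec P U) \<and>
          gs = map (germ X P x U) ss \<and> relI (sec P U) R ss) \<rparr>"

text \<open>The inverse image \<open>f\<^sup>*Q\<close>: its sections over \<open>U\<close> are the functions \<open>x \<mapsto> s(x) \<in> Q\<^bsub>f(x)\<^esub>\<close> on \<open>U\<close>
  that are locally given by sections of \<open>Q\<close>; operations and relations are pointwise.\<close>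

definition pullback ::
  "'x topology \<Rightarrow> ('x \<Rightarrow> 'y) \<Rightarrow> 'y topology \<Rightarrow> ('f, 'r, 'y, 'e) presheaf \<Rightarrow>
   ('f, 'r, 'x, 'x \<Rightarrow> ('y set \<times> 'e) set) presheaf" where
  "pullback X f Y Q =
     \<lparr> sec = (\<lambda>U.
         \<lparr> univ = {s \<in> extensional U. \<forall>x\<in>U. \<exists>V W t. openin X V \<and> x \<in> V \<and> V \<subseteq> U \<and>
              openin Y W \<and> f ` V \<subseteq> W \<and> t \<in> univ (sec Q W) \<and>
              (\<forall>x'\<in>V. s x' = germ Y Q (f x') W t)},
           funI = (\<lambda>F ss. \<lambda>x\<in>U. funI (stalk Y Q (f x)) F (map (\<lambda>s. s x) ss)),
           relI = (\<lambda>R ss. \<forall>x\<in>U. relI (stalk Y Q (f x)) R (map (\<lambda>s. s x) ss)) \<rparr>),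
       res = (\<lambda>U V s. restrict s V) \<rparr>"

text \<open>Maps are extensional (undefined outside their domain), so that equality of HOL functions is
  equality of morphisms.\<close>

definition sheaf_mor ::
  "('f, 'r) lang \<Rightarrow> 'p topology \<Rightarrow> ('f, 'r, 'p, 'e) presheaf \<Rightarrow> ('f, 'r, 'p, 'd) presheaf \<Rightarrow>
   ('p set \<Rightarrow> 'e \<Rightarrow> 'd) \<Rightarrow> bool" where
  "sheaf_mor L X P Q h \<longleftrightarrow>
     h \<in> extensional {U. openin X U} \<and>
     (\<forall>U. openin X U \<longrightarrow> h U \<in> extensional (univ (sec P U)) \<and> homom L (sec P U) (sec Q U) (h U)) \<and>
     (\<forall>U V. openin X U \<and> openin X V \<and> V \<subseteq> U \<longrightarrow>
        (\<forall>s\<in>univ (sec P U). h V (res P U V s) = res Q U V (h U s)))"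

text \<open>The map \<open>Q\<^bsub>f(x)\<^esub> \<rightarrow> P\<^sub>x\<close> induced by \<open>\<phi> : f\<^sup>*Q \<rightarrow> P\<close>, where a germ of \<open>f\<^sup>*Q\<close> at \<open>x\<close> is
  identified with its value in \<open>Q\<^bsub>f(x)\<^esub>\<close>.\<close>

definition stalk_map ::
  "'x topology \<Rightarrow> ('f, 'r, 'x, 'd) presheaf \<Rightarrow> ('x \<Rightarrow> 'y) \<Rightarrow> 'y topology \<Rightarrow>
   ('f, 'r, 'y, 'e) presheaf \<Rightarrow> ('x set \<Rightarrow> ('x \<Rightarrow> ('y set \<times> 'e) set) \<Rightarrow> 'd) \<Rightarrow>
   'x \<Rightarrow> ('y set \<times> 'e) set \<Rightarrow> ('x set \<times> 'd) set" where
  "stalk_map X P f Y Q \<phi> x g =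
     (THE h. \<exists>U s. openin X U \<and> x \<in> U \<and> s \<in> univ (sec (pullback X f Y Q) U) \<and> s x = g \<and>
        h = germ X P x U (\<phi> U s))"


section \<open>Categories, slices and right adjoints\<close>

text \<open>Hom-sets need not be disjoint; \<open>Comp C a b c g f\<close> is \<open>g \<circ> f\<close> for \<open>f : a \<rightarrow> b\<close>, \<open>g : b \<rightarrow> c\<close>.\<close>

record ('o, 'm) cat =
  Obj :: "'o set"
  Hom :: "'o \<Rightarrow> 'o \<Rightarrow> 'm set"
  Idn :: "'o \<Rightarrow> 'm"
  Comp :: "'o \<Rightarrow> 'o \<Rightarrow> 'o \<Rightarrow> 'm \<Rightarrow> 'm \<Rightarrow> 'm"

definition category :: "('o, 'm) cat \<Rightarrow> bool" where
  "category C \<longleftrightarrow>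
     (\<forall>a\<in>Obj C. Idn C a \<in> Hom C a a) \<and>
     (\<forall>a\<in>Obj C. \<forall>b\<in>Obj C. \<forall>c\<in>Obj C. \<forall>f\<in>Hom C a b. \<forall>g\<in>Hom C b c.
        Comp C a b c g f \<in> Hom C a c) \<and>
     (\<forall>a\<in>Obj C. \<forall>b\<in>Obj C. \<forall>f\<in>Hom C a b.
        Comp C a a b f (Idn C a) = f \<and> Comp C a b b (Idn C b) f = f) \<and>
     (\<forall>a\<in>Obj C. \<forall>b\<in>Obj C. \<forall>c\<in>Obj C. \<forall>d\<in>Obj C.
        \<forall>f\<in>Hom C a b. \<forall>g\<in>Hom C b c. \<forall>h\<in>Hom C c d.
        Comp C a b d (Comp C b c d h g) f = Comp C a c d h (Comp C a b c g f))"

type_synonym ('o, 'm, 'o2, 'm2) fctr = "('o \<Rightarrow> 'o2) \<times> ('o \<Rightarrow> 'o \<Rightarrow> 'm \<Rightarrow> 'm2)"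

definition is_functor ::
  "('o, 'm) cat \<Rightarrow> ('o2, 'm2) cat \<Rightarrow> ('o, 'm, 'o2, 'm2) fctr \<Rightarrow> bool" where
  "is_functor C D F \<longleftrightarrow> category C \<and> category D \<and>
     (\<forall>a\<in>Obj C. fst F a \<in> Obj D) \<and>
     (\<forall>a\<in>Obj C. \<forall>b\<in>Obj C. \<forall>f\<in>Hom C a b. snd F a b f \<in> Hom D (fst F a) (fst F b)) \<and>
     (\<forall>a\<in>Obj C. snd F a a (Idn C a) = Idn D (fst F a)) \<and>
     (\<forall>a\<in>Obj C. \<forall>b\<in>Obj C. \<forall>c\<in>Obj C. \<forall>f\<in>Hom C a b. \<forall>g\<in>Hom C b c.
        snd F a c (Comp C a b c g f) =
        Comp D (fst F a) (fst F b) (fst F c) (snd F b c g) (snd F a b f))"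

definition full_subcat :: "('o, 'm) cat \<Rightarrow> 'o set \<Rightarrow> ('o, 'm) cat" where
  "full_subcat C S = C\<lparr>Obj := S\<rparr>"

text \<open>A right adjoint \<open>G\<close> to \<open>F : C \<rightarrow> D\<close> that is only defined on the full subcategory of \<open>D\<close> on
  \<open>S\<close>, with its natural bijections \<open>D(F c, d) \<cong> C(c, G d)\<close> for \<open>c\<close> in \<open>C\<close> and \<open>d\<close> in \<open>S\<close>.
  For \<open>S = Obj D\<close> this is a right adjoint in the ordinary sense.\<close>

definition has_right_adjoint_on ::
  "('o, 'm) cat \<Rightarrow> ('o2, 'm2) cat \<Rightarrow> ('o, 'm, 'o2, 'm2) fctr \<Rightarrow> 'o2 set \<Rightarrow> bool" where
  "has_right_adjoint_on C D F S \<longleftrightarrow>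
     is_functor C D F \<and> S \<subseteq> Obj D \<and>
     (\<exists>(G :: ('o2, 'm2, 'o, 'm) fctr) (\<Phi> :: 'o \<Rightarrow> 'o2 \<Rightarrow> 'm2 \<Rightarrow> 'm).
        is_functor (full_subcat D S) C G \<and>
        (\<forall>c\<in>Obj C. \<forall>d\<in>S. bij_betw (\<Phi> c d) (Hom D (fst F c) d) (Hom C c (fst G d))) \<and>
        (\<forall>c\<in>Obj C. \<forall>c'\<in>Obj C. \<forall>d\<in>S. \<forall>h\<in>Hom C c' c. \<forall>k\<in>Hom D (fst F c) d.
           \<Phi> c' d (Comp D (fst F c') (fst F c) d k (snd F c' c h)) =
           Comp C c' c (fst G d) (\<Phi> c d k) h) \<and>
        (\<forall>c\<in>Obj C. \<forall>d\<in>S. \<forall>d'\<in>S. \<forall>k\<in>Hom D (fst F c) d. \<forall>l\<in>Hom D d d'.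
           \<Phi> c d' (Comp D (fst F c) d d' l k) =
           Comp C c (fst G d) (fst G d') (snd G d d' l) (\<Phi> c d k)))"

definition has_right_adjoint ::
  "('o, 'm) cat \<Rightarrow> ('o2, 'm2) cat \<Rightarrow> ('o, 'm, 'o2, 'm2) fctr \<Rightarrow> bool" where
  "has_right_adjoint C D F \<longleftrightarrow> has_right_adjoint_on C D F (Obj D)"

definition slice :: "('o, 'm) cat \<Rightarrow> 'o \<Rightarrow> ('o \<times> 'm, 'm) cat" where
  "slice C x =
     \<lparr> Obj = {(a, p). a \<in> Obj C \<and> p \<in> Hom C a x},
       Hom = (\<lambda>(a, p) (b, q). {h \<in> Hom C a b. Comp C a b x q h = p}),
       Idn = (\<lambda>(a, p). Idn C a),
       Comp = (\<lambda>(a, p) (b, q) (c, r) g f. Comp C a b c g f) \<rparr>"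

text \<open>The functor acting as the identity on objects and morphisms.\<close>

definition forgetful :: "('o, 'm, 'o, 'm) fctr" where
  "forgetful = (\<lambda>a. a, \<lambda>a b f. f)"


section \<open>Modelled spaces\<close>

type_synonym ('f, 'r, 'p, 'e) mspace = "'p topology \<times> ('f, 'r, 'p, 'e) presheaf"

text \<open>A morphism is \<open>(f, \<phi>)\<close> with \<open>\<phi> : f\<^sup>*Q \<rightarrow> P\<close>.\<close>

type_synonym ('p, 'e) mmor =
  "('p \<Rightarrow> 'p) \<times> ('p set \<Rightarrow> ('p \<Rightarrow> ('p set \<times> 'e) set) \<Rightarrow> 'e)"

fun T0_modelled_space ::
  "('f, 'r) lang \<Rightarrow> ('f, 'r) sequent set \<Rightarrow> ('f, 'r, 'p, 'e) mspace \<Rightarrow> bool" where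
  "T0_modelled_space L T0 (X, P) \<longleftrightarrow> sheaf_of_models L T0 X P"

fun T_modelled_space ::
  "('f, 'r) lang \<Rightarrow> ('f, 'r) sequent set \<Rightarrow> ('f, 'r) sequent set \<Rightarrow> ('f, 'r, 'p, 'e) mspace \<Rightarrow> bool"
  where
  "T_modelled_space L T0 T (X, P) \<longleftrightarrow>
     T0_modelled_space L T0 (X, P) \<and> (\<forall>x\<in>topspace X. model L T (stalk X P x))"

fun ms_hom ::
  "('f, 'r) lang \<Rightarrow> ('f, 'r, 'p, 'e) mspace \<Rightarrow> ('f, 'r, 'p, 'e) mspace \<Rightarrow> ('p, 'e) mmor set" where
  "ms_hom L (X, P) (Y, Q) =
     {(f, \<phi>). f \<in> extensional (topspace X) \<and> continuous_map X Y f \<and>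
        sheaf_mor L X (pullback X f Y Q) P \<phi>}"

text \<open>The identity is given by the canonical isomorphism \<open>id\<^sup>*P \<cong> P\<close>.\<close>

fun ms_id :: "('f, 'r, 'p, 'e) mspace \<Rightarrow> ('p, 'e) mmor" where
  "ms_id (X, P) =
     (\<lambda>x\<in>topspace X. x,
      \<lambda>U\<in>{U. openin X U}. \<lambda>s\<in>univ (sec (pullback X (\<lambda>x\<in>topspace X. x) X P) U).
        THE t. t \<in> univ (sec P U) \<and> (\<forall>x\<in>U. s x = germ X P x U t))"

text \<open>The sheaf part of \<open>(g, \<gamma>) \<circ> (f, \<phi>)\<close> is \<open>(g f)\<^sup>*R \<cong> f\<^sup>*g\<^sup>*R \<rightarrow> f\<^sup>*Q \<rightarrow> P\<close>; the first map is,
  in terms of stalks, \<open>R\<^bsub>g(f(x))\<^esub> \<rightarrow> Q\<^bsub>f(x)\<^esub>\<close>.\<close>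

fun ms_comp ::
  "('f, 'r, 'p, 'e) mspace \<Rightarrow> ('f, 'r, 'p, 'e) mspace \<Rightarrow> ('f, 'r, 'p, 'e) mspace \<Rightarrow>
   ('p, 'e) mmor \<Rightarrow> ('p, 'e) mmor \<Rightarrow> ('p, 'e) mmor" where
  "ms_comp (X, P) (Y, Q) (Z, R) (g, \<gamma>) (f, \<phi>) =
     (compose (topspace X) g f,
      \<lambda>U\<in>{U. openin X U}. \<lambda>s\<in>univ (sec (pullback X (compose (topspace X) g f) Z R) U).
        \<phi> U (\<lambda>x\<in>U. stalk_map Y Q g Z R \<gamma> (f x) (s x)))"

fun ms_admissible ::
  "('f, 'r) horn_pair set \<Rightarrow> ('f, 'r, 'p, 'e) mspace \<Rightarrow> ('f, 'r, 'p, 'e) mspace \<Rightarrow>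
   ('p, 'e) mmor \<Rightarrow> bool" where
  "ms_admissible \<Lambda> (X, P) (Y, Q) (f, \<phi>) \<longleftrightarrow>
     (\<forall>x\<in>topspace X.
        admissible \<Lambda> (stalk Y Q (f x)) (stalk X P x) (stalk_map X P f Y Q \<phi> x))"


section \<open>Size\<close>

text \<open>HOL has no category of all modelled spaces, so size is made explicit. All spaces and sheaves
  live on one type \<open>'u\<close>, and a collection \<open>\<U>\<close> of subsets of \<open>'u\<close> measures size: a set of any type
  is \<open>\<U>\<close>-small if it injects into a member of \<open>\<U>\<close>.\<close>

definition small :: "'u set set \<Rightarrow> 'a set \<Rightarrow> bool" where
  "small \<U> A \<longleftrightarrow> (\<exists>B\<in>\<U>. A \<lesssim> B)"

text \<open>The members of \<open>\<U>\<close> play the role of the sets in a universe. Closure under unions of small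
  families is not needed: in \<open>small_space\<close> the total set of sections is required to be small, which
  follows from smallness of the space and of each set of sections if the universe is closed under
  such unions.\<close>

definition universe :: "'u set set \<Rightarrow> bool" where
  "universe \<U> \<longleftrightarrow> (\<exists>A\<in>\<U>. infinite A) \<and> (\<forall>A\<in>\<U>. small \<U> (Pow A))"

text \<open>HOL does not prove that a universe exists. It does prove that pairs as below exist on
  suitable types, for example with \<open>\<U>\<close> consisting of one infinite set \<open>A\<close> and \<open>\<V>\<close> of one set
  equipollent to \<open>Pow (Pow A)\<close>.\<close>

definition enlargement :: "'u set set \<Rightarrow> 'u set set \<Rightarrow> bool" where
  "enlargement \<U> \<V> \<longleftrightarrow> (\<exists>A\<in>\<U>. infinite A) \<and> (\<forall>A\<in>\<U>. small \<V> (Pow (Pow A)))"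

definition small_lang :: "'u set set \<Rightarrow> ('f, 'r) lang \<Rightarrow> bool" where
  "small_lang \<U> L \<longleftrightarrow> small \<U> (funs L) \<and> small \<U> (rels L)"

fun small_space :: "'u set set \<Rightarrow> ('f, 'r, 'p, 'e) mspace \<Rightarrow> bool" where
  "small_space \<U> (X, P) \<longleftrightarrow>
     small \<U> (topspace X) \<and> small \<U> {(U, s). openin X U \<and> s \<in> univ (sec P U)}"

definition T0_ModSp ::
  "'u set set \<Rightarrow> ('f, 'r) lang \<Rightarrow> ('f, 'r) sequent set \<Rightarrow>
   (('f, 'r, 'u, 'u) mspace, ('u, 'u) mmor) cat" where
  "T0_ModSp \<U> L T0 =
     \<lparr> Obj = {A. T0_modelled_space L T0 A \<and> small_space \<U> A},
       Hom = ms_hom L, Idn = ms_id, Comp = ms_comp \<rparr>"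

definition A_ModSp ::
  "'u set set \<Rightarrow> ('f, 'r) lang \<Rightarrow> ('f, 'r) sequent set \<Rightarrow> ('f, 'r) sequent set \<Rightarrow>
   ('f, 'r) horn_pair set \<Rightarrow> (('f, 'r, 'u, 'u) mspace, ('u, 'u) mmor) cat" where
  "A_ModSp \<U> L T0 T \<Lambda> =
     \<lparr> Obj = {A. T_modelled_space L T0 T A \<and> small_space \<U> A},
       Hom = (\<lambda>A B. {h \<in> ms_hom L A B. ms_admissible \<Lambda> A B h}),
       Idn = ms_id, Comp = ms_comp \<rparr>"

end

theory Submission
  imports Defs
begin

text \<open>
  Call a map out of a \<open>T\<^sub>0\<close>-model etale if it is built by repeatedly adjoining witnesses \<open>v\<close> with
  \<open>\<psi>(u, v)\<close> at tuples satisfying \<open>\<phi>(u)\<close>, for pairs in \<open>\<Lambda>\<close>. Every homomorphism into a \<open>T\<^sub>0\<close>-model \<open>B\<close>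
  factors uniquely into an etale map followed by an admissible one: adjoin exactly the witnesses that
  exist in \<open>B\<close>. If \<open>B\<close> is a \<open>T\<close>-model, then so is the middle object, because admissible maps reflect
  the covering axioms. A point of \<open>Spec(Y, Q)\<close> is a point \<open>y\<close> of \<open>Y\<close> with an etale map from \<open>Q\<^sub>y\<close> to a
  \<open>T\<close>-model \<open>E\<close> such that \<open>P\<^bsub>p(y)\<^esub> \<rightarrow> Q\<^sub>y \<rightarrow> E\<close> is admissible; the stalk there is \<open>E\<close>. A morphism
  \<open>(Z, R) \<rightarrow> (Y, Q)\<close> lifts by factoring all of its stalk maps.

  All witnesses are unique, so every element of \<open>E\<close> is the value of a word built from elements of
  \<open>Q\<^sub>y\<close> by taking witnesses, and \<open>E\<close> is determined by the set of facts (formulas at words) true in it.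
  The facts true in the middle object of a factorization form the least set closed under finitary
  Horn rules, including one that adjoins a witness if it exists in \<open>B\<close>. Since derivations are
  finite, each of these facts persists on a neighbourhood, which makes the lift continuous.
\<close>

section \<open>Semantics of coherent formulas\<close>

text \<open>Spaces and sheaves have to live on the given type \<open>'u\<close>, so a model or a map
  of models cannot itself be a point. A set of facts can be coded: it determines a term model with
  named generators. The names are sections of \<open>Q\<close>, not germs, so one word can be read
  at many nearby points. Hence a basic open set may prescribe facts, and a section of the structure
  sheaf is locally one word.

  Uniqueness of witnesses for the formulas in \<open>K\<close> carries the proof. It gives words at
  most one value, it reduces admissibility to existence of witnesses, and it lets the axioms of
  \<open>T0\<close> pass from values at points to sections. The disjunctions in \<open>T\<close>
  have no such transfer and hold only in stalks.

  The double power set in \<open>enlargement\<close> comes from counting. If an infinite set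
  \<open>A\<close> bounds the language, the base space and its sections, then there are at most
  \<open>A\<close> facts. Points are built from sets of facts, so there are at most
  \<open>Pow A\<close> of them. A section is recorded by a relation between points and words, which
  gives \<open>Pow (Pow A)\<close>.\<close>

lemma tuples_simps [simp]:
  "[] \<in> tuples n A \<longleftrightarrow> n = 0"
  "x # xs \<in> tuples (Suc n) A \<longleftrightarrow> x \<in> A \<and> xs \<in> tuples n A"
  by (auto simp: tuples_def)

lemma tuples_length: "xs \<in> tuples n A \<Longrightarrow> length xs = n"
  by (simp add: tuples_def)

lemma tuples_nth: "xs \<in> tuples n A \<Longrightarrow> i < n \<Longrightarrow> xs ! i \<in> A"
  by (auto simp: tuples_def)

lemma tuples_append: "xs \<in> tuples m A \<Longrightarrow> ys \<in> tuples n A \<Longrightarrow> xs @ ys \<in> tuples (m + n) A"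
  by (auto simp: tuples_def)

lemma tuples_SucE:
  assumes "xs \<in> tuples (Suc n) A"
  obtains y ys where "xs = y # ys" "y \<in> A" "ys \<in> tuples n A"
  using assms by (cases xs) (auto simp: tuples_def)

lemma tuples_snocE:
  assumes "xs \<in> tuples (Suc n) A"
  obtains y ys where "xs = ys @ [y]" "y \<in> A" "ys \<in> tuples n A"
  using assms by (cases xs rule: rev_cases) (auto simp: tuples_def)

lemma val_in_univ:
  assumes "is_struct L M" "xs \<in> tuples n (univ M)"
  shows "wf_tm L n t \<Longrightarrow> val M xs t \<in> univ M"
proof (induction t)
  case (Var i)
  then show ?case using assms(2) tuples_nth by fastforce
next
  case (Fun F ts)
  then have "map (val M xs) ts \<in> tuples (far L F) (univ M)" by (auto simp: tuples_def)
  with Fun.prems assms(1) show ?case by (auto simp: is_struct_def)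
qed

lemma val_subst: "wf_tm L n t \<Longrightarrow> (\<And>i. i < n \<Longrightarrow> val M xs (\<sigma> i) = ys ! i) \<Longrightarrow>
    val M xs (subst_tm \<sigma> t) = val M ys t"
proof (induction t)
  case (Fun F ts)
  then have "map (val M xs) (map (subst_tm \<sigma>) ts) = map (val M ys) ts" by simp
  then show ?case by (simp del: map_map map_eq_conv)
qed auto

text \<open>The hypothesis ranges over all indices, including those beyond the lengths of the lists,
  because \<open>under\<close> shifts terms \<open>\<sigma> i\<close> whose variables are not
  bounded.\<close>

lemma val_rename:
  "(\<And>j. xs ! (\<rho> j) = ys ! j) \<Longrightarrow> val M xs (subst_tm (\<lambda>j. Var (\<rho> j)) t) = val M ys t"
proof (induction t)
  case (Fun F ts)
  then have "map (val M xs) (map (subst_tm (\<lambda>j. Var (\<rho> j))) ts) = map (val M ys) ts" by simp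
  then show ?case by (simp del: map_map map_eq_conv)
qed auto

lemma val_under:
  assumes "\<And>i. i < n \<Longrightarrow> val M xs (\<sigma> i) = ys ! i" "i < Suc n"
  shows "val M (x # xs) (under \<sigma> i) = (x # ys) ! i"
  using assms val_rename[of "x # xs" Suc xs M] by (cases i) (auto simp: under_def)

lemma sat_subst: "wf_fm L n \<phi> \<Longrightarrow> (\<And>i. i < n \<Longrightarrow> val M xs (\<sigma> i) = ys ! i) \<Longrightarrow>
    sat M xs (subst \<sigma> \<phi>) \<longleftrightarrow> sat M ys \<phi>"
proof (induction \<phi> arbitrary: n \<sigma> xs ys)
  case (Rel R ts)
  then have "map (val M xs) (map (subst_tm \<sigma>) ts) = map (val M ys) ts"
    by (auto intro!: val_subst)
  then show ?case by (simp del: map_map map_eq_conv)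
next
  case (Eqn s t)
  then show ?case using val_subst[of L n s M xs \<sigma> ys] val_subst[of L n t M xs \<sigma> ys] by simp
next
  case (Conj \<phi> \<psi>)
  then show ?case using Conj.IH(1)[of n xs \<sigma> ys] Conj.IH(2)[of n xs \<sigma> ys] by simp
next
  case (Disj \<phi> \<psi>)
  then show ?case using Disj.IH(1)[of n xs \<sigma> ys] Disj.IH(2)[of n xs \<sigma> ys] by simp
next
  case (Exi \<phi>)
  have "sat M (x # xs) (subst (under \<sigma>) \<phi>) \<longleftrightarrow> sat M (x # ys) \<phi>" for x
    using Exi.IH[of "Suc n" "x # xs" "under \<sigma>" "x # ys"] Exi.prems val_under[of n M xs \<sigma> ys]
    by auto
  then show ?case by simp
qed auto

lemma wf_subst_tm: "wf_tm L n t \<Longrightarrow> (\<And>i. i < n \<Longrightarrow> wf_tm L m (\<sigma> i)) \<Longrightarrow> wf_tm L m (subst_tm \<sigma> t)"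
  by (induction t) auto

lemma wf_under:
  assumes "\<And>i. i < n \<Longrightarrow> wf_tm L m (\<sigma> i)" "i < Suc n"
  shows "wf_tm L (Suc m) (under \<sigma> i)"
  using assms wf_subst_tm[of L m _ "Suc m" "\<lambda>j. Var (Suc j)"] by (cases i) (auto simp: under_def)

lemma wf_subst: "wf_fm L n \<phi> \<Longrightarrow> (\<And>i. i < n \<Longrightarrow> wf_tm L m (\<sigma> i)) \<Longrightarrow> wf_fm L m (subst \<sigma> \<phi>)"
proof (induction \<phi> arbitrary: n m \<sigma>)
  case (Exi \<phi>)
  then show ?case using wf_under[of n L m \<sigma>] by simp
qed (use wf_subst_tm in \<open>auto, blast+\<close>)

lemma wf_lift: "wf_fm L n \<phi> \<Longrightarrow> wf_fm L (m + n) (lift m \<phi>)"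
  unfolding lift_def by (erule wf_subst) auto

lemma sat_lift:
  assumes "wf_fm L n \<phi>" "length xs = m"
  shows "sat M (xs @ ys) (lift m \<phi>) \<longleftrightarrow> sat M ys \<phi>"
  unfolding lift_def
  by (rule sat_subst[OF assms(1)]) (use assms(2) in \<open>auto simp: nth_append\<close>)

lemma sat_lift1: "wf_fm L n \<phi> \<Longrightarrow> sat M (x # ys) (lift 1 \<phi>) \<longleftrightarrow> sat M ys \<phi>"
  using sat_lift[of L n \<phi> "[x]"] by simp

lemma wf_inst: "wf_tm L n t \<Longrightarrow> wf_fm L (Suc n) \<phi> \<Longrightarrow> wf_fm L n (inst t \<phi>)"
  unfolding inst_def by (erule wf_subst) (auto split: nat.split)

lemma sat_inst:
  "wf_fm L (Suc n) \<phi> \<Longrightarrow> sat M xs (inst t \<phi>) \<longleftrightarrow> sat M (val M xs t # xs) \<phi>"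
  unfolding inst_def by (erule sat_subst) (auto split: nat.split)

lemma sat_conjs: "sat M xs (conjs \<phi>s) \<longleftrightarrow> (\<forall>\<phi>\<in>set \<phi>s. sat M xs \<phi>)"
  unfolding conjs_def by (induction \<phi>s) auto

lemma sat_disjs: "sat M xs (disjs \<phi>s) \<longleftrightarrow> (\<exists>\<phi>\<in>set \<phi>s. sat M xs \<phi>)"
  unfolding disjs_def by (induction \<phi>s) auto

lemma sat_Exis:
  "sat M us ((Exi ^^ m) \<psi>) \<longleftrightarrow> (\<exists>b\<in>tuples m (univ M). sat M (b @ us) \<psi>)"
proof (induction m arbitrary: us)
  case 0
  show ?case by (auto simp: tuples_def)
next
  case (Suc m)
  have "sat M us ((Exi ^^ Suc m) \<psi>) \<longleftrightarrow>
      (\<exists>x\<in>univ M. \<exists>b\<in>tuples m (univ M). sat M (b @ x # us) \<psi>)"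
    by (simp add: Suc.IH)
  also have "\<dots> \<longleftrightarrow> (\<exists>b\<in>tuples (Suc m) (univ M). sat M (b @ us) \<psi>)"
  proof
    assume "\<exists>x\<in>univ M. \<exists>b\<in>tuples m (univ M). sat M (b @ x # us) \<psi>"
    then obtain x b where "x \<in> univ M" "b \<in> tuples m (univ M)" "sat M (b @ x # us) \<psi>" by blast
    then show "\<exists>b\<in>tuples (Suc m) (univ M). sat M (b @ us) \<psi>"
      by (intro bexI[of _ "b @ [x]"]) (auto simp: tuples_def)
  next
    assume "\<exists>b\<in>tuples (Suc m) (univ M). sat M (b @ us) \<psi>"
    then show "\<exists>x\<in>univ M. \<exists>b\<in>tuples m (univ M). sat M (b @ x # us) \<psi>"
      by (metis append.assoc append_Cons append_Nil tuples_snocE)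
  qed
  finally show ?case .
qed

lemma wf_Exis: "wf_fm L n ((Exi ^^ m) \<psi>) \<longleftrightarrow> wf_fm L (m + n) \<psi>"
  by (induction m arbitrary: n) auto

definition wf_axioms :: "('f, 'r) lang \<Rightarrow> ('f, 'r) sequent set \<Rightarrow> bool" where
  "wf_axioms L T \<longleftrightarrow> (\<forall>(n, \<phi>, \<psi>)\<in>T. wf_fm L n \<phi> \<and> wf_fm L n \<psi>)"

text \<open>\<open>sat_subst\<close> needs the context of both formulas, which the substitution rule
  does not record.\<close>

lemma derives_wf:
  assumes "derives L T n \<phi> \<psi>" "wf_axioms L T"
  shows "wf_fm L n \<phi> \<and> wf_fm L n \<psi>"
  using assms
proof induction
  case (substitution n \<phi> \<psi> m \<sigma>)
  then show ?case using wf_subst by blast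
next
  case (ex_right n \<psi> \<phi>)
  then show ?case using wf_lift[of L n \<psi> 1] by auto
next
  case (frobenius n \<phi> \<psi>)
  then show ?case using wf_lift[of L n \<phi> 1] by auto
qed (auto simp: wf_axioms_def intro: wf_inst)

lemma soundness:
  assumes "derives L T n \<phi> \<psi>" "wf_axioms L T" "model L T M" "xs \<in> tuples n (univ M)" "sat M xs \<phi>"
  shows "sat M xs \<psi>"
  using assms
proof (induction arbitrary: xs)
  case (ax n \<phi> \<psi>)
  then show ?case by (fastforce simp: model_def)
next
  case (substitution n \<phi> \<psi> m \<sigma>)
  \<comment> \<open>The substituted sequent at \<open>xs\<close> is the original one at the tuple of
    values of the terms \<open>\<sigma> i\<close>.\<close>
  let ?ys = "map (\<lambda>i. val M xs (\<sigma> i)) [0..<n]"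
  have wf: "wf_fm L n \<phi>" "wf_fm L n \<psi>" using substitution derives_wf by blast+
  have "?ys \<in> tuples n (univ M)"
    using substitution val_in_univ[of L M xs m] by (auto simp: tuples_def model_def)
  moreover have "sat M xs (subst \<sigma> \<chi>) \<longleftrightarrow> sat M ?ys \<chi>" if "wf_fm L n \<chi>" for \<chi>
    by (rule sat_subst[OF that]) auto
  ultimately show ?case using substitution wf by metis
next
  case (eq_repl n s t \<phi>)
  then have "sat M (val M xs s # xs) \<phi>" "val M xs s = val M xs t" by (auto simp: sat_inst)
  then have "sat M (val M xs t # xs) \<phi>" by simp
  then show ?case using eq_repl.hyps by (simp add: sat_inst)
next
  case (ex_left n \<psi> \<phi>)
  then obtain x where "x \<in> univ M" "sat M (x # xs) \<phi>" by auto
  then have "sat M (x # xs) (lift 1 \<psi>)"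
    using ex_left.IH[of "x # xs"] ex_left.prems by simp
  then show ?case using ex_left.hyps sat_lift1[of L n \<psi> M x xs] by simp
next
  case (ex_right n \<psi> \<phi>)
  then obtain y ys where "xs = y # ys" "y \<in> univ M" "ys \<in> tuples n (univ M)"
    using tuples_SucE by metis
  then show ?case using ex_right sat_lift1[of L n \<psi> M y ys] by auto
next
  case (frobenius n \<phi> \<psi>)
  then show ?case using sat_lift1[of L n \<phi> M _ xs] by auto
qed auto

lemma provably_uniqueD:
  assumes "provably_unique L T n m \<psi>" "wf_axioms L T" "model L T M" "wf_fm L (m + n) \<psi>"
    "u \<in> tuples n (univ M)" "v \<in> tuples m (univ M)" "v' \<in> tuples m (univ M)"
    "sat M (v @ u) \<psi>" "sat M (v' @ u) \<psi>"
  shows "v = v'"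
proof -
  \<comment> \<open>The variable layout of \<open>provably_unique\<close>: \<open>lift m\<close>
    forgets \<open>v'\<close>, and the other substitution jumps over \<open>v\<close>.\<close>
  let ?xs = "v' @ v @ u"
  have l: "length v = m" "length v' = m" "length u = n" using assms tuples_length by blast+
  have "?xs \<in> tuples (m + (m + n)) (univ M)" using assms by (intro tuples_append)
  moreover have "sat M ?xs (lift m \<psi>)" using sat_lift[OF assms(4) l(2)] assms(8) by blast
  moreover have "sat M ?xs (subst (\<lambda>i. if i < m then Var i else Var (i + m)) \<psi>) \<longleftrightarrow> sat M (v' @ u) \<psi>"
    by (rule sat_subst[OF assms(4)]) (use l in \<open>auto simp: nth_append\<close>)
  ultimately have "sat M ?xs (conjs (map (\<lambda>j. Eqn (Var (m + j)) (Var j)) [0..<m]))"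
    using soundness[OF assms(1)[unfolded provably_unique_def] assms(2,3), of ?xs] assms(9) by simp
  then have "\<forall>j<m. ?xs ! (m + j) = ?xs ! j" by (auto simp: sat_conjs)
  then show ?thesis using l by (intro nth_equalityI) (auto simp: nth_append)
qed

section \<open>Monotonicity in the theory and cartesian formulas\<close>

lemma derives_mono: "derives L T n \<phi> \<psi> \<Longrightarrow> T \<subseteq> T' \<Longrightarrow> derives L T' n \<phi> \<psi>"
proof (induction rule: derives.induct)
  case (substitution n \<phi> \<psi> m \<sigma>)
  then show ?case by (blast intro: derives.substitution)
next
  case (ex_right n \<psi> \<phi>)
  then show ?case by (blast intro: derives.ex_right)
next
  case (frobenius n \<phi> \<psi>)
  then show ?case by (blast intro: derives.frobenius)
qed (auto intro: derives.intros)

lemma cartesian_fm_mono: "cartesian_fm L T n \<phi> \<Longrightarrow> T \<subseteq> T' \<Longrightarrow> cartesian_fm L T' n \<phi>"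
proof (induction rule: cartesian_fm.induct)
  case (cart_ex n \<phi>)
  then show ?case unfolding provably_unique_def by (blast intro: derives_mono cartesian_fm.cart_ex[unfolded provably_unique_def])
qed (auto intro: cartesian_fm.intros)

lemma cartesian_fm_wf: "cartesian_fm L T n \<phi> \<Longrightarrow> wf_fm L n \<phi>"
  by (induction rule: cartesian_fm.induct) auto

lemma horn_cartesian: "horn L n \<phi> \<Longrightarrow> cartesian_fm L T n \<phi>"
  by (induction rule: horn.induct) (auto intro: cartesian_fm.intros)

text \<open>Provable uniqueness survives enlarging the theory, so an axiom that is cartesian
  relative to its predecessors is cartesian relative to \<open>T\<close>. This is all that is
  extracted from the well-founded order.\<close>

lemma cartesian_theory_cartesian_axioms:
  assumes "cartesian_theory L T" "(n, \<phi>, \<psi>) \<in> T"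
  shows "cartesian_fm L T n \<phi>" "cartesian_fm L T n \<psi>"
proof -
  obtain ord where "\<forall>(n, \<phi>, \<psi>)\<in>T.
           cartesian_fm L {s \<in> T. (s, (n, \<phi>, \<psi>)) \<in> ord - Id} n \<phi> \<and>
           cartesian_fm L {s \<in> T. (s, (n, \<phi>, \<psi>)) \<in> ord - Id} n \<psi>"
    using assms(1) unfolding cartesian_theory_def by blast
  then show "cartesian_fm L T n \<phi>" "cartesian_fm L T n \<psi>"
    using assms(2) cartesian_fm_mono[of L "{s \<in> T. (s, (n, \<phi>, \<psi>)) \<in> ord - Id}" n _ T] by blast+
qed

section \<open>Homomorphisms\<close>

lemma homom_univ: "homom L A B h \<Longrightarrow> x \<in> univ A \<Longrightarrow> h x \<in> univ B"
  by (auto simp: homom_def)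

lemma homom_tuples: "homom L A B h \<Longrightarrow> xs \<in> tuples n (univ A) \<Longrightarrow> map h xs \<in> tuples n (univ B)"
  by (auto simp: homom_def tuples_def)

lemma homom_funI:
  "homom L A B h \<Longrightarrow> F \<in> funs L \<Longrightarrow> xs \<in> tuples (far L F) (univ A) \<Longrightarrow>
     h (funI A F xs) = funI B F (map h xs)"
  by (auto simp: homom_def)

lemma homom_relI:
  "homom L A B h \<Longrightarrow> R \<in> rels L \<Longrightarrow> xs \<in> tuples (rar L R) (univ A) \<Longrightarrow> relI A R xs \<Longrightarrow>
     relI B R (map h xs)"
  by (auto simp: homom_def)

lemma homom_val:
  assumes "homom L A B h" "is_struct L A" "xs \<in> tuples n (univ A)"
  shows "wf_tm L n t \<Longrightarrow> h (val A xs t) = val B (map h xs) t"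
proof (induction t)
  case (Var i)
  then show ?case using assms(3) by (auto simp: tuples_def)
next
  case (Fun F ts)
  then have "map (val A xs) ts \<in> tuples (far L F) (univ A)"
    using val_in_univ[OF assms(2,3)] by (auto simp: tuples_def)
  then have "h (val A xs (Fun F ts)) = funI B F (map (h \<circ> val A xs) ts)"
    using homom_funI[OF assms(1)] Fun.prems by simp
  also have "map (h \<circ> val A xs) ts = map (val B (map h xs)) ts" using Fun by auto
  finally show ?case by simp
qed

lemma homom_sat:
  assumes "homom L A B h" "is_struct L A"
  shows "wf_fm L n \<phi> \<Longrightarrow> xs \<in> tuples n (univ A) \<Longrightarrow> sat A xs \<phi> \<Longrightarrow> sat B (map h xs) \<phi>"
proof (induction \<phi> arbitrary: n xs)
  case (Rel R ts)
  have "map (val A xs) ts \<in> tuples (rar L R) (univ A)"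
    using val_in_univ[OF assms(2) Rel.prems(2)] Rel.prems(1) by (auto simp: tuples_def)
  then have "relI B R (map h (map (val A xs) ts))"
    using homom_relI[OF assms(1)] Rel.prems by (simp del: map_map)
  also have "map h (map (val A xs) ts) = map (val B (map h xs)) ts"
    using homom_val[OF assms Rel.prems(2)] Rel.prems(1) by auto
  finally show ?case by simp
next
  case (Eqn s t)
  then show ?case using homom_val[OF assms Eqn.prems(2)] by (metis sat.simps(3) wf_fm.simps(3))
next
  case (Exi \<phi>)
  then obtain x where "x \<in> univ A" "sat A (x # xs) \<phi>" by auto
  then show ?case using Exi.IH[of "Suc n" "x # xs"] Exi.prems homom_univ[OF assms(1)] by auto
next
  case (Disj \<phi> \<psi>)
  then show ?case by auto
qed auto

lemma homom_id: "homom L A A (\<lambda>x. x)"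
  by (auto simp: homom_def)

lemma homom_cong: "homom L A B h \<Longrightarrow> is_struct L A \<Longrightarrow> (\<And>x. x \<in> univ A \<Longrightarrow> h x = h' x) \<Longrightarrow> homom L A B h'"
proof -
  assume h: "homom L A B h" "is_struct L A" "\<And>x. x \<in> univ A \<Longrightarrow> h x = h' x"
  have m: "map h xs = map h' xs" if "xs \<in> tuples n (univ A)" for xs n
    using that h(3) by (auto simp: tuples_def)
  show ?thesis
    using h unfolding homom_def
    by (auto simp flip: m) (auto simp: is_struct_def h(3) simp flip: h(3) m)
qed

lemma homom_comp: "homom L A B h \<Longrightarrow> homom L B C k \<Longrightarrow> homom L A C (\<lambda>x. k (h x))"
proof -
  assume hk: "homom L A B h" "homom L B C k"
  have m: "map (\<lambda>x. k (h x)) xs = map k (map h xs)" for xs by simp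
  show ?thesis
    unfolding homom_def m
    using hk homom_tuples[OF hk(1)] homom_funI[OF hk(1)] homom_funI[OF hk(2)]
      homom_relI[OF hk(1)] homom_relI[OF hk(2)] homom_univ[OF hk(1)] homom_univ[OF hk(2)]
    by (auto simp del: map_map)
qed

text \<open>The inverse is required to be a homomorphism too, since a bijective homomorphism need
  not reflect relations.\<close>

definition isom ::
  "('f, 'r) lang \<Rightarrow> ('f, 'r, 'a) struct \<Rightarrow> ('f, 'r, 'b) struct \<Rightarrow> ('a \<Rightarrow> 'b) \<Rightarrow> ('b \<Rightarrow> 'a) \<Rightarrow> bool" where
  "isom L A B h k \<longleftrightarrow> homom L A B h \<and> homom L B A k \<and>
     (\<forall>x\<in>univ A. k (h x) = x) \<and> (\<forall>y\<in>univ B. h (k y) = y)"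

lemma isom_sat:
  assumes "isom L A B h k" "is_struct L A" "is_struct L B" "wf_fm L n \<phi>" "xs \<in> tuples n (univ A)"
  shows "sat B (map h xs) \<phi> \<longleftrightarrow> sat A xs \<phi>"
proof
  have "map k (map h xs) = xs" using assms(1,5) by (auto simp: isom_def tuples_def intro!: map_idI)
  then show "sat B (map h xs) \<phi> \<Longrightarrow> sat A xs \<phi>"
    using homom_sat[of L B A k n \<phi> "map h xs"] assms homom_tuples[of L A B h xs n]
    by (auto simp: isom_def)
  show "sat A xs \<phi> \<Longrightarrow> sat B (map h xs) \<phi>"
    using homom_sat[of L A B h n \<phi> xs] assms by (auto simp: isom_def)
qed

lemma isom_sym: "isom L A B h k \<Longrightarrow> isom L B A k h"
  by (auto simp: isom_def)

lemma isom_model: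
  assumes "isom L A B h k" "is_struct L B" "model L T A" "wf_axioms L T"
  shows "model L T B"
proof -
  have "sat B ys \<psi>"
    if ax: "(n, \<phi>, \<psi>) \<in> T" and ys: "ys \<in> tuples n (univ B)" and s: "sat B ys \<phi>" for n \<phi> \<psi> ys
  proof -
  have A: "is_struct L A" using assms(3) by (simp add: model_def)
  have kys: "map k ys \<in> tuples n (univ A)" using homom_tuples assms(1) ys by (auto simp: isom_def)
  note i = isom_sat[OF isom_sym[OF assms(1)] assms(2) A _ ys]
  have wf: "wf_fm L n \<phi>" "wf_fm L n \<psi>" using ax assms(4) by (auto simp: wf_axioms_def)
  have "sat A (map k ys) \<psi>" using i[OF wf(1)] s kys ax assms(3) by (auto simp: model_def)
  then show "sat B ys \<psi>" using i[OF wf(2)] by simp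
  qed
  with assms(2) show ?thesis unfolding model_def by blast
qed

section \<open>Formulas with unique witnesses and words\<close>

text \<open>\<open>graph_fm L F\<close> is \<open>F(u) = v\<close>: treating function symbols as unique witnesses of their graphs
  leaves witnesses as the only way to form new elements.\<close>

definition graph_fm :: "('f, 'r) lang \<Rightarrow> 'f \<Rightarrow> ('f, 'r) fm" where
  "graph_fm L F = Eqn (Fun F (map (\<lambda>i. Var (Suc i)) [0..<far L F])) (Var 0)"

text \<open>Atomic formulas at distinct variables serve as normal forms: compound arguments are
  moved into the words by \<open>tm_word\<close>, and the rules for \<open>Rel\<close> and
  \<open>Eqn\<close> reduce to \<open>rel_fm\<close> and \<open>eq_fm\<close>.\<close>

definition rel_fm :: "('f, 'r) lang \<Rightarrow> 'r \<Rightarrow> ('f, 'r) fm" where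
  "rel_fm L R = Rel R (map Var [0..<rar L R])"

definition eq_fm :: "('f, 'r) fm" where
  "eq_fm = Eqn (Var 0) (Var 1)"

lemma sat_eq_fm [simp]: "sat M [x, y] eq_fm \<longleftrightarrow> x = y"
  by (simp add: eq_fm_def)

lemma map_nth_id: "length xs = n \<Longrightarrow> map (\<lambda>i. xs ! i) [0..<n] = xs"
  using map_nth by blast

lemma sat_graph_fm: "length xs = far L F \<Longrightarrow> sat M (y # xs) (graph_fm L F) \<longleftrightarrow> funI M F xs = y"
  by (simp add: graph_fm_def comp_def map_nth_id)

lemma sat_rel_fm: "length xs = rar L R \<Longrightarrow> sat M xs (rel_fm L R) \<longleftrightarrow> relI M R xs"
  by (simp add: rel_fm_def comp_def map_nth_id)

lemma wf_graph_fm: "F \<in> funs L \<Longrightarrow> wf_fm L (Suc (far L F)) (graph_fm L F)"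
  by (auto simp: graph_fm_def)

lemma wf_rel_fm: "R \<in> rels L \<Longrightarrow> wf_fm L (rar L R) (rel_fm L R)"
  by (auto simp: rel_fm_def)

text \<open>Formulas whose nested existential quantifiers have unique witnesses in every model of \<open>T0\<close>. The
  spatiality of the context is what allows the second clause.\<close>

inductive unique_fm ::
  "('f, 'r) lang \<Rightarrow> ('f, 'r) sequent set \<Rightarrow> ('f, 'r) horn_pair set \<Rightarrow> nat \<Rightarrow> ('f, 'r) fm \<Rightarrow> bool"
  for L T0 \<Lambda> where
  uf_cartesian: "cartesian_fm L T0 n \<theta> \<Longrightarrow> unique_fm L T0 \<Lambda> n \<theta>"
| uf_pair: "(n, \<phi>, m, \<psi>) \<in> \<Lambda> \<Longrightarrow> k \<le> m \<Longrightarrow> unique_fm L T0 \<Lambda> (m - k + n) ((Exi ^^ k) \<psi>)"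
| uf_graph: "F \<in> funs L \<Longrightarrow> unique_fm L T0 \<Lambda> (far L F) (Exi (graph_fm L F))"

text \<open>\<open>Wit \<chi> ws\<close> stands for the unique witness of \<open>Exi \<chi>\<close> at \<open>ws\<close>; it is undefined where there is
  none.\<close>

datatype ('f, 'r, 'c) word = Par 'c | Wit "('f, 'r) fm" "('f, 'r, 'c) word list"

type_synonym ('f, 'r, 'c) fact = "('f, 'r) fm \<times> ('f, 'r, 'c) word list"

fun tm_word :: "('f, 'r) lang \<Rightarrow> ('f, 'r, 'c) word list \<Rightarrow> 'f tm \<Rightarrow> ('f, 'r, 'c) word" where
  "tm_word L ws (Var i) = ws ! i"
| "tm_word L ws (Fun F ts) = Wit (graph_fm L F) (map (tm_word L ws) ts)"

locale coste =
  fixes L :: "('f, 'r) lang" and T0 T :: "('f, 'r) sequent set" and \<Lambda> :: "('f, 'r) horn_pair set"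
  assumes spatial: "spatial_coste_context L T0 T \<Lambda>"
begin

abbreviation K :: "nat \<Rightarrow> ('f, 'r) fm \<Rightarrow> bool" where "K \<equiv> unique_fm L T0 \<Lambda>"

lemma T0_cartesian: "cartesian_theory L T0"
  using spatial by (simp add: spatial_coste_context_def coste_context_def)

lemma wf_T0: "wf_axioms L T0"
  unfolding wf_axioms_def using cartesian_theory_cartesian_axioms[OF T0_cartesian] cartesian_fm_wf by blast

lemma pairs:
  assumes "(n, \<phi>, m, \<psi>) \<in> \<Lambda>"
  shows "horn L n \<phi>" "horn L (m + n) \<psi>" "derives L T0 (m + n) \<psi> (lift m \<phi>)"
    "provably_unique L T0 n m \<psi>"
  using assms spatial by (auto simp: spatial_coste_context_def coste_context_def)

lemma pair_wf:
  assumes "(n, \<phi>, m, \<psi>) \<in> \<Lambda>"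
  shows "wf_fm L n \<phi>" "wf_fm L (m + n) \<psi>"
  using pairs[OF assms] horn_cartesian cartesian_fm_wf by blast+

lemma pair_unique:
  assumes "(n, \<phi>, m, \<psi>) \<in> \<Lambda>" "model L T0 M"
    "u \<in> tuples n (univ M)" "v \<in> tuples m (univ M)" "v' \<in> tuples m (univ M)"
    "sat M (v @ u) \<psi>" "sat M (v' @ u) \<psi>"
  shows "v = v'"
  using provably_uniqueD[OF pairs(4)[OF assms(1)] wf_T0 assms(2) pair_wf(2)[OF assms(1)]] assms by blast

section \<open>Closure properties of \<open>K\<close> and uniqueness of witnesses\<close>

lemma K_wf: "K n \<theta> \<Longrightarrow> wf_fm L n \<theta>"
proof (induction rule: unique_fm.induct)
  case (uf_cartesian n \<theta>)
  then show ?case by (rule cartesian_fm_wf)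
next
  case (uf_pair n \<phi> m \<psi> k)
  then show ?case using pair_wf(2) by (simp add: wf_Exis)
next
  case (uf_graph F)
  then show ?case by (simp add: wf_graph_fm)
qed

lemma K_atomic: "atomic \<theta> \<Longrightarrow> wf_fm L n \<theta> \<Longrightarrow> K n \<theta>"
  by (intro uf_cartesian cart_atomic)

lemma K_eq [simp]: "K (Suc (Suc 0)) eq_fm"
  by (intro K_atomic) (auto simp: eq_fm_def)

lemma K_rel: "R \<in> rels L \<Longrightarrow> K (rar L R) (rel_fm L R)"
  by (intro K_atomic) (auto simp: wf_rel_fm rel_fm_def)

lemma K_horn: "horn L n \<theta> \<Longrightarrow> K n \<theta>"
  by (intro uf_cartesian horn_cartesian)

lemma K_axiom: "(n, \<phi>, \<psi>) \<in> T0 \<Longrightarrow> K n \<phi>" "(n, \<phi>, \<psi>) \<in> T0 \<Longrightarrow> K n \<psi>"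
  using cartesian_theory_cartesian_axioms[OF T0_cartesian] by (blast intro: uf_cartesian)+

lemma K_Exis: "(n, \<phi>, m, \<psi>) \<in> \<Lambda> \<Longrightarrow> K n ((Exi ^^ m) \<psi>)"
  using uf_pair[of n \<phi> m \<psi> \<Lambda> m] by simp

inductive_cases cart_ConjE: "cartesian_fm L T0 n (Conj \<phi> \<psi>)"
inductive_cases cart_ExiE: "cartesian_fm L T0 n (Exi \<phi>)"
inductive_cases cart_DisjE: "cartesian_fm L T0 n (Disj \<phi> \<psi>)"
inductive_cases cart_FalsityE: "cartesian_fm L T0 n Falsity"

text \<open>For \<open>k = 0\<close> a formula from \<open>uf_pair\<close> is Horn, hence cartesian.
  So in the \<open>pair\<close> case here the formula really starts with a quantifier, which settles
  the other connectives at once.\<close>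

lemma K_cases:
  assumes "K n \<theta>"
  obtains (cart) "cartesian_fm L T0 n \<theta>"
  | (pair) n' \<phi> m \<psi> k where "(n', \<phi>, m, \<psi>) \<in> \<Lambda>" "k < m" "n = m - Suc k + n'" "\<theta> = Exi ((Exi ^^ k) \<psi>)"
  | (graph) F where "F \<in> funs L" "n = far L F" "\<theta> = Exi (graph_fm L F)"
  using assms
proof cases
  case uf_cartesian
  then show ?thesis by (rule cart)
next
  case (uf_pair n' \<phi> m \<psi> k)
  show ?thesis
  proof (cases k)
    case 0
    then show ?thesis using uf_pair pairs(2) horn_cartesian cart by fastforce
  next
    case (Suc k')
    then show ?thesis using uf_pair pair[of n' \<phi> m \<psi> k'] by simp
  qed
next
  case (uf_graph F)
  then show ?thesis by (intro graph)
qed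

lemma K_Conj: assumes "K n (Conj \<phi> \<psi>)" shows "K n \<phi>" "K n \<psi>"
  using assms by (auto elim!: K_cases elim: cart_ConjE intro: uf_cartesian)

lemma not_K_Disj: "\<not> K n (Disj \<phi> \<psi>)"
  by (auto elim!: K_cases elim: cart_DisjE)

lemma not_K_Falsity: "\<not> K n Falsity"
  by (auto elim!: K_cases elim: cart_FalsityE)

text \<open>This is why \<open>uf_pair\<close> admits every \<open>k \<le> m\<close>: opening a
  quantifier of a block leaves the next smaller block.\<close>

lemma K_Exi: assumes "K n (Exi \<chi>)" shows "K (Suc n) \<chi>"
  using assms
proof (cases rule: K_cases)
  case cart
  then show ?thesis by (auto elim!: cart_ExiE intro: uf_cartesian)
next
  case (pair n' \<phi> m \<psi> k)
  then show ?thesis using uf_pair[of n' \<phi> m \<psi> \<Lambda> k] by (simp add: Suc_diff_Suc)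
next
  case (graph F)
  then show ?thesis by (auto intro!: K_atomic simp: wf_graph_fm graph_fm_def)
qed

text \<open>In the case of a pair from \<Lambda>, only whole tuples of witnesses are provably
  unique. A single component is unique once the components already chosen are held fixed.\<close>

lemma K_unique:
  assumes "K n (Exi \<chi>)" "model L T0 M" "xs \<in> tuples n (univ M)" "x \<in> univ M" "x' \<in> univ M"
    "sat M (x # xs) \<chi>" "sat M (x' # xs) \<chi>"
  shows "x = x'"
  using assms(1)
proof (cases rule: K_cases)
  case cart
  then have "provably_unique L T0 n 1 \<chi>" "wf_fm L (1 + n) \<chi>"
    by (auto elim!: cart_ExiE dest: cartesian_fm_wf)
  from provably_uniqueD[OF this(1) wf_T0 assms(2) this(2), of xs "[x]" "[x']"] show ?thesis
    using assms by simp
next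
  case (pair n' \<phi> m \<psi> k)
  then obtain b b' where b: "b \<in> tuples k (univ M)" "sat M (b @ x # xs) \<psi>"
    "b' \<in> tuples k (univ M)" "sat M (b' @ x' # xs) \<psi>"
    using assms(6,7) by (auto simp: sat_Exis)
  \<comment> \<open>The first entries of \<open>xs\<close> are the witnesses of the quantifiers
    already opened, the remaining \<open>n'\<close> are the parameters of the pair. Completing
    \<open>x\<close> by the inner witnesses \<open>b\<close> gives a full witness tuple.\<close>
  let ?v = "take (m - Suc k) xs" and ?u = "drop (m - Suc k) xs"
  have u: "?u \<in> tuples n' (univ M)" using assms(3) pair
    by (auto simp: tuples_def dest: in_set_dropD)
  have v: "?v \<in> tuples (m - Suc k) (univ M)" using assms(3) pair
    by (auto simp: tuples_def dest: in_set_takeD)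
  have m: "m = k + Suc (m - Suc k)" using pair by simp
  have "b @ x # ?v \<in> tuples m (univ M)" "b' @ x' # ?v \<in> tuples m (univ M)"
    using assms(4,5) b v by (subst m, intro tuples_append, simp_all)+
  from pair_unique[OF pair(1) assms(2) u this] b have "b @ x # ?v = b' @ x' # ?v" by simp
  then show ?thesis using b by (auto simp: tuples_def)
next
  case (graph F)
  then show ?thesis using assms tuples_length[OF assms(3)] by (auto simp: sat_graph_fm)
qed

subsection \<open>Evaluation of words\<close>

text \<open>A relation, because a witness may be missing. The set \<open>D\<close> limits the
  parameters that denote anything: at a point it will consist of the sections defined near that
  point, so definedness of a word varies with the point.\<close>

inductive ev ::
  "('f, 'r, 'b) struct \<Rightarrow> 'c set \<Rightarrow> ('c \<Rightarrow> 'b) \<Rightarrow> ('f, 'r, 'c) word \<Rightarrow> 'b \<Rightarrow> bool"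
  for B D \<alpha> where
  ev_Par: "c \<in> D \<Longrightarrow> \<alpha> c \<in> univ B \<Longrightarrow> ev B D \<alpha> (Par c) (\<alpha> c)"
| ev_Wit: "K (length ws) (Exi \<chi>) \<Longrightarrow> list_all2 (ev B D \<alpha>) ws bs \<Longrightarrow> b \<in> univ B \<Longrightarrow>
    sat B (b # bs) \<chi> \<Longrightarrow> ev B D \<alpha> (Wit \<chi> ws) b"

inductive_cases ev_ParE [elim!]: "ev B D \<alpha> (Par c) b"
inductive_cases ev_WitE: "ev B D \<alpha> (Wit \<chi> ws) b"

lemma ev_univ: "ev B D \<alpha> w b \<Longrightarrow> b \<in> univ B"
  by (induction rule: ev.cases) auto

lemma evs_tuples: "list_all2 (ev B D \<alpha>) ws bs \<Longrightarrow> bs \<in> tuples (length ws) (univ B)"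
  using ev_univ by (fastforce simp: tuples_def list_all2_conv_all_nth in_set_conv_nth)

text \<open>By induction the arguments have the same values, and then \<open>K_unique\<close> leaves
  one witness.\<close>

lemma ev_det:
  assumes "model L T0 B" "ev B D \<alpha> w b" "ev B D \<alpha> w b'"
  shows "b = b'"
  using assms(2,3)
proof (induction arbitrary: b')
  case (ev_Par c)
  then show ?case by auto
next
  case (ev_Wit ws \<chi> bs b)
  from ev_Wit.prems obtain bs' where b': "list_all2 (ev B D \<alpha>) ws bs'" "b' \<in> univ B" "sat B (b' # bs') \<chi>"
    by (auto elim: ev_WitE)
  have "bs = bs'"
    using ev_Wit.IH b'(1) by (intro nth_equalityI) (auto simp: list_all2_conv_all_nth)
  moreover have "list_all2 (ev B D \<alpha>) ws bs"
    using ev_Wit.IH by (rule list_all2_mono) blast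
  ultimately show ?case
    using K_unique[OF ev_Wit.hyps(1) assms(1)] evs_tuples ev_Wit.hyps b' by blast
qed

lemma evs_det:
  assumes "model L T0 B" "list_all2 (ev B D \<alpha>) ws bs" "list_all2 (ev B D \<alpha>) ws bs'"
  shows "bs = bs'"
proof (rule nth_equalityI)
  show "length bs = length bs'" using assms(2,3) list_all2_lengthD by metis
  show "bs ! i = bs' ! i" if "i < length bs" for i
    using assms(2,3) that by (auto simp: list_all2_conv_all_nth intro: ev_det[OF assms(1), of D \<alpha> "ws ! i"])
qed

text \<open>Formulas in \<open>K\<close> are positive, so the image of a witness is a
  witness.\<close>

lemma ev_homom:
  assumes "homom L A B h" "model L T0 A" "\<And>c. c \<in> D \<Longrightarrow> \<alpha> c \<in> univ A \<Longrightarrow> c \<in> D' \<and> h (\<alpha> c) = \<beta> c"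
  shows "ev A D \<alpha> w a \<Longrightarrow> ev B D' \<beta> w (h a)"
proof (induction rule: ev.induct)
  case (ev_Par c)
  then show ?case using ev.ev_Par[of c D' \<beta> B] assms homom_univ by metis
next
  case (ev_Wit ws \<chi> bs b)
  have "list_all2 (ev B D' \<beta>) ws (map h bs)"
    using ev_Wit.IH by (auto simp: list_all2_conv_all_nth)
  moreover have "bs \<in> tuples (length ws) (univ A)"
    using ev_Wit.IH by (intro evs_tuples[of A D \<alpha>]) (auto elim: list_all2_mono)
  ultimately show ?case
    using ev_Wit homom_sat[OF assms(1), of "Suc (length ws)" \<chi> "b # bs"] K_wf[OF K_Exi] assms(2)
      homom_univ[OF assms(1)]
    by (intro ev.ev_Wit[where bs = "map h bs"]) (auto simp: model_def)
qed

lemma ev_tm_word: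
  assumes "model L T0 B" "list_all2 (ev B D \<alpha>) ws bs"
  shows "wf_tm L (length ws) t \<Longrightarrow> ev B D \<alpha> (tm_word L ws t) (val B bs t)"
proof (induction t)
  case (Var i)
  then show ?case using assms(2) by (auto simp: list_all2_conv_all_nth)
next
  case (Fun F ts)
  have B: "is_struct L B" using assms(1) by (simp add: model_def)
  have 1: "list_all2 (ev B D \<alpha>) (map (tm_word L ws) ts) (map (val B bs) ts)"
    using Fun by (auto simp: list_all2_conv_all_nth)
  show ?case
    using Fun.prems uf_graph[of F L T0 \<Lambda>] val_in_univ[OF B evs_tuples[OF assms(2)] Fun.prems] 1
    by (auto intro!: ev_Wit[OF _ 1] simp: sat_graph_fm)
qed

text \<open>The positive diagram of \<open>B\<close>, restricted to formulas in \<open>K\<close> and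
  with words in place of constants.\<close>

definition Diag :: "('f, 'r, 'b) struct \<Rightarrow> 'c set \<Rightarrow> ('c \<Rightarrow> 'b) \<Rightarrow> ('f, 'r, 'c) fact set" where
  "Diag B D \<alpha> = {(\<theta>, ws). K (length ws) \<theta> \<and> (\<exists>bs. list_all2 (ev B D \<alpha>) ws bs \<and> sat B bs \<theta>)}"

lemma Diag_iff:
  assumes "model L T0 B" "list_all2 (ev B D \<alpha>) ws bs" "K (length ws) \<theta>"
  shows "(\<theta>, ws) \<in> Diag B D \<alpha> \<longleftrightarrow> sat B bs \<theta>"
proof
  assume "(\<theta>, ws) \<in> Diag B D \<alpha>"
  then obtain bs' where "list_all2 (ev B D \<alpha>) ws bs'" "sat B bs' \<theta>" by (auto simp: Diag_def)
  with evs_det[OF assms(1,2)] show "sat B bs \<theta>" by blast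
qed (use assms in \<open>auto simp: Diag_def\<close>)

lemma Diag_eq_iff:
  assumes "model L T0 B"
  shows "(eq_fm, [w, w']) \<in> Diag B D \<alpha> \<longleftrightarrow> (\<exists>b. ev B D \<alpha> w b \<and> ev B D \<alpha> w' b)"
proof
  assume "(eq_fm, [w, w']) \<in> Diag B D \<alpha>"
  then show "\<exists>b. ev B D \<alpha> w b \<and> ev B D \<alpha> w' b"
    by (auto simp: Diag_def list_all2_Cons1)
next
  assume "\<exists>b. ev B D \<alpha> w b \<and> ev B D \<alpha> w' b"
  then obtain b where "ev B D \<alpha> w b" "ev B D \<alpha> w' b" by blast
  then have "list_all2 (ev B D \<alpha>) [w, w'] [b, b]" by simp
  then show "(eq_fm, [w, w']) \<in> Diag B D \<alpha>"
    unfolding Diag_def using sat_eq_fm[of B b b] by fastforce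
qed

subsection \<open>Closed sets of facts\<close>

text \<open>The fact \<open>(eq_fm, [w, w])\<close> expresses that \<open>w\<close> is defined.\<close>

abbreviation defs :: "('f, 'r, 'c) word list \<Rightarrow> ('f, 'r, 'c) fact set" where
  "defs ws \<equiv> (\<lambda>w. (eq_fm, [w, w])) ` set ws"

text \<open>The closure properties of a positive diagram that are needed to build a model of
  \<open>T0\<close> from it. \<open>r_exE\<close> names a witness, \<open>r_strict\<close> says that
  a word is defined only if its witness exists, and \<open>r_unique\<close> and
  \<open>r_cong\<close> make equality a congruence. The conditions \<open>K\<close> on introduced
  formulas keep derived facts within the class on which the truth lemma holds. All premise sets are
  finite, which later turns derivability into an open condition.\<close>

inductive rule :: "('f, 'r, 'c) fact set \<Rightarrow> ('f, 'r, 'c) fact \<Rightarrow> bool" where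
  r_def: "w \<in> set ws \<Longrightarrow> rule {(\<theta>, ws)} (eq_fm, [w, w])"
| r_truth: "rule (defs ws) (Truth, ws)"
| r_conj: "K (length ws) (Conj \<phi> \<psi>) \<Longrightarrow> rule {(\<phi>, ws), (\<psi>, ws)} (Conj \<phi> \<psi>, ws)"
| r_conj1: "rule {(Conj \<phi> \<psi>, ws)} (\<phi>, ws)"
| r_conj2: "rule {(Conj \<phi> \<psi>, ws)} (\<psi>, ws)"
| r_exI: "K (length ws) (Exi \<chi>) \<Longrightarrow> rule {(\<chi>, w # ws)} (Exi \<chi>, ws)"
| r_exE: "rule {(Exi \<chi>, ws)} (\<chi>, Wit \<chi> ws # ws)"
| r_unique: "K (length ws) (Exi \<chi>) \<Longrightarrow> rule {(\<chi>, w # ws), (\<chi>, w' # ws)} (eq_fm, [w, w'])"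
| r_strict: "rule {(eq_fm, [Wit \<chi> ws, Wit \<chi> ws])} (Exi \<chi>, ws)"
| r_fun: "F \<in> funs L \<Longrightarrow> length ws = far L F \<Longrightarrow> rule (defs ws) (Exi (graph_fm L F), ws)"
| r_cong: "length ws = length ws' \<Longrightarrow>
    rule (insert (\<theta>, ws) ((\<lambda>(w, w'). (eq_fm, [w, w'])) ` set (zip ws ws'))) (\<theta>, ws')"
| r_relI: "K (length ws) (Rel R ts) \<Longrightarrow>
    rule (insert (rel_fm L R, map (tm_word L ws) ts) (defs ws)) (Rel R ts, ws)"
| r_relE: "rule {(Rel R ts, ws)} (rel_fm L R, map (tm_word L ws) ts)"
| r_eqnI: "K (length ws) (Eqn s t) \<Longrightarrow>
    rule (insert (eq_fm, [tm_word L ws s, tm_word L ws t]) (defs ws)) (Eqn s t, ws)"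
| r_eqnE: "rule {(Eqn s t, ws)} (eq_fm, [tm_word L ws s, tm_word L ws t])"
| r_axiom: "(length ws, \<phi>, \<psi>) \<in> T0 \<Longrightarrow> rule {(\<phi>, ws)} (\<psi>, ws)"

definition closed :: "('f, 'r, 'c) fact set \<Rightarrow> bool" where
  "closed S \<longleftrightarrow> (\<forall>(\<theta>, ws)\<in>S. K (length ws) \<theta>) \<and> (\<forall>ps c. rule ps c \<longrightarrow> ps \<subseteq> S \<longrightarrow> c \<in> S)"

lemma rule_finite: "rule ps c \<Longrightarrow> finite ps"
  by (induction rule: rule.induct) auto

lemma closed_rule: "closed S \<Longrightarrow> rule ps c \<Longrightarrow> ps \<subseteq> S \<Longrightarrow> c \<in> S"
  unfolding closed_def by blast

lemma closed_K: "closed S \<Longrightarrow> (\<theta>, ws) \<in> S \<Longrightarrow> K (length ws) \<theta>"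
  by (auto simp: closed_def)

lemma defs_Diag:
  assumes "defs ws \<subseteq> Diag B D \<alpha>"
  obtains bs where "list_all2 (ev B D \<alpha>) ws bs"
proof -
  have "\<forall>w\<in>set ws. \<exists>b. ev B D \<alpha> w b"
  proof
    fix w assume "w \<in> set ws"
    then have "(eq_fm, [w, w]) \<in> Diag B D \<alpha>" using assms by blast
    then show "\<exists>b. ev B D \<alpha> w b" by (auto simp: Diag_def list_all2_Cons1)
  qed
  then obtain f where "\<forall>w\<in>set ws. ev B D \<alpha> w (f w)" by metis
  then have "list_all2 (ev B D \<alpha>) ws (map f ws)" by (auto simp: list_all2_conv_all_nth)
  then show ?thesis by (rule that)
qed

lemma DiagI: "K (length ws) \<theta> \<Longrightarrow> list_all2 (ev B D \<alpha>) ws bs \<Longrightarrow> sat B bs \<theta> \<Longrightarrow> (\<theta>, ws) \<in> Diag B D \<alpha>"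
  by (auto simp: Diag_def)

lemma DiagE:
  assumes "(\<theta>, ws) \<in> Diag B D \<alpha>"
  obtains bs where "K (length ws) \<theta>" "list_all2 (ev B D \<alpha>) ws bs" "sat B bs \<theta>"
  using assms by (auto simp: Diag_def)

text \<open>Soundness of the rules. As words have at most one value, premises about the same words
  speak about the same tuple of elements.\<close>

lemma Diag_closed:
  assumes B: "model L T0 B"
  shows "closed (Diag B D \<alpha>)"
proof -
  let ?S = "Diag B D \<alpha>"
  have st: "is_struct L B" using B by (simp add: model_def)
  have "c \<in> ?S" if "rule ps c" "ps \<subseteq> ?S" for ps c
    using that
  proof induction
    case (r_def w ws \<theta>)
    then obtain bs i where "list_all2 (ev B D \<alpha>) ws bs" "i < length ws" "ws ! i = w"
      by (auto elim!: DiagE simp: in_set_conv_nth)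
    then show ?case by (auto simp: Diag_eq_iff[OF B] list_all2_conv_all_nth)
  next
    case (r_truth ws)
    from defs_Diag[OF this] obtain bs where "list_all2 (ev B D \<alpha>) ws bs" .
    then show ?case by (intro DiagI K_atomic) auto
  next
    case (r_conj ws \<phi> \<psi>)
    from r_conj(2) obtain bs bs' where "list_all2 (ev B D \<alpha>) ws bs" "sat B bs \<phi>"
      "list_all2 (ev B D \<alpha>) ws bs'" "sat B bs' \<psi>"
      by (auto elim!: DiagE)
    moreover from this have "bs' = bs" using evs_det[OF B] by blast
    ultimately show ?case using r_conj(1) by (intro DiagI[of _ _ B D \<alpha> bs]) auto
  next
    case (r_conj1 \<phi> \<psi> ws)
    then show ?case by (auto elim!: DiagE intro!: DiagI dest: K_Conj)
  next
    case (r_conj2 \<phi> \<psi> ws)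
    then show ?case by (auto elim!: DiagE intro!: DiagI dest: K_Conj)
  next
    case (r_exI ws \<chi> w)
    then obtain b bs where "ev B D \<alpha> w b" "list_all2 (ev B D \<alpha>) ws bs" "sat B (b # bs) \<chi>"
      by (auto elim!: DiagE simp: list_all2_Cons1)
    moreover from this have "b \<in> univ B" by (intro ev_univ)
    ultimately show ?case using r_exI by (intro DiagI[of _ _ B D \<alpha> bs]) auto
  next
    case (r_exE \<chi> ws)
    then obtain b bs where "K (length ws) (Exi \<chi>)" "list_all2 (ev B D \<alpha>) ws bs" "b \<in> univ B"
      "sat B (b # bs) \<chi>"
      by (auto elim!: DiagE)
    then show ?case by (intro DiagI[of _ _ B D \<alpha> "b # bs"]) (auto intro: ev_Wit K_Exi)
  next
    case (r_unique ws \<chi> w w')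
    then obtain b b' bs bs' where b: "ev B D \<alpha> w b" "list_all2 (ev B D \<alpha>) ws bs" "sat B (b # bs) \<chi>"
      "ev B D \<alpha> w' b'" "list_all2 (ev B D \<alpha>) ws bs'" "sat B (b' # bs') \<chi>"
      by (auto elim!: DiagE simp: list_all2_Cons1)
    then have "bs' = bs" using evs_det[OF B] by blast
    then have "b = b'" using K_unique[OF r_unique(1) B evs_tuples[OF b(2)] ev_univ[OF b(1)] ev_univ[OF b(4)]] b by simp
    then show ?case using b by (auto simp: Diag_eq_iff[OF B])
  next
    case (r_strict \<chi> ws)
    then have "(eq_fm, [Wit \<chi> ws, Wit \<chi> ws]) \<in> ?S" by simp
    then obtain b where b: "ev B D \<alpha> (Wit \<chi> ws) b" unfolding Diag_eq_iff[OF B] by blast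
    then obtain bs where "K (length ws) (Exi \<chi>)" "list_all2 (ev B D \<alpha>) ws bs" "sat B (b # bs) \<chi>"
      by (rule ev_WitE) blast
    moreover have "b \<in> univ B" using b by (rule ev_univ)
    ultimately show ?case by (intro DiagI[of _ _ B D \<alpha> bs]) auto
  next
    case (r_fun F ws)
    from defs_Diag[OF r_fun(3)] obtain bs where bs: "list_all2 (ev B D \<alpha>) ws bs" .
    have "funI B F bs \<in> univ B"
      using evs_tuples[OF bs] r_fun st by (auto simp: is_struct_def)
    then show ?case using bs r_fun uf_graph[of F L T0 \<Lambda>] list_all2_lengthD[OF bs]
      by (intro DiagI[of _ _ B D \<alpha> bs]) (auto simp: sat_graph_fm)
  next
    case (r_cong ws ws' \<theta>)
    then obtain bs where bs: "K (length ws) \<theta>" "list_all2 (ev B D \<alpha>) ws bs" "sat B bs \<theta>"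
      by (auto elim!: DiagE)
    \<comment> \<open>An equality fact says that both words share a value, so the values
      \<open>bs\<close> of \<open>ws\<close> serve for \<open>ws'\<close> as well.\<close>
    have "ev B D \<alpha> (ws' ! i) (bs ! i)" if "i < length ws'" for i
    proof -
      have "(ws ! i, ws' ! i) \<in> set (zip ws ws')" using that r_cong(1) by (auto simp: set_zip)
      then have "(eq_fm, [ws ! i, ws' ! i]) \<in> ?S" using r_cong(2) by blast
      moreover have "ev B D \<alpha> (ws ! i) (bs ! i)" using bs(2) that r_cong(1) by (auto simp: list_all2_conv_all_nth)
      moreover from calculation obtain b where "ev B D \<alpha> (ws ! i) b" "ev B D \<alpha> (ws' ! i) b"
        unfolding Diag_eq_iff[OF B] by blast
      ultimately show ?thesis using ev_det[OF B] by metis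
    qed
    then have "list_all2 (ev B D \<alpha>) ws' bs"
      using bs(2) r_cong(1) by (auto simp: list_all2_conv_all_nth)
    then show ?case using bs(1,3) r_cong(1) by (simp add: DiagI)
  next
    case (r_relI ws R ts)
    have d: "defs ws \<subseteq> ?S" using r_relI(2) by simp
    from defs_Diag[OF d] obtain bs where bs: "list_all2 (ev B D \<alpha>) ws bs" .
    have wf: "wf_fm L (length ws) (Rel R ts)" by (rule K_wf[OF r_relI(1)])
    have 1: "list_all2 (ev B D \<alpha>) (map (tm_word L ws) ts) (map (val B bs) ts)"
      using ev_tm_word[OF B bs] wf by (auto simp: list_all2_conv_all_nth)
    have "(rel_fm L R, map (tm_word L ws) ts) \<in> ?S" using r_relI(2) by simp
    then have "relI B R (map (val B bs) ts)"
      using Diag_iff[OF B 1] wf K_rel[of R] by (auto simp: sat_rel_fm)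
    then show ?case using bs r_relI(1) by (intro DiagI[of _ _ B D \<alpha> bs]) auto
  next
    case (r_relE R ts ws)
    then obtain bs where K: "K (length ws) (Rel R ts)" and bs: "list_all2 (ev B D \<alpha>) ws bs" "sat B bs (Rel R ts)"
      by (auto elim!: DiagE)
    have wf: "wf_fm L (length ws) (Rel R ts)" using K_wf[OF K] .
    have 1: "list_all2 (ev B D \<alpha>) (map (tm_word L ws) ts) (map (val B bs) ts)"
      using ev_tm_word[OF B bs(1)] wf by (auto simp: list_all2_conv_all_nth)
    show ?case using bs(2) K_rel[of R] wf by (intro DiagI[OF _ 1]) (auto simp: sat_rel_fm)
  next
    case (r_eqnI ws s t)
    have d: "defs ws \<subseteq> ?S" using r_eqnI(2) by simp
    from defs_Diag[OF d] obtain bs where bs: "list_all2 (ev B D \<alpha>) ws bs" .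
    have wf: "wf_fm L (length ws) (Eqn s t)" by (rule K_wf[OF r_eqnI(1)])
    have "(eq_fm, [tm_word L ws s, tm_word L ws t]) \<in> ?S" using r_eqnI(2) by simp
    then obtain b where "ev B D \<alpha> (tm_word L ws s) b" "ev B D \<alpha> (tm_word L ws t) b"
      unfolding Diag_eq_iff[OF B] by blast
    moreover have "ev B D \<alpha> (tm_word L ws s) (val B bs s)" "ev B D \<alpha> (tm_word L ws t) (val B bs t)"
      using ev_tm_word[OF B bs] wf by simp_all
    ultimately have "val B bs s = val B bs t" using ev_det[OF B] by metis
    then show ?case using bs r_eqnI(1) by (intro DiagI[of _ _ B D \<alpha> bs]) auto
  next
    case (r_eqnE s t ws)
    then obtain bs where K: "K (length ws) (Eqn s t)" and bs: "list_all2 (ev B D \<alpha>) ws bs" "sat B bs (Eqn s t)"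
      by (auto elim!: DiagE)
    then show ?case unfolding Diag_eq_iff[OF B]
      using ev_tm_word[OF B bs(1), of s] ev_tm_word[OF B bs(1), of t] K_wf[OF K] by auto
  next
    case (r_axiom ws \<phi> \<psi>)
    then obtain bs where bs: "list_all2 (ev B D \<alpha>) ws bs" "sat B bs \<phi>" by (auto elim!: DiagE)
    have "sat B bs \<psi>" using B r_axiom(1) evs_tuples[OF bs(1)] bs(2) by (fastforce simp: model_def)
    then show ?case using bs r_axiom K_axiom by (intro DiagI) auto
  qed
  moreover have "K (length ws) \<theta>" if "(\<theta>, ws) \<in> ?S" for \<theta> ws using that by (auto simp: Diag_def)
  ultimately show ?thesis by (auto simp: closed_def)
qed

end

context coste
begin

subsection \<open>The term model of a closed set of facts\<close>

definition cls :: "('f, 'r, 'c) fact set \<Rightarrow> ('f, 'r, 'c) word \<Rightarrow> ('f, 'r, 'c) word set" where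
  "cls S w = {w'. (eq_fm, [w, w']) \<in> S}"

abbreviation defd :: "('f, 'r, 'c) fact set \<Rightarrow> ('f, 'r, 'c) word \<Rightarrow> bool" where
  "defd S w \<equiv> (eq_fm, [w, w]) \<in> S"

definition rep :: "('f, 'r, 'c) word set \<Rightarrow> ('f, 'r, 'c) word" where
  "rep b = (SOME w. w \<in> b)"

text \<open>Operations and relations are read off chosen representatives; \<open>TM_funI\<close> and
  \<open>TM_relI\<close> remove the choice by congruence.\<close>

definition TM :: "('f, 'r, 'c) fact set \<Rightarrow> ('f, 'r, ('f, 'r, 'c) word set) struct" where
  "TM S = \<lparr> univ = cls S ` {w. defd S w},
            funI = (\<lambda>F bs. cls S (Wit (graph_fm L F) (map rep bs))),
            relI = (\<lambda>R bs. (rel_fm L R, map rep bs) \<in> S) \<rparr>"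

lemma univ_TM: "univ (TM S) = cls S ` {w. defd S w}"
  by (simp add: TM_def)

lemma closed_def1: "closed S \<Longrightarrow> (\<theta>, ws) \<in> S \<Longrightarrow> w \<in> set ws \<Longrightarrow> defd S w"
  using closed_rule[OF _ r_def] by blast

lemma closed_cong:
  assumes "closed S" "(\<theta>, ws) \<in> S" "list_all2 (\<lambda>w w'. (eq_fm, [w, w']) \<in> S) ws ws'"
  shows "(\<theta>, ws') \<in> S"
  using assms(2,3) by (intro closed_rule[OF assms(1) r_cong[of ws ws' \<theta>]]) (auto simp: list_all2_iff)

lemma eq_sym: assumes "closed S" "(eq_fm, [w, w']) \<in> S" shows "(eq_fm, [w', w]) \<in> S"
proof -
  have "defd S w" using closed_def1[OF assms] by simp
  \<comment> \<open>Congruence replaces the first entry of \<open>[w, w]\<close> by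
    \<open>w'\<close>.\<close>
  from closed_cong[OF assms(1) this, of "[w', w]"] assms(2) this show ?thesis by simp
qed

lemma eq_trans:
  assumes "closed S" "(eq_fm, [w, w']) \<in> S" "(eq_fm, [w', w'']) \<in> S"
  shows "(eq_fm, [w, w'']) \<in> S"
proof -
  have "defd S w" using closed_def1[OF assms(1,2)] by simp
  from closed_cong[OF assms(1,2), of "[w, w'']"] assms(3) this show ?thesis by simp
qed

lemma cls_eq_iff: "closed S \<Longrightarrow> defd S w \<Longrightarrow> cls S w = cls S w' \<longleftrightarrow> (eq_fm, [w, w']) \<in> S"
  unfolding cls_def using eq_sym eq_trans by blast

text \<open>The class of an undefined word is empty, and no element of the term model is
  empty.\<close>

lemma defd_cls: "closed S \<Longrightarrow> cls S w \<in> univ (TM S) \<Longrightarrow> defd S w"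
proof -
  assume S: "closed S" "cls S w \<in> univ (TM S)"
  then obtain w0 where w0: "defd S w0" "cls S w = cls S w0" by (auto simp: univ_TM)
  then have "(eq_fm, [w, w0]) \<in> S" by (auto simp: cls_def set_eq_iff)
  then show ?thesis using closed_def1[OF S(1)] by fastforce
qed

lemma rep_cls: assumes "closed S" "defd S w" shows "(eq_fm, [w, rep (cls S w)]) \<in> S"
proof -
  have "w \<in> cls S w" using assms by (simp add: cls_def)
  then have "rep (cls S w) \<in> cls S w" unfolding rep_def by (rule someI)
  then show ?thesis by (simp add: cls_def)
qed

lemma reps_cls:
  assumes "closed S" "\<forall>w\<in>set ws. defd S w"
  shows "list_all2 (\<lambda>w w'. (eq_fm, [w, w']) \<in> S) ws (map rep (map (cls S) ws))"
  using assms(2) by (auto simp: list_all2_conv_all_nth intro!: rep_cls[OF assms(1)])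

lemma TM_tuplesE:
  assumes "bs \<in> tuples n (univ (TM S))"
  obtains ws where "bs = map (cls S) ws" "\<forall>w\<in>set ws. defd S w" "length ws = n"
proof -
  have "\<forall>b\<in>set bs. \<exists>w. defd S w \<and> b = cls S w" using assms by (auto simp: tuples_def univ_TM)
  then obtain f where f: "\<forall>b\<in>set bs. defd S (f b) \<and> b = cls S (f b)" by metis
  show ?thesis
    using f assms by (intro that[of "map f bs"]) (auto simp: tuples_def map_idI[symmetric])
qed

lemma closed_fun:
  assumes "closed S" "F \<in> funs L" "length ws = far L F" "\<forall>w\<in>set ws. defd S w"
  shows "(graph_fm L F, Wit (graph_fm L F) ws # ws) \<in> S"
proof -
  have "(Exi (graph_fm L F), ws) \<in> S"
    using assms by (intro closed_rule[OF assms(1) r_fun]) auto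
  then show ?thesis by (intro closed_rule[OF assms(1) r_exE]) simp
qed

lemma list_eq_sym: "closed S \<Longrightarrow> list_all2 (\<lambda>w w'. (eq_fm, [w, w']) \<in> S) ws ws' \<Longrightarrow>
    list_all2 (\<lambda>w w'. (eq_fm, [w, w']) \<in> S) ws' ws"
  unfolding list_all2_conv_all_nth using eq_sym by metis

text \<open>Congruence moves the graph fact for \<open>ws\<close> to \<open>ws'\<close>. Then both
  words are witnesses of one graph formula at \<open>ws'\<close>, and \<open>r_unique\<close>
  equates them.\<close>

lemma closed_fun_cong:
  assumes "closed S" "F \<in> funs L" "length ws = far L F"
    "list_all2 (\<lambda>w w'. (eq_fm, [w, w']) \<in> S) ws ws'"
  shows "(eq_fm, [Wit (graph_fm L F) ws, Wit (graph_fm L F) ws']) \<in> S"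
proof -
  let ?g = "graph_fm L F"
  have len: "length ws' = far L F" using assms list_all2_lengthD by metis
  have d: "\<forall>w\<in>set ws. defd S w" "\<forall>w\<in>set ws'. defd S w"
    using assms(4) closed_def1[OF assms(1)]
    by (fastforce simp: list_all2_conv_all_nth in_set_conv_nth)+
  have 1: "(?g, Wit ?g ws # ws) \<in> S" using closed_fun[OF assms(1-3) d(1)] .
  then have "defd S (Wit ?g ws)" using closed_def1[OF assms(1)] by fastforce
  with closed_cong[OF assms(1) 1] assms(4) have "(?g, Wit ?g ws # ws') \<in> S" by simp
  moreover have "(?g, Wit ?g ws' # ws') \<in> S" using closed_fun[OF assms(1,2) len d(2)] .
  moreover have "K (length ws') (Exi ?g)" using uf_graph[OF assms(2)] len by simp
  ultimately show ?thesis using closed_rule[OF assms(1) r_unique] by simp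
qed

lemma TM_funI:
  assumes "closed S" "F \<in> funs L" "length ws = far L F" "\<forall>w\<in>set ws. defd S w"
  shows "funI (TM S) F (map (cls S) ws) = cls S (Wit (graph_fm L F) ws)"
proof -
  have "(eq_fm, [Wit (graph_fm L F) ws, Wit (graph_fm L F) (map rep (map (cls S) ws))]) \<in> S"
    by (rule closed_fun_cong[OF assms(1-3) reps_cls[OF assms(1,4)]])
  moreover have "defd S (Wit (graph_fm L F) ws)"
    using closed_fun[OF assms] closed_def1[OF assms(1)] by fastforce
  ultimately have "cls S (Wit (graph_fm L F) ws) = cls S (Wit (graph_fm L F) (map rep (map (cls S) ws)))"
    by (simp only: cls_eq_iff[OF assms(1)])
  then show ?thesis by (simp add: TM_def)
qed

lemma TM_relI:
  assumes "closed S" "\<forall>w\<in>set ws. defd S w"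
  shows "relI (TM S) R (map (cls S) ws) \<longleftrightarrow> (rel_fm L R, ws) \<in> S"
  using closed_cong[OF assms(1) _ reps_cls[OF assms]] 
    closed_cong[OF assms(1) _ list_eq_sym[OF assms(1) reps_cls[OF assms]]]
  by (auto simp: TM_def)

lemma TM_is_struct: assumes "closed S" shows "is_struct L (TM S)"
  unfolding is_struct_def
proof (intro ballI)
  fix F xs assume F: "F \<in> funs L" and "xs \<in> tuples (far L F) (univ (TM S))"
  then obtain ws where ws: "xs = map (cls S) ws" "\<forall>w\<in>set ws. defd S w" "length ws = far L F"
    by (auto elim: TM_tuplesE)
  have "defd S (Wit (graph_fm L F) ws)"
    using closed_fun[OF assms F ws(3,2)] closed_def1[OF assms] by fastforce
  then show "funI (TM S) F xs \<in> univ (TM S)"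
    using TM_funI[OF assms F ws(3,2)] ws(1) by (simp add: univ_TM)
qed

lemma TM_val:
  assumes "closed S" "\<forall>w\<in>set ws. defd S w"
  shows "wf_tm L (length ws) t \<Longrightarrow>
    val (TM S) (map (cls S) ws) t = cls S (tm_word L ws t) \<and> defd S (tm_word L ws t)"
proof (induction t)
  case (Var i)
  then show ?case using assms by auto
next
  case (Fun F ts)
  have 1: "map (val (TM S) (map (cls S) ws)) ts = map (cls S) (map (tm_word L ws) ts)"
    using Fun by auto
  have 2: "\<forall>w\<in>set (map (tm_word L ws) ts). defd S w" using Fun by auto
  have F: "F \<in> funs L" "length (map (tm_word L ws) ts) = far L F" using Fun.prems by auto
  have "defd S (Wit (graph_fm L F) (map (tm_word L ws) ts))"
    using closed_fun[OF assms(1) F 2] closed_def1[OF assms(1)] by fastforce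
  then show ?case using TM_funI[OF assms(1) F 2] by (simp only: 1 val.simps tm_word.simps simp_thms)
qed

text \<open>The truth lemma, with \<open>Wit \<chi> ws\<close> as Henkin witness in the existential
  case. Disjunction and falsity do not occur in \<open>K\<close>.\<close>

lemma TM_sat:
  assumes S: "closed S"
  shows "K (length ws) \<theta> \<Longrightarrow> \<forall>w\<in>set ws. defd S w \<Longrightarrow>
    sat (TM S) (map (cls S) ws) \<theta> \<longleftrightarrow> (\<theta>, ws) \<in> S"
proof (induction \<theta> arbitrary: ws)
  case Truth
  then show ?case using closed_rule[OF S r_truth[of ws]] by auto
next
  case (Rel R ts)
  have wf: "\<forall>t\<in>set ts. wf_tm L (length ws) t" using K_wf[OF Rel.prems(1)] by simp
  have 1: "map (val (TM S) (map (cls S) ws)) ts = map (cls S) (map (tm_word L ws) ts)"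
    using TM_val[OF S Rel.prems(2)] wf by auto
  have 2: "\<forall>w\<in>set (map (tm_word L ws) ts). defd S w" using TM_val[OF S Rel.prems(2)] wf by auto
  have "sat (TM S) (map (cls S) ws) (Rel R ts) \<longleftrightarrow> (rel_fm L R, map (tm_word L ws) ts) \<in> S"
    using TM_relI[OF S 2] 1 by (simp only: sat.simps)
  also have "\<dots> \<longleftrightarrow> (Rel R ts, ws) \<in> S"
    using closed_rule[OF S r_relI[OF Rel.prems(1)]] closed_rule[OF S r_relE[of R ts ws]] Rel.prems(2)
    by auto
  finally show ?case .
next
  case (Eqn s t)
  have wf: "wf_tm L (length ws) s" "wf_tm L (length ws) t" using K_wf[OF Eqn.prems(1)] by simp_all
  note v = TM_val[OF S Eqn.prems(2)]
  have "sat (TM S) (map (cls S) ws) (Eqn s t) \<longleftrightarrow> (eq_fm, [tm_word L ws s, tm_word L ws t]) \<in> S"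
    using v[OF wf(1)] v[OF wf(2)] cls_eq_iff[OF S] by simp
  also have "\<dots> \<longleftrightarrow> (Eqn s t, ws) \<in> S"
    using closed_rule[OF S r_eqnI[OF Eqn.prems(1)]] closed_rule[OF S r_eqnE[of s t ws]] Eqn.prems(2)
    by auto
  finally show ?case .
next
  case (Conj \<phi> \<psi>)
  have "(Conj \<phi> \<psi>, ws) \<in> S \<longleftrightarrow> (\<phi>, ws) \<in> S \<and> (\<psi>, ws) \<in> S"
    using closed_rule[OF S r_conj[OF Conj.prems(1)]]
      closed_rule[OF S r_conj1[of \<phi> \<psi> ws]] closed_rule[OF S r_conj2[of \<phi> \<psi> ws]]
    by blast
  then show ?case
    using Conj.IH(1)[of ws] Conj.IH(2)[of ws] K_Conj[OF Conj.prems(1)] Conj.prems(2) by simp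
next
  case (Exi \<chi>)
  note K = K_Exi[OF Exi.prems(1)]
  show ?case
  proof
    assume "sat (TM S) (map (cls S) ws) (Exi \<chi>)"
    then obtain w where w: "defd S w" "sat (TM S) (map (cls S) (w # ws)) \<chi>" by (auto simp: univ_TM)
    then have "(\<chi>, w # ws) \<in> S" using Exi.IH[of "w # ws"] Exi.prems K by simp
    then show "(Exi \<chi>, ws) \<in> S" using closed_rule[OF S r_exI[OF Exi.prems(1)]] by simp
  next
    assume "(Exi \<chi>, ws) \<in> S"
    then have 1: "(\<chi>, Wit \<chi> ws # ws) \<in> S" using closed_rule[OF S r_exE] by simp
    then have d: "defd S (Wit \<chi> ws)" using closed_def1[OF S] by fastforce
    with 1 have "sat (TM S) (map (cls S) (Wit \<chi> ws # ws)) \<chi>"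
      using Exi.IH[of "Wit \<chi> ws # ws"] Exi.prems K by simp
    then show "sat (TM S) (map (cls S) ws) (Exi \<chi>)" using d by (auto simp: univ_TM)
  qed
qed (use not_K_Disj not_K_Falsity in blast)+

text \<open>Both sides of an axiom of \<open>T0\<close> lie in \<open>K\<close>, so the truth lemma
  turns \<open>r_axiom\<close> into validity.\<close>

lemma TM_model: assumes S: "closed S" shows "model L T0 (TM S)"
proof -
  have "sat (TM S) xs \<psi>"
    if ax: "(n, \<phi>, \<psi>) \<in> T0" "xs \<in> tuples n (univ (TM S))" "sat (TM S) xs \<phi>" for n \<phi> \<psi> xs
  proof -
    from ax(2) obtain ws where ws: "xs = map (cls S) ws" "\<forall>w\<in>set ws. defd S w" "length ws = n"
      by (rule TM_tuplesE)
    have "(\<phi>, ws) \<in> S" using TM_sat[OF S _ ws(2)] ax K_axiom ws by blast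
    then have "(\<psi>, ws) \<in> S" using closed_rule[OF S r_axiom] ax(1) ws(3) by simp
    then show ?thesis using TM_sat[OF S _ ws(2)] ax K_axiom ws by blast
  qed
  then show ?thesis using TM_is_struct[OF S] unfolding model_def by blast
qed

definition params_in :: "'c set \<Rightarrow> ('f, 'r, 'c) fact set \<Rightarrow> bool" where
  "params_in D S \<longleftrightarrow> (\<forall>c. defd S (Par c) \<longrightarrow> c \<in> D)"

abbreviation cpar :: "('f, 'r, 'c) fact set \<Rightarrow> 'c \<Rightarrow> ('f, 'r, 'c) word set" where
  "cpar S \<equiv> \<lambda>c. cls S (Par c)"

text \<open>Every defined word names its own class, so the term model is generated by its
  parameters.\<close>

lemma TM_ev:
  assumes S: "closed S" "params_in D S"
  shows "defd S w \<Longrightarrow> ev (TM S) D (cpar S) w (cls S w)"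
proof (induction w)
  case (Par c)
  then show ?case using S by (auto simp: params_in_def univ_TM intro!: ev_Par)
next
  case (Wit \<chi> ws)
  have e: "(Exi \<chi>, ws) \<in> S" using closed_rule[OF S(1) r_strict] Wit.prems by simp
  then have "(\<chi>, Wit \<chi> ws # ws) \<in> S" using closed_rule[OF S(1) r_exE] by simp
  moreover have d: "\<forall>w\<in>set ws. defd S w" using closed_def1[OF S(1) e] by blast
  moreover have "K (length ws) (Exi \<chi>)" using closed_K[OF S(1) e] .
  ultimately show ?case
    using TM_sat[OF S(1), of "Wit \<chi> ws # ws" \<chi>] K_Exi Wit
    by (intro ev_Wit[where bs = "map (cls S) ws"])
       (auto simp: list_all2_conv_all_nth univ_TM)
qed

lemma TM_ev_conv:
  assumes S: "closed S"
  shows "ev (TM S) D (cpar S) w b \<Longrightarrow> defd S w \<and> b = cls S w"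
proof (induction rule: ev.induct)
  case (ev_Par c)
  then show ?case using defd_cls[OF S] by blast
next
  case (ev_Wit ws \<chi> bs b)
  have d: "\<forall>w\<in>set ws. defd S w" and bs: "bs = map (cls S) ws"
    using ev_Wit.IH by (auto simp: list_all2_conv_all_nth in_set_conv_nth intro!: nth_equalityI)
  obtain w where w: "defd S w" "b = cls S w" using ev_Wit.hyps by (auto simp: univ_TM)
  have 1: "(\<chi>, w # ws) \<in> S"
    using TM_sat[OF S, of "w # ws" \<chi>] K_Exi[OF ev_Wit.hyps(1)] d w bs ev_Wit.hyps by simp
  then have "(Exi \<chi>, ws) \<in> S" using closed_rule[OF S r_exI[OF ev_Wit.hyps(1)]] by simp
  then have 2: "(\<chi>, Wit \<chi> ws # ws) \<in> S" using closed_rule[OF S r_exE] by simp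
  \<comment> \<open>Whatever word \<open>w\<close> represents the witness \<open>b\<close>,
    uniqueness equates it with the canonical one.\<close>
  have "(eq_fm, [w, Wit \<chi> ws]) \<in> S"
    using closed_rule[OF S r_unique[OF ev_Wit.hyps(1)]] 1 2 by simp
  then show ?case using w cls_eq_iff[OF S] closed_def1[OF S 2] by simp
qed

lemma TM_evs:
  assumes "closed S" "params_in D S" "\<forall>w\<in>set ws. defd S w"
  shows "list_all2 (ev (TM S) D (cpar S)) ws (map (cls S) ws)"
  using assms(3) by (auto simp: list_all2_conv_all_nth intro!: TM_ev[OF assms(1,2)])

text \<open>The set of facts can be recovered from its term model. This is why a set of facts may
  stand for a model together with its named generators.\<close>

lemma Diag_TM:
  assumes S: "closed S" "params_in D S"
  shows "Diag (TM S) D (cpar S) = S"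
proof (intro equalityI subsetI)
  fix p assume "p \<in> Diag (TM S) D (cpar S)"
  then obtain \<theta> ws bs where p: "p = (\<theta>, ws)" "K (length ws) \<theta>"
    "list_all2 (ev (TM S) D (cpar S)) ws bs" "sat (TM S) bs \<theta>" by (auto simp: Diag_def)
  have "\<forall>w\<in>set ws. defd S w" "bs = map (cls S) ws"
    using p(3) TM_ev_conv[OF S(1)]
    by (auto simp: list_all2_conv_all_nth in_set_conv_nth intro!: nth_equalityI) blast+
  then show "p \<in> S" using TM_sat[OF S(1)] p by simp
next
  fix p assume p: "p \<in> S"
  obtain \<theta> ws where [simp]: "p = (\<theta>, ws)" by force
  have d: "\<forall>w\<in>set ws. defd S w" using closed_def1[OF S(1)] p by simp
  show "p \<in> Diag (TM S) D (cpar S)"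
    using TM_evs[OF S d] TM_sat[OF S(1) _ d, of \<theta>] closed_K[OF S(1), of \<theta> ws] p
    by (auto intro: DiagI)
qed

lemma Diag_homom:
  assumes "homom L A B h" "model L T0 A" "\<And>c. c \<in> D \<Longrightarrow> \<alpha> c \<in> univ A \<Longrightarrow> c \<in> D' \<and> h (\<alpha> c) = \<beta> c"
  shows "Diag A D \<alpha> \<subseteq> Diag B D' \<beta>"
proof
  fix p assume "p \<in> Diag A D \<alpha>"
  then obtain \<theta> ws bs where p: "p = (\<theta>, ws)" "K (length ws) \<theta>" "list_all2 (ev A D \<alpha>) ws bs" "sat A bs \<theta>"
    by (auto simp: Diag_def)
  have "list_all2 (ev B D' \<beta>) ws (map h bs)"
    using p(3) ev_homom[OF assms] by (simp add: list_all2_map2 list_all2_mono)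
  moreover have "sat B (map h bs) \<theta>"
    using homom_sat[OF assms(1) _ K_wf[OF p(2)] evs_tuples[OF p(3)] p(4)] assms(2) by (simp add: model_def)
  ultimately show "p \<in> Diag B D' \<beta>" using p by (auto intro: DiagI)
qed

text \<open>Homomorphisms out of a term model evaluate words in the target, which makes them unique once the
  values of the parameters are fixed.\<close>

definition eval_map :: "('f, 'r, 'b) struct \<Rightarrow> 'c set \<Rightarrow> ('c \<Rightarrow> 'b) \<Rightarrow> ('f, 'r, 'c) word set \<Rightarrow> 'b" where
  "eval_map B D \<alpha> x = (THE b. \<exists>w\<in>x. ev B D \<alpha> w b)"

text \<open>Words in one class are equal in \<open>S\<close>, hence have a common value in
  \<open>B\<close>, so the description in \<open>eval_map\<close> does not depend on the
  representative.\<close>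

lemma eval_map_ev:
  assumes "closed S" "model L T0 B" "S \<subseteq> Diag B D \<alpha>" "defd S w"
  shows "ev B D \<alpha> w (eval_map B D \<alpha> (cls S w))"
proof -
  have "(eq_fm, [w, w]) \<in> Diag B D \<alpha>" using assms by blast
  then obtain b where b: "ev B D \<alpha> w b" unfolding Diag_eq_iff[OF assms(2)] by blast
  have "w \<in> cls S w" using assms by (simp add: cls_def)
  moreover have "b' = b" if "w' \<in> cls S w" "ev B D \<alpha> w' b'" for w' b'
  proof -
    have "(eq_fm, [w, w']) \<in> Diag B D \<alpha>" using that(1) assms(3) by (auto simp: cls_def)
    then obtain b'' where "ev B D \<alpha> w b''" "ev B D \<alpha> w' b''" unfolding Diag_eq_iff[OF assms(2)] by blast
    then show ?thesis using b that(2) ev_det[OF assms(2)] by metis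
  qed
  ultimately have "eval_map B D \<alpha> (cls S w) = b"
    unfolding eval_map_def using b by (intro the_equality) blast+
  then show ?thesis using b by simp
qed

lemma eval_map_evs:
  assumes "closed S" "model L T0 B" "S \<subseteq> Diag B D \<alpha>" "\<forall>w\<in>set ws. defd S w"
  shows "list_all2 (ev B D \<alpha>) ws (map (eval_map B D \<alpha>) (map (cls S) ws))"
  using eval_map_ev[OF assms(1-3)] assms(4) by (auto simp: list_all2_conv_all_nth)

text \<open>The inclusion into the diagram says that \<open>B\<close> satisfies every fact of
  \<open>S\<close>, and operations and relations of the term model are such facts.\<close>

lemma eval_map_homom:
  assumes S: "closed S" "model L T0 B" "S \<subseteq> Diag B D \<alpha>"
  shows "homom L (TM S) B (eval_map B D \<alpha>)"
proof -
  let ?h = "eval_map B D \<alpha>"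
  have sat: "sat B (map ?h (map (cls S) ws)) \<theta>" if "(\<theta>, ws) \<in> S" for \<theta> ws
  proof -
    have "\<forall>w\<in>set ws. defd S w" using closed_def1[OF S(1) that] by blast
    then show ?thesis
      using Diag_iff[OF S(2) eval_map_evs[OF S] closed_K[OF S(1) that]] that S(3) by blast
  qed
  have "?h (funI (TM S) F xs) = funI B F (map ?h xs)"
    if F: "F \<in> funs L" "xs \<in> tuples (far L F) (univ (TM S))" for F xs
  proof -
    from F(2) obtain ws where ws: "xs = map (cls S) ws" "\<forall>w\<in>set ws. defd S w" "length ws = far L F"
      by (rule TM_tuplesE)
    have "sat B (map ?h (map (cls S) (Wit (graph_fm L F) ws # ws))) (graph_fm L F)"
      by (intro sat closed_fun S F ws)
    then show ?thesis using TM_funI[OF S(1) F(1) ws(3,2)] ws by (simp add: sat_graph_fm)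
  qed
  moreover have "relI B R (map ?h xs)"
    if R: "R \<in> rels L" "xs \<in> tuples (rar L R) (univ (TM S))" "relI (TM S) R xs" for R xs
  proof -
    from R(2) obtain ws where ws: "xs = map (cls S) ws" "\<forall>w\<in>set ws. defd S w" "length ws = rar L R"
      by (rule TM_tuplesE)
    then have "sat B (map ?h xs) (rel_fm L R)" using R TM_relI[OF S(1) ws(2)] sat by simp
    then show ?thesis using ws by (simp add: sat_rel_fm)
  qed
  moreover have "?h ` univ (TM S) \<subseteq> univ B" using eval_map_ev[OF S] ev_univ by (fastforce simp: univ_TM)
  ultimately show ?thesis by (auto simp: homom_def)
qed

lemma eval_map_Par:
  assumes "closed S" "model L T0 B" "S \<subseteq> Diag B D \<alpha>" "defd S (Par c)"
  shows "eval_map B D \<alpha> (cpar S c) = \<alpha> c"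
  using eval_map_ev[OF assms] by auto

lemma TM_homom_ev:
  assumes "closed S" "params_in D S" "homom L (TM S) B k"
    "\<And>c. defd S (Par c) \<Longrightarrow> k (cpar S c) = \<alpha> c" "defd S w"
  shows "ev B D \<alpha> w (k (cls S w))"
  by (rule ev_homom[OF assms(3) TM_model[OF assms(1)] _ TM_ev[OF assms(1,2,5)]])
     (use assms(4) defd_cls[OF assms(1)] in blast)

lemma TM_homom_unique:
  assumes S: "closed S" "params_in D S" and B: "model L T0 B"
    and k: "homom L (TM S) B k" "homom L (TM S) B k'"
    "\<And>c. defd S (Par c) \<Longrightarrow> k (cpar S c) = k' (cpar S c)" and x: "x \<in> univ (TM S)"
  shows "k x = k' x"
proof -
  obtain w where w: "defd S w" "x = cls S w" using x by (auto simp: univ_TM)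
  have "ev B D (\<lambda>c. k' (cpar S c)) w (k (cls S w))"
    by (rule TM_homom_ev[OF S k(1) k(3) w(1)])
  moreover have "ev B D (\<lambda>c. k' (cpar S c)) w (k' (cls S w))"
    by (rule TM_homom_ev[OF S k(2) refl w(1)])
  ultimately show ?thesis unfolding w(2) by (rule ev_det[OF B])
qed

text \<open>The converse of \<open>eval_map_homom\<close>: homomorphisms preserve facts, and
  \<open>Diag_TM\<close> identifies the facts of the term model with \<open>S\<close>.\<close>

lemma TM_homom_sub_Diag:
  assumes "closed S" "params_in D S" "homom L (TM S) B k"
    "\<And>c. defd S (Par c) \<Longrightarrow> k (cpar S c) = \<alpha> c"
  shows "S \<subseteq> Diag B D \<alpha>"
  using Diag_homom[OF assms(3) TM_model[OF assms(1)], of D "cpar S" D \<alpha>] Diag_TM[OF assms(1,2)]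
    assms(4) defd_cls[OF assms(1)] by blast

subsection \<open>Admissible homomorphisms\<close>

text \<open>By spatiality witnesses are unique in both models. Uniqueness in \<open>B\<close> forces
  the image of a witness from \<open>A\<close> to be the prescribed tuple, so only existence in
  \<open>A\<close> remains.\<close>

lemma admissible_iff:
  assumes "homom L A B h" "model L T0 A" "model L T0 B"
  shows "admissible \<Lambda> A B h \<longleftrightarrow> (\<forall>(n, \<phi>, m, \<psi>)\<in>\<Lambda>. \<forall>a\<in>tuples n (univ A).
     sat A a \<phi> \<longrightarrow> sat B (map h a) ((Exi ^^ m) \<psi>) \<longrightarrow> sat A a ((Exi ^^ m) \<psi>))"
    (is "_ \<longleftrightarrow> ?R")
proof
  assume adm: "admissible \<Lambda> A B h"
  show ?R
  proof (clarify, goal_cases)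
    case (1 n \<phi> m \<psi> a)
    then obtain b where b: "b \<in> tuples m (univ B)" "sat B (b @ map h a) \<psi>" by (auto simp: sat_Exis)
    from adm 1(1) have "\<forall>a\<in>tuples n (univ A). \<forall>b\<in>tuples m (univ B).
        sat A a \<phi> \<and> sat B (b @ map h a) \<psi> \<longrightarrow>
        (\<exists>!a'. a' \<in> tuples m (univ A) \<and> sat A (a' @ a) \<psi> \<and> map h a' = b)"
      unfolding admissible_def by fast
    then have "\<exists>!a'. a' \<in> tuples m (univ A) \<and> sat A (a' @ a) \<psi> \<and> map h a' = b"
      using 1 b by blast
    then show ?case by (auto simp: sat_Exis)
  qed
next
  assume R: ?R
  show "admissible \<Lambda> A B h"
    unfolding admissible_def
  proof (clarify, goal_cases)
    case (1 n \<phi> m \<psi> a b)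
    have "sat B (map h a) ((Exi ^^ m) \<psi>)" using 1 by (auto simp: sat_Exis)
    then have "sat A a ((Exi ^^ m) \<psi>)" using R 1 by fast
    then obtain a' where a': "a' \<in> tuples m (univ A)" "sat A (a' @ a) \<psi>" by (auto simp: sat_Exis)
    have "sat B (map h (a' @ a)) \<psi>"
      using homom_sat[OF assms(1) _ pair_wf(2)[OF 1(1)] tuples_append a'(2)] a'(1) 1 assms(2)
      by (simp add: model_def)
    then have "map h a' = b"
      using pair_unique[OF 1(1) assms(3) homom_tuples[OF assms(1) 1(2)] homom_tuples[OF assms(1) a'(1)] 1(3)] 1
      by simp
    then show ?case
      using a' pair_unique[OF 1(1) assms(2) 1(2)] by blast
  qed
qed

lemma admissibleD:
  assumes "admissible \<Lambda> A B h" "homom L A B h" "model L T0 A" "model L T0 B"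
    "(n, \<phi>, m, \<psi>) \<in> \<Lambda>" "a \<in> tuples n (univ A)" "sat A a \<phi>" "sat B (map h a) ((Exi ^^ m) \<psi>)"
  shows "sat A a ((Exi ^^ m) \<psi>)"
  using bspec[OF assms(1)[unfolded admissible_iff[OF assms(2-4)]] assms(5)] assms(6-8) by blast

lemma admissible_comp:
  assumes "homom L A B h" "homom L B C k" "model L T0 A" "model L T0 B" "model L T0 C"
    "admissible \<Lambda> A B h" "admissible \<Lambda> B C k"
  shows "admissible \<Lambda> A C (\<lambda>x. k (h x))"
  unfolding admissible_iff[OF homom_comp[OF assms(1,2)] assms(3,5)]
proof (clarify, goal_cases)
  case (1 n \<phi> m \<psi> a)
  have "sat B (map h a) \<phi>"
    using homom_sat[OF assms(1) _ pair_wf(1)[OF 1(1)] 1(2,3)] assms(3) by (simp add: model_def)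
  moreover have "sat C (map k (map h a)) ((Exi ^^ m) \<psi>)" using 1(4) by (simp add: comp_def)
  ultimately have "sat B (map h a) ((Exi ^^ m) \<psi>)"
    by (rule admissibleD[OF assms(7,2,4,5) 1(1) homom_tuples[OF assms(1) 1(2)]])
  then show ?case by (rule admissibleD[OF assms(6,1,3,4) 1(1-3)])
qed

text \<open>A witness in \<open>B\<close> maps to one in \<open>C\<close>, and admissibility of the
  composite brings that back to \<open>A\<close>.\<close>

lemma admissible_cancel:
  assumes "homom L A B h" "homom L B C k" "model L T0 A" "model L T0 B" "model L T0 C"
    "admissible \<Lambda> A C (\<lambda>x. k (h x))"
  shows "admissible \<Lambda> A B h"
  unfolding admissible_iff[OF assms(1,3,4)]
proof (clarify, goal_cases)
  case (1 n \<phi> m \<psi> a)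
  have "wf_fm L n ((Exi ^^ m) \<psi>)" using pair_wf(2)[OF 1(1)] by (simp add: wf_Exis)
  then have "sat C (map k (map h a)) ((Exi ^^ m) \<psi>)"
    using homom_sat[OF assms(2) _ _ homom_tuples[OF assms(1) 1(2)] 1(4)] assms(4) by (simp add: model_def)
  then have "sat C (map (\<lambda>x. k (h x)) a) ((Exi ^^ m) \<psi>)" by (simp add: comp_def)
  then show ?case by (rule admissibleD[OF assms(6) homom_comp[OF assms(1,2)] assms(3,5) 1(1-3)])
qed

lemma admissible_isom:
  assumes "isom L A B h k" "model L T0 A" "model L T0 B"
  shows "admissible \<Lambda> A B h"
proof -
  have h: "homom L A B h" using assms(1) by (simp add: isom_def)
  show ?thesis
    unfolding admissible_iff[OF h assms(2,3)]
  proof (clarify, goal_cases)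
    case (1 n \<phi> m \<psi> a)
    have "wf_fm L n ((Exi ^^ m) \<psi>)" using pair_wf(2)[OF 1(1)] by (simp add: wf_Exis)
    then show ?case using isom_sat[OF assms(1)] assms(2,3) 1 by (auto simp: model_def)
  qed
qed

lemma admissible_cong:
  assumes "admissible \<Lambda> A B h" "homom L A B h" "model L T0 A" "model L T0 B" "\<And>x. x \<in> univ A \<Longrightarrow> h x = h' x"
  shows "admissible \<Lambda> A B h'"
proof -
  have h': "homom L A B h'" using homom_cong[OF assms(2)] assms(3,5) by (simp add: model_def)
  have m: "map h a = map h' a" if "a \<in> tuples n (univ A)" for a n
    using that assms(5) by (auto simp: tuples_def)
  show ?thesis
    unfolding admissible_iff[OF h' assms(3,4)]
  proof (clarify, goal_cases)
    case (1 n \<phi> m \<psi> a)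
    then show ?case using admissibleD[OF assms(1-4) 1(1-3)] m[OF 1(2)] by simp
  qed
qed

lemma model_T_imp_T0: "model L T M \<Longrightarrow> model L T0 M"
proof -
  assume "model L T M"
  moreover have "T0 \<subseteq> T" using spatial by (auto simp: spatial_coste_context_def coste_context_def)
  ultimately show ?thesis unfolding model_def by blast
qed

lemma wf_T: "wf_axioms L T"
proof -
  obtain Ax where Ax: "\<forall>(n, \<phi>, ps)\<in>Ax. horn L n \<phi> \<and> (\<forall>(m, \<psi>)\<in>set ps. (n, \<phi>, m, \<psi>) \<in> \<Lambda>)"
    "T = T0 \<union> (\<lambda>(n, \<phi>, ps). cover_axiom n \<phi> ps) ` Ax"
    using spatial unfolding spatial_coste_context_def coste_context_def by blast
  have d: "wf_fm L n (disjs \<phi>s)" if "\<forall>\<phi>\<in>set \<phi>s. wf_fm L n \<phi>" for n and \<phi>s :: "('f, 'r) fm list"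
    using that unfolding disjs_def by (induction \<phi>s) auto
  show ?thesis
    using wf_T0 Ax pair_wf(2) horn_cartesian cartesian_fm_wf
    by (fastforce simp: wf_axioms_def cover_axiom_def wf_Exis intro!: d)
qed

text \<open>\<open>B\<close> satisfies some disjunct of a covering axiom at the image tuple. That
  disjunct belongs to a pair in \<Lambda>, so admissibility pulls its witness back. An empty
  disjunction would contradict validity in \<open>B\<close>.\<close>

lemma admissible_reflects_T:
  assumes "homom L A B h" "model L T0 A" "model L T B" "admissible \<Lambda> A B h"
  shows "model L T A"
proof -
  obtain Ax where Ax: "\<forall>(n, \<phi>, ps)\<in>Ax. horn L n \<phi> \<and> (\<forall>(m, \<psi>)\<in>set ps. (n, \<phi>, m, \<psi>) \<in> \<Lambda>)"
    "T = T0 \<union> (\<lambda>(n, \<phi>, ps). cover_axiom n \<phi> ps) ` Ax"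
    using spatial unfolding spatial_coste_context_def coste_context_def by blast
  have B: "model L T0 B" using assms(3) by (rule model_T_imp_T0)
  have "sat A xs (snd (snd (cover_axiom n \<phi> ps)))"
    if a: "(n, \<phi>, ps) \<in> Ax" "xs \<in> tuples n (univ A)" "sat A xs \<phi>" for n \<phi> ps xs
  proof -
    have h: "horn L n \<phi>" "\<forall>(m, \<psi>)\<in>set ps. (n, \<phi>, m, \<psi>) \<in> \<Lambda>" using Ax(1) a(1) by auto
    have "sat B (map h xs) \<phi>"
      using homom_sat[OF assms(1) _ _ a(2,3)] horn_cartesian[OF h(1)] cartesian_fm_wf assms(2)
      unfolding model_def by blast
    moreover have "cover_axiom n \<phi> ps \<in> T" using Ax(2) a(1) by force
    ultimately have "sat B (map h xs) (disjs (map (\<lambda>(m, \<psi>). (Exi ^^ m) \<psi>) ps))"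
      using assms(3) homom_tuples[OF assms(1) a(2)] by (auto simp: model_def cover_axiom_def)
    then obtain m \<psi> where m: "(m, \<psi>) \<in> set ps" "sat B (map h xs) ((Exi ^^ m) \<psi>)"
      by (auto simp: sat_disjs)
    then have "(n, \<phi>, m, \<psi>) \<in> \<Lambda>" using h(2) by blast
    then have "sat A xs ((Exi ^^ m) \<psi>)" by (rule admissibleD[OF assms(4,1,2) B _ a(2,3) m(2)])
    then show ?thesis using m(1) by (force simp: cover_axiom_def sat_disjs)
  qed
  then show ?thesis
    using assms(2) Ax(2) unfolding model_def by (fastforce simp: cover_axiom_def)
qed

subsection \<open>The etale part of a set of facts\<close>

text \<open>\<open>etale PF Or\<close> adjoins to \<open>PF\<close> only those witnesses for pairs in \<open>\<Lambda>\<close> that \<open>Or\<close> knows of; for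
  \<open>Or = Diag B D \<alpha>\<close> its term model is the middle object of the factorization of \<open>\<alpha>\<close> into an etale
  map followed by an admissible one.\<close>

inductive_set etale :: "('f, 'r, 'c) fact set \<Rightarrow> ('f, 'r, 'c) fact set \<Rightarrow> ('f, 'r, 'c) fact set"
  for PF Or where
  et_rule: "rule ps c \<Longrightarrow> (\<And>p. p \<in> ps \<Longrightarrow> p \<in> etale PF Or) \<Longrightarrow> c \<in> etale PF Or"
| et_base: "p \<in> PF \<Longrightarrow> p \<in> etale PF Or"
| et_pair: "(length ws, \<phi>, m, \<psi>) \<in> \<Lambda> \<Longrightarrow> (\<phi>, ws) \<in> etale PF Or \<Longrightarrow> ((Exi ^^ m) \<psi>, ws) \<in> Or \<Longrightarrow>
    ((Exi ^^ m) \<psi>, ws) \<in> etale PF Or"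

text \<open>\<open>et_pair\<close> only adds facts that are already in \<open>Or\<close>.\<close>

lemma etale_sub: "closed S \<Longrightarrow> PF \<subseteq> S \<Longrightarrow> Or \<subseteq> S \<Longrightarrow> etale PF Or \<subseteq> S"
proof
  fix p assume S: "closed S" "PF \<subseteq> S" "Or \<subseteq> S" and "p \<in> etale PF Or"
  from this(4) show "p \<in> S"
  proof induction
    case (et_rule ps c)
    then show ?case using closed_rule[OF S(1) et_rule(1)] by blast
  qed (use S in blast)+
qed

text \<open>Closure under rules is built in; the bound \<open>S\<close> guarantees that all derived
  facts are in \<open>K\<close>.\<close>

lemma etale_closed: "closed S \<Longrightarrow> PF \<subseteq> S \<Longrightarrow> Or \<subseteq> S \<Longrightarrow> closed (etale PF Or)"
  unfolding closed_def[of "etale PF Or"] using etale_sub[of S PF Or] closed_K[of S]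
  by (blast intro: et_rule)

lemma etale_mono: assumes "Or \<subseteq> Or'" shows "etale PF Or \<subseteq> etale PF Or'"
proof
  fix p assume "p \<in> etale PF Or"
  then show "p \<in> etale PF Or'"
    by induction (use assms in \<open>blast intro: etale.intros\<close>)+
qed

lemma etale_base: "PF \<subseteq> etale PF Or"
  using et_base by blast

text \<open>Every witness fact used in a derivation is itself derived. This puts the etale part into
  the self-referential form \<open>S \<subseteq> etale PF S\<close>, which mentions no target and
  can be imposed on points.\<close>

lemma etale_idem:
  assumes "closed S" "PF \<subseteq> S" "Or \<subseteq> S"
  shows "etale PF (etale PF Or) = etale PF Or"
proof
  show sub: "etale PF (etale PF Or) \<subseteq> etale PF Or"
    using etale_sub[OF etale_closed[OF assms] etale_base] by blast
  show "etale PF Or \<subseteq> etale PF (etale PF Or)"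
  proof
    fix p assume "p \<in> etale PF Or"
    then show "p \<in> etale PF (etale PF Or)"
    proof induction
      case (et_pair ws \<phi> m \<psi>)
      then show ?case by (intro etale.et_pair) (auto intro: etale.et_pair)
    qed (blast intro: etale.intros)+
  qed
qed

text \<open>If \<open>\<phi>\<close> is derived at \<open>ws\<close> and a witness exists in
  \<open>B\<close>, the oracle contains the witness fact, so \<open>et_pair\<close> adjoins
  it.\<close>

lemma etale_admissible:
  assumes B: "model L T0 B" and PF: "PF \<subseteq> Diag B D \<alpha>"
  defines "S \<equiv> etale PF (Diag B D \<alpha>)"
  shows "admissible \<Lambda> (TM S) B (eval_map B D \<alpha>)"
proof -
  have S: "closed S" unfolding S_def using etale_closed[OF Diag_closed[OF B] PF] by blast
  have sub: "S \<subseteq> Diag B D \<alpha>" unfolding S_def using etale_sub[OF Diag_closed[OF B] PF] by blast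
  show ?thesis
    unfolding admissible_iff[OF eval_map_homom[OF S B sub] TM_model[OF S] B]
  proof (clarify, goal_cases)
    case (1 n \<phi> m \<psi> a)
    from 1(2) obtain ws where ws: "a = map (cls S) ws" "\<forall>w\<in>set ws. defd S w" "length ws = n"
      by (rule TM_tuplesE)
    have K: "K (length ws) ((Exi ^^ m) \<psi>)" "K (length ws) \<phi>"
      using K_Exis[OF 1(1)] K_horn[OF pairs(1)[OF 1(1)]] ws(3) by simp_all
    have "((Exi ^^ m) \<psi>, ws) \<in> Diag B D \<alpha>"
      using Diag_iff[OF B eval_map_evs[OF S B sub ws(2)] K(1)] 1(4) ws(1) by simp
    moreover have "(\<phi>, ws) \<in> S" using TM_sat[OF S K(2) ws(2)] 1(3) ws(1) by simp
    ultimately have "((Exi ^^ m) \<psi>, ws) \<in> S"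
      using 1(1) ws(3) unfolding S_def by (intro etale.et_pair) auto
    then show ?case using TM_sat[OF S K(1) ws(2)] ws(1) by simp
  qed
qed

text \<open>Uniqueness of the factorization. Facts of \<open>S\<close> hold in \<open>B\<close>, so
  a derivation with oracle \<open>S\<close> is one with oracle \<open>Diag B D \<alpha>\<close>.
  Conversely, whenever \<open>et_pair\<close> adjoins a witness found in \<open>B\<close>,
  admissibility of \<open>k\<close> shows that \<open>S\<close> has it already.\<close>

lemma etale_unique:
  assumes S: "closed S" "params_in D S" "PF \<subseteq> S" "S \<subseteq> etale PF S"
    and B: "model L T0 B" and k: "homom L (TM S) B k" "admissible \<Lambda> (TM S) B k"
    "\<And>c. defd S (Par c) \<Longrightarrow> k (cpar S c) = \<alpha> c"
  shows "S = etale PF (Diag B D \<alpha>)"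
proof
  have "S \<subseteq> Diag B D \<alpha>" by (rule TM_homom_sub_Diag[OF S(1,2) k(1,3)])
  then show "S \<subseteq> etale PF (Diag B D \<alpha>)" using S(4) etale_mono by blast
  show "etale PF (Diag B D \<alpha>) \<subseteq> S"
  proof
    fix p assume "p \<in> etale PF (Diag B D \<alpha>)"
    then show "p \<in> S"
    proof induction
      case (et_rule ps c)
      then show ?case using closed_rule[OF S(1) et_rule(1)] by blast
    next
      case (et_base p)
      then show ?case using S(3) by blast
    next
      case (et_pair ws \<phi> m \<psi>)
      have d: "\<forall>w\<in>set ws. defd S w" using closed_def1[OF S(1) et_pair.IH] by blast
      have K: "K (length ws) ((Exi ^^ m) \<psi>)" "K (length ws) \<phi>"
        using K_Exis[OF et_pair(1)] K_horn[OF pairs(1)[OF et_pair(1)]] by simp_all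
      have "list_all2 (ev B D \<alpha>) ws (map k (map (cls S) ws))"
        using TM_homom_ev[OF S(1,2) k(1,3)] d by (auto simp: list_all2_conv_all_nth)
      then have "sat B (map k (map (cls S) ws)) ((Exi ^^ m) \<psi>)"
        using Diag_iff[OF B _ K(1)] et_pair(3) by blast
      moreover have "sat (TM S) (map (cls S) ws) \<phi>" using TM_sat[OF S(1) K(2) d] et_pair.IH by simp
      moreover have "map (cls S) ws \<in> tuples (length ws) (univ (TM S))"
        using d by (auto simp: tuples_def univ_TM)
      ultimately have "sat (TM S) (map (cls S) ws) ((Exi ^^ m) \<psi>)"
        by (intro admissibleD[OF k(2,1) TM_model[OF S(1)] B et_pair(1)])
      then show ?case using TM_sat[OF S(1) K(1) d] by simp
    qed
  qed
qed

subsection \<open>Facts about parameters\<close>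

text \<open>The positive diagram of \<open>C\<close> in names \<open>D\<close>. Several names may
  denote one element; the equations between them are among the facts.\<close>

definition param_facts :: "('f, 'r, 'a) struct \<Rightarrow> 'c set \<Rightarrow> ('c \<Rightarrow> 'a) \<Rightarrow> ('f, 'r, 'c) fact set" where
  "param_facts C D \<gamma> = {(\<theta>, map Par cs) | \<theta> cs. set cs \<subseteq> D \<and> K (length cs) \<theta> \<and> sat C (map \<gamma> cs) \<theta>}"

lemma param_factsI:
  "set cs \<subseteq> D \<Longrightarrow> K (length cs) \<theta> \<Longrightarrow> sat C (map \<gamma> cs) \<theta> \<Longrightarrow> (\<theta>, map Par cs) \<in> param_facts C D \<gamma>"
  unfolding param_facts_def by blast

lemma param_facts_Diag:
  assumes "model L T0 C" "homom L C B h" "\<gamma> ` D \<subseteq> univ C" "\<And>c. c \<in> D \<Longrightarrow> \<alpha> c = h (\<gamma> c)"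
  shows "param_facts C D \<gamma> \<subseteq> Diag B D \<alpha>"
proof
  fix p assume "p \<in> param_facts C D \<gamma>"
  then obtain \<theta> cs where p: "p = (\<theta>, map Par cs)" "set cs \<subseteq> D" "K (length cs) \<theta>" "sat C (map \<gamma> cs) \<theta>"
    by (auto simp: param_facts_def)
  have t: "map \<gamma> cs \<in> tuples (length cs) (univ C)" using p assms(3) by (auto simp: tuples_def)
  have "sat B (map h (map \<gamma> cs)) \<theta>"
    using homom_sat[OF assms(2) _ K_wf[OF p(3)] t p(4)] assms(1) by (simp add: model_def)
  moreover have "map h (map \<gamma> cs) = map \<alpha> cs" using p(2) assms(4) by auto
  ultimately have "sat B (map \<alpha> cs) \<theta>" by (simp only:)
  moreover have "list_all2 (ev B D \<alpha>) (map Par cs) (map \<alpha> cs)"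
  proof (rule list_all2_all_nthI)
    fix i assume "i < length (map Par cs :: ('f, 'r, 'c) word list)"
    then have i: "i < length cs" "cs ! i \<in> D" using p(2) by auto
    have "\<alpha> (cs ! i) \<in> univ B" using homom_univ[OF assms(2)] assms(3,4) i by (auto simp: image_subset_iff)
    then show "ev B D \<alpha> (map Par cs ! i) (map \<alpha> cs ! i)" using ev_Par[of "cs ! i" D \<alpha> B] i by simp
  qed simp
  ultimately show "p \<in> Diag B D \<alpha>" using p by (auto intro: DiagI)
qed

definition param_map :: "'c set \<Rightarrow> ('c \<Rightarrow> 'a) \<Rightarrow> ('f, 'r, 'c) fact set \<Rightarrow> 'a \<Rightarrow> ('f, 'r, 'c) word set" where
  "param_map D \<gamma> S x = cls S (Par (SOME c. c \<in> D \<and> \<gamma> c = x))"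

lemma param_defd: "param_facts C D \<gamma> \<subseteq> S \<Longrightarrow> c \<in> D \<Longrightarrow> defd S (Par c)"
  using param_factsI[of "[c, c]" D eq_fm C \<gamma>] by auto

text \<open>Two names of the same element are equated by \<open>param_facts\<close>, so the choice
  in \<open>param_map\<close> is immaterial.\<close>

lemma param_map_Par:
  assumes "closed S" "param_facts C D \<gamma> \<subseteq> S" "c \<in> D"
  shows "param_map D \<gamma> S (\<gamma> c) = cpar S c"
proof -
  let ?c = "SOME c'. c' \<in> D \<and> \<gamma> c' = \<gamma> c"
  have c: "?c \<in> D \<and> \<gamma> ?c = \<gamma> c" by (rule someI[of _ c]) (use assms in simp)
  then have "(eq_fm, map Par [?c, c]) \<in> S"
    using param_factsI[of "[?c, c]" D eq_fm C \<gamma>] assms by auto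
  then show ?thesis using cls_eq_iff[OF assms(1) param_defd[OF assms(2), of ?c]] c by (simp add: param_map_def)
qed

lemma param_map_homom:
  assumes S: "closed S" "param_facts C D \<gamma> \<subseteq> S" and C: "is_struct L C" "\<gamma> ` D = univ C"
  shows "homom L C (TM S) (param_map D \<gamma> S)"
proof -
  let ?j = "param_map D \<gamma> S"
  have par: "\<exists>cs. xs = map \<gamma> cs \<and> set cs \<subseteq> D \<and> length cs = n" if "xs \<in> tuples n (univ C)" for xs n
  proof -
    have "set xs \<subseteq> \<gamma> ` D" using that C(2) by (auto simp: tuples_def)
    then have "xs \<in> lists (\<gamma> ` D)" by blast
    then obtain cs where "cs \<in> lists D" "xs = map \<gamma> cs" unfolding lists_image by blast
    then show ?thesis using that by (auto simp: tuples_def)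
  qed
  have j: "map ?j (map \<gamma> cs) = map (cls S) (map Par cs)" if "set cs \<subseteq> D" for cs
    using that param_map_Par[OF S] by auto
  have d: "\<forall>w\<in>set (map Par cs). defd S w" if "set cs \<subseteq> D" for cs
    using that param_defd[OF S(2)] by auto
  have "?j (funI C F xs) = funI (TM S) F (map ?j xs)"
    if F: "F \<in> funs L" "xs \<in> tuples (far L F) (univ C)" for F xs
  proof -
    obtain cs where cs: "xs = map \<gamma> cs" "set cs \<subseteq> D" "length cs = far L F" using par[OF F(2)] by blast
    have "funI C F xs \<in> univ C" using C(1) F by (auto simp: is_struct_def)
    then obtain c where c: "c \<in> D" "\<gamma> c = funI C F xs" using C(2) by (metis imageE)
    have "(graph_fm L F, map Par (c # cs)) \<in> S"
      using param_factsI[of "c # cs" D "graph_fm L F" C \<gamma>] K_Exi[OF uf_graph[OF F(1)]] S(2) c cs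
      by (auto simp: sat_graph_fm)
    then have "sat (TM S) (map (cls S) (map Par (c # cs))) (graph_fm L F)"
      using TM_sat[OF S(1) _ d[of "c # cs"]] c cs K_Exi[OF uf_graph[OF F(1)]] by simp
    then have "funI (TM S) F (map (cls S) (map Par cs)) = cpar S c"
      using cs by (simp add: sat_graph_fm)
    then show ?thesis using param_map_Par[OF S c(1)] c(2) by (simp only: cs(1) j[OF cs(2)])
  qed
  moreover have "relI (TM S) R (map ?j xs)"
    if R: "R \<in> rels L" "xs \<in> tuples (rar L R) (univ C)" "relI C R xs" for R xs
  proof -
    obtain cs where cs: "xs = map \<gamma> cs" "set cs \<subseteq> D" "length cs = rar L R" using par[OF R(2)] by blast
    have "(rel_fm L R, map Par cs) \<in> S"
      using param_factsI[of cs D "rel_fm L R" C \<gamma>] K_rel[OF R(1)] S(2) cs R(3) by (auto simp: sat_rel_fm)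
    then show ?thesis using TM_relI[OF S(1) d[OF cs(2)]] by (simp only: cs(1) j[OF cs(2)])
  qed
  moreover have "?j ` univ C \<subseteq> univ (TM S)"
    unfolding C(2)[symmetric] using param_map_Par[OF S] param_defd[OF S(2)] by (auto simp: univ_TM)
  ultimately show ?thesis by (auto simp: homom_def)
qed

end

section \<open>Stalks\<close>

lemma presheaf_model: "presheaf_of_models L T0 X P \<Longrightarrow> openin X U \<Longrightarrow> model L T0 (sec P U)"
  and presheaf_res: "presheaf_of_models L T0 X P \<Longrightarrow> openin X U \<Longrightarrow> openin X V \<Longrightarrow> V \<subseteq> U \<Longrightarrow>
    homom L (sec P U) (sec P V) (res P U V)"
  and presheaf_res_id: "presheaf_of_models L T0 X P \<Longrightarrow> openin X U \<Longrightarrow> s \<in> univ (sec P U) \<Longrightarrow>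
    res P U U s = s"
  and presheaf_res_res: "presheaf_of_models L T0 X P \<Longrightarrow> openin X U \<Longrightarrow> openin X V \<Longrightarrow> openin X W \<Longrightarrow>
    W \<subseteq> V \<Longrightarrow> V \<subseteq> U \<Longrightarrow> s \<in> univ (sec P U) \<Longrightarrow> res P V W (res P U V s) = res P U W s"
  by (simp_all add: presheaf_of_models_def)

locale presheaf =
  fixes L :: "('f, 'r) lang" and T0 :: "('f, 'r) sequent set"
    and X :: "'p topology" and P :: "('f, 'r, 'p, 'e) presheaf"
  assumes presheaf: "presheaf_of_models L T0 X P"
begin

lemmas sec_model = presheaf_model[OF presheaf]
lemmas res_homom = presheaf_res[OF presheaf]
lemmas res_id = presheaf_res_id[OF presheaf]
lemmas res_res = presheaf_res_res[OF presheaf]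

lemma sec_struct: "openin X U \<Longrightarrow> is_struct L (sec P U)"
  using sec_model by (simp add: model_def)

lemma res_univ: "openin X U \<Longrightarrow> openin X V \<Longrightarrow> V \<subseteq> U \<Longrightarrow> s \<in> univ (sec P U) \<Longrightarrow>
    res P U V s \<in> univ (sec P V)"
  using homom_univ[OF res_homom] .

lemma res_tuples: "openin X U \<Longrightarrow> openin X V \<Longrightarrow> V \<subseteq> U \<Longrightarrow> ss \<in> tuples n (univ (sec P U)) \<Longrightarrow>
    map (res P U V) ss \<in> tuples n (univ (sec P V))"
  using homom_tuples[OF res_homom] .

lemma map_res_res:
  assumes "openin X U" "openin X V" "openin X W" "W \<subseteq> V" "V \<subseteq> U" "ss \<in> tuples n (univ (sec P U))"
  shows "map (res P V W) (map (res P U V) ss) = map (res P U W) ss"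
  using assms res_res[OF assms(1-5)] by (auto simp: tuples_def)

lemma germ_eqI:
  assumes "openin X U" "openin X V" "s \<in> univ (sec P U)" "t \<in> univ (sec P V)"
    "openin X W" "x \<in> W" "W \<subseteq> U \<inter> V" "res P U W s = res P V W t"
  shows "germ X P x U s = germ X P x V t"
proof -
  have sub: "germ X P x U s \<subseteq> germ X P x V t"
    if "openin X U" "openin X V" "s \<in> univ (sec P U)" "t \<in> univ (sec P V)"
      "openin X W" "x \<in> W" "W \<subseteq> U \<inter> V" "res P U W s = res P V W t" for U V W s t
  proof
    fix p assume "p \<in> germ X P x U s"
    then obtain V' t' W' where p: "p = (V', t')" "openin X V'" "x \<in> V'" "t' \<in> univ (sec P V')"
      "openin X W'" "x \<in> W'" "W' \<subseteq> U \<inter> V'" "res P U W' s = res P V' W' t'"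
      by (auto simp: germ_def)
    \<comment> \<open>Agreement of sections is transitive on the intersection of the two
      neighbourhoods.\<close>
    let ?N = "W \<inter> W'"
    have N: "openin X ?N" "x \<in> ?N" using that p by auto
    have "res P V ?N t = res P W ?N (res P V W t)"
      using that p N by (intro res_res[symmetric]) auto
    also have "\<dots> = res P W ?N (res P U W s)" using that by simp
    also have "\<dots> = res P U ?N s" using that p N by (intro res_res) auto
    also have "\<dots> = res P W' ?N (res P U W' s)" using that p N by (intro res_res[symmetric]) auto
    also have "\<dots> = res P W' ?N (res P V' W' t')" using p by simp
    also have "\<dots> = res P V' ?N t'" using that p N by (intro res_res) auto
    finally have "res P V ?N t = res P V' ?N t'" .
    moreover have "?N \<subseteq> V \<inter> V'" using that p by auto
    ultimately show "p \<in> germ X P x V t" using p N by (auto simp: germ_def)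
  qed
  show ?thesis
    using sub[OF assms] sub[OF assms(2,1,4,3,5,6) _ assms(8)[symmetric]] assms(7) by blast
qed

lemma germ_eq_iff:
  assumes "openin X U" "openin X V" "x \<in> U" "x \<in> V" "s \<in> univ (sec P U)" "t \<in> univ (sec P V)"
  shows "germ X P x U s = germ X P x V t \<longleftrightarrow>
    (\<exists>W. openin X W \<and> x \<in> W \<and> W \<subseteq> U \<inter> V \<and> res P U W s = res P V W t)"
proof
  assume "germ X P x U s = germ X P x V t"
  moreover have "(V, t) \<in> germ X P x V t" using assms by (auto simp: germ_def)
  ultimately have "(V, t) \<in> germ X P x U s" by blast
  then show "\<exists>W. openin X W \<and> x \<in> W \<and> W \<subseteq> U \<inter> V \<and> res P U W s = res P V W t"
    by (auto simp: germ_def)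
qed (use germ_eqI assms in blast)

lemma germ_res:
  assumes "openin X U" "openin X V" "V \<subseteq> U" "x \<in> V" "s \<in> univ (sec P U)"
  shows "germ X P x V (res P U V s) = germ X P x U s"
  using assms res_univ[OF assms(1-3,5)]
  by (intro germ_eqI[where W = V]) (auto simp: res_res)

lemma map_germ_res:
  assumes "openin X U" "openin X V" "V \<subseteq> U" "x \<in> V" "ss \<in> tuples n (univ (sec P U))"
  shows "map (germ X P x V) (map (res P U V) ss) = map (germ X P x U) ss"
  using assms germ_res[OF assms(1-4)] by (auto simp: tuples_def)

lemma univ_stalk: "univ (stalk X P x) = {germ X P x U s | U s. openin X U \<and> x \<in> U \<and> s \<in> univ (sec P U)}"
  by (simp add: stalk_def)

lemma germ_in_stalk: "openin X U \<Longrightarrow> x \<in> U \<Longrightarrow> s \<in> univ (sec P U) \<Longrightarrow> germ X P x U s \<in> univ (stalk X P x)"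
  by (auto simp: univ_stalk)

lemma stalkE:
  assumes "g \<in> univ (stalk X P x)"
  obtains U s where "openin X U" "x \<in> U" "s \<in> univ (sec P U)" "g = germ X P x U s"
  using assms by (auto simp: univ_stalk)

lemma stalk_tuplesE:
  assumes "gs \<in> tuples n (univ (stalk X P x))" "x \<in> topspace X"
  obtains U ss where "openin X U" "x \<in> U" "ss \<in> tuples n (univ (sec P U))" "gs = map (germ X P x U) ss"
proof -
  have "\<exists>U ss. openin X U \<and> x \<in> U \<and> ss \<in> tuples n (univ (sec P U)) \<and> gs = map (germ X P x U) ss"
    using assms(1)
  proof (induction n arbitrary: gs)
    case 0
    then show ?case using assms(2) by (intro exI[of _ "topspace X"] exI[of _ "[]"]) (auto simp: tuples_def)
  next
    case (Suc n)
    then obtain h hs where g: "gs = h # hs" "h \<in> univ (stalk X P x)" "hs \<in> tuples n (univ (stalk X P x))"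
      by (auto elim: tuples_SucE)
    from Suc.IH[OF g(3)] obtain U ss where U: "openin X U" "x \<in> U" "ss \<in> tuples n (univ (sec P U))"
      "hs = map (germ X P x U) ss" by blast
    from g(2) obtain V s where V: "openin X V" "x \<in> V" "s \<in> univ (sec P V)" "h = germ X P x V s"
      by (rule stalkE)
    let ?W = "U \<inter> V"
    have W: "openin X ?W" "x \<in> ?W" "?W \<subseteq> U" "?W \<subseteq> V" using U V by auto
    have "gs = map (germ X P x ?W) (res P V ?W s # map (res P U ?W) ss)"
      using map_germ_res[OF U(1) W(1,3,2) U(3)] germ_res[OF V(1) W(1,4,2) V(3)] g U V by simp
    then show ?case
      using W res_univ[OF V(1) W(1,4) V(3)] res_tuples[OF U(1) W(1,3) U(3)]
      by (intro exI[of _ ?W] exI[of _ "res P V ?W s # map (res P U ?W) ss"]) simp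
  qed
  then show ?thesis using that by blast
qed

lemma map_germ_eqD:
  assumes "openin X U" "openin X V" "x \<in> U" "x \<in> V" "ss \<in> tuples n (univ (sec P U))"
    "ts \<in> tuples n (univ (sec P V))" "map (germ X P x U) ss = map (germ X P x V) ts"
  shows "\<exists>W. openin X W \<and> x \<in> W \<and> W \<subseteq> U \<inter> V \<and> map (res P U W) ss = map (res P V W) ts"
  using assms(5-7)
proof (induction n arbitrary: ss ts)
  case 0
  then show ?case using assms(1-4) by (intro exI[of _ "U \<inter> V"]) (auto simp: tuples_def)
next
  case (Suc n)
  then obtain s ss' t ts' where st: "ss = s # ss'" "ts = t # ts'"
    "s \<in> univ (sec P U)" "ss' \<in> tuples n (univ (sec P U))" "t \<in> univ (sec P V)" "ts' \<in> tuples n (univ (sec P V))"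
    by (auto elim!: tuples_SucE)
  from Suc.IH[OF st(4,6)] Suc.prems(3) st obtain W where W: "openin X W" "x \<in> W" "W \<subseteq> U \<inter> V"
    "map (res P U W) ss' = map (res P V W) ts'" by auto
  from germ_eq_iff[OF assms(1-4) st(3,5)] Suc.prems(3) st obtain W' where
    W': "openin X W'" "x \<in> W'" "W' \<subseteq> U \<inter> V" "res P U W' s = res P V W' t" by auto
  let ?N = "W \<inter> W'"
  have N: "openin X ?N" "?N \<subseteq> W" "?N \<subseteq> W'" using W W' by auto
  have WU: "W \<subseteq> U" "W \<subseteq> V" "W' \<subseteq> U" "W' \<subseteq> V" using W W' by auto
  have "map (res P U ?N) ss' = map (res P V ?N) ts'"
    using map_res_res[OF assms(1) W(1) N(1,2) WU(1) st(4)] map_res_res[OF assms(2) W(1) N(1,2) WU(2) st(6)] W(4)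
    by simp
  moreover have "res P U ?N s = res P V ?N t"
    using res_res[OF assms(1) W'(1) N(1,3) WU(3) st(3)] res_res[OF assms(2) W'(1) N(1,3) WU(4) st(5)] W'(4)
    by simp
  ultimately show ?case using st N W W' by (intro exI[of _ ?N]) auto
qed

lemma stalk_funI:
  assumes "openin X U" "x \<in> U" "F \<in> funs L" "ss \<in> tuples (far L F) (univ (sec P U))"
  shows "funI (stalk X P x) F (map (germ X P x U) ss) = germ X P x U (funI (sec P U) F ss)"
proof -
  have u: "g = germ X P x U (funI (sec P U) F ss)"
    if V: "openin X V" "x \<in> V" "set ts \<subseteq> univ (sec P V)" "map (germ X P x U) ss = map (germ X P x V) ts"
      "g = germ X P x V (funI (sec P V) F ts)" for V ts g
  proof -
    have "length ts = length ss" using V(4) by (metis length_map)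
    then have ts: "ts \<in> tuples (far L F) (univ (sec P V))" using V(3) assms(4) by (auto simp: tuples_def)
    from map_germ_eqD[OF assms(1) V(1) assms(2) V(2) assms(4) ts V(4)] obtain W where
      W: "openin X W" "x \<in> W" "W \<subseteq> U \<inter> V" "map (res P U W) ss = map (res P V W) ts" by blast
    have "res P V W (funI (sec P V) F ts) = res P U W (funI (sec P U) F ss)"
      using homom_funI[OF res_homom[OF V(1) W(1)] assms(3) ts] 
        homom_funI[OF res_homom[OF assms(1) W(1)] assms(3,4)] W(3,4) by simp
    then show ?thesis unfolding V(5)
      using W sec_struct[OF assms(1)] sec_struct[OF V(1)] assms ts
      by (intro germ_eqI[OF V(1) assms(1) _ _ W(1,2)]) (auto simp: is_struct_def)
  qed
  have "(THE g. \<exists>V ts. openin X V \<and> x \<in> V \<and> set ts \<subseteq> univ (sec P V) \<and>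
      map (germ X P x U) ss = map (germ X P x V) ts \<and> g = germ X P x V (funI (sec P V) F ts)) =
      germ X P x U (funI (sec P U) F ss)"
  proof (rule the_equality)
    show "\<exists>V ts. openin X V \<and> x \<in> V \<and> set ts \<subseteq> univ (sec P V) \<and>
      map (germ X P x U) ss = map (germ X P x V) ts \<and>
      germ X P x U (funI (sec P U) F ss) = germ X P x V (funI (sec P V) F ts)"
      using assms by (intro exI[of _ U] exI[of _ ss]) (simp add: tuples_def)
  qed (elim exE conjE, rule u)
  then show ?thesis by (simp add: stalk_def)
qed

lemma stalk_relI:
  assumes "openin X U" "x \<in> U" "R \<in> rels L" "ss \<in> tuples (rar L R) (univ (sec P U))"
  shows "relI (stalk X P x) R (map (germ X P x U) ss) \<longleftrightarrow>
    (\<exists>W. openin X W \<and> x \<in> W \<and> W \<subseteq> U \<and> relI (sec P W) R (map (res P U W) ss))"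
proof
  assume "relI (stalk X P x) R (map (germ X P x U) ss)"
  then obtain V ts where V: "openin X V" "x \<in> V" "set ts \<subseteq> univ (sec P V)"
    "map (germ X P x U) ss = map (germ X P x V) ts" "relI (sec P V) R ts" by (auto simp: stalk_def)
  have "length ts = length ss" using V(4) by (metis length_map)
  then have ts: "ts \<in> tuples (rar L R) (univ (sec P V))" using V(3) assms(4) by (auto simp: tuples_def)
  from map_germ_eqD[OF assms(1) V(1) assms(2) V(2) assms(4) ts V(4)] obtain W where
    W: "openin X W" "x \<in> W" "W \<subseteq> U \<inter> V" "map (res P U W) ss = map (res P V W) ts" by blast
  then show "\<exists>W. openin X W \<and> x \<in> W \<and> W \<subseteq> U \<and> relI (sec P W) R (map (res P U W) ss)"
    using homom_relI[OF res_homom[OF V(1) W(1)] assms(3) ts V(5)] by auto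
next
  assume "\<exists>W. openin X W \<and> x \<in> W \<and> W \<subseteq> U \<and> relI (sec P W) R (map (res P U W) ss)"
  then obtain W where W: "openin X W" "x \<in> W" "W \<subseteq> U" "relI (sec P W) R (map (res P U W) ss)" by blast
  then show "relI (stalk X P x) R (map (germ X P x U) ss)"
    using map_germ_res[OF assms(1) W(1,3,2) assms(4), symmetric] res_tuples[OF assms(1) W(1,3) assms(4)]
    unfolding stalk_def tuples_def
    by (auto simp del: map_map map_eq_conv intro!: exI[of _ W] exI[of _ "map (res P U W) ss"])
qed

lemma stalk_struct: assumes "x \<in> topspace X" shows "is_struct L (stalk X P x)"
  unfolding is_struct_def
proof (intro ballI)
  fix F gs assume F: "F \<in> funs L" and "gs \<in> tuples (far L F) (univ (stalk X P x))"
  then obtain U ss where U: "openin X U" "x \<in> U" "ss \<in> tuples (far L F) (univ (sec P U))"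
    "gs = map (germ X P x U) ss" using assms by (auto elim: stalk_tuplesE)
  then show "funI (stalk X P x) F gs \<in> univ (stalk X P x)"
    using stalk_funI[OF U(1,2) F U(3)] sec_struct[OF U(1)] F by (auto simp: is_struct_def intro!: germ_in_stalk)
qed

lemma germ_homom:
  assumes "openin X U" "x \<in> U"
  shows "homom L (sec P U) (stalk X P x) (germ X P x U)"
proof -
  have "relI (stalk X P x) R (map (germ X P x U) ss)"
    if "R \<in> rels L" "ss \<in> tuples (rar L R) (univ (sec P U))" "relI (sec P U) R ss" for R ss
    unfolding stalk_relI[OF assms that(1,2)]
  proof -
    have "map (res P U U) ss = ss" using that(2) res_id[OF assms(1)] by (auto simp: tuples_def intro!: map_idI)
    then show "\<exists>W. openin X W \<and> x \<in> W \<and> W \<subseteq> U \<and> relI (sec P W) R (map (res P U W) ss)"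
      using that(3) assms by (intro exI[of _ U]) simp
  qed
  then show ?thesis
    using stalk_funI[OF assms] germ_in_stalk[OF assms] unfolding homom_def by auto
qed

text \<open>A coherent formula involves finitely many sections and instances, which live on a common
  neighbourhood of \<open>x\<close>. The converse is preservation along the homomorphism that takes
  germs.\<close>

lemma stalk_sat:
  assumes x: "x \<in> topspace X"
  shows "wf_fm L n \<phi> \<Longrightarrow> openin X U \<Longrightarrow> x \<in> U \<Longrightarrow> ss \<in> tuples n (univ (sec P U)) \<Longrightarrow>
    sat (stalk X P x) (map (germ X P x U) ss) \<phi> \<longleftrightarrow>
    (\<exists>W. openin X W \<and> x \<in> W \<and> W \<subseteq> U \<and> sat (sec P W) (map (res P U W) ss) \<phi>)"
proof
  assume wf: "wf_fm L n \<phi>" and U: "openin X U" "x \<in> U" "ss \<in> tuples n (univ (sec P U))"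
  assume "\<exists>W. openin X W \<and> x \<in> W \<and> W \<subseteq> U \<and> sat (sec P W) (map (res P U W) ss) \<phi>"
  then obtain W where W: "openin X W" "x \<in> W" "W \<subseteq> U" "sat (sec P W) (map (res P U W) ss) \<phi>" by blast
  then show "sat (stalk X P x) (map (germ X P x U) ss) \<phi>"
    using homom_sat[OF germ_homom[OF W(1,2)] sec_struct[OF W(1)] wf res_tuples[OF U(1) W(1,3) U(3)] W(4)]
      map_germ_res[OF U(1) W(1,3,2) U(3)] by (simp only:)
next
  assume "wf_fm L n \<phi>" "openin X U" "x \<in> U" "ss \<in> tuples n (univ (sec P U))"
    "sat (stalk X P x) (map (germ X P x U) ss) \<phi>"
  then show "\<exists>W. openin X W \<and> x \<in> W \<and> W \<subseteq> U \<and> sat (sec P W) (map (res P U W) ss) \<phi>"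
  proof (induction \<phi> arbitrary: n U ss)
    case (Rel R ts)
    let ?vs = "map (val (sec P U) ss) ts"
    have vs: "?vs \<in> tuples (rar L R) (univ (sec P U))"
      using val_in_univ[OF sec_struct Rel.prems(4)] Rel.prems(1,2) by (auto simp: tuples_def)
    have "map (val (stalk X P x) (map (germ X P x U) ss)) ts = map (germ X P x U) ?vs"
      using homom_val[OF germ_homom sec_struct Rel.prems(4)] Rel.prems(1-3) by auto
    then have "relI (stalk X P x) R (map (germ X P x U) ?vs)" using Rel.prems(5) by (simp only: sat.simps)
    then obtain W where W: "openin X W" "x \<in> W" "W \<subseteq> U" "relI (sec P W) R (map (res P U W) ?vs)"
      using stalk_relI[OF Rel.prems(2,3) _ vs] Rel.prems(1) by auto
    have "map (res P U W) ?vs = map (val (sec P W) (map (res P U W) ss)) ts"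
      using homom_val[OF res_homom[OF Rel.prems(2) W(1,3)] sec_struct[OF Rel.prems(2)] Rel.prems(4)] Rel.prems(1)
      by auto
    then have "sat (sec P W) (map (res P U W) ss) (Rel R ts)" using W(4) by (simp only: sat.simps)
    then show ?case using W by blast
  next
    case (Eqn s t)
    have wf: "wf_tm L n s" "wf_tm L n t" using Eqn.prems(1) by auto
    note st = sec_struct[OF Eqn.prems(2)]
    have "germ X P x U (val (sec P U) ss s) = germ X P x U (val (sec P U) ss t)"
      using homom_val[OF germ_homom[OF Eqn.prems(2,3)] st Eqn.prems(4)] wf Eqn.prems(5) by simp
    then obtain W where W: "openin X W" "x \<in> W" "W \<subseteq> U"
      "res P U W (val (sec P U) ss s) = res P U W (val (sec P U) ss t)"
      using germ_eq_iff[OF Eqn.prems(2,2,3,3) val_in_univ[OF st Eqn.prems(4) wf(1)] val_in_univ[OF st Eqn.prems(4) wf(2)]]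
      by auto
    then have "sat (sec P W) (map (res P U W) ss) (Eqn s t)"
      using homom_val[OF res_homom[OF Eqn.prems(2) W(1,3)] st Eqn.prems(4)] wf by simp
    then show ?case using W by blast
  next
    case (Conj \<phi> \<psi>)
    obtain W W' where W: "openin X W" "x \<in> W" "W \<subseteq> U" "sat (sec P W) (map (res P U W) ss) \<phi>"
      and W': "openin X W'" "x \<in> W'" "W' \<subseteq> U" "sat (sec P W') (map (res P U W') ss) \<psi>"
      using Conj.IH(1)[of n U ss] Conj.IH(2)[of n U ss] Conj.prems by auto
    let ?N = "W \<inter> W'"
    have N: "openin X ?N" "?N \<subseteq> W" "?N \<subseteq> W'" using W W' by auto
    have wf: "wf_fm L n \<phi>" "wf_fm L n \<psi>" using Conj.prems by auto
    have "sat (sec P ?N) (map (res P W ?N) (map (res P U W) ss)) \<phi>"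
      by (rule homom_sat[OF res_homom[OF W(1) N(1,2)] sec_struct[OF W(1)] wf(1)
          res_tuples[OF Conj.prems(2) W(1,3) Conj.prems(4)] W(4)])
    moreover have "sat (sec P ?N) (map (res P W' ?N) (map (res P U W') ss)) \<psi>"
      by (rule homom_sat[OF res_homom[OF W'(1) N(1,3)] sec_struct[OF W'(1)] wf(2)
          res_tuples[OF Conj.prems(2) W'(1,3) Conj.prems(4)] W'(4)])
    ultimately have "sat (sec P ?N) (map (res P U ?N) ss) (Conj \<phi> \<psi>)"
      unfolding map_res_res[OF Conj.prems(2) W(1) N(1,2) W(3) Conj.prems(4)]
        map_res_res[OF Conj.prems(2) W'(1) N(1,3) W'(3) Conj.prems(4)] by simp
    then show ?case using N W W' by (intro exI[of _ ?N]) auto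
  next
    case (Exi \<phi>)
    then obtain g where g: "g \<in> univ (stalk X P x)" "sat (stalk X P x) (g # map (germ X P x U) ss) \<phi>"
      by auto
    obtain V t where V: "openin X V" "x \<in> V" "t \<in> univ (sec P V)" "g = germ X P x V t"
      using g(1) by (rule stalkE)
    let ?N = "U \<inter> V"
    have N: "openin X ?N" "?N \<subseteq> U" "?N \<subseteq> V" "x \<in> ?N" using Exi.prems V by auto
    let ?ss = "res P V ?N t # map (res P U ?N) ss"
    have ss: "?ss \<in> tuples (Suc n) (univ (sec P ?N))"
      using res_univ[OF V(1) N(1,3) V(3)] res_tuples[OF Exi.prems(2) N(1,2) Exi.prems(4)] by simp
    have "map (germ X P x ?N) ?ss = g # map (germ X P x U) ss"
      using germ_res[OF V(1) N(1,3,4) V(3)] map_germ_res[OF Exi.prems(2) N(1,2,4) Exi.prems(4)] V(4) by simp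
    then have "sat (stalk X P x) (map (germ X P x ?N) ?ss) \<phi>" using g(2) by (simp only:)
    then obtain W where W: "openin X W" "x \<in> W" "W \<subseteq> ?N" "sat (sec P W) (map (res P ?N W) ?ss) \<phi>"
      using Exi.IH[OF _ N(1,4) ss] Exi.prems(1) by auto
    have WU: "W \<subseteq> U" using W by auto
    have "map (res P ?N W) ?ss = res P ?N W (res P V ?N t) # map (res P U W) ss"
      using map_res_res[OF Exi.prems(2) N(1) W(1,3) N(2) Exi.prems(4)] by simp
    moreover have "res P ?N W (res P V ?N t) \<in> univ (sec P W)"
      using res_univ[OF N(1) W(1,3) res_univ[OF V(1) N(1,3) V(3)]] .
    ultimately have "sat (sec P W) (map (res P U W) ss) (Exi \<phi>)" using W(4) by (auto simp del: map_map)
    then show ?case using W WU by blast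
  next
    case (Disj \<phi> \<psi>)
    then show ?case using Disj.IH(1)[of n U ss] Disj.IH(2)[of n U ss] by auto
  qed auto
qed

lemma stalk_model:
  assumes "wf_axioms L T0" and x: "x \<in> topspace X"
  shows "model L T0 (stalk X P x)"
proof -
  have "sat (stalk X P x) gs \<psi>"
    if ax: "(n, \<phi>, \<psi>) \<in> T0" "gs \<in> tuples n (univ (stalk X P x))" "sat (stalk X P x) gs \<phi>" for n \<phi> \<psi> gs
  proof -
    have wf: "wf_fm L n \<phi>" "wf_fm L n \<psi>" using ax(1) assms(1) by (auto simp: wf_axioms_def)
    from ax(2) x obtain U ss where U: "openin X U" "x \<in> U" "ss \<in> tuples n (univ (sec P U))"
      "gs = map (germ X P x U) ss" by (rule stalk_tuplesE)
    from ax(3) obtain W where W: "openin X W" "x \<in> W" "W \<subseteq> U" "sat (sec P W) (map (res P U W) ss) \<phi>"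
      using stalk_sat[OF x wf(1) U(1-3)] U(4) by auto
    have "sat (sec P W) (map (res P U W) ss) \<psi>"
      using sec_model[OF W(1)] ax(1) res_tuples[OF U(1) W(1,3) U(3)] W(4) by (fastforce simp: model_def)
    then show ?thesis using stalk_sat[OF x wf(2) U(1-3)] U(4) W by blast
  qed
  then show ?thesis using stalk_struct[OF x] unfolding model_def by blast
qed

end

section \<open>Sections of a sheaf through their germs\<close>

locale sheaf = presheaf L T0 X P
  for L :: "('f, 'r) lang" and T0 :: "('f, 'r) sequent set"
    and X :: "'p topology" and P :: "('f, 'r, 'p, 'e) presheaf" +
  assumes sheaf: "sheaf_of_models L T0 X P"
begin

lemma glue:
  assumes "\<And>V. V \<in> \<C> \<Longrightarrow> openin X V" "\<And>V. V \<in> \<C> \<Longrightarrow> s V \<in> univ (sec P V)"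
    "\<And>V W. V \<in> \<C> \<Longrightarrow> W \<in> \<C> \<Longrightarrow> res P V (V \<inter> W) (s V) = res P W (V \<inter> W) (s W)"
  shows "\<exists>!t. t \<in> univ (sec P (\<Union>\<C>)) \<and> (\<forall>V\<in>\<C>. res P (\<Union>\<C>) V t = s V)"
  using sheaf[unfolded sheaf_of_models_def, THEN conjunct2, rule_format, of \<C>, THEN conjunct1, rule_format, of s]
    assms by blast

lemma rel_local:
  assumes "\<And>V. V \<in> \<C> \<Longrightarrow> openin X V" "R \<in> rels L" "ts \<in> tuples (rar L R) (univ (sec P (\<Union>\<C>)))"
    "\<And>V. V \<in> \<C> \<Longrightarrow> relI (sec P V) R (map (res P (\<Union>\<C>) V) ts)"
  shows "relI (sec P (\<Union>\<C>)) R ts"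
  using sheaf[unfolded sheaf_of_models_def, THEN conjunct2, rule_format, of \<C>, THEN conjunct2, rule_format, of R ts]
    assms by blast

lemma germs_determine:
  assumes U: "openin X U" "s \<in> univ (sec P U)" "t \<in> univ (sec P U)"
    and e: "\<And>x. x \<in> U \<Longrightarrow> germ X P x U s = germ X P x U t"
  shows "s = t"
proof -
  \<comment> \<open>All open sets on which \<open>s\<close> and \<open>t\<close> agree. They cover
    \<open>U\<close>, and both sections glue the same family.\<close>
  let ?C = "{W. openin X W \<and> W \<subseteq> U \<and> res P U W s = res P U W t}"
  have C: "\<Union>?C = U" using e germ_eq_iff[OF U(1,1) _ _ U(2,3)] by fastforce
  have "\<exists>!r. r \<in> univ (sec P (\<Union>?C)) \<and> (\<forall>V\<in>?C. res P (\<Union>?C) V r = res P U V s)"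
  proof (rule glue)
    fix V W assume V: "V \<in> ?C" and W: "W \<in> ?C"
    then show "res P V (V \<inter> W) (res P U V s) = res P W (V \<inter> W) (res P U W s)"
      using U by (subst (1 2) res_res) auto
  qed (use U res_univ in auto)
  then show ?thesis unfolding C using U(2,3) by (metis (mono_tags, lifting) mem_Collect_eq)
qed

lemma rel_stalkwise:
  assumes U: "openin X U" "R \<in> rels L" "ss \<in> tuples (rar L R) (univ (sec P U))"
    and e: "\<And>x. x \<in> U \<Longrightarrow> relI (stalk X P x) R (map (germ X P x U) ss)"
  shows "relI (sec P U) R ss"
proof -
  let ?C = "{W. openin X W \<and> W \<subseteq> U \<and> relI (sec P W) R (map (res P U W) ss)}"
  have C: "\<Union>?C = U" using e stalk_relI[OF U(1) _ U(2,3)] by fastforce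
  have "relI (sec P (\<Union>?C)) R ss" by (rule rel_local) (unfold C, use U in auto)
  then show ?thesis unfolding C .
qed

lemma glue_germs:
  assumes U: "openin X U"
    and g: "\<And>x. x \<in> U \<Longrightarrow> \<exists>V t. openin X V \<and> x \<in> V \<and> V \<subseteq> U \<and> t \<in> univ (sec P V) \<and>
      (\<forall>x'\<in>V. g x' = germ X P x' V t)"
  shows "\<exists>!s. s \<in> univ (sec P U) \<and> (\<forall>x\<in>U. germ X P x U s = g x)"
proof -
  let ?Q = "\<lambda>V t. t \<in> univ (sec P V) \<and> (\<forall>x'\<in>V. g x' = germ X P x' V t)"
  let ?C = "{V. openin X V \<and> V \<subseteq> U \<and> (\<exists>t. ?Q V t)}"
  define t where "t V = (SOME t. ?Q V t)" for V
  have t: "?Q V (t V)" if "V \<in> ?C" for V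
    unfolding t_def using that by (intro someI_ex[of "?Q V"]) blast
  have C: "\<Union>?C = U"
  proof
    show "U \<subseteq> \<Union>?C"
    proof
      fix x assume "x \<in> U"
      from g[OF this] obtain V t where "openin X V" "x \<in> V" "V \<subseteq> U" "?Q V t" by blast
      then show "x \<in> \<Union>?C" by blast
    qed
  qed blast
  have "\<exists>!s. s \<in> univ (sec P (\<Union>?C)) \<and> (\<forall>V\<in>?C. res P (\<Union>?C) V s = t V)"
  proof (rule glue)
    fix V W assume V: "V \<in> ?C" and W: "W \<in> ?C"
    have VW: "openin X V" "openin X W" "openin X (V \<inter> W)" "t V \<in> univ (sec P V)" "t W \<in> univ (sec P W)"
      using V W t[OF V] t[OF W] by auto
    \<comment> \<open>Chosen local sections agree on overlaps because both have the germs prescribed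
      by \<open>g\<close>.\<close>
    show "res P V (V \<inter> W) (t V) = res P W (V \<inter> W) (t W)"
    proof (rule germs_determine)
      fix x assume x: "x \<in> V \<inter> W"
      have "germ X P x (V \<inter> W) (res P V (V \<inter> W) (t V)) = g x"
        using x VW t[OF V] by (subst germ_res) auto
      moreover have "germ X P x (V \<inter> W) (res P W (V \<inter> W) (t W)) = g x"
        using x VW t[OF W] by (subst germ_res) auto
      ultimately show "germ X P x (V \<inter> W) (res P V (V \<inter> W) (t V)) = germ X P x (V \<inter> W) (res P W (V \<inter> W) (t W))"
        by simp
    qed (use VW res_univ in auto)
  next
    fix V assume V: "V \<in> ?C"
    show "openin X V" using V by blast
    show "t V \<in> univ (sec P V)" using t[OF V] by blast
  qed
  from ex1_implies_ex[OF this] obtain s where s: "s \<in> univ (sec P U)" "\<forall>V\<in>?C. res P U V s = t V"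
    unfolding C by (elim exE conjE)
  have "germ X P x U s = g x" if x: "x \<in> U" for x
  proof -
    from x have "x \<in> \<Union>?C" unfolding C .
    then obtain V where V: "V \<in> ?C" "x \<in> V" by (rule UnionE)
    then have "germ X P x U s = germ X P x V (t V)" using germ_res[OF U, of V x s] s by auto
    then show ?thesis using t[OF V(1)] V(2) by simp
  qed
  with s show ?thesis by (intro ex1I[of _ s]) (auto intro: germs_determine[OF U])
qed

end

section \<open>Morphisms of modelled spaces and their stalk maps\<close>

lemma sheafI: "sheaf_of_models L T0 X P \<Longrightarrow> sheaf L T0 X P"
  by unfold_locales (simp add: sheaf_of_models_def, assumption)

locale ms_map = dom: sheaf L T0 X P + cod: sheaf L T0 Y Q
  for L :: "('f, 'r) lang" and T0 :: "('f, 'r) sequent set"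
    and X :: "'x topology" and P :: "('f, 'r, 'x, 'd) presheaf"
    and Y :: "'y topology" and Q :: "('f, 'r, 'y, 'e) presheaf" +
  fixes f :: "'x \<Rightarrow> 'y"
  assumes cont: "continuous_map X Y f"
begin

abbreviation pb :: "'x set \<Rightarrow> ('f, 'r, 'x \<Rightarrow> ('y set \<times> 'e) set) struct" where
  "pb \<equiv> sec (pullback X f Y Q)"

abbreviation pbs :: "'x set \<Rightarrow> 'y set \<Rightarrow> 'e \<Rightarrow> 'x \<Rightarrow> ('y set \<times> 'e) set" where
  "pbs U W t \<equiv> (\<lambda>x\<in>U. germ Y Q (f x) W t)"

abbreviation sm :: "('x set \<Rightarrow> ('x \<Rightarrow> ('y set \<times> 'e) set) \<Rightarrow> 'd) \<Rightarrow> 'x \<Rightarrow> ('y set \<times> 'e) set \<Rightarrow> ('x set \<times> 'd) set"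
  where "sm \<equiv> stalk_map X P f Y Q"

lemma pb_univ: "univ (pb U) = {s \<in> extensional U. \<forall>x\<in>U. \<exists>V W t. openin X V \<and> x \<in> V \<and> V \<subseteq> U \<and>
              openin Y W \<and> f ` V \<subseteq> W \<and> t \<in> univ (sec Q W) \<and>
              (\<forall>x'\<in>V. s x' = germ Y Q (f x') W t)}"
  by (simp add: pullback_def)

lemma pb_res [simp]: "res (pullback X f Y Q) U V s = restrict s V"
  by (simp add: pullback_def)

lemma openin_preimage: "openin Y W \<Longrightarrow> openin X {x \<in> topspace X. f x \<in> W}"
  using cont by (rule openin_continuous_map_preimage)

lemma f_top: "x \<in> topspace X \<Longrightarrow> f x \<in> topspace Y"
  using cont by (auto simp: continuous_map_def)

lemma pbs_univ: "openin X U \<Longrightarrow> openin Y W \<Longrightarrow> f ` U \<subseteq> W \<Longrightarrow> t \<in> univ (sec Q W) \<Longrightarrow>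
    pbs U W t \<in> univ (pb U)"
  unfolding pb_univ by (auto intro!: exI[of _ U] exI[of _ W] exI[of _ t])

lemma pbE:
  assumes "s \<in> univ (pb U)" "x \<in> U"
  obtains V W t where "openin X V" "x \<in> V" "V \<subseteq> U" "openin Y W" "f ` V \<subseteq> W" "t \<in> univ (sec Q W)"
    "\<forall>x'\<in>V. s x' = germ Y Q (f x') W t"
  using assms unfolding pb_univ by blast

lemma pb_restrict:
  assumes "s \<in> univ (pb U)" "openin X V" "V \<subseteq> U"
  shows "restrict s V \<in> univ (pb V)"
proof -
  have "\<exists>V' W t. openin X V' \<and> x \<in> V' \<and> V' \<subseteq> V \<and> openin Y W \<and> f ` V' \<subseteq> W \<and> t \<in> univ (sec Q W) \<and>
      (\<forall>x'\<in>V'. restrict s V x' = germ Y Q (f x') W t)" if x: "x \<in> V" for x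
  proof -
    obtain V' W t where "openin X V'" "x \<in> V'" "V' \<subseteq> U" "openin Y W" "f ` V' \<subseteq> W" "t \<in> univ (sec Q W)"
      "\<forall>x'\<in>V'. s x' = germ Y Q (f x') W t"
      using pbE[OF assms(1) subsetD[OF assms(3) x]] .
    then show ?thesis using x assms(2) by (intro exI[of _ "V' \<inter> V"] exI[of _ W] exI[of _ t]) auto
  qed
  then show ?thesis unfolding pb_univ by simp
qed

lemma pb_stalk: "s \<in> univ (pb U) \<Longrightarrow> x \<in> U \<Longrightarrow> s x \<in> univ (stalk Y Q (f x))"
  by (elim pbE) (auto intro!: cod.germ_in_stalk)

lemma pb_through:
  assumes "g \<in> univ (stalk Y Q (f x))" "x \<in> topspace X"
  obtains U W t where "openin X U" "x \<in> U" "openin Y W" "f ` U \<subseteq> W" "t \<in> univ (sec Q W)"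
    "pbs U W t \<in> univ (pb U)" "pbs U W t x = g"
proof -
  obtain W t where W: "openin Y W" "f x \<in> W" "t \<in> univ (sec Q W)" "g = germ Y Q (f x) W t"
    using assms(1) by (rule cod.stalkE)
  show ?thesis
    using W assms(2) openin_preimage[OF W(1)]
    by (intro that[of "{x \<in> topspace X. f x \<in> W}" W t] pbs_univ) auto
qed

text \<open>Evaluation at \<open>x\<close> therefore identifies the stalk of the pullback with the
  stalk of \<open>Q\<close> at \<open>f x\<close>, and the description in \<open>stalk_map\<close>
  does not depend on the section.\<close>

lemma pb_agree:
  assumes "s \<in> univ (pb U)" "s' \<in> univ (pb U')" "x \<in> U" "x \<in> U'" "s x = s' x"
  obtains N where "openin X N" "x \<in> N" "N \<subseteq> U \<inter> U'" "\<forall>x'\<in>N. s x' = s' x'"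
proof -
  obtain V W t where V: "openin X V" "x \<in> V" "V \<subseteq> U" "openin Y W" "f ` V \<subseteq> W" "t \<in> univ (sec Q W)"
    "\<forall>x'\<in>V. s x' = germ Y Q (f x') W t" using pbE[OF assms(1,3)] .
  obtain V' W' t' where V': "openin X V'" "x \<in> V'" "V' \<subseteq> U'" "openin Y W'" "f ` V' \<subseteq> W'" "t' \<in> univ (sec Q W')"
    "\<forall>x'\<in>V'. s' x' = germ Y Q (f x') W' t'" using pbE[OF assms(2,4)] .
  have "germ Y Q (f x) W t = germ Y Q (f x) W' t'" using assms(5) V(2,7) V'(2,7) by simp
  moreover have "f x \<in> W" "f x \<in> W'" using V(2,5) V'(2,5) by auto
  ultimately obtain O1 where O1: "openin Y O1" "f x \<in> O1" "O1 \<subseteq> W \<inter> W'" "res Q W O1 t = res Q W' O1 t'"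
    using cod.germ_eq_iff[OF V(4) V'(4) _ _ V(6) V'(6)] by blast
  let ?N = "V \<inter> V' \<inter> {x \<in> topspace X. f x \<in> O1}"
  have "s x' = s' x'" if "x' \<in> ?N" for x'
  proof -
    have "germ Y Q (f x') W t = germ Y Q (f x') W' t'"
      using that O1 by (intro cod.germ_eqI[OF V(4) V'(4) V(6) V'(6) O1(1)]) auto
    then show ?thesis using V(7) V'(7) that by auto
  qed
  moreover have "openin X ?N" using V(1) V'(1) openin_preimage[OF O1(1)] by auto
  moreover have "x \<in> topspace X" using V(1,2) openin_subset by blast
  moreover have "x \<in> ?N" "?N \<subseteq> U \<inter> U'"
    using calculation V(2,3,5) V'(2,3,5) O1(2) by auto
  ultimately show ?thesis by (intro that[of ?N]) auto
qed

lemma sheaf_mor_univ: "sheaf_mor L X (pullback X f Y Q) P \<phi> \<Longrightarrow> openin X U \<Longrightarrow> s \<in> univ (pb U) \<Longrightarrow>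
    \<phi> U s \<in> univ (sec P U)"
  by (rule homom_univ[of L "pb U"]) (simp_all add: sheaf_mor_def)

lemma sm_eq:
  assumes "sheaf_mor L X (pullback X f Y Q) P \<phi>" "openin X U" "x \<in> U" "s \<in> univ (pb U)"
  shows "sm \<phi> x (s x) = germ X P x U (\<phi> U s)"
  unfolding stalk_map_def
proof (rule the_equality)
  show "\<exists>U' s'. openin X U' \<and> x \<in> U' \<and> s' \<in> univ (pb U') \<and> s' x = s x \<and>
      germ X P x U (\<phi> U s) = germ X P x U' (\<phi> U' s')"
    using assms by blast
  fix h assume "\<exists>U' s'. openin X U' \<and> x \<in> U' \<and> s' \<in> univ (pb U') \<and> s' x = s x \<and> h = germ X P x U' (\<phi> U' s')"
  then obtain U' s' where s': "openin X U'" "x \<in> U'" "s' \<in> univ (pb U')" "s x = s' x"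
    "h = germ X P x U' (\<phi> U' s')" by metis
  obtain N where N: "openin X N" "x \<in> N" "N \<subseteq> U \<inter> U'" "\<forall>x'\<in>N. s x' = s' x'"
    using pb_agree[OF assms(4) s'(3) assms(3) s'(2,4)] .
  have "restrict s N = restrict s' N" by (rule restrict_ext) (use N(4) in auto)
  moreover have "\<phi> N (restrict s N) = res P U N (\<phi> U s)" "\<phi> N (restrict s' N) = res P U' N (\<phi> U' s')"
    using assms(1,2,4) s' N(1,3) unfolding sheaf_mor_def pb_res by (metis le_inf_iff)+
  ultimately show "h = germ X P x U (\<phi> U s)"
    unfolding s'(5) using s' assms N sheaf_mor_univ[OF assms(1)]
    by (intro dom.germ_eqI[OF s'(1) assms(2) _ _ N(1,2)]) auto
qed

lemma pb_tuple_local: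
  assumes "ss \<in> tuples n (univ (pb U))" "openin X U" "x \<in> U"
  shows "\<exists>V W ts. openin X V \<and> x \<in> V \<and> V \<subseteq> U \<and> openin Y W \<and> f ` V \<subseteq> W \<and> ts \<in> tuples n (univ (sec Q W)) \<and>
    (\<forall>x'\<in>V. map (\<lambda>s. s x') ss = map (germ Y Q (f x') W) ts)"
  using assms(1)
proof (induction n arbitrary: ss)
  case 0
  have "f ` U \<subseteq> topspace Y" using f_top openin_subset[OF assms(2)] by auto
  then show ?case using 0 assms(2,3) by (intro exI[of _ U] exI[of _ "topspace Y"] exI[of _ "[]"]) (auto simp: tuples_def)
next
  case (Suc n)
  then obtain s ss' where s: "ss = s # ss'" "s \<in> univ (pb U)" "ss' \<in> tuples n (univ (pb U))"
    by (auto elim: tuples_SucE)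
  from Suc.IH[OF s(3)] obtain V W ts where V: "openin X V" "x \<in> V" "V \<subseteq> U" "openin Y W" "f ` V \<subseteq> W"
    "ts \<in> tuples n (univ (sec Q W))" "\<forall>x'\<in>V. map (\<lambda>s. s x') ss' = map (germ Y Q (f x') W) ts" by blast
  obtain V' W' t where V': "openin X V'" "x \<in> V'" "V' \<subseteq> U" "openin Y W'" "f ` V' \<subseteq> W'" "t \<in> univ (sec Q W')"
    "\<forall>x'\<in>V'. s x' = germ Y Q (f x') W' t" using pbE[OF s(2) assms(3)] .
  let ?O = "W \<inter> W'"
  have O: "openin Y ?O" "?O \<subseteq> W" "?O \<subseteq> W'" using V V' by auto
  have "map (\<lambda>s. s x') ss = map (germ Y Q (f x') ?O) (res Q W' ?O t # map (res Q W ?O) ts)"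
    if "x' \<in> V \<inter> V'" for x'
  proof -
    have fx: "f x' \<in> ?O" using that V V' by auto
    show ?thesis
      using cod.map_germ_res[OF V(4) O(1,2) fx V(6)] cod.germ_res[OF V'(4) O(1,3) fx V'(6)] V(7) V'(7) that s(1)
      by simp
  qed
  moreover have "res Q W' ?O t # map (res Q W ?O) ts \<in> tuples (Suc n) (univ (sec Q ?O))"
    using cod.res_tuples[OF V(4) O(1,2) V(6)] cod.res_univ[OF V'(4) O(1,3) V'(6)] by simp
  ultimately show ?case using V V' O
    by (intro exI[of _ "V \<inter> V'"] exI[of _ ?O] exI[of _ "res Q W' ?O t # map (res Q W ?O) ts"]) auto
qed

lemma pb_funI: "funI (pb U) F ss = (\<lambda>x\<in>U. funI (stalk Y Q (f x)) F (map (\<lambda>s. s x) ss))"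
  and pb_relI: "relI (pb U) R ss \<longleftrightarrow> (\<forall>x\<in>U. relI (stalk Y Q (f x)) R (map (\<lambda>s. s x) ss))"
  by (simp_all add: pullback_def)

lemma pb_struct:
  assumes U: "openin X U"
  shows "is_struct L (pb U)"
  unfolding is_struct_def
proof (intro ballI)
  fix F ss assume F: "F \<in> funs L" "ss \<in> tuples (far L F) (univ (pb U))"
  have "\<exists>V W t. openin X V \<and> x \<in> V \<and> V \<subseteq> U \<and> openin Y W \<and> f ` V \<subseteq> W \<and> t \<in> univ (sec Q W) \<and>
      (\<forall>x'\<in>V. funI (pb U) F ss x' = germ Y Q (f x') W t)" if x: "x \<in> U" for x
  proof -
    from pb_tuple_local[OF F(2) U x] obtain V W ts where V: "openin X V" "x \<in> V" "V \<subseteq> U" "openin Y W" "f ` V \<subseteq> W"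
      "ts \<in> tuples (far L F) (univ (sec Q W))" "\<forall>x'\<in>V. map (\<lambda>s. s x') ss = map (germ Y Q (f x') W) ts"
      by blast
    have "funI (pb U) F ss x' = germ Y Q (f x') W (funI (sec Q W) F ts)" if "x' \<in> V" for x'
      using V that cod.stalk_funI[OF V(4) _ F(1) V(6), of "f x'"] by (auto simp: pb_funI)
    moreover have "funI (sec Q W) F ts \<in> univ (sec Q W)"
      using cod.sec_struct[OF V(4)] V(6) F(1) by (auto simp: is_struct_def)
    ultimately show ?thesis using V by blast
  qed
  then show "funI (pb U) F ss \<in> univ (pb U)" unfolding pb_univ by (auto simp: pb_funI)
qed

lemma sm_homom:
  assumes \<phi>: "sheaf_mor L X (pullback X f Y Q) P \<phi>" and x: "x \<in> topspace X"
  shows "homom L (stalk Y Q (f x)) (stalk X P x) (sm \<phi> x)"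
proof -
  have hom: "homom L (pb U) (sec P U) (\<phi> U)" if "openin X U" for U using \<phi> that by (simp add: sheaf_mor_def)
  \<comment> \<open>Lifts a tuple of germs to sections of the pullback over one open set. A relation
    between the germs spreads to a neighbourhood, so it can be made to hold at every point of that
    open set, as \<open>pb_relI\<close> demands.\<close>
  have tup: "\<exists>U ss. openin X U \<and> x \<in> U \<and> ss \<in> tuples n (univ (pb U)) \<and> gs = map (\<lambda>s. s x) ss \<and>
      (R \<in> rels L \<and> n = rar L R \<and> relI (stalk Y Q (f x)) R gs \<longrightarrow> relI (pb U) R ss)"
    if gs: "gs \<in> tuples n (univ (stalk Y Q (f x)))" for n gs R
  proof -
    obtain W ts where W: "openin Y W" "f x \<in> W" "ts \<in> tuples n (univ (sec Q W))" "gs = map (germ Y Q (f x) W) ts"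
      using gs f_top[OF x] by (rule cod.stalk_tuplesE)
    obtain W' where W': "openin Y W'" "f x \<in> W'" "W' \<subseteq> W"
      "R \<in> rels L \<and> n = rar L R \<and> relI (stalk Y Q (f x)) R gs \<longrightarrow> relI (sec Q W') R (map (res Q W W') ts)"
    proof (cases "R \<in> rels L \<and> n = rar L R \<and> relI (stalk Y Q (f x)) R gs")
      case True
      then show ?thesis using that cod.stalk_relI[OF W(1,2), of R ts] W by blast
    qed (use that W in blast)
    let ?U = "{x \<in> topspace X. f x \<in> W'}" and ?ts = "map (res Q W W') ts"
    have ts: "?ts \<in> tuples n (univ (sec Q W'))" using cod.res_tuples[OF W(1) W'(1,3) W(3)] .
    have U: "openin X ?U" "x \<in> ?U" "f ` ?U \<subseteq> W'" using openin_preimage[OF W'(1)] x W' by auto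
    have v: "map (\<lambda>s. s x') (map (pbs ?U W') ?ts) = map (germ Y Q (f x') W') ?ts" if "x' \<in> ?U" for x'
      using that by simp
    have "map (pbs ?U W') ?ts \<in> tuples n (univ (pb ?U))"
      using ts pbs_univ[OF U(1) W'(1) U(3)] by (auto simp: tuples_def)
    moreover have "gs = map (\<lambda>s. s x) (map (pbs ?U W') ?ts)"
      unfolding v[OF U(2)] using cod.map_germ_res[OF W(1) W'(1,3,2) W(3)] W(4) by simp
    moreover have "relI (pb ?U) R (map (pbs ?U W') ?ts)" if "R \<in> rels L \<and> n = rar L R \<and> relI (stalk Y Q (f x)) R gs"
      unfolding pb_relI
    proof
      fix x' assume "x' \<in> ?U"
      then show "relI (stalk Y Q (f x')) R (map (\<lambda>s. s x') (map (pbs ?U W') ?ts))"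
        unfolding v[OF \<open>x' \<in> ?U\<close>]
        using homom_relI[OF cod.germ_homom[OF W'(1)]] that W'(4) ts by blast
    qed
    ultimately show ?thesis using U by blast
  qed
  have img: "map (sm \<phi> x) (map (\<lambda>s. s x) ss) = map (germ X P x U) (map (\<phi> U) ss)"
    if "openin X U" "x \<in> U" "ss \<in> tuples n (univ (pb U))" for U ss n
    using that sm_eq[OF \<phi> that(1,2)] by (auto simp: tuples_def)
  have "sm \<phi> x (funI (stalk Y Q (f x)) F gs) = funI (stalk X P x) F (map (sm \<phi> x) gs)"
    if F: "F \<in> funs L" "gs \<in> tuples (far L F) (univ (stalk Y Q (f x)))" for F gs
  proof -
    obtain U ss where U: "openin X U" "x \<in> U" "ss \<in> tuples (far L F) (univ (pb U))" "gs = map (\<lambda>s. s x) ss"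
      using tup[OF F(2)] by blast
    have s: "funI (pb U) F ss \<in> univ (pb U)" using pb_struct[OF U(1)] U(3) F(1) by (auto simp: is_struct_def)
    have "sm \<phi> x (funI (stalk Y Q (f x)) F gs) = sm \<phi> x (funI (pb U) F ss x)" using U by (simp add: pb_funI)
    also have "\<dots> = germ X P x U (\<phi> U (funI (pb U) F ss))" by (rule sm_eq[OF \<phi> U(1,2) s])
    also have "\<dots> = germ X P x U (funI (sec P U) F (map (\<phi> U) ss))" using homom_funI[OF hom[OF U(1)] F(1) U(3)] by simp
    also have "\<dots> = funI (stalk X P x) F (map (germ X P x U) (map (\<phi> U) ss))"
      using dom.stalk_funI[OF U(1,2) F(1) homom_tuples[OF hom[OF U(1)] U(3)]] by simp
    finally show ?thesis by (simp only: img[OF U(1-3)] U(4))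
  qed
  moreover have "relI (stalk X P x) R (map (sm \<phi> x) gs)"
    if R: "R \<in> rels L" "gs \<in> tuples (rar L R) (univ (stalk Y Q (f x)))" "relI (stalk Y Q (f x)) R gs" for R gs
  proof -
    obtain U ss where U: "openin X U" "x \<in> U" "ss \<in> tuples (rar L R) (univ (pb U))" "gs = map (\<lambda>s. s x) ss"
      "relI (pb U) R ss" using tup[OF R(2), of R] R by blast
    have "relI (sec P U) R (map (\<phi> U) ss)" using homom_relI[OF hom[OF U(1)] R(1) U(3,5)] .
    then show ?thesis
      using homom_relI[OF dom.germ_homom[OF U(1,2)] R(1) homom_tuples[OF hom[OF U(1)] U(3)]] img[OF U(1-3)] U(4)
      by (simp only:)
  qed
  moreover have "sm \<phi> x ` univ (stalk Y Q (f x)) \<subseteq> univ (stalk X P x)"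
  proof (rule image_subsetI)
    fix g assume "g \<in> univ (stalk Y Q (f x))"
    then obtain U W t where U: "openin X U" "x \<in> U" "pbs U W t \<in> univ (pb U)" "pbs U W t x = g"
      using pb_through[OF _ x] by metis
    then have "sm \<phi> x g = germ X P x U (\<phi> U (pbs U W t))" using sm_eq[OF \<phi> U(1-3)] by metis
    then show "sm \<phi> x g \<in> univ (stalk X P x)"
      using dom.germ_in_stalk[OF U(1,2) sheaf_mor_univ[OF \<phi> U(1,3)]] by simp
  qed
  ultimately show ?thesis by (auto simp: homom_def)
qed

lemma sm_germ:
  assumes "sheaf_mor L X (pullback X f Y Q) P \<phi>" "openin Y W" "t \<in> univ (sec Q W)"
  obtains r where "r \<in> univ (sec P {x \<in> topspace X. f x \<in> W})"
    "\<forall>x\<in>topspace X. f x \<in> W \<longrightarrow> sm \<phi> x (germ Y Q (f x) W t) = germ X P x {x \<in> topspace X. f x \<in> W} r"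
proof -
  let ?U = "{x \<in> topspace X. f x \<in> W}"
  have U: "openin X ?U" using openin_preimage[OF assms(2)] .
  have s: "pbs ?U W t \<in> univ (pb ?U)" by (rule pbs_univ[OF U assms(2) _ assms(3)]) auto
  show ?thesis
    using sm_eq[OF assms(1) U _ s] sheaf_mor_univ[OF assms(1) U s] by (intro that) auto
qed

text \<open>Sections of \<open>P\<close> are determined by germs, and the germs of
  \<open>\<phi> U s\<close> are the stalk maps applied to the values of \<open>s\<close>.\<close>

lemma sheaf_mor_ext:
  assumes "sheaf_mor L X (pullback X f Y Q) P \<phi>" "sheaf_mor L X (pullback X f Y Q) P \<phi>'"
    "\<And>x g. x \<in> topspace X \<Longrightarrow> g \<in> univ (stalk Y Q (f x)) \<Longrightarrow> sm \<phi> x g = sm \<phi>' x g"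
  shows "\<phi> = \<phi>'"
proof (rule extensionalityI)
  fix U assume "U \<in> {U. openin X U}"
  then have U: "openin X U" by simp
  show "\<phi> U = \<phi>' U"
  proof (rule extensionalityI)
    fix s assume s: "s \<in> univ (pb U)"
    show "\<phi> U s = \<phi>' U s"
    proof (rule dom.germs_determine[OF U])
      fix x assume x: "x \<in> U"
      then have "x \<in> topspace X" using openin_subset[OF U] by blast
      then show "germ X P x U (\<phi> U s) = germ X P x U (\<phi>' U s)"
        using sm_eq[OF assms(1) U x s] sm_eq[OF assms(2) U x s] assms(3) pb_stalk[OF s x] by simp
    qed (use sheaf_mor_univ assms U s in auto)
  qed (use assms(1,2) U in \<open>auto simp: sheaf_mor_def\<close>)
qed (use assms(1,2) in \<open>auto simp: sheaf_mor_def\<close>)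

text \<open>Equations and relations between sections of a sheaf may be checked on germs, where
  everything reduces to the homomorphisms \<open>k x\<close>.\<close>

lemma sheaf_morI:
  assumes ext: "\<phi> \<in> extensional {U. openin X U}" "\<And>U. openin X U \<Longrightarrow> \<phi> U \<in> extensional (univ (pb U))"
    and k: "\<And>x. x \<in> topspace X \<Longrightarrow> homom L (stalk Y Q (f x)) (stalk X P x) (k x)"
    and \<phi>: "\<And>U s. openin X U \<Longrightarrow> s \<in> univ (pb U) \<Longrightarrow> \<phi> U s \<in> univ (sec P U)"
      "\<And>U s x. openin X U \<Longrightarrow> s \<in> univ (pb U) \<Longrightarrow> x \<in> U \<Longrightarrow> germ X P x U (\<phi> U s) = k x (s x)"
  shows "sheaf_mor L X (pullback X f Y Q) P \<phi>"
    "\<And>x g. x \<in> topspace X \<Longrightarrow> g \<in> univ (stalk Y Q (f x)) \<Longrightarrow> sm \<phi> x g = k x g"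
proof -
  have germs: "map (germ X P x U) (map (\<phi> U) ss) = map (k x) (map (\<lambda>s. s x) ss)"
    if "openin X U" "x \<in> U" "ss \<in> tuples n (univ (pb U))" for U x ss n
    using that \<phi>(2)[OF that(1)] by (auto simp: tuples_def)
  have hom: "homom L (pb U) (sec P U) (\<phi> U)" if U: "openin X U" for U
  proof -
    have top: "x \<in> topspace X" if "x \<in> U" for x using that openin_subset[OF U] by blast
    have tup: "map (\<phi> U) ss \<in> tuples n (univ (sec P U))" if "ss \<in> tuples n (univ (pb U))" for ss n
      using that \<phi>(1)[OF U] by (auto simp: tuples_def)
    have st: "map (\<lambda>s. s x) ss \<in> tuples n (univ (stalk Y Q (f x)))"
      if "ss \<in> tuples n (univ (pb U))" "x \<in> U" for ss n x
      using that pb_stalk by (auto simp: tuples_def)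
    have "\<phi> U (funI (pb U) F ss) = funI (sec P U) F (map (\<phi> U) ss)"
      if F: "F \<in> funs L" "ss \<in> tuples (far L F) (univ (pb U))" for F ss
    proof (rule dom.germs_determine[OF U])
      have s: "funI (pb U) F ss \<in> univ (pb U)" using pb_struct[OF U] F by (auto simp: is_struct_def)
      then show "\<phi> U (funI (pb U) F ss) \<in> univ (sec P U)" by (rule \<phi>(1)[OF U])
      show "funI (sec P U) F (map (\<phi> U) ss) \<in> univ (sec P U)"
        using dom.sec_struct[OF U] tup[OF F(2)] F(1) by (auto simp: is_struct_def)
      fix x assume x: "x \<in> U"
      have "germ X P x U (\<phi> U (funI (pb U) F ss)) = k x (funI (stalk Y Q (f x)) F (map (\<lambda>s. s x) ss))"
        using \<phi>(2)[OF U s x] x by (simp add: pb_funI)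
      also have "\<dots> = funI (stalk X P x) F (map (k x) (map (\<lambda>s. s x) ss))"
        by (rule homom_funI[OF k[OF top[OF x]] F(1) st[OF F(2) x]])
      also have "\<dots> = funI (stalk X P x) F (map (germ X P x U) (map (\<phi> U) ss))"
        by (simp only: germs[OF U x F(2)])
      also have "\<dots> = germ X P x U (funI (sec P U) F (map (\<phi> U) ss))"
        by (rule dom.stalk_funI[OF U x F(1) tup[OF F(2)]])
      finally show "germ X P x U (\<phi> U (funI (pb U) F ss)) = germ X P x U (funI (sec P U) F (map (\<phi> U) ss))" .
    qed
    moreover have "relI (sec P U) R (map (\<phi> U) ss)"
      if R: "R \<in> rels L" "ss \<in> tuples (rar L R) (univ (pb U))" "relI (pb U) R ss" for R ss
    proof (rule dom.rel_stalkwise[OF U R(1) tup[OF R(2)]])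
      fix x assume x: "x \<in> U"
      show "relI (stalk X P x) R (map (germ X P x U) (map (\<phi> U) ss))"
        unfolding germs[OF U x R(2)]
        using homom_relI[OF k[OF top[OF x]] R(1) st[OF R(2) x]] R(3) x by (simp add: pb_relI)
    qed
    ultimately show ?thesis using \<phi>(1)[OF U] unfolding homom_def by auto
  qed
  have nat: "\<phi> V (restrict s V) = res P U V (\<phi> U s)"
    if U: "openin X U" "openin X V" "V \<subseteq> U" "s \<in> univ (pb U)" for U V s
  proof (rule dom.germs_determine[OF U(2)])
    note s = pb_restrict[OF U(4,2,3)]
    show "\<phi> V (restrict s V) \<in> univ (sec P V)" by (rule \<phi>(1)[OF U(2) s])
    show "res P U V (\<phi> U s) \<in> univ (sec P V)" by (rule dom.res_univ[OF U(1-3) \<phi>(1)[OF U(1,4)]])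
    fix x assume x: "x \<in> V"
    then show "germ X P x V (\<phi> V (restrict s V)) = germ X P x V (res P U V (\<phi> U s))"
      using \<phi>(2)[OF U(2) s x] \<phi>(2)[OF U(1,4)] U(3) dom.germ_res[OF U(1-3) x \<phi>(1)[OF U(1,4)]] by auto
  qed
  show mor: "sheaf_mor L X (pullback X f Y Q) P \<phi>"
    using ext hom nat by (simp add: sheaf_mor_def)
  fix x g assume x: "x \<in> topspace X" and "g \<in> univ (stalk Y Q (f x))"
  then obtain U W t where U: "openin X U" "x \<in> U" "pbs U W t \<in> univ (pb U)" "pbs U W t x = g"
    using pb_through[OF _ x] by metis
  then show "sm \<phi> x g = k x g" using sm_eq[OF mor U(1-3)] \<phi>(2)[OF U(1,3,2)] by metis
qed

definition mk_mor :: "('x \<Rightarrow> ('y set \<times> 'e) set \<Rightarrow> ('x set \<times> 'd) set) \<Rightarrow> 'x set \<Rightarrow> ('x \<Rightarrow> ('y set \<times> 'e) set) \<Rightarrow> 'd" where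
  "mk_mor k = (\<lambda>U\<in>{U. openin X U}. \<lambda>s\<in>univ (pb U).
     THE r. r \<in> univ (sec P U) \<and> (\<forall>x\<in>U. germ X P x U r = k x (s x)))"

text \<open>A family of stalk homomorphisms comes from a comorphism if it carries sections to
  sections locally. It suffices to test this on sections of \<open>Q\<close>, since every section of
  the pullback is locally one of them; the results are then glued by their germs.\<close>

lemma mk_mor:
  assumes k: "\<And>x. x \<in> topspace X \<Longrightarrow> homom L (stalk Y Q (f x)) (stalk X P x) (k x)"
    and loc: "\<And>x W t. x \<in> topspace X \<Longrightarrow> openin Y W \<Longrightarrow> f x \<in> W \<Longrightarrow> t \<in> univ (sec Q W) \<Longrightarrow>
      \<exists>V r. openin X V \<and> x \<in> V \<and> f ` V \<subseteq> W \<and> r \<in> univ (sec P V) \<and>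
        (\<forall>x'\<in>V. k x' (germ Y Q (f x') W t) = germ X P x' V r)"
  shows "sheaf_mor L X (pullback X f Y Q) P (mk_mor k)"
    "\<And>x g. x \<in> topspace X \<Longrightarrow> g \<in> univ (stalk Y Q (f x)) \<Longrightarrow> sm (mk_mor k) x g = k x g"
proof -
  have ex: "\<exists>!r. r \<in> univ (sec P U) \<and> (\<forall>x\<in>U. germ X P x U r = k x (s x))"
    if U: "openin X U" "s \<in> univ (pb U)" for U s
  proof (rule dom.glue_germs[OF U(1)])
    fix x assume x: "x \<in> U"
    obtain V W t where V: "openin X V" "x \<in> V" "V \<subseteq> U" "openin Y W" "f ` V \<subseteq> W" "t \<in> univ (sec Q W)"
      "\<forall>x'\<in>V. s x' = germ Y Q (f x') W t" using pbE[OF U(2) x] .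
    have "x \<in> topspace X" using x openin_subset[OF U(1)] by blast
    from loc[OF this V(4) _ V(6)] V(2,5) obtain V' r where V': "openin X V'" "x \<in> V'" "r \<in> univ (sec P V')"
      "\<forall>x'\<in>V'. k x' (germ Y Q (f x') W t) = germ X P x' V' r" by blast
    let ?N = "V \<inter> V'"
    have N: "openin X ?N" "?N \<subseteq> V'" "x \<in> ?N" "?N \<subseteq> U" using V V' by auto
    have "k x' (s x') = germ X P x' ?N (res P V' ?N r)" if "x' \<in> ?N" for x'
      using dom.germ_res[OF V'(1) N(1,2) that V'(3)] V(7) V'(4) that by simp
    then show "\<exists>V t. openin X V \<and> x \<in> V \<and> V \<subseteq> U \<and> t \<in> univ (sec P V) \<and> (\<forall>x'\<in>V. k x' (s x') = germ X P x' V t)"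
      using N dom.res_univ[OF V'(1) N(1,2) V'(3)] by blast
  qed
  have mk: "mk_mor k U s \<in> univ (sec P U) \<and> (\<forall>x\<in>U. germ X P x U (mk_mor k U s) = k x (s x))"
    if U: "openin X U" "s \<in> univ (pb U)" for U s
    using theI'[OF ex[OF U]] U by (simp add: mk_mor_def)
  have e: "mk_mor k \<in> extensional {U. openin X U}" "\<And>U. openin X U \<Longrightarrow> mk_mor k U \<in> extensional (univ (pb U))"
    by (auto simp: mk_mor_def)
  show "sheaf_mor L X (pullback X f Y Q) P (mk_mor k)"
    by (rule sheaf_morI(1)[OF e k]) (use mk in auto)
  show "sm (mk_mor k) x g = k x g" if "x \<in> topspace X" "g \<in> univ (stalk Y Q (f x))" for x g
    by (rule sheaf_morI(2)[OF e k]) (use mk that in auto)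
qed

end

section \<open>The categories of modelled spaces\<close>

lemma ms_mapI:
  "sheaf_of_models L T0 X P \<Longrightarrow> sheaf_of_models L T0 Y Q \<Longrightarrow> continuous_map X Y f \<Longrightarrow> ms_map L T0 X P Y Q f"
  by (simp add: ms_map_def ms_map_axioms_def sheafI)

text \<open>Reduces every equation between morphisms, in particular the category laws, to points and
  stalk maps. There composition is ordinary composition by \<open>ms_comp_hom\<close>.\<close>

lemma ms_hom_eqI:
  assumes "sheaf_of_models L T0 X P" "sheaf_of_models L T0 Y Q"
    "(f, \<phi>) \<in> ms_hom L (X, P) (Y, Q)" "(f', \<phi>') \<in> ms_hom L (X, P) (Y, Q)"
    "\<And>x. x \<in> topspace X \<Longrightarrow> f x = f' x"
    "\<And>x g. x \<in> topspace X \<Longrightarrow> g \<in> univ (stalk Y Q (f x)) \<Longrightarrow>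
      stalk_map X P f Y Q \<phi> x g = stalk_map X P f' Y Q \<phi>' x g"
  shows "(f, \<phi>) = (f', \<phi>')"
proof -
  have f: "f = f'" using assms(3-5) by (auto intro: extensionalityI)
  interpret ms_map L T0 X P Y Q f using assms(1-3) by (intro ms_mapI) auto
  show ?thesis using sheaf_mor_ext[of \<phi> \<phi>'] assms(3,4,6) f by auto
qed

lemma ms_id_hom:
  fixes X :: "'p topology" and P :: "('f, 'r, 'p, 'e) presheaf"
  assumes "sheaf_of_models L T0 X P"
  obtains f \<phi> where "ms_id (X, P) = (f, \<phi>)" "(f, \<phi>) \<in> ms_hom L (X, P) (X, P)" "\<And>x. x \<in> topspace X \<Longrightarrow> f x = x"
    "\<And>x g. x \<in> topspace X \<Longrightarrow> g \<in> univ (stalk X P x) \<Longrightarrow> stalk_map X P f X P \<phi> x g = g"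
proof -
  let ?f = "\<lambda>x\<in>topspace X. x" and ?k = "\<lambda>x::'p. \<lambda>g::('p set \<times> 'e) set. g"
  have c: "continuous_map X X ?f" by (rule continuous_map_eq[OF continuous_map_id]) simp
  interpret ms_map L T0 X P X P ?f using ms_mapI[OF assms assms c] .
  \<comment> \<open>The identity comorphism is the one glued from the identities of the
    stalks.\<close>
  have id: "ms_id (X, P) = (?f, mk_mor ?k)"
    by (auto simp: mk_mor_def eq_commute[of _ "germ X P _ _ _"] cong: restrict_cong)
  have k: "homom L (stalk X P (?f x)) (stalk X P x) (?k x)" if "x \<in> topspace X" for x
    using that by (simp add: homom_id)
  have l: "\<exists>V r. openin X V \<and> x \<in> V \<and> ?f ` V \<subseteq> W \<and> r \<in> univ (sec P V) \<and>
        (\<forall>x'\<in>V. ?k x' (germ X P (?f x') W t) = germ X P x' V r)"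
    if "x \<in> topspace X" "openin X W" "?f x \<in> W" "t \<in> univ (sec P W)" for x W t
    using that openin_subset[OF that(2)] by (intro exI[of _ W] exI[of _ t]) auto
  show ?thesis
    by (rule that[OF id]) (use mk_mor[OF k l] c in auto)
qed

lemma ms_comp_hom:
  assumes sh: "sheaf_of_models L T0 X P" "sheaf_of_models L T0 Y Q" "sheaf_of_models L T0 Z R"
    and f: "(f, \<phi>) \<in> ms_hom L (X, P) (Y, Q)" and g: "(g, \<gamma>) \<in> ms_hom L (Y, Q) (Z, R)"
  obtains h \<eta> where "ms_comp (X, P) (Y, Q) (Z, R) (g, \<gamma>) (f, \<phi>) = (h, \<eta>)" "(h, \<eta>) \<in> ms_hom L (X, P) (Z, R)"
    "\<And>x. x \<in> topspace X \<Longrightarrow> h x = g (f x)"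
    "\<And>x r. x \<in> topspace X \<Longrightarrow> r \<in> univ (stalk Z R (g (f x))) \<Longrightarrow>
      stalk_map X P h Z R \<eta> x r = stalk_map X P f Y Q \<phi> x (stalk_map Y Q g Z R \<gamma> (f x) r)"
proof -
  let ?h = "compose (topspace X) g f"
  interpret F: ms_map L T0 X P Y Q f using sh f by (intro ms_mapI) auto
  interpret G: ms_map L T0 Y Q Z R g using sh g by (intro ms_mapI) auto
  have h: "?h x = g (f x)" if "x \<in> topspace X" for x using that by (simp add: compose_def)
  have c: "continuous_map X Z ?h"
    using continuous_map_compose[OF F.cont G.cont] by (rule continuous_map_eq) (simp add: h)
  interpret H: ms_map L T0 X P Z R ?h using sh c by (intro ms_mapI) auto
  have \<phi>: "sheaf_mor L X (pullback X f Y Q) P \<phi>" and \<gamma>: "sheaf_mor L Y (pullback Y g Z R) Q \<gamma>"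
    using f g by auto
  define \<eta> where "\<eta> = (\<lambda>U\<in>{U. openin X U}. \<lambda>s\<in>univ (H.pb U). \<phi> U (\<lambda>x\<in>U. G.sm \<gamma> (f x) (s x)))"
  let ?k = "\<lambda>x r. F.sm \<phi> x (G.sm \<gamma> (f x) r)"
  \<comment> \<open>Locally \<open>s\<close> comes from a section of the sheaf on \<open>Z\<close>,
    which \<gamma> sends to a section of \<open>Q\<close>. So the pointwise image under the stalk
    maps is a section of the pullback along \<open>f\<close>.\<close>
  have s': "(\<lambda>x\<in>U. G.sm \<gamma> (f x) (s x)) \<in> univ (F.pb U)" if U: "openin X U" "s \<in> univ (H.pb U)" for U s
  proof -
    have "\<exists>V W t. openin X V \<and> x \<in> V \<and> V \<subseteq> U \<and> openin Y W \<and> f ` V \<subseteq> W \<and> t \<in> univ (sec Q W) \<and>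
        (\<forall>x'\<in>V. (\<lambda>x\<in>U. G.sm \<gamma> (f x) (s x)) x' = germ Y Q (f x') W t)" if x: "x \<in> U" for x
    proof -
      obtain V W t where V: "openin X V" "x \<in> V" "V \<subseteq> U" "openin Z W" "?h ` V \<subseteq> W" "t \<in> univ (sec R W)"
        "\<forall>x'\<in>V. s x' = germ Z R (?h x') W t" using H.pbE[OF U(2) x] .
      let ?W = "{y \<in> topspace Y. g y \<in> W}"
      obtain r where r: "r \<in> univ (sec Q ?W)"
        "\<forall>y\<in>topspace Y. g y \<in> W \<longrightarrow> G.sm \<gamma> y (germ Z R (g y) W t) = germ Y Q y ?W r"
        using G.sm_germ[OF \<gamma> V(4,6)] .
      have top: "x' \<in> topspace X" if "x' \<in> V" for x' using that openin_subset[OF V(1)] by blast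
      have fV: "f ` V \<subseteq> ?W" using V(5) top h F.f_top by force
      have "(\<lambda>x\<in>U. G.sm \<gamma> (f x) (s x)) x' = germ Y Q (f x') ?W r" if "x' \<in> V" for x'
        using bspec[OF r(2), of "f x'"] V(3) bspec[OF V(7) that] h[OF top[OF that]] fV that by auto
      then show ?thesis using V(1-3) G.openin_preimage[OF V(4)] fV r(1) by blast
    qed
    then show ?thesis unfolding F.pb_univ by simp
  qed
  have e: "\<eta> \<in> extensional {U. openin X U}" "\<And>U. openin X U \<Longrightarrow> \<eta> U \<in> extensional (univ (H.pb U))"
    by (auto simp: \<eta>_def)
  have k: "homom L (stalk Z R (?h x)) (stalk X P x) (?k x)" if x: "x \<in> topspace X" for x
    unfolding h[OF x] using homom_comp[OF G.sm_homom[OF \<gamma> F.f_top[OF x]] F.sm_homom[OF \<phi> x]] .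
  have u: "\<eta> U s \<in> univ (sec P U)" if U: "openin X U" "s \<in> univ (H.pb U)" for U s
    using F.sheaf_mor_univ[OF \<phi> U(1) s'[OF U]] U by (simp add: \<eta>_def)
  have v: "germ X P x U (\<eta> U s) = ?k x (s x)" if U: "openin X U" "s \<in> univ (H.pb U)" "x \<in> U" for U s x
    using F.sm_eq[OF \<phi> U(1,3) s'[OF U(1,2)]] U by (simp add: \<eta>_def)
  show ?thesis
  proof (rule that[of ?h \<eta>])
    show "ms_comp (X, P) (Y, Q) (Z, R) (g, \<gamma>) (f, \<phi>) = (?h, \<eta>)" by (simp add: \<eta>_def)
    show "(?h, \<eta>) \<in> ms_hom L (X, P) (Z, R)" using H.sheaf_morI(1)[OF e k u v] c by (simp add: compose_def)
    show "stalk_map X P ?h Z R \<eta> x r = ?k x r" if "x \<in> topspace X" "r \<in> univ (stalk Z R (g (f x)))" for x r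
      by (rule H.sheaf_morI(2)[OF e k u v]) (use that h in auto)
  qed (rule h)
qed

lemma ms_comp_id_left:
  assumes sh: "sheaf_of_models L T0 X P" "sheaf_of_models L T0 Y Q" and f: "(f, \<phi>) \<in> ms_hom L (X, P) (Y, Q)"
  shows "ms_comp (X, P) (Y, Q) (Y, Q) (ms_id (Y, Q)) (f, \<phi>) = (f, \<phi>)"
proof -
  interpret F: ms_map L T0 X P Y Q f using sh f by (intro ms_mapI) auto
  obtain i \<iota> where i: "ms_id (Y, Q) = (i, \<iota>)" "(i, \<iota>) \<in> ms_hom L (Y, Q) (Y, Q)"
    "\<And>x. x \<in> topspace Y \<Longrightarrow> i x = x"
    "\<And>x g. x \<in> topspace Y \<Longrightarrow> g \<in> univ (stalk Y Q x) \<Longrightarrow> stalk_map Y Q i Y Q \<iota> x g = g"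
    using ms_id_hom[OF sh(2)] by blast
  obtain h \<eta> where h: "ms_comp (X, P) (Y, Q) (Y, Q) (i, \<iota>) (f, \<phi>) = (h, \<eta>)" "(h, \<eta>) \<in> ms_hom L (X, P) (Y, Q)"
    "\<And>x. x \<in> topspace X \<Longrightarrow> h x = i (f x)"
    "\<And>x r. x \<in> topspace X \<Longrightarrow> r \<in> univ (stalk Y Q (i (f x))) \<Longrightarrow>
      stalk_map X P h Y Q \<eta> x r = stalk_map X P f Y Q \<phi> x (stalk_map Y Q i Y Q \<iota> (f x) r)"
    using ms_comp_hom[OF sh(1,2,2) f i(2)] by blast
  have "(h, \<eta>) = (f, \<phi>)"
    by (rule ms_hom_eqI[OF sh h(2) f]) (use h(3,4) i(3,4) F.f_top in auto)
  then show ?thesis using h(1) i(1) by (simp del: ms_comp.simps ms_id.simps)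
qed

lemma ms_comp_id_right:
  assumes sh: "sheaf_of_models L T0 X P" "sheaf_of_models L T0 Y Q" and f: "(f, \<phi>) \<in> ms_hom L (X, P) (Y, Q)"
  shows "ms_comp (X, P) (X, P) (Y, Q) (f, \<phi>) (ms_id (X, P)) = (f, \<phi>)"
proof -
  interpret F: ms_map L T0 X P Y Q f using sh f by (intro ms_mapI) auto
  obtain i \<iota> where i: "ms_id (X, P) = (i, \<iota>)" "(i, \<iota>) \<in> ms_hom L (X, P) (X, P)"
    "\<And>x. x \<in> topspace X \<Longrightarrow> i x = x"
    "\<And>x g. x \<in> topspace X \<Longrightarrow> g \<in> univ (stalk X P x) \<Longrightarrow> stalk_map X P i X P \<iota> x g = g"
    using ms_id_hom[OF sh(1)] by blast
  obtain h \<eta> where h: "ms_comp (X, P) (X, P) (Y, Q) (f, \<phi>) (i, \<iota>) = (h, \<eta>)" "(h, \<eta>) \<in> ms_hom L (X, P) (Y, Q)"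
    "\<And>x. x \<in> topspace X \<Longrightarrow> h x = f (i x)"
    "\<And>x r. x \<in> topspace X \<Longrightarrow> r \<in> univ (stalk Y Q (f (i x))) \<Longrightarrow>
      stalk_map X P h Y Q \<eta> x r = stalk_map X P i X P \<iota> x (stalk_map X P f Y Q \<phi> (i x) r)"
    using ms_comp_hom[OF sh(1,1,2) i(2) f] by blast
  have \<phi>: "sheaf_mor L X (pullback X f Y Q) P \<phi>" using f by auto
  have "(h, \<eta>) = (f, \<phi>)"
    by (rule ms_hom_eqI[OF sh h(2) f]) (use h(3,4) i(3,4) homom_univ[OF F.sm_homom[OF \<phi>]] in auto)
  then show ?thesis using h(1) i(1) by (simp del: ms_comp.simps ms_id.simps)
qed

lemma ms_comp_assoc:
  assumes sh: "sheaf_of_models L T0 X P" "sheaf_of_models L T0 Y Q" "sheaf_of_models L T0 Z R" "sheaf_of_models L T0 W S"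
    and f: "(f1, f2) \<in> ms_hom L (X, P) (Y, Q)" and g: "(g1, g2) \<in> ms_hom L (Y, Q) (Z, R)"
    and h: "(h1, h2) \<in> ms_hom L (Z, R) (W, S)"
  shows "ms_comp (X, P) (Y, Q) (W, S) (ms_comp (Y, Q) (Z, R) (W, S) (h1, h2) (g1, g2)) (f1, f2) =
    ms_comp (X, P) (Z, R) (W, S) (h1, h2) (ms_comp (X, P) (Y, Q) (Z, R) (g1, g2) (f1, f2))"
proof -
  interpret F: ms_map L T0 X P Y Q f1 using sh f by (intro ms_mapI) auto
  interpret G: ms_map L T0 Y Q Z R g1 using sh g by (intro ms_mapI) auto
  interpret H: ms_map L T0 Z R W S h1 using sh h by (intro ms_mapI) auto
  have H2: "sheaf_mor L Z (pullback Z h1 W S) R h2" using h by auto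
  obtain a \<alpha> where a: "ms_comp (Y, Q) (Z, R) (W, S) (h1, h2) (g1, g2) = (a, \<alpha>)" "(a, \<alpha>) \<in> ms_hom L (Y, Q) (W, S)"
    "\<And>x. x \<in> topspace Y \<Longrightarrow> a x = h1 (g1 x)"
    "\<And>x r. x \<in> topspace Y \<Longrightarrow> r \<in> univ (stalk W S (h1 (g1 x))) \<Longrightarrow>
      stalk_map Y Q a W S \<alpha> x r = G.sm g2 x (H.sm h2 (g1 x) r)"
    using ms_comp_hom[OF sh(2,3,4) g h] by blast
  obtain b \<beta> where b: "ms_comp (X, P) (Y, Q) (Z, R) (g1, g2) (f1, f2) = (b, \<beta>)" "(b, \<beta>) \<in> ms_hom L (X, P) (Z, R)"
    "\<And>x. x \<in> topspace X \<Longrightarrow> b x = g1 (f1 x)"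
    "\<And>x r. x \<in> topspace X \<Longrightarrow> r \<in> univ (stalk Z R (g1 (f1 x))) \<Longrightarrow>
      stalk_map X P b Z R \<beta> x r = F.sm f2 x (G.sm g2 (f1 x) r)"
    using ms_comp_hom[OF sh(1,2,3) f g] by blast
  obtain c \<gamma> where c: "ms_comp (X, P) (Y, Q) (W, S) (a, \<alpha>) (f1, f2) = (c, \<gamma>)" "(c, \<gamma>) \<in> ms_hom L (X, P) (W, S)"
    "\<And>x. x \<in> topspace X \<Longrightarrow> c x = a (f1 x)"
    "\<And>x r. x \<in> topspace X \<Longrightarrow> r \<in> univ (stalk W S (a (f1 x))) \<Longrightarrow>
      stalk_map X P c W S \<gamma> x r = F.sm f2 x (stalk_map Y Q a W S \<alpha> (f1 x) r)"
    using ms_comp_hom[OF sh(1,2,4) f a(2)] by blast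
  obtain d \<delta> where d: "ms_comp (X, P) (Z, R) (W, S) (h1, h2) (b, \<beta>) = (d, \<delta>)" "(d, \<delta>) \<in> ms_hom L (X, P) (W, S)"
    "\<And>x. x \<in> topspace X \<Longrightarrow> d x = h1 (b x)"
    "\<And>x r. x \<in> topspace X \<Longrightarrow> r \<in> univ (stalk W S (h1 (b x))) \<Longrightarrow>
      stalk_map X P d W S \<delta> x r = stalk_map X P b Z R \<beta> x (H.sm h2 (b x) r)"
    using ms_comp_hom[OF sh(1,3,4) b(2) h] by blast
  have "(c, \<gamma>) = (d, \<delta>)"
  proof (rule ms_hom_eqI[OF sh(1,4) c(2) d(2)])
    fix x assume x: "x \<in> topspace X"
    have top: "f1 x \<in> topspace Y" "g1 (f1 x) \<in> topspace Z" using x F.f_top G.f_top by auto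
    then show "c x = d x" using a(3) b(3) c(3) d(3) x by simp
    fix r assume "r \<in> univ (stalk W S (c x))"
    then have r: "r \<in> univ (stalk W S (h1 (g1 (f1 x))))" using a(3) c(3) x top by simp
    show "stalk_map X P c W S \<gamma> x r = stalk_map X P d W S \<delta> x r"
      using r x top a(3,4) b(3,4) c(3,4) d(3,4) homom_univ[OF H.sm_homom[OF H2 top(2)]] by simp
  qed
  then show ?thesis using a(1) b(1) c(1) d(1) by (simp del: ms_comp.simps)
qed

lemma category_T0_ModSp:
  fixes \<U> :: "'u set set" and L :: "('f, 'r) lang"
  shows "category (T0_ModSp \<U> L T0)"
proof -
  have 1: "ms_id A \<in> ms_hom L A A" if "T0_modelled_space L T0 A" for A :: "('f, 'r, 'u, 'u) mspace"
    using that ms_id_hom[of L T0 "fst A" "snd A"] by (cases A) (simp, metis)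
  have 2: "ms_comp A B C g f \<in> ms_hom L A C"
    if "T0_modelled_space L T0 A" "T0_modelled_space L T0 B" "T0_modelled_space L T0 C"
      "f \<in> ms_hom L A B" "g \<in> ms_hom L B C" for A B C :: "('f, 'r, 'u, 'u) mspace" and f g
    using that ms_comp_hom[of L T0 "fst A" "snd A" "fst B" "snd B" "fst C" "snd C" "fst f" "snd f" "fst g" "snd g"]
    by (cases A, cases B, cases C, cases f, cases g) (simp del: ms_comp.simps ms_hom.simps, metis)
  have 3: "ms_comp A A B f (ms_id A) = f" "ms_comp A B B (ms_id B) f = f"
    if "T0_modelled_space L T0 A" "T0_modelled_space L T0 B" "f \<in> ms_hom L A B"
    for A B :: "('f, 'r, 'u, 'u) mspace" and f
    using that ms_comp_id_left[of L T0 "fst A" "snd A" "fst B" "snd B" "fst f" "snd f"]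
      ms_comp_id_right[of L T0 "fst A" "snd A" "fst B" "snd B" "fst f" "snd f"]
    by (cases A, cases B, cases f, simp del: ms_comp.simps ms_hom.simps ms_id.simps)+
  have 4: "ms_comp A B D (ms_comp B C D h g) f = ms_comp A C D h (ms_comp A B C g f)"
    if "T0_modelled_space L T0 A" "T0_modelled_space L T0 B" "T0_modelled_space L T0 C" "T0_modelled_space L T0 D"
      "f \<in> ms_hom L A B" "g \<in> ms_hom L B C" "h \<in> ms_hom L C D" for A B C D :: "('f, 'r, 'u, 'u) mspace" and f g h
    using that ms_comp_assoc[of L T0 "fst A" "snd A" "fst B" "snd B" "fst C" "snd C" "fst D" "snd D" "fst f" "snd f" "fst g" "snd g" "fst h" "snd h"]
    by (cases A, cases B, cases C, cases D, cases f, cases g, cases h) (simp del: ms_comp.simps ms_hom.simps)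
  show ?thesis
    unfolding category_def T0_ModSp_def using 1 2 3 4 by simp
qed

section \<open>Slices and universal arrows\<close>

lemma category_slice:
  assumes C: "category C" and x: "x \<in> Obj C"
  shows "category (slice C x)"
proof -
  have as: "Comp C a b d (Comp C b c d h g) f = Comp C a c d h (Comp C a b c g f)"
    if "a \<in> Obj C" "b \<in> Obj C" "c \<in> Obj C" "d \<in> Obj C" "f \<in> Hom C a b" "g \<in> Hom C b c" "h \<in> Hom C c d"
    for a b c d f g h using C that unfolding category_def by blast
  have cl: "Comp C a b c g f \<in> Hom C a c"
    if "a \<in> Obj C" "b \<in> Obj C" "c \<in> Obj C" "f \<in> Hom C a b" "g \<in> Hom C b c" for a b c f g
    using C that unfolding category_def by blast
  have id: "Idn C a \<in> Hom C a a" if "a \<in> Obj C" for a using C that unfolding category_def by blast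
  have un: "Comp C a a b f (Idn C a) = f" "Comp C a b b (Idn C b) f = f"
    if "a \<in> Obj C" "b \<in> Obj C" "f \<in> Hom C a b" for a b f using C that unfolding category_def by blast+
  show ?thesis
    unfolding category_def slice_def using x by (auto simp: id cl un as)
qed

text \<open>One universal arrow for each object of \<open>S\<close> suffices; action on morphisms,
  functoriality and naturality follow from uniqueness of factorizations.\<close>

lemma right_adjoint_onI:
  assumes F: "is_functor C D F" and S: "S \<subseteq> Obj D"
    and ua: "\<And>d. d \<in> S \<Longrightarrow> \<exists>g \<epsilon>. g \<in> Obj C \<and> \<epsilon> \<in> Hom D (fst F g) d \<and>
      (\<forall>c\<in>Obj C. \<forall>k\<in>Hom D (fst F c) d.
        \<exists>!h. h \<in> Hom C c g \<and> Comp D (fst F c) (fst F g) d \<epsilon> (snd F c g h) = k)"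
  shows "has_right_adjoint_on C D F S"
proof -
  obtain G \<epsilon> where "\<forall>d\<in>S. G d \<in> Obj C \<and> \<epsilon> d \<in> Hom D (fst F (G d)) d \<and>
      (\<forall>c\<in>Obj C. \<forall>k\<in>Hom D (fst F c) d.
        \<exists>!h. h \<in> Hom C c (G d) \<and> Comp D (fst F c) (fst F (G d)) d (\<epsilon> d) (snd F c (G d) h) = k)"
    using ua by metis
  then have GO: "G d \<in> Obj C" and ep: "\<epsilon> d \<in> Hom D (fst F (G d)) d"
    and un: "\<And>c k. c \<in> Obj C \<Longrightarrow> k \<in> Hom D (fst F c) d \<Longrightarrow>
        \<exists>!h. h \<in> Hom C c (G d) \<and> Comp D (fst F c) (fst F (G d)) d (\<epsilon> d) (snd F c (G d) h) = k"
    if "d \<in> S" for d using that by blast+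
  have C: "category C" and D: "category D" using F by (auto simp: is_functor_def)
  have Cid: "Idn C a \<in> Hom C a a" if "a \<in> Obj C" for a using C that unfolding category_def by blast
  have Ccl: "Comp C a b c g f \<in> Hom C a c"
    if "a \<in> Obj C" "b \<in> Obj C" "c \<in> Obj C" "f \<in> Hom C a b" "g \<in> Hom C b c" for a b c f g
    using C that unfolding category_def by blast
  have Did: "Idn D a \<in> Hom D a a" if "a \<in> Obj D" for a using D that unfolding category_def by blast
  have Dun: "Comp D a a b f (Idn D a) = f" "Comp D a b b (Idn D b) f = f"
    if "a \<in> Obj D" "b \<in> Obj D" "f \<in> Hom D a b" for a b f using D that unfolding category_def by blast+
  have Das: "Comp D a b d (Comp D b c d h g) f = Comp D a c d h (Comp D a b c g f)"
    if "a \<in> Obj D" "b \<in> Obj D" "c \<in> Obj D" "d \<in> Obj D" "f \<in> Hom D a b" "g \<in> Hom D b c" "h \<in> Hom D c d"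
    for a b c d f g h using D that unfolding category_def by blast
  have Dcl: "Comp D a b c g f \<in> Hom D a c"
    if "a \<in> Obj D" "b \<in> Obj D" "c \<in> Obj D" "f \<in> Hom D a b" "g \<in> Hom D b c" for a b c f g
    using D that unfolding category_def by blast
  have FO: "fst F a \<in> Obj D" if "a \<in> Obj C" for a using F that unfolding is_functor_def by blast
  have FH: "snd F a b f \<in> Hom D (fst F a) (fst F b)" if "a \<in> Obj C" "b \<in> Obj C" "f \<in> Hom C a b" for a b f
    using F that unfolding is_functor_def by blast
  have Fid: "snd F a a (Idn C a) = Idn D (fst F a)" if "a \<in> Obj C" for a
    using F that unfolding is_functor_def by blast
  have Fc: "snd F a c (Comp C a b c g f) = Comp D (fst F a) (fst F b) (fst F c) (snd F b c g) (snd F a b f)"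
    if "a \<in> Obj C" "b \<in> Obj C" "c \<in> Obj C" "f \<in> Hom C a b" "g \<in> Hom C b c" for a b c f g
    using F that unfolding is_functor_def by blast
  have SO: "d \<in> Obj D" if "d \<in> S" for d using that S by blast
  define ev where "ev c d h = Comp D (fst F c) (fst F (G d)) d (\<epsilon> d) (snd F c (G d) h)" for c d h
  \<comment> \<open>\<open>ev\<close> composes with the counit; \<open>\<Phi>\<close> is its
    inverse, the transpose.\<close>
  define \<Phi> where "\<Phi> c d k = (THE h. h \<in> Hom C c (G d) \<and> ev c d h = k)" for c d k
  have \<Phi>: "\<Phi> c d k \<in> Hom C c (G d)" "ev c d (\<Phi> c d k) = k"
    if "c \<in> Obj C" "d \<in> S" "k \<in> Hom D (fst F c) d" for c d k
    using theI'[OF un[OF that(2,1,3)]] unfolding \<Phi>_def ev_def by blast+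
  have evH: "ev c d h \<in> Hom D (fst F c) d" if "c \<in> Obj C" "d \<in> S" "h \<in> Hom C c (G d)" for c d h
    unfolding ev_def using that by (intro Dcl FO GO SO FH ep)
  have \<Phi>eq: "\<Phi> c d (ev c d h) = h" if "c \<in> Obj C" "d \<in> S" "h \<in> Hom C c (G d)" for c d h
    unfolding \<Phi>_def using the1_equality[OF un[OF that(2,1) evH[OF that]]] that(3) by (simp add: ev_def)
  have inj: "h = h'" if "c \<in> Obj C" "d \<in> S" "h \<in> Hom C c (G d)" "h' \<in> Hom C c (G d)" "ev c d h = ev c d h'"
    for c d h h' using \<Phi>eq[OF that(1-3)] \<Phi>eq[OF that(1,2,4)] that(5) by metis
  have evc: "ev c' d (Comp C c' c (G d) h f) = Comp D (fst F c') (fst F c) d (ev c d h) (snd F c' c f)"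
    if "c \<in> Obj C" "c' \<in> Obj C" "d \<in> S" "h \<in> Hom C c (G d)" "f \<in> Hom C c' c" for c c' d h f
    unfolding ev_def using that by (simp add: Fc GO Das FO SO FH ep)
  \<comment> \<open>The adjoint sends \<open>l\<close> to the transpose of \<open>l\<close> after
    the counit, the only choice that makes the counit natural.\<close>
  define G1 where "G1 d d' l = \<Phi> (G d) d' (Comp D (fst F (G d)) d d' l (\<epsilon> d))" for d d' l
  have lk: "Comp D (fst F (G d)) d d' l (\<epsilon> d) \<in> Hom D (fst F (G d)) d'"
    if "d \<in> S" "d' \<in> S" "l \<in> Hom D d d'" for d d' l
    using that by (intro Dcl FO GO SO ep)
  have G1: "G1 d d' l \<in> Hom C (G d) (G d')" "ev (G d) d' (G1 d d' l) = Comp D (fst F (G d)) d d' l (\<epsilon> d)"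
    if "d \<in> S" "d' \<in> S" "l \<in> Hom D d d'" for d d' l
    unfolding G1_def using \<Phi>[OF GO[OF that(1)] that(2) lk[OF that]] by blast+
  have evG: "ev c d' (Comp C c (G d) (G d') (G1 d d' l) h) = Comp D (fst F c) d d' l (ev c d h)"
    if "c \<in> Obj C" "d \<in> S" "d' \<in> S" "h \<in> Hom C c (G d)" "l \<in> Hom D d d'" for c d d' h l
  proof -
    have "ev c d' (Comp C c (G d) (G d') (G1 d d' l) h) =
        Comp D (fst F c) (fst F (G d)) d' (Comp D (fst F (G d)) d d' l (\<epsilon> d)) (snd F c (G d) h)"
      using evc[OF GO[OF that(2)] that(1,3) G1(1)[OF that(2,3,5)] that(4)] G1(2)[OF that(2,3,5)] by simp
    also have "\<dots> = Comp D (fst F c) d d' l (ev c d h)"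
      unfolding ev_def using that by (intro Das FO GO SO FH ep)
    finally show ?thesis .
  qed
  have fct: "is_functor (full_subcat D S) C (G, G1)"
  proof -
    have cat: "category (full_subcat D S)"
      using D S unfolding category_def full_subcat_def by (simp add: subset_iff)
    have "G1 d d (Idn D d) = Idn C (G d)" if d: "d \<in> S" for d
    proof (rule inj[OF GO[OF d] d])
      show "ev (G d) d (G1 d d (Idn D d)) = ev (G d) d (Idn C (G d))"
        using G1(2)[OF d d Did[OF SO[OF d]]] unfolding ev_def
        using d by (simp add: Fid GO Dun FO SO ep)
    qed (use d in \<open>auto intro!: G1 Did SO Cid GO\<close>)
    moreover have "G1 a c (Comp D a b c g f) = Comp C (G a) (G b) (G c) (G1 b c g) (G1 a b f)"
      if a: "a \<in> S" "b \<in> S" "c \<in> S" "f \<in> Hom D a b" "g \<in> Hom D b c" for a b c f g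
    proof (rule inj[OF GO[OF a(1)] a(3)])
      have gf: "Comp D a b c g f \<in> Hom D a c" using a by (intro Dcl SO)
      have "ev (G a) c (Comp C (G a) (G b) (G c) (G1 b c g) (G1 a b f)) =
          Comp D (fst F (G a)) b c g (Comp D (fst F (G a)) a b f (\<epsilon> a))"
        using evG[OF GO[OF a(1)] a(2,3) G1(1)[OF a(1,2,4)] a(5)] G1(2)[OF a(1,2,4)] by simp
      also have "\<dots> = Comp D (fst F (G a)) a c (Comp D a b c g f) (\<epsilon> a)"
        using a by (intro Das[symmetric] FO GO SO ep)
      also have "\<dots> = ev (G a) c (G1 a c (Comp D a b c g f))" using G1(2)[OF a(1,3) gf] by simp
      finally show "ev (G a) c (G1 a c (Comp D a b c g f)) =
          ev (G a) c (Comp C (G a) (G b) (G c) (G1 b c g) (G1 a b f))" by simp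
      show "G1 a c (Comp D a b c g f) \<in> Hom C (G a) (G c)" by (rule G1(1)[OF a(1,3) gf])
    qed (use a in \<open>auto intro!: Ccl GO G1\<close>)
    ultimately show ?thesis
      unfolding is_functor_def using cat C GO G1(1) by (simp add: full_subcat_def)
  qed
  have bij: "bij_betw (\<Phi> c d) (Hom D (fst F c) d) (Hom C c (G d))" if "c \<in> Obj C" "d \<in> S" for c d
    using that by (intro bij_betw_byWitness[where f' = "ev c d"]) (auto simp: \<Phi> \<Phi>eq evH)
  have nat1: "\<Phi> c' d (Comp D (fst F c') (fst F c) d k (snd F c' c h)) = Comp C c' c (G d) (\<Phi> c d k) h"
    if c: "c \<in> Obj C" "c' \<in> Obj C" "d \<in> S" "h \<in> Hom C c' c" "k \<in> Hom D (fst F c) d" for c c' d h k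
    using evc[OF c(1-3) \<Phi>(1)[OF c(1,3,5)] c(4)] \<Phi>(2)[OF c(1,3,5)]
      \<Phi>eq[OF c(2,3) Ccl[OF c(2,1) GO[OF c(3)] c(4) \<Phi>(1)[OF c(1,3,5)]]] by simp
  have nat2: "\<Phi> c d' (Comp D (fst F c) d d' l k) = Comp C c (G d) (G d') (G1 d d' l) (\<Phi> c d k)"
    if c: "c \<in> Obj C" "d \<in> S" "d' \<in> S" "k \<in> Hom D (fst F c) d" "l \<in> Hom D d d'" for c d d' k l
    using evG[OF c(1-3) \<Phi>(1)[OF c(1,2,4)] c(5)] \<Phi>(2)[OF c(1,2,4)]
      \<Phi>eq[OF c(1,3) Ccl[OF c(1) GO[OF c(2)] GO[OF c(3)] \<Phi>(1)[OF c(1,2,4)] G1(1)[OF c(2,3,5)]]] by simp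
  show ?thesis
    unfolding has_right_adjoint_on_def
    by (intro HOL.conjI F S exI[of _ "(G, G1)"] exI[of _ \<Phi>]) (use fct bij nat1 nat2 in auto)
qed

lemma category_sub:
  assumes C: "category C" and sub: "Obj C' \<subseteq> Obj C" "\<And>a b. Hom C' a b \<subseteq> Hom C a b" "Idn C' = Idn C" "Comp C' = Comp C"
    and id: "\<And>a. a \<in> Obj C' \<Longrightarrow> Idn C a \<in> Hom C' a a"
    and comp: "\<And>a b c f g. a \<in> Obj C' \<Longrightarrow> b \<in> Obj C' \<Longrightarrow> c \<in> Obj C' \<Longrightarrow> f \<in> Hom C' a b \<Longrightarrow> g \<in> Hom C' b c \<Longrightarrow>
      Comp C a b c g f \<in> Hom C' a c"
  shows "category C'"
proof -
  have O: "a \<in> Obj C" if "a \<in> Obj C'" for a using that sub by blast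
  have H: "f \<in> Hom C a b" if "f \<in> Hom C' a b" for a b f using that sub by blast
  have "Comp C a a b f (Idn C a) = f" "Comp C a b b (Idn C b) f = f"
    if "a \<in> Obj C'" "b \<in> Obj C'" "f \<in> Hom C' a b" for a b f
    using C O[OF that(1)] O[OF that(2)] H[OF that(3)] unfolding category_def by blast+
  moreover have "Comp C a b d (Comp C b c d h g) f = Comp C a c d h (Comp C a b c g f)"
    if "a \<in> Obj C'" "b \<in> Obj C'" "c \<in> Obj C'" "d \<in> Obj C'" "f \<in> Hom C' a b" "g \<in> Hom C' b c" "h \<in> Hom C' c d"
    for a b c d f g h
    using C O[OF that(1)] O[OF that(2)] O[OF that(3)] O[OF that(4)] H[OF that(5)] H[OF that(6)] H[OF that(7)]
    unfolding category_def by blast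
  ultimately show ?thesis
    unfolding category_def sub(3,4) using id comp by simp
qed

section \<open>Admissible morphisms as a subcategory\<close>

context coste
begin

lemma stalk_T0: "sheaf_of_models L T0 X P \<Longrightarrow> x \<in> topspace X \<Longrightarrow> model L T0 (stalk X P x)"
  using presheaf.stalk_model[of L T0 X P, OF _ wf_T0] by (simp add: presheaf_def sheaf_of_models_def)

lemma stalk_map_homom:
  assumes "sheaf_of_models L T0 X P" "sheaf_of_models L T0 Y Q" "(f, \<phi>) \<in> ms_hom L (X, P) (Y, Q)" "x \<in> topspace X"
  shows "homom L (stalk Y Q (f x)) (stalk X P x) (stalk_map X P f Y Q \<phi> x)"
    "f x \<in> topspace Y"
proof -
  interpret ms_map L T0 X P Y Q f using assms by (intro ms_mapI) auto
  show "homom L (stalk Y Q (f x)) (stalk X P x) (sm \<phi> x)" "f x \<in> topspace Y"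
    using sm_homom f_top assms by auto
qed

lemma ms_admissible_id:
  assumes "sheaf_of_models L T0 X P"
  shows "ms_admissible \<Lambda> (X, P) (X, P) (ms_id (X, P))"
proof -
  obtain i \<iota> where i: "ms_id (X, P) = (i, \<iota>)" "(i, \<iota>) \<in> ms_hom L (X, P) (X, P)"
    "\<And>x. x \<in> topspace X \<Longrightarrow> i x = x"
    "\<And>x g. x \<in> topspace X \<Longrightarrow> g \<in> univ (stalk X P x) \<Longrightarrow> stalk_map X P i X P \<iota> x g = g"
    using ms_id_hom[OF assms] by blast
  have "admissible \<Lambda> (stalk X P (i x)) (stalk X P x) (stalk_map X P i X P \<iota> x)" if x: "x \<in> topspace X" for x
  proof -
    note M = stalk_T0[OF assms x]
    have "admissible \<Lambda> (stalk X P x) (stalk X P x) (\<lambda>g. g)"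
      using admissible_isom[OF _ M M, of "\<lambda>g. g" "\<lambda>g. g"] by (simp add: isom_def homom_id)
    from admissible_cong[OF this homom_id M M, of "stalk_map X P i X P \<iota> x"] show ?thesis
      using i(3,4) x by simp
  qed
  then show ?thesis unfolding i(1) by simp
qed

lemma ms_admissible_comp:
  assumes sh: "sheaf_of_models L T0 X P" "sheaf_of_models L T0 Y Q" "sheaf_of_models L T0 Z R"
    and f: "(f, \<phi>) \<in> ms_hom L (X, P) (Y, Q)" and g: "(g, \<gamma>) \<in> ms_hom L (Y, Q) (Z, R)"
    and adm: "ms_admissible \<Lambda> (X, P) (Y, Q) (f, \<phi>)" "ms_admissible \<Lambda> (Y, Q) (Z, R) (g, \<gamma>)"
  shows "ms_admissible \<Lambda> (X, P) (Z, R) (ms_comp (X, P) (Y, Q) (Z, R) (g, \<gamma>) (f, \<phi>))"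
proof -
  obtain h \<eta> where h: "ms_comp (X, P) (Y, Q) (Z, R) (g, \<gamma>) (f, \<phi>) = (h, \<eta>)" "(h, \<eta>) \<in> ms_hom L (X, P) (Z, R)"
    "\<And>x. x \<in> topspace X \<Longrightarrow> h x = g (f x)"
    "\<And>x r. x \<in> topspace X \<Longrightarrow> r \<in> univ (stalk Z R (g (f x))) \<Longrightarrow>
      stalk_map X P h Z R \<eta> x r = stalk_map X P f Y Q \<phi> x (stalk_map Y Q g Z R \<gamma> (f x) r)"
    using ms_comp_hom[OF sh f g] by blast
  have "admissible \<Lambda> (stalk Z R (h x)) (stalk X P x) (stalk_map X P h Z R \<eta> x)" if x: "x \<in> topspace X" for x
  proof -
    note F = stalk_map_homom[OF sh(1,2) f x]
    note G = stalk_map_homom[OF sh(2,3) g F(2)]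
    note M = stalk_T0[OF sh(1) x] stalk_T0[OF sh(2) F(2)] stalk_T0[OF sh(3) G(2)]
    have a: "admissible \<Lambda> (stalk Z R (g (f x))) (stalk X P x)
        (\<lambda>r. stalk_map X P f Y Q \<phi> x (stalk_map Y Q g Z R \<gamma> (f x) r))"
      using adm x F(2) by (intro admissible_comp[OF G(1) F(1) M(3,2,1)]) auto
    show ?thesis
      using admissible_cong[OF a homom_comp[OF G(1) F(1)] M(3,1), of "stalk_map X P h Z R \<eta> x"] h(3,4) x by simp
  qed
  then show ?thesis unfolding h(1) by simp
qed

lemma category_A_ModSp: "category (A_ModSp (\<U> :: 'u set set) L T0 T \<Lambda>)"
proof -
  have 1: "ms_admissible \<Lambda> A A (ms_id A)" if "T0_modelled_space L T0 A" for A :: "('f, 'r, 'u, 'u) mspace"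
    using that ms_admissible_id by (cases A) (simp del: ms_id.simps ms_admissible.simps)
  have 2: "ms_admissible \<Lambda> A C (ms_comp A B C g f)"
    if "T0_modelled_space L T0 A" "T0_modelled_space L T0 B" "T0_modelled_space L T0 C"
      "f \<in> ms_hom L A B" "g \<in> ms_hom L B C" "ms_admissible \<Lambda> A B f" "ms_admissible \<Lambda> B C g"
    for A B C :: "('f, 'r, 'u, 'u) mspace" and f g
    using that ms_admissible_comp[of "fst A" "snd A" "fst B" "snd B" "fst C" "snd C" "fst f" "snd f" "fst g" "snd g"]
    by (cases A, cases B, cases C, cases f, cases g) (simp del: ms_comp.simps ms_hom.simps ms_admissible.simps)
  have T: "T0_modelled_space L T0 A" if "T_modelled_space L T0 T A" for A :: "('f, 'r, 'u, 'u) mspace"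
    using that by (cases A) simp
  show ?thesis
    by (rule category_sub[OF category_T0_ModSp[of \<U> L T0]])
      (use 1 2 T category_T0_ModSp[of \<U> L T0] in \<open>auto simp: T0_ModSp_def A_ModSp_def category_def\<close>)
qed

lemma forgetful_functor:
  fixes \<U> :: "'u set set"
  assumes "XP \<in> Obj (A_ModSp \<U> L T0 T \<Lambda>)"
  shows "is_functor (slice (A_ModSp \<U> L T0 T \<Lambda>) XP) (slice (T0_ModSp \<U> L T0) XP) forgetful"
proof -
  have T: "T0_modelled_space L T0 A" if "T_modelled_space L T0 T A" for A :: "('f, 'r, 'u, 'u) mspace"
    using that by (cases A) simp
  then have XP: "XP \<in> Obj (T0_ModSp \<U> L T0)" using assms by (auto simp: A_ModSp_def T0_ModSp_def)
  show ?thesis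
    unfolding is_functor_def
    using category_slice[OF category_A_ModSp assms] category_slice[OF category_T0_ModSp XP] T
    by (auto simp: forgetful_def slice_def A_ModSp_def T0_ModSp_def)
qed

end

section \<open>The spectrum\<close>

lemma isomI_bij:
  assumes h: "homom L A B h" "bij_betw h (univ A) (univ B)" and st: "is_struct L A"
    and refl: "\<And>R xs. R \<in> rels L \<Longrightarrow> xs \<in> tuples (rar L R) (univ A) \<Longrightarrow> relI B R (map h xs) \<Longrightarrow> relI A R xs"
  shows "isom L A B h (inv_into (univ A) h)"
proof -
  let ?k = "inv_into (univ A) h"
  have k: "?k y \<in> univ A" "h (?k y) = y" if "y \<in> univ B" for y
    using h(2) that by (auto simp: bij_betw_def inv_into_into f_inv_into_f)
  have kh: "?k (h x) = x" if "x \<in> univ A" for x using h(2) that by (simp add: bij_betw_def)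
  have tup: "map ?k ys \<in> tuples n (univ A)" "map h (map ?k ys) = ys" if "ys \<in> tuples n (univ B)" for n ys
    using that k by (auto simp: tuples_def intro!: map_idI)
  have "?k (funI B F ys) = funI A F (map ?k ys)" if F: "F \<in> funs L" "ys \<in> tuples (far L F) (univ B)" for F ys
    using homom_funI[OF h(1) F(1) tup(1)[OF F(2)]] tup[OF F(2)] kh[of "funI A F (map ?k ys)"] st F(1)
    by (simp add: is_struct_def)
  moreover have "relI A R (map ?k ys)" if R: "R \<in> rels L" "ys \<in> tuples (rar L R) (univ B)" "relI B R ys" for R ys
    using refl[OF R(1) tup(1)[OF R(2)]] tup(2)[OF R(2)] R(3) by simp
  ultimately show ?thesis using h(1) k kh by (auto simp: isom_def homom_def)
qed

type_synonym ('f, 'r, 'u) gword = "('f, 'r, 'u set \<times> 'u) word"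
type_synonym ('f, 'r, 'u) gfact = "('f, 'r, 'u set \<times> 'u) fact"

text \<open>The parameters at a point \<open>y\<close> are the sections of \<open>Q\<close> on neighbourhoods of \<open>y\<close>, standing for
  their germs.\<close>

definition local_params :: "'u topology \<Rightarrow> ('f, 'r, 'u, 'u) presheaf \<Rightarrow> 'u \<Rightarrow> ('u set \<times> 'u) set" where
  "local_params Y Q y = {(U, q). openin Y U \<and> y \<in> U \<and> q \<in> univ (sec Q U)}"

definition param_germ :: "'u topology \<Rightarrow> ('f, 'r, 'u, 'u) presheaf \<Rightarrow> 'u \<Rightarrow> ('u set \<times> 'u) \<Rightarrow> ('u set \<times> 'u) set" where
  "param_germ Y Q y = (\<lambda>(U, q). germ Y Q y U q)"

locale over_base = coste L T0 T \<Lambda>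
  for L :: "('f, 'r) lang" and T0 T :: "('f, 'r) sequent set" and \<Lambda> :: "('f, 'r) horn_pair set" +
  fixes X :: "'u topology" and P :: "('f, 'r, 'u, 'u) presheaf"
    and Y :: "'u topology" and Q :: "('f, 'r, 'u, 'u) presheaf"
    and p :: "'u \<Rightarrow> 'u" and \<pi> :: "'u set \<Rightarrow> ('u \<Rightarrow> ('u set \<times> 'u) set) \<Rightarrow> 'u"
  assumes XP: "sheaf_of_models L T0 X P" and YQ: "sheaf_of_models L T0 Y Q"
    and p: "(p, \<pi>) \<in> ms_hom L (Y, Q) (X, P)"
begin

sublocale Q: sheaf L T0 Y Q by (rule sheafI[OF YQ])

abbreviation PF :: "'u \<Rightarrow> ('f, 'r, 'u) gfact set" where
  "PF y \<equiv> param_facts (stalk Y Q y) (local_params Y Q y) (param_germ Y Q y)"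

abbreviation jj :: "'u \<Rightarrow> ('f, 'r, 'u) gfact set \<Rightarrow> ('u set \<times> 'u) set \<Rightarrow> ('f, 'r, 'u) gword set" where
  "jj y \<equiv> param_map (local_params Y Q y) (param_germ Y Q y)"

text \<open>A point over \<open>y\<close> is an etale map from \<open>Q\<^sub>y\<close> to a model of \<open>T\<close>, represented by the set of facts
  it satisfies, whose composite with \<open>P\<^bsub>p(y)\<^esub> \<rightarrow> Q\<^sub>y\<close> is admissible.\<close>

definition spec_points :: "('u \<times> ('f, 'r, 'u) gfact set) set" where
  "spec_points = {(y, S). y \<in> topspace Y \<and> closed S \<and> params_in (local_params Y Q y) S \<and> PF y \<subseteq> S \<and>
     S \<subseteq> etale (PF y) S \<and> model L T (TM S) \<and>
     admissible \<Lambda> (stalk X P (p y)) (TM S) (\<lambda>g. jj y S (stalk_map Y Q p X P \<pi> y g))}"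

lemma param_germ_local_params: "param_germ Y Q y ` local_params Y Q y = univ (stalk Y Q y)"
  by (auto simp: param_germ_def local_params_def Q.univ_stalk image_iff)

lemma Q_stalk: "y \<in> topspace Y \<Longrightarrow> model L T0 (stalk Y Q y)"
  by (rule stalk_T0[OF YQ])

lemma jj_homom: "y \<in> topspace Y \<Longrightarrow> closed S \<Longrightarrow> PF y \<subseteq> S \<Longrightarrow> homom L (stalk Y Q y) (TM S) (jj y S)"
  using Q_stalk by (intro param_map_homom param_germ_local_params) (auto simp: model_def)

lemma jj_germ: "closed S \<Longrightarrow> PF y \<subseteq> S \<Longrightarrow> openin Y U \<Longrightarrow> y \<in> U \<Longrightarrow> q \<in> univ (sec Q U) \<Longrightarrow>
    jj y S (germ Y Q y U q) = cpar S (U, q)"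
  using param_map_Par[of S "stalk Y Q y" "local_params Y Q y" "param_germ Y Q y" "(U, q)"] by (simp add: param_germ_def local_params_def)

end

text \<open>The points of the spectrum have to be elements of \<open>'u\<close>, so they are
  represented by \<open>codes\<close>. The bijection with \<open>spec_points\<close> and the coding
  \<open>enc\<close> of sections are assumed here and supplied by a cardinality argument in
  \<open>ex_spectrum\<close>.\<close>

locale spectrum = over_base L T0 T \<Lambda> X P Y Q p \<pi>
  for L :: "('f, 'r) lang" and T0 T :: "('f, 'r) sequent set" and \<Lambda> :: "('f, 'r) horn_pair set"
    and X :: "'u topology" and P :: "('f, 'r, 'u, 'u) presheaf"
    and Y :: "'u topology" and Q :: "('f, 'r, 'u, 'u) presheaf"
    and p :: "'u \<Rightarrow> 'u" and \<pi> :: "'u set \<Rightarrow> ('u \<Rightarrow> ('u set \<times> 'u) set) \<Rightarrow> 'u" +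
  fixes codes :: "'u set" and yy :: "'u \<Rightarrow> 'u" and SS :: "'u \<Rightarrow> ('f, 'r, 'u) gfact set"
    and enc :: "'u set \<Rightarrow> ('u \<Rightarrow> ('f, 'r, 'u) gword set) \<Rightarrow> 'u"
  assumes code: "bij_betw (\<lambda>w. (yy w, SS w)) codes spec_points"
begin

lemma pt: assumes "w \<in> codes"
  shows "yy w \<in> topspace Y" "closed (SS w)" "params_in (local_params Y Q (yy w)) (SS w)" "PF (yy w) \<subseteq> SS w"
    "SS w \<subseteq> etale (PF (yy w)) (SS w)" "model L T (TM (SS w))"
    "admissible \<Lambda> (stalk X P (p (yy w))) (TM (SS w)) (\<lambda>g. jj (yy w) (SS w) (stalk_map Y Q p X P \<pi> (yy w) g))"
proof -
  have "(yy w, SS w) \<in> spec_points" using code assms by (auto simp: bij_betw_def)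
  then show "yy w \<in> topspace Y" "closed (SS w)" "params_in (local_params Y Q (yy w)) (SS w)" "PF (yy w) \<subseteq> SS w"
    "SS w \<subseteq> etale (PF (yy w)) (SS w)" "model L T (TM (SS w))"
    "admissible \<Lambda> (stalk X P (p (yy w))) (TM (SS w)) (\<lambda>g. jj (yy w) (SS w) (stalk_map Y Q p X P \<pi> (yy w) g))"
    unfolding spec_points_def by simp_all
qed

abbreviation M :: "'u \<Rightarrow> ('f, 'r, ('f, 'r, 'u) gword set) struct" where "M w \<equiv> TM (SS w)"

lemma M_T0: "w \<in> codes \<Longrightarrow> model L T0 (M w)"
  by (intro TM_model pt)

definition basic_open :: "'u set \<Rightarrow> ('f, 'r, 'u) gfact set \<Rightarrow> 'u set" where
  "basic_open V F = {w \<in> codes. yy w \<in> V \<and> F \<subseteq> SS w}"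

text \<open>The sets \<open>basic_open V F\<close> are the basic open sets: finitely many facts are prescribed.\<close>

definition sptop :: "'u topology" where
  "sptop = topology (\<lambda>W. W \<subseteq> codes \<and> (\<forall>w\<in>W. \<exists>V F. openin Y V \<and> finite F \<and> w \<in> basic_open V F \<and> basic_open V F \<subseteq> W))"

lemma openin_sptop:
  "openin sptop W \<longleftrightarrow> W \<subseteq> codes \<and> (\<forall>w\<in>W. \<exists>V F. openin Y V \<and> finite F \<and> w \<in> basic_open V F \<and> basic_open V F \<subseteq> W)"
proof -
  let ?O = "\<lambda>W. W \<subseteq> codes \<and> (\<forall>w\<in>W. \<exists>V F. openin Y V \<and> finite F \<and> w \<in> basic_open V F \<and> basic_open V F \<subseteq> W)"
  have int: "?O (A \<inter> B)" if A: "?O A" and B: "?O B" for A B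
  proof (rule HOL.conjI, use A in blast, rule ballI)
    fix w assume w: "w \<in> A \<inter> B"
    obtain V F where V: "openin Y V" "finite F" "w \<in> basic_open V F" "basic_open V F \<subseteq> A" using A w by blast
    obtain V' F' where V': "openin Y V'" "finite F'" "w \<in> basic_open V' F'" "basic_open V' F' \<subseteq> B" using B w by blast
    have "basic_open (V \<inter> V') (F \<union> F') = basic_open V F \<inter> basic_open V' F'" by (auto simp: basic_open_def)
    then show "\<exists>V F. openin Y V \<and> finite F \<and> w \<in> basic_open V F \<and> basic_open V F \<subseteq> A \<inter> B"
      using V V' by (intro exI[of _ "V \<inter> V'"] exI[of _ "F \<union> F'"]) auto
  qed
  have un: "?O (\<Union>\<K>)" if "\<forall>K\<in>\<K>. ?O K" for \<K>
  proof (rule HOL.conjI, use that in blast, rule ballI)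
    fix w assume "w \<in> \<Union>\<K>"
    then obtain K where K: "K \<in> \<K>" "w \<in> K" by blast
    have "?O K" using that K(1) by (rule bspec)
    with K(2) obtain V F where "openin Y V" "finite F" "w \<in> basic_open V F" "basic_open V F \<subseteq> K" by blast
    then show "\<exists>V F. openin Y V \<and> finite F \<and> w \<in> basic_open V F \<and> basic_open V F \<subseteq> \<Union>\<K>" using K by blast
  qed
  have "istopology ?O" unfolding istopology_def by (rule HOL.conjI, intro allI impI, rule int, assumption+, intro allI impI, rule un)
  then show ?thesis unfolding sptop_def by (simp add: topology_inverse')
qed

lemma openin_basic_open: "openin Y V \<Longrightarrow> finite F \<Longrightarrow> openin sptop (basic_open V F)"
  unfolding openin_sptop by (auto simp: basic_open_def)

lemma topspace_sptop [simp]: "topspace sptop = codes"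
proof -
  have "codes = basic_open (topspace Y) {}" using pt(1) by (auto simp: basic_open_def)
  then have "openin sptop codes" using openin_basic_open[of "topspace Y" "{}"] by simp
  then show ?thesis using openin_subset[of sptop] openin_sptop by (metis openin_topspace subset_antisym)
qed

lemma openin_codes: "openin sptop U \<Longrightarrow> w \<in> U \<Longrightarrow> w \<in> codes"
  using openin_sptop by blast

text \<open>Equality and definedness of words are facts, so both are open conditions.\<close>

lemma openin_fact: assumes "openin sptop U" shows "openin sptop {w \<in> U. f \<in> SS w}"
proof -
  have "{w \<in> U. f \<in> SS w} = U \<inter> basic_open (topspace Y) {f}"
    using openin_codes[OF assms] pt(1) by (auto simp: basic_open_def)
  then show ?thesis using assms openin_basic_open[of "topspace Y" "{f}"] by auto
qed

text \<open>A section is a function into the term models that is locally the value of a single word; \<open>enc\<close>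
  codes it as an element of the type \<open>'u\<close> on which all sheaves have to live.\<close>

definition Secs :: "'u set \<Rightarrow> ('u \<Rightarrow> ('f, 'r, 'u) gword set) set" where
  "Secs U = {s \<in> extensional U. \<forall>w\<in>U. \<exists>N u. openin sptop N \<and> w \<in> N \<and> N \<subseteq> U \<and>
     (\<forall>w'\<in>N. defd (SS w') u \<and> s w' = cls (SS w') u)}"

definition dec :: "'u set \<Rightarrow> 'u \<Rightarrow> 'u \<Rightarrow> ('f, 'r, 'u) gword set" where
  "dec U = inv_into (Secs U) (enc U)"

definition spsh :: "('f, 'r, 'u, 'u) presheaf" where
  "spsh = \<lparr> sec = (\<lambda>U. \<lparr> univ = enc U ` Secs U,
      funI = (\<lambda>F es. enc U (\<lambda>w\<in>U. funI (M w) F (map (\<lambda>e. dec U e w) es))),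
      relI = (\<lambda>R es. \<forall>w\<in>U. relI (M w) R (map (\<lambda>e. dec U e w) es)) \<rparr>),
    res = (\<lambda>U V e. enc V (restrict (dec U e) V)) \<rparr>"

lemma Secs_univ: "s \<in> Secs U \<Longrightarrow> w \<in> U \<Longrightarrow> s w \<in> univ (M w)"
  unfolding Secs_def univ_TM by fastforce

lemma SecsE:
  assumes "s \<in> Secs U" "w \<in> U"
  obtains N u where "openin sptop N" "w \<in> N" "N \<subseteq> U" "\<forall>w'\<in>N. defd (SS w') u \<and> s w' = cls (SS w') u"
  using assms unfolding Secs_def by blast

lemma Secs_restrict: assumes "s \<in> Secs U" "openin sptop V" "V \<subseteq> U" shows "restrict s V \<in> Secs V"
proof -
  have "\<exists>N u. openin sptop N \<and> w \<in> N \<and> N \<subseteq> V \<and> (\<forall>w'\<in>N. defd (SS w') u \<and> restrict s V w' = cls (SS w') u)"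
    if w: "w \<in> V" for w
  proof -
    obtain N u where "openin sptop N" "w \<in> N" "N \<subseteq> U" "\<forall>w'\<in>N. defd (SS w') u \<and> s w' = cls (SS w') u"
      using SecsE[OF assms(1) subsetD[OF assms(3) w]] .
    then show ?thesis using assms(2) w by (intro exI[of _ "N \<inter> V"] exI[of _ u]) auto
  qed
  then show ?thesis unfolding Secs_def by simp
qed

lemma Secs_word:
  assumes "openin sptop U" "\<forall>w\<in>U. defd (SS w) u"
  shows "(\<lambda>w\<in>U. cls (SS w) u) \<in> Secs U"
  unfolding Secs_def using assms by (auto intro!: exI[of _ U] exI[of _ u])

end

text \<open>Injectivity of \<open>enc\<close> refers to the topology of the codes and to the
  sections over its open sets, hence this second stage.\<close>

locale coded_spectrum = spectrum L T0 T \<Lambda> X P Y Q p \<pi> codes yy SS enc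
  for L :: "('f, 'r) lang" and T0 T :: "('f, 'r) sequent set" and \<Lambda> :: "('f, 'r) horn_pair set"
    and X :: "'u topology" and P :: "('f, 'r, 'u, 'u) presheaf"
    and Y :: "'u topology" and Q :: "('f, 'r, 'u, 'u) presheaf"
    and p :: "'u \<Rightarrow> 'u" and \<pi> :: "'u set \<Rightarrow> ('u \<Rightarrow> ('u set \<times> 'u) set) \<Rightarrow> 'u"
    and codes :: "'u set" and yy :: "'u \<Rightarrow> 'u" and SS :: "'u \<Rightarrow> ('f, 'r, 'u) gfact set"
    and enc :: "'u set \<Rightarrow> ('u \<Rightarrow> ('f, 'r, 'u) gword set) \<Rightarrow> 'u" +
  assumes enc: "openin sptop U \<Longrightarrow> inj_on (enc U) (Secs U)"
begin

lemma dec_enc: "openin sptop U \<Longrightarrow> s \<in> Secs U \<Longrightarrow> dec U (enc U s) = s"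
  unfolding dec_def using enc by simp

lemma sec_univ: "univ (sec spsh U) = enc U ` Secs U"
  by (simp add: spsh_def)

lemma dec_Secs: "e \<in> univ (sec spsh U) \<Longrightarrow> dec U e \<in> Secs U"
  unfolding dec_def sec_univ by (rule inv_into_into)

lemma enc_dec: "e \<in> univ (sec spsh U) \<Longrightarrow> enc U (dec U e) = e"
  unfolding dec_def sec_univ by (simp add: f_inv_into_f)

lemma enc_univ: "s \<in> Secs U \<Longrightarrow> enc U s \<in> univ (sec spsh U)"
  by (simp add: sec_univ)

lemma spsh_funI: "funI (sec spsh U) F es = enc U (\<lambda>w\<in>U. funI (M w) F (map (\<lambda>e. dec U e w) es))"
  and spsh_relI: "relI (sec spsh U) R es \<longleftrightarrow> (\<forall>w\<in>U. relI (M w) R (map (\<lambda>e. dec U e w) es))"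
  and spsh_res: "res spsh U V e = enc V (restrict (dec U e) V)"
  by (simp_all add: spsh_def)

lemma dec_eqI:
  assumes "openin sptop U" "e \<in> univ (sec spsh U)" "e' \<in> univ (sec spsh U)" "\<And>w. w \<in> U \<Longrightarrow> dec U e w = dec U e' w"
  shows "e = e'"
proof -
  have "dec U e = dec U e'"
    using dec_Secs[OF assms(2)] dec_Secs[OF assms(3)] assms(4) by (auto simp: Secs_def intro: extensionalityI)
  then show ?thesis using enc_dec assms(2,3) by metis
qed

abbreviation vals :: "'u set \<Rightarrow> 'u list \<Rightarrow> 'u \<Rightarrow> ('f, 'r, 'u) gword set list" where
  "vals U es w \<equiv> map (\<lambda>e. dec U e w) es"

lemma vals_tuples: "es \<in> tuples n (univ (sec spsh U)) \<Longrightarrow> w \<in> U \<Longrightarrow> vals U es w \<in> tuples n (univ (M w))"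
  using Secs_univ[OF dec_Secs] by (fastforce simp: tuples_def)

lemma vals_local:
  assumes "es \<in> tuples n (univ (sec spsh U))" "openin sptop U" "w \<in> U"
  shows "\<exists>N us. openin sptop N \<and> w \<in> N \<and> N \<subseteq> U \<and> length us = n \<and>
    (\<forall>w'\<in>N. (\<forall>u\<in>set us. defd (SS w') u) \<and> vals U es w' = map (cls (SS w')) us)"
  using assms(1)
proof (induction n arbitrary: es)
  case 0
  then show ?case using assms(2,3) by (intro exI[of _ U] exI[of _ "[]"]) (auto simp: tuples_def)
next
  case (Suc n)
  then obtain e es' where e: "es = e # es'" "e \<in> univ (sec spsh U)" "es' \<in> tuples n (univ (sec spsh U))"
    by (auto elim: tuples_SucE)
  from Suc.IH[OF e(3)] obtain N us where N: "openin sptop N" "w \<in> N" "N \<subseteq> U" "length us = n"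
    "\<forall>w'\<in>N. (\<forall>u\<in>set us. defd (SS w') u) \<and> vals U es' w' = map (cls (SS w')) us" by blast
  obtain N' u where N': "openin sptop N'" "w \<in> N'" "N' \<subseteq> U" "\<forall>w'\<in>N'. defd (SS w') u \<and> dec U e w' = cls (SS w') u"
    using SecsE[OF dec_Secs[OF e(2)] assms(3)] .
  show ?case using N N' e(1) by (intro exI[of _ "N \<inter> N'"] exI[of _ "u # us"]) auto
qed

section \<open>The structure sheaf and its models of sections\<close>

lemma fun_Secs:
  assumes U: "openin sptop U" and F: "F \<in> funs L" and es: "es \<in> tuples (far L F) (univ (sec spsh U))"
  shows "(\<lambda>w\<in>U. funI (M w) F (vals U es w)) \<in> Secs U"
proof -
  have "\<exists>N u. openin sptop N \<and> w \<in> N \<and> N \<subseteq> U \<and>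
      (\<forall>w'\<in>N. defd (SS w') u \<and> (\<lambda>w\<in>U. funI (M w) F (vals U es w)) w' = cls (SS w') u)" if w: "w \<in> U" for w
  proof -
    from vals_local[OF es U w] obtain N us where N: "openin sptop N" "w \<in> N" "N \<subseteq> U" "length us = far L F"
      "\<forall>w'\<in>N. (\<forall>u\<in>set us. defd (SS w') u) \<and> vals U es w' = map (cls (SS w')) us" by blast
    let ?u = "Wit (graph_fm L F) us"
    have "defd (SS w') ?u \<and> (\<lambda>w\<in>U. funI (M w) F (vals U es w)) w' = cls (SS w') ?u" if w': "w' \<in> N" for w'
    proof -
      have cl: "closed (SS w')" using pt(2) openin_codes[OF N(1) w'] .
      have us: "\<forall>u\<in>set us. defd (SS w') u" "vals U es w' = map (cls (SS w')) us" using N(5) w' by auto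
      have "defd (SS w') ?u" using closed_def1[OF cl closed_fun[OF cl F N(4) us(1)]] by simp
      then show ?thesis using TM_funI[OF cl F N(4) us(1)] us(2) w' N(3) by auto
    qed
    then show ?thesis using N by blast
  qed
  then show ?thesis unfolding Secs_def by simp
qed

lemma spsh_struct: "openin sptop U \<Longrightarrow> is_struct L (sec spsh U)"
  unfolding is_struct_def by (simp add: spsh_funI enc_univ fun_Secs)

lemma dec_homom:
  assumes U: "openin sptop U" "w \<in> U"
  shows "homom L (sec spsh U) (M w) (\<lambda>e. dec U e w)"
  unfolding homom_def using Secs_univ[OF dec_Secs U(2)] fun_Secs[OF U(1)] U
  by (auto simp: spsh_funI spsh_relI dec_enc)

text \<open>Uniqueness turns the pointwise witnesses into a function. Where the arguments are named
  by words \<open>us\<close>, the witness is named by the single word \<open>Wit \<chi> us\<close>,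
  so this function is a section.\<close>

lemma wit_Secs:
  assumes U: "openin sptop U" and K: "K n (Exi \<chi>)" and es: "es \<in> tuples n (univ (sec spsh U))"
    and sat: "\<And>w. w \<in> U \<Longrightarrow> sat (M w) (vals U es w) (Exi \<chi>)"
  shows "\<exists>e\<in>univ (sec spsh U). \<forall>w\<in>U. sat (M w) (dec U e w # vals U es w) \<chi>"
proof -
  define s where "s = (\<lambda>w\<in>U. THE x. x \<in> univ (M w) \<and> sat (M w) (x # vals U es w) \<chi>)"
  have s_eq: "s w = x" if "w \<in> U" "x \<in> univ (M w)" "sat (M w) (x # vals U es w) \<chi>" for w x
  proof -
    have "(THE x. x \<in> univ (M w) \<and> sat (M w) (x # vals U es w) \<chi>) = x"
      using that K_unique[OF K M_T0[OF openin_codes[OF U that(1)]] vals_tuples[OF es that(1)]]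
      by (intro the_equality) auto
    then show ?thesis using that(1) by (simp add: s_def)
  qed
  have sx: "sat (M w) (s w # vals U es w) \<chi>" if w: "w \<in> U" for w
  proof -
    obtain x where x: "x \<in> univ (M w)" "sat (M w) (x # vals U es w) \<chi>" using sat[OF w] by auto
    then show ?thesis using s_eq[OF w x] by simp
  qed
  have "\<exists>N u. openin sptop N \<and> w \<in> N \<and> N \<subseteq> U \<and> (\<forall>w'\<in>N. defd (SS w') u \<and> s w' = cls (SS w') u)"
    if w: "w \<in> U" for w
  proof -
    from vals_local[OF es U w] obtain N us where N: "openin sptop N" "w \<in> N" "N \<subseteq> U" "length us = n"
      "\<forall>w'\<in>N. (\<forall>u\<in>set us. defd (SS w') u) \<and> vals U es w' = map (cls (SS w')) us" by blast
    have "defd (SS w') (Wit \<chi> us) \<and> s w' = cls (SS w') (Wit \<chi> us)" if w': "w' \<in> N" for w'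
    proof -
      have cl: "closed (SS w')" using pt(2) openin_codes[OF N(1) w'] .
      have U': "w' \<in> U" using w' N(3) by blast
      have us: "\<forall>u\<in>set us. defd (SS w') u" "vals U es w' = map (cls (SS w')) us" using N(5) w' by auto
      have "(Exi \<chi>, us) \<in> SS w'" using TM_sat[OF cl _ us(1), of "Exi \<chi>"] K N(4) sat[OF U'] us(2) by simp
      then have 1: "(\<chi>, Wit \<chi> us # us) \<in> SS w'" using closed_rule[OF cl r_exE] by simp
      then have d: "defd (SS w') (Wit \<chi> us)" using closed_def1[OF cl] by fastforce
      have "sat (M w') (map (cls (SS w')) (Wit \<chi> us # us)) \<chi>"
        using TM_sat[OF cl, of "Wit \<chi> us # us" \<chi>] K_Exi[OF K] N(4) us(1) d 1 by simp
      then show ?thesis using s_eq[OF U', of "cls (SS w') (Wit \<chi> us)"] d us(2) by (simp add: univ_TM)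
    qed
    then show ?thesis using N by blast
  qed
  then have "s \<in> Secs U" unfolding Secs_def by (simp add: s_def)
  then show ?thesis using sx by (intro bexI[of _ "enc U s"]) (auto simp: dec_enc[OF U] enc_univ)
qed

text \<open>Truth at all points gives truth of sections for formulas in \<open>K\<close>, since
  unique witnesses glue. Applied to the conclusions of axioms, this makes the sections a model of
  \<open>T0\<close>.\<close>

lemma spsh_sat:
  assumes U: "openin sptop U"
  shows "K n \<theta> \<Longrightarrow> es \<in> tuples n (univ (sec spsh U)) \<Longrightarrow> (\<And>w. w \<in> U \<Longrightarrow> sat (M w) (vals U es w) \<theta>) \<Longrightarrow>
    sat (sec spsh U) es \<theta>"
proof (induction \<theta> arbitrary: n es)
  case (Rel R ts)
  have wf: "\<forall>t\<in>set ts. wf_tm L n t" using K_wf[OF Rel.prems(1)] by simp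
  have "relI (M w) R (vals U (map (val (sec spsh U) es) ts) w)" if w: "w \<in> U" for w
  proof -
    have "vals U (map (val (sec spsh U) es) ts) w = map (val (M w) (vals U es w)) ts"
      using homom_val[OF dec_homom[OF U w] spsh_struct[OF U] Rel.prems(2)] wf by auto
    then show ?thesis using Rel.prems(3)[OF w] by (simp only: sat.simps)
  qed
  then show ?case unfolding sat.simps spsh_relI by (rule ballI)
next
  case (Eqn s t)
  have wf: "wf_tm L n s" "wf_tm L n t" using K_wf[OF Eqn.prems(1)] by auto
  have "val (sec spsh U) es s = val (sec spsh U) es t"
  proof (rule dec_eqI[OF U])
    show "val (sec spsh U) es s \<in> univ (sec spsh U)" "val (sec spsh U) es t \<in> univ (sec spsh U)"
      using val_in_univ[OF spsh_struct[OF U] Eqn.prems(2)] wf by blast+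
    fix w assume w: "w \<in> U"
    show "dec U (val (sec spsh U) es s) w = dec U (val (sec spsh U) es t) w"
      using homom_val[OF dec_homom[OF U w] spsh_struct[OF U] Eqn.prems(2)] wf Eqn.prems(3)[OF w] by simp
  qed
  then show ?case by simp
next
  case (Conj \<phi> \<psi>)
  then show ?case using K_Conj[OF Conj.prems(1)] by simp
next
  case (Exi \<chi>)
  obtain e where e: "e \<in> univ (sec spsh U)" "\<forall>w\<in>U. sat (M w) (dec U e w # vals U es w) \<chi>"
    using wit_Secs[OF U Exi.prems] by blast
  then have "sat (sec spsh U) (e # es) \<chi>"
    using Exi.prems(2) by (intro Exi.IH[OF K_Exi[OF Exi.prems(1)]]) auto
  then show ?case using e(1) by auto
qed (use not_K_Disj not_K_Falsity in auto)

lemma spsh_model: assumes U: "openin sptop U" shows "model L T0 (sec spsh U)"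
proof -
  have "sat (sec spsh U) es \<psi>"
    if ax: "(n, \<phi>, \<psi>) \<in> T0" "es \<in> tuples n (univ (sec spsh U))" "sat (sec spsh U) es \<phi>" for n \<phi> \<psi> es
  proof (rule spsh_sat[OF U K_axiom(2)[OF ax(1)] ax(2)])
    fix w assume w: "w \<in> U"
    have "sat (M w) (vals U es w) \<phi>"
      by (rule homom_sat[OF dec_homom[OF U w] spsh_struct[OF U] K_wf[OF K_axiom(1)[OF ax(1)]] ax(2,3)])
    then show "sat (M w) (vals U es w) \<psi>"
      using M_T0[OF openin_codes[OF U w]] ax(1) vals_tuples[OF ax(2) w] by (fastforce simp: model_def)
  qed
  then show ?thesis using spsh_struct[OF U] unfolding model_def by blast
qed

lemma dec_res:
  assumes "openin sptop U" "openin sptop V" "V \<subseteq> U" "e \<in> univ (sec spsh U)"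
  shows "res spsh U V e \<in> univ (sec spsh V)" "dec V (res spsh U V e) = restrict (dec U e) V"
  using Secs_restrict[OF dec_Secs[OF assms(4)] assms(2,3)] assms(2) by (simp_all add: spsh_res enc_univ dec_enc)

lemma spsh_presheaf: "presheaf_of_models L T0 sptop spsh"
proof -
  have hom: "homom L (sec spsh U) (sec spsh V) (res spsh U V)"
    if U: "openin sptop U" "openin sptop V" "V \<subseteq> U" for U V
  proof -
    have vals: "vals V (map (res spsh U V) es) w = vals U es w"
      if "es \<in> tuples n (univ (sec spsh U))" "w \<in> V" for es n w
      using that dec_res(2)[OF U] by (auto simp: tuples_def)
    have "res spsh U V (funI (sec spsh U) F es) = funI (sec spsh V) F (map (res spsh U V) es)"
      if F: "F \<in> funs L" "es \<in> tuples (far L F) (univ (sec spsh U))" for F es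
    proof -
      have "restrict (\<lambda>w\<in>U. funI (M w) F (vals U es w)) V = (\<lambda>w\<in>V. funI (M w) F (vals V (map (res spsh U V) es) w))"
      proof (rule ext)
        fix w
        show "restrict (\<lambda>w\<in>U. funI (M w) F (vals U es w)) V w = (\<lambda>w\<in>V. funI (M w) F (vals V (map (res spsh U V) es) w)) w"
          using vals[OF F(2), of w] U(3) by (cases "w \<in> V") (auto simp del: map_map)
      qed
      then show ?thesis
        by (simp only: spsh_res spsh_funI dec_enc[OF U(1) fun_Secs[OF U(1) F]])
    qed
    moreover have "relI (sec spsh V) R (map (res spsh U V) es)"
      if R: "R \<in> rels L" "es \<in> tuples (rar L R) (univ (sec spsh U))" "relI (sec spsh U) R es" for R es
      using vals[OF R(2)] R(3) U(3) unfolding spsh_relI by (metis subsetD)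
    ultimately show ?thesis using dec_res(1)[OF U] unfolding homom_def by auto
  qed
  have id: "res spsh U U e = e" if "openin sptop U" "e \<in> univ (sec spsh U)" for U e
    using that dec_res[OF that(1,1) subset_refl that(2)] by (intro dec_eqI[OF that(1)]) auto
  have comp: "res spsh V W (res spsh U V e) = res spsh U W e"
    if U: "openin sptop U" "openin sptop V" "openin sptop W" "W \<subseteq> V" "V \<subseteq> U" "e \<in> univ (sec spsh U)" for U V W e
  proof (rule dec_eqI[OF U(3)])
    have WU: "W \<subseteq> U" using U by blast
    note a = dec_res[OF U(1,2,5,6)] note b = dec_res[OF U(2,3,4) a(1)] note c = dec_res[OF U(1,3) WU U(6)]
    show "res spsh V W (res spsh U V e) \<in> univ (sec spsh W)" "res spsh U W e \<in> univ (sec spsh W)" using b c by auto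
    show "dec W (res spsh V W (res spsh U V e)) w = dec W (res spsh U W e) w" if "w \<in> W" for w
      using a(2) b(2) c(2) that U(4) by auto
  qed
  show ?thesis unfolding presheaf_of_models_def
    by (intro HOL.conjI allI impI ballI) (auto intro: spsh_model hom id comp)
qed

lemma spsh_sheaf: "sheaf_of_models L T0 sptop spsh"
proof -
  have glue: "\<exists>!t. t \<in> univ (sec spsh (\<Union>\<C>)) \<and> (\<forall>V\<in>\<C>. res spsh (\<Union>\<C>) V t = s V)"
    if C: "\<forall>V\<in>\<C>. openin sptop V" and s: "\<forall>V\<in>\<C>. s V \<in> univ (sec spsh V)"
      "\<forall>V\<in>\<C>. \<forall>W\<in>\<C>. res spsh V (V \<inter> W) (s V) = res spsh W (V \<inter> W) (s W)" for \<C> s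
  proof -
    have U: "openin sptop (\<Union>\<C>)" using C by blast
    have agree: "dec V (s V) w = dec W (s W) w" if "V \<in> \<C>" "W \<in> \<C>" "w \<in> V" "w \<in> W" for V W w
    proof -
      have o: "openin sptop V" "openin sptop W" "openin sptop (V \<inter> W)" using C that by auto
      have "restrict (dec V (s V)) (V \<inter> W) = restrict (dec W (s W)) (V \<inter> W)"
        using dec_res(2)[OF o(1,3), of "s V"] dec_res(2)[OF o(2,3), of "s W"] s that by auto
      then show ?thesis using that by (metis IntI restrict_apply')
    qed
    \<comment> \<open>At each point any member of the cover may be chosen; by \<open>agree\<close>
      the value is the same.\<close>
    define t where "t = (\<lambda>w\<in>\<Union>\<C>. dec (SOME V. V \<in> \<C> \<and> w \<in> V) (s (SOME V. V \<in> \<C> \<and> w \<in> V)) w)"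
    have t: "t w = dec V (s V) w" if "V \<in> \<C>" "w \<in> V" for V w
    proof -
      have "(SOME V. V \<in> \<C> \<and> w \<in> V) \<in> \<C> \<and> w \<in> (SOME V. V \<in> \<C> \<and> w \<in> V)"
        using that by (intro someI[of "\<lambda>V. V \<in> \<C> \<and> w \<in> V" V]) simp
      moreover have "w \<in> \<Union>\<C>" using that by blast
      ultimately show ?thesis unfolding t_def restrict_apply'[OF \<open>w \<in> \<Union>\<C>\<close>]
        by (intro agree that) auto
    qed
    have "\<exists>N u. openin sptop N \<and> w \<in> N \<and> N \<subseteq> \<Union>\<C> \<and> (\<forall>w'\<in>N. defd (SS w') u \<and> t w' = cls (SS w') u)"
      if "w \<in> \<Union>\<C>" for w
    proof -
      from that obtain V where V: "V \<in> \<C>" "w \<in> V" by blast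
      obtain N u where N: "openin sptop N" "w \<in> N" "N \<subseteq> V" "\<forall>w'\<in>N. defd (SS w') u \<and> dec V (s V) w' = cls (SS w') u"
        using SecsE[OF dec_Secs V(2)] s V by metis
      then have "\<forall>w'\<in>N. defd (SS w') u \<and> t w' = cls (SS w') u" using t[OF V(1)] by auto
      then show ?thesis using N V by blast
    qed
    moreover have "t \<in> extensional (\<Union>\<C>)" by (simp add: t_def)
    ultimately have tS: "t \<in> Secs (\<Union>\<C>)" unfolding Secs_def by blast
    have "res spsh (\<Union>\<C>) V (enc (\<Union>\<C>) t) = s V" if V: "V \<in> \<C>" for V
    proof (rule dec_eqI)
      have sub: "V \<subseteq> \<Union>\<C>" using V by blast
      show o: "openin sptop V" using C V by blast
      note r = dec_res[OF U o sub enc_univ[OF tS]]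
      show "res spsh (\<Union>\<C>) V (enc (\<Union>\<C>) t) \<in> univ (sec spsh V)" "s V \<in> univ (sec spsh V)" using r s V by auto
      show "dec V (res spsh (\<Union>\<C>) V (enc (\<Union>\<C>) t)) w = dec V (s V) w" if "w \<in> V" for w
        using r(2) dec_enc[OF U tS] t[OF V that] that by simp
    qed
    moreover have "t' = enc (\<Union>\<C>) t"
      if t': "t' \<in> univ (sec spsh (\<Union>\<C>))" "\<forall>V\<in>\<C>. res spsh (\<Union>\<C>) V t' = s V" for t'
    proof (rule dec_eqI[OF U t'(1) enc_univ[OF tS]])
      fix w assume "w \<in> \<Union>\<C>"
      then obtain V where V: "V \<in> \<C>" "w \<in> V" by blast
      have "V \<subseteq> \<Union>\<C>" using V by blast
      from dec_res(2)[OF U _ this t'(1)] C V t'(2) have "dec V (s V) = restrict (dec (\<Union>\<C>) t') V" by auto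
      then show "dec (\<Union>\<C>) t' w = dec (\<Union>\<C>) (enc (\<Union>\<C>) t) w" using dec_enc[OF U tS] t[OF V] V(2) by simp
    qed
    ultimately show ?thesis using enc_univ[OF tS] by blast
  qed
  have rel: "relI (sec spsh (\<Union>\<C>)) R ts"
    if C: "\<forall>V\<in>\<C>. openin sptop V" and R: "R \<in> rels L" "ts \<in> tuples (rar L R) (univ (sec spsh (\<Union>\<C>)))"
      "\<forall>V\<in>\<C>. relI (sec spsh V) R (map (res spsh (\<Union>\<C>) V) ts)" for \<C> R ts
    unfolding spsh_relI
  proof
    fix w assume "w \<in> \<Union>\<C>"
    then obtain V where V: "V \<in> \<C>" "w \<in> V" by blast
    have o: "openin sptop (\<Union>\<C>)" "openin sptop V" "V \<subseteq> \<Union>\<C>" using C V by auto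
    have "vals V (map (res spsh (\<Union>\<C>) V) ts) w = vals (\<Union>\<C>) ts w"
      using dec_res(2)[OF o] R(2) V(2) by (auto simp: tuples_def)
    then show "relI (M w) R (vals (\<Union>\<C>) ts w)" using R(3) V unfolding spsh_relI by metis
  qed
  show ?thesis unfolding sheaf_of_models_def
    by (rule HOL.conjI, rule spsh_presheaf, intro allI impI, rule HOL.conjI, intro allI impI,
      elim conjE, rule glue, assumption+, intro ballI impI, rule rel, assumption+)
qed

sublocale E: sheaf L T0 sptop spsh by (rule sheafI[OF spsh_sheaf])

subsection \<open>The stalks of the spectrum\<close>

text \<open>Two sections are named near \<open>w\<close> by words. Equality of their values at
  \<open>w\<close> is a fact about these words, hence holds on an open set, so a germ is nothing
  more than a value.\<close>

lemma germ_dec_iff: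
  assumes "openin sptop U" "openin sptop V" "w \<in> U" "w \<in> V" "e \<in> univ (sec spsh U)" "e' \<in> univ (sec spsh V)"
  shows "germ sptop spsh w U e = germ sptop spsh w V e' \<longleftrightarrow> dec U e w = dec V e' w"
proof
  assume "germ sptop spsh w U e = germ sptop spsh w V e'"
  then obtain W where W: "openin sptop W" "w \<in> W" "W \<subseteq> U \<inter> V" "res spsh U W e = res spsh V W e'"
    using E.germ_eq_iff[OF assms] by blast
  then have "restrict (dec U e) W = restrict (dec V e') W"
    using dec_res(2)[OF assms(1) W(1) _ assms(5)] dec_res(2)[OF assms(2) W(1) _ assms(6)] by auto
  then show "dec U e w = dec V e' w" using W(2) by (metis restrict_apply')
next
  assume eq: "dec U e w = dec V e' w"
  obtain N u where N: "openin sptop N" "w \<in> N" "N \<subseteq> U" "\<forall>w'\<in>N. defd (SS w') u \<and> dec U e w' = cls (SS w') u"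
    using SecsE[OF dec_Secs[OF assms(5)] assms(3)] .
  obtain N' u' where N': "openin sptop N'" "w \<in> N'" "N' \<subseteq> V" "\<forall>w'\<in>N'. defd (SS w') u' \<and> dec V e' w' = cls (SS w') u'"
    using SecsE[OF dec_Secs[OF assms(6)] assms(4)] .
  let ?W = "{w' \<in> N \<inter> N'. (eq_fm, [u, u']) \<in> SS w'}"
  have W: "openin sptop ?W" using N(1) N'(1) by (intro openin_fact) auto
  have WU: "?W \<subseteq> U" "?W \<subseteq> V" using N(3) N'(3) by auto
  have iff: "dec U e w' = dec V e' w' \<longleftrightarrow> (eq_fm, [u, u']) \<in> SS w'" if "w' \<in> N \<inter> N'" for w'
  proof -
    have "defd (SS w') u" "dec U e w' = cls (SS w') u" "dec V e' w' = cls (SS w') u'" using that N(4) N'(4) by auto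
    then show ?thesis using cls_eq_iff[OF pt(2)] openin_codes[OF N(1)] that by auto
  qed
  then have w: "w \<in> ?W" using eq N(2) N'(2) by auto
  have "res spsh U ?W e = res spsh V ?W e'"
  proof (rule dec_eqI[OF W])
    note r = dec_res[OF assms(1) W WU(1) assms(5)] dec_res[OF assms(2) W WU(2) assms(6)]
    show "res spsh U ?W e \<in> univ (sec spsh ?W)" "res spsh V ?W e' \<in> univ (sec spsh ?W)" using r by auto
    show "dec ?W (res spsh U ?W e) w' = dec ?W (res spsh V ?W e') w'" if "w' \<in> ?W" for w'
      unfolding r(2,4) using iff that by simp
  qed
  then show "germ sptop spsh w U e = germ sptop spsh w V e'"
    using WU by (intro E.germ_eqI[OF assms(1,2,5,6) W w]) auto
qed

definition stalk_value :: "'u \<Rightarrow> ('u set \<times> 'u) set \<Rightarrow> ('f, 'r, 'u) gword set" where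
  "stalk_value w g = (SOME x. \<exists>U e. openin sptop U \<and> w \<in> U \<and> e \<in> univ (sec spsh U) \<and> g = germ sptop spsh w U e \<and> x = dec U e w)"

lemma stalk_value_germ:
  assumes "openin sptop U" "w \<in> U" "e \<in> univ (sec spsh U)"
  shows "stalk_value w (germ sptop spsh w U e) = dec U e w"
proof -
  have "\<exists>V e'. openin sptop V \<and> w \<in> V \<and> e' \<in> univ (sec spsh V) \<and>
      germ sptop spsh w U e = germ sptop spsh w V e' \<and> stalk_value w (germ sptop spsh w U e) = dec V e' w"
    unfolding stalk_value_def by (rule someI[of _ "dec U e w"]) (use assms in blast)
  then show ?thesis using germ_dec_iff[OF assms(1) _ assms(2) _ assms(3)] by metis
qed

definition word_section :: "'u set \<Rightarrow> ('f, 'r, 'u) gword \<Rightarrow> 'u" where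
  "word_section N u = enc N (\<lambda>w\<in>N. cls (SS w) u)"

lemma word_section:
  assumes "openin sptop N" "\<forall>w\<in>N. defd (SS w) u"
  shows "word_section N u \<in> univ (sec spsh N)" "w \<in> N \<Longrightarrow> dec N (word_section N u) w = cls (SS w) u"
  using Secs_word[OF assms] by (simp_all add: word_section_def enc_univ dec_enc[OF assms(1)])

lemma defd_nbhd:
  assumes "w \<in> codes" "defd (SS w) u"
  obtains N where "openin sptop N" "w \<in> N" "\<forall>w'\<in>N. defd (SS w') u"
proof -
  have "openin sptop {w' \<in> codes. defd (SS w') u}" using openin_fact[of codes] openin_topspace[of sptop] by simp
  then show ?thesis using assms that by blast
qed

definition value_germ :: "'u \<Rightarrow> ('f, 'r, 'u) gword set \<Rightarrow> ('u set \<times> 'u) set" where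
  "value_germ w = inv_into (univ (stalk sptop spsh w)) (stalk_value w)"

lemma stalk_isom:
  assumes w: "w \<in> codes"
  shows "isom L (stalk sptop spsh w) (M w) (stalk_value w) (value_germ w)"
  unfolding value_germ_def
proof (rule isomI_bij)
  have wt: "w \<in> topspace sptop" using w by simp
  show st: "is_struct L (stalk sptop spsh w)" using E.stalk_struct[OF wt] .
  have vals: "map (stalk_value w) (map (germ sptop spsh w U) es) = vals U es w"
    if "openin sptop U" "w \<in> U" "es \<in> tuples n (univ (sec spsh U))" for U es n
    using that stalk_value_germ[OF that(1,2)] by (auto simp: tuples_def)
  have "stalk_value w (funI (stalk sptop spsh w) F gs) = funI (M w) F (map (stalk_value w) gs)"
    if F: "F \<in> funs L" "gs \<in> tuples (far L F) (univ (stalk sptop spsh w))" for F gs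
  proof -
    obtain U es where U: "openin sptop U" "w \<in> U" "es \<in> tuples (far L F) (univ (sec spsh U))"
      "gs = map (germ sptop spsh w U) es" using F(2) wt by (rule E.stalk_tuplesE)
    have "funI (sec spsh U) F es \<in> univ (sec spsh U)" using spsh_struct[OF U(1)] F(1) U(3) by (simp add: is_struct_def)
    then have "stalk_value w (funI (stalk sptop spsh w) F gs) = dec U (funI (sec spsh U) F es) w"
      using E.stalk_funI[OF U(1,2) F(1) U(3)] U(4) stalk_value_germ[OF U(1,2)] by simp
    also have "\<dots> = funI (M w) F (vals U es w)" by (rule homom_funI[OF dec_homom[OF U(1,2)] F(1) U(3)])
    finally show ?thesis by (simp only: U(4) vals[OF U(1-3)])
  qed
  moreover have rel: "relI (M w) R (map (stalk_value w) gs) \<longleftrightarrow> relI (stalk sptop spsh w) R gs"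
    if R: "R \<in> rels L" "gs \<in> tuples (rar L R) (univ (stalk sptop spsh w))" for R gs
  proof -
    obtain U es where U: "openin sptop U" "w \<in> U" "es \<in> tuples (rar L R) (univ (sec spsh U))"
      "gs = map (germ sptop spsh w U) es" using R(2) wt by (rule E.stalk_tuplesE)
    have "relI (stalk sptop spsh w) R gs \<longleftrightarrow>
        (\<exists>W. openin sptop W \<and> w \<in> W \<and> W \<subseteq> U \<and> relI (sec spsh W) R (map (res spsh U W) es))"
      using E.stalk_relI[OF U(1,2) R(1) U(3)] U(4) by simp
    also have "\<dots> \<longleftrightarrow> (\<exists>W. openin sptop W \<and> w \<in> W \<and> W \<subseteq> U \<and> (\<forall>w'\<in>W. relI (M w') R (vals U es w')))"
    proof -
      have "relI (sec spsh W) R (map (res spsh U W) es) \<longleftrightarrow> (\<forall>w'\<in>W. relI (M w') R (vals U es w'))"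
        if W: "openin sptop W" "W \<subseteq> U" for W
      proof -
        have "vals W (map (res spsh U W) es) w' = vals U es w'" if "w' \<in> W" for w'
          using dec_res(2)[OF U(1) W] U(3) that by (auto simp: tuples_def)
        then show ?thesis unfolding spsh_relI by metis
      qed
      then show ?thesis by blast
    qed
    \<comment> \<open>Once the arguments are named by words \<open>us\<close>, the relation is the
      fact \<open>(rel_fm L R, us)\<close>, which holds on an open set as soon as it holds at
      \<open>w\<close>.\<close>
    also have "\<dots> \<longleftrightarrow> relI (M w) R (vals U es w)"
    proof
      assume r: "relI (M w) R (vals U es w)"
      from vals_local[OF U(3,1,2)] obtain N us where N: "openin sptop N" "w \<in> N" "N \<subseteq> U"
        "\<forall>w'\<in>N. (\<forall>u\<in>set us. defd (SS w') u) \<and> vals U es w' = map (cls (SS w')) us" by blast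
      have rw: "relI (M w') R (vals U es w') \<longleftrightarrow> (rel_fm L R, us) \<in> SS w'" if "w' \<in> N" for w'
        using TM_relI[OF pt(2)[OF openin_codes[OF N(1) that]]] N(4) that by auto
      have "openin sptop {w' \<in> N. (rel_fm L R, us) \<in> SS w'}" by (rule openin_fact[OF N(1)])
      moreover have "w \<in> {w' \<in> N. (rel_fm L R, us) \<in> SS w'}" using rw[OF N(2)] r N(2) by blast
      ultimately show "\<exists>W. openin sptop W \<and> w \<in> W \<and> W \<subseteq> U \<and> (\<forall>w'\<in>W. relI (M w') R (vals U es w'))"
        using N(3) rw by (intro exI[of _ "{w' \<in> N. (rel_fm L R, us) \<in> SS w'}"]) blast
    qed blast
    finally show ?thesis by (simp only: U(4) vals[OF U(1-3)])
  qed
  moreover have im: "stalk_value w ` univ (stalk sptop spsh w) = univ (M w)"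
  proof (intro equalityI subsetI)
    fix x assume "x \<in> stalk_value w ` univ (stalk sptop spsh w)"
    then show "x \<in> univ (M w)" using stalk_value_germ Secs_univ[OF dec_Secs] by (auto elim!: E.stalkE)
  next
    fix x assume "x \<in> univ (M w)"
    then obtain u where u: "defd (SS w) u" "x = cls (SS w) u" by (auto simp: univ_TM)
    \<comment> \<open>Definedness persists near \<open>w\<close>, so the word \<open>u\<close>
      itself names a section with the required value.\<close>
    obtain N where N: "openin sptop N" "w \<in> N" "\<forall>w'\<in>N. defd (SS w') u" using defd_nbhd[OF w u(1)] .
    have "stalk_value w (germ sptop spsh w N (word_section N u)) = x"
      using stalk_value_germ[OF N(1,2) word_section(1)[OF N(1,3)]] word_section(2)[OF N(1,3,2)] u(2) by simp
    then show "x \<in> stalk_value w ` univ (stalk sptop spsh w)"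
      using E.germ_in_stalk[OF N(1,2) word_section(1)[OF N(1,3)]] by blast
  qed
  ultimately show "homom L (stalk sptop spsh w) (M w) (stalk_value w)" unfolding homom_def by blast
  show "relI (stalk sptop spsh w) R gs"
    if "R \<in> rels L" "gs \<in> tuples (rar L R) (univ (stalk sptop spsh w))" "relI (M w) R (map (stalk_value w) gs)" for R gs
    using rel that by blast
  have "inj_on (stalk_value w) (univ (stalk sptop spsh w))"
  proof (rule inj_onI)
    fix g g' assume g: "g \<in> univ (stalk sptop spsh w)" "g' \<in> univ (stalk sptop spsh w)" "stalk_value w g = stalk_value w g'"
    obtain U e where U: "openin sptop U" "w \<in> U" "e \<in> univ (sec spsh U)" "g = germ sptop spsh w U e"
      using g(1) by (rule E.stalkE)
    obtain V e' where V: "openin sptop V" "w \<in> V" "e' \<in> univ (sec spsh V)" "g' = germ sptop spsh w V e'"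
      using g(2) by (rule E.stalkE)
    show "g = g'" using g(3) stalk_value_germ[OF U(1-3)] stalk_value_germ[OF V(1-3)] germ_dec_iff[OF U(1) V(1) U(2) V(2) U(3) V(3)] U(4) V(4)
      by simp
  qed
  then show "bij_betw (stalk_value w) (univ (stalk sptop spsh w)) (univ (M w))" using im by (simp add: bij_betw_def)
qed

lemma value_germ_word_section:
  assumes "openin sptop N" "w \<in> N" "\<forall>w'\<in>N. defd (SS w') u"
  shows "value_germ w (cls (SS w) u) = germ sptop spsh w N (word_section N u)"
proof -
  have g: "germ sptop spsh w N (word_section N u) \<in> univ (stalk sptop spsh w)"
    using E.germ_in_stalk[OF assms(1,2) word_section(1)[OF assms(1,3)]] .
  have "stalk_value w (germ sptop spsh w N (word_section N u)) = cls (SS w) u"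
    using stalk_value_germ[OF assms(1,2) word_section(1)[OF assms(1,3)]] word_section(2)[OF assms(1,3,2)] by simp
  then show ?thesis using stalk_isom[OF openin_codes[OF assms(1,2)]] g by (auto simp: isom_def)
qed

lemma spec_T_modelled: "T_modelled_space L T0 T (sptop, spsh)"
  using spsh_sheaf isom_model[OF isom_sym[OF stalk_isom] _ pt(6) wf_T] E.stalk_struct by simp

end

section \<open>The universal property of the spectrum\<close>

context coded_spectrum
begin

definition epf :: "'u \<Rightarrow> 'u" where "epf = (\<lambda>w\<in>codes. yy w)"

text \<open>Specified by its stalk maps, which determine it by \<open>ms_hom_eqI\<close>: at a point
  it is the etale map from the stalk of \<open>Q\<close>, moved into the stalk of the structure
  sheaf.\<close>

definition counit_comorphism :: "('u set \<Rightarrow> ('u \<Rightarrow> ('u set \<times> 'u) set) \<Rightarrow> 'u) \<Rightarrow> bool" where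
  "counit_comorphism \<epsilon> \<longleftrightarrow> (epf, \<epsilon>) \<in> ms_hom L (sptop, spsh) (Y, Q) \<and>
     (\<forall>w\<in>codes. \<forall>g\<in>univ (stalk Y Q (yy w)). stalk_map sptop spsh epf Y Q \<epsilon> w g = value_germ w (jj (yy w) (SS w) g))"

lemma epf [simp]: "w \<in> codes \<Longrightarrow> epf w = yy w"
  by (simp add: epf_def)

lemma pt_param:
  assumes "w \<in> codes" "openin Y W" "yy w \<in> W" "t \<in> univ (sec Q W)"
  shows "defd (SS w) (Par (W, t))" "jj (yy w) (SS w) (germ Y Q (yy w) W t) = cpar (SS w) (W, t)"
  using param_defd[OF pt(4)[OF assms(1)], of "(W, t)"] jj_germ[OF pt(2,4)[OF assms(1)] assms(2-4)] assms
  by (simp_all add: local_params_def)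

lemma jj_value_germ_homom: assumes "w \<in> codes" shows "homom L (stalk Y Q (yy w)) (stalk sptop spsh w) (\<lambda>g. value_germ w (jj (yy w) (SS w) g))"
  using homom_comp[OF jj_homom[OF pt(1,2,4)[OF assms]]] stalk_isom[OF assms] by (auto simp: isom_def)

lemma ex_counit: "\<exists>\<epsilon>. counit_comorphism \<epsilon>"
proof -
  have cont: "continuous_map sptop Y epf"
    unfolding continuous_map_def
  proof (intro HOL.conjI allI impI)
    show "epf \<in> topspace sptop \<rightarrow> topspace Y" using pt(1) by auto
    fix V assume V: "openin Y V"
    have "{w \<in> topspace sptop. epf w \<in> V} = basic_open V {}" by (auto simp: basic_open_def)
    then show "openin sptop {w \<in> topspace sptop. epf w \<in> V}" using openin_basic_open[OF V] by simp
  qed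
  interpret ms_map L T0 sptop spsh Y Q epf by (rule ms_mapI[OF spsh_sheaf YQ cont])
  let ?k = "\<lambda>w g. value_germ w (jj (yy w) (SS w) g)"
  have k: "homom L (stalk Y Q (epf w)) (stalk sptop spsh w) (?k w)" if "w \<in> topspace sptop" for w
    using jj_value_germ_homom that by simp
  have loc: "\<exists>V r. openin sptop V \<and> w \<in> V \<and> epf ` V \<subseteq> W \<and> r \<in> univ (sec spsh V) \<and>
        (\<forall>w'\<in>V. ?k w' (germ Y Q (epf w') W t) = germ sptop spsh w' V r)"
    if w: "w \<in> topspace sptop" "openin Y W" "epf w \<in> W" "t \<in> univ (sec Q W)" for w W t
  proof -
    \<comment> \<open>On the whole preimage of \<open>W\<close>, the section \<open>t\<close> is
      sent to the section named by the single parameter \<open>(W, t)\<close>.\<close>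
    have V: "openin sptop (basic_open W {})" using w(2) by (simp add: openin_basic_open)
    have b: "w' \<in> codes" "yy w' \<in> W" if "w' \<in> basic_open W {}" for w' using that by (auto simp: basic_open_def)
    have d: "\<forall>w'\<in>basic_open W {}. defd (SS w') (Par (W, t))" using pt_param(1)[OF b(1) w(2) b(2) w(4)] by blast
    have "?k w' (germ Y Q (epf w') W t) = germ sptop spsh w' (basic_open W {}) (word_section (basic_open W {}) (Par (W, t)))"
      if w': "w' \<in> basic_open W {}" for w'
      using pt_param(2)[OF b(1)[OF w'] w(2) b(2)[OF w'] w(4)] value_germ_word_section[OF V w' d] b(1)[OF w'] by simp
    moreover have "w \<in> basic_open W {}" using w by (simp add: basic_open_def)
    moreover have "epf ` basic_open W {} \<subseteq> W" using b by auto
    ultimately show ?thesis using V word_section(1)[OF V d] by blast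
  qed
  have "counit_comorphism (mk_mor ?k)"
    using mk_mor[OF k loc] cont by (simp add: counit_comorphism_def epf_def)
  then show ?thesis by blast
qed

text \<open>This is the last condition in \<open>spec_points\<close>, transported along the
  isomorphism between the term model and the stalk.\<close>

lemma counit_admissible:
  assumes "counit_comorphism \<epsilon>"
  shows "ms_admissible \<Lambda> (sptop, spsh) (X, P) (ms_comp (sptop, spsh) (Y, Q) (X, P) (p, \<pi>) (epf, \<epsilon>))"
proof -
  have e: "(epf, \<epsilon>) \<in> ms_hom L (sptop, spsh) (Y, Q)" using assms by (simp add: counit_comorphism_def)
  obtain a \<alpha> where a: "ms_comp (sptop, spsh) (Y, Q) (X, P) (p, \<pi>) (epf, \<epsilon>) = (a, \<alpha>)"
    "(a, \<alpha>) \<in> ms_hom L (sptop, spsh) (X, P)"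
    "\<And>w. w \<in> topspace sptop \<Longrightarrow> a w = p (epf w)"
    "\<And>w g. w \<in> topspace sptop \<Longrightarrow> g \<in> univ (stalk X P (p (epf w))) \<Longrightarrow>
      stalk_map sptop spsh a X P \<alpha> w g = stalk_map sptop spsh epf Y Q \<epsilon> w (stalk_map Y Q p X P \<pi> (epf w) g)"
    using ms_comp_hom[OF spsh_sheaf YQ XP e p] by blast
  have "admissible \<Lambda> (stalk X P (a w)) (stalk sptop spsh w) (stalk_map sptop spsh a X P \<alpha> w)" if w: "w \<in> codes" for w
  proof -
    note pm = stalk_map_homom[OF YQ XP p pt(1)[OF w]]
    note param_map = jj_homom[OF pt(1,2,4)[OF w]]
    have value_germ: "homom L (M w) (stalk sptop spsh w) (value_germ w)" using stalk_isom[OF w] by (simp add: isom_def)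
    have st: "model L T0 (stalk sptop spsh w)" using stalk_T0[OF spsh_sheaf] w by simp
    note X0 = stalk_T0[OF XP pm(2)]
    have "admissible \<Lambda> (stalk X P (p (yy w))) (stalk sptop spsh w)
        (\<lambda>g. value_germ w (jj (yy w) (SS w) (stalk_map Y Q p X P \<pi> (yy w) g)))"
      by (rule admissible_comp[OF homom_comp[OF pm(1) param_map] value_germ X0 M_T0[OF w] st pt(7)[OF w]
            admissible_isom[OF isom_sym[OF stalk_isom[OF w]] M_T0[OF w] st]])
    from admissible_cong[OF this homom_comp[OF homom_comp[OF pm(1) param_map] value_germ] X0 st] show ?thesis
      using a(3,4) w assms homom_univ[OF pm(1)] by (simp add: counit_comorphism_def)
  qed
  then show ?thesis unfolding a(1) by simp
qed

end

section \<open>Lifting a morphism to the spectrum\<close>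

locale lifting = coded_spectrum L T0 T \<Lambda> X P Y Q p \<pi> codes yy SS enc
  for L :: "('f, 'r) lang" and T0 T :: "('f, 'r) sequent set" and \<Lambda> :: "('f, 'r) horn_pair set"
    and X :: "'u topology" and P :: "('f, 'r, 'u, 'u) presheaf"
    and Y :: "'u topology" and Q :: "('f, 'r, 'u, 'u) presheaf"
    and p :: "'u \<Rightarrow> 'u" and \<pi> :: "'u set \<Rightarrow> ('u \<Rightarrow> ('u set \<times> 'u) set) \<Rightarrow> 'u"
    and codes :: "'u set" and yy :: "'u \<Rightarrow> 'u" and SS :: "'u \<Rightarrow> ('f, 'r, 'u) gfact set"
    and enc :: "'u set \<Rightarrow> ('u \<Rightarrow> ('f, 'r, 'u) gword set) \<Rightarrow> 'u" +
  fixes \<epsilon> :: "'u set \<Rightarrow> ('u \<Rightarrow> ('u set \<times> 'u) set) \<Rightarrow> 'u"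
    and Z :: "'u topology" and R :: "('f, 'r, 'u, 'u) presheaf"
    and h :: "'u \<Rightarrow> 'u" and \<eta> :: "'u set \<Rightarrow> ('u \<Rightarrow> ('u set \<times> 'u) set) \<Rightarrow> 'u"
  assumes eps: "counit_comorphism \<epsilon>"
    and ZR: "sheaf_of_models L T0 Z R" "\<And>z. z \<in> topspace Z \<Longrightarrow> model L T (stalk Z R z)"
    and h: "(h, \<eta>) \<in> ms_hom L (Z, R) (Y, Q)"
    and ph: "ms_admissible \<Lambda> (Z, R) (X, P) (ms_comp (Z, R) (Y, Q) (X, P) (p, \<pi>) (h, \<eta>))"
begin

sublocale H: ms_map L T0 Z R Y Q h
  using ZR(1) YQ h by (intro ms_mapI) auto

lemma eta: "sheaf_mor L Z (pullback Z h Y Q) R \<eta>"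
  using h by simp

abbreviation RS where "RS z \<equiv> stalk Z R z"

abbreviation Dh where "Dh z \<equiv> local_params Y Q (h z)"

definition param_value :: "'u \<Rightarrow> 'u set \<times> 'u \<Rightarrow> ('u set \<times> 'u) set" where
  "param_value z c = H.sm \<eta> z (param_germ Y Q (h z) c)"

lemma param_value: "param_value z (W, t) = H.sm \<eta> z (germ Y Q (h z) W t)"
  by (simp add: param_value_def param_germ_def)

abbreviation true_facts :: "'u \<Rightarrow> ('f, 'r, 'u) gfact set" where
  "true_facts z \<equiv> Diag (RS z) (Dh z) (param_value z)"

text \<open>The candidate for the lifted point over \<open>h z\<close>.\<close>

definition etale_facts :: "'u \<Rightarrow> ('f, 'r, 'u) gfact set" where
  "etale_facts z = etale (PF (h z)) (true_facts z)"

abbreviation km :: "'u \<Rightarrow> ('f, 'r, 'u) gword set \<Rightarrow> ('u set \<times> 'u) set" where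
  "km z \<equiv> eval_map (RS z) (Dh z) (param_value z)"

lemma RS_T0: "z \<in> topspace Z \<Longrightarrow> model L T0 (RS z)"
  by (rule stalk_T0[OF ZR(1)])

lemma PF_true_facts: "z \<in> topspace Z \<Longrightarrow> PF (h z) \<subseteq> true_facts z"
  using H.sm_homom[OF eta] Q_stalk[OF H.f_top] param_germ_local_params by (intro param_facts_Diag) (auto simp: param_value_def)

lemma etale_facts_true_facts: "z \<in> topspace Z \<Longrightarrow> etale_facts z \<subseteq> true_facts z"
  unfolding etale_facts_def by (rule etale_sub[OF Diag_closed[OF RS_T0] PF_true_facts]) auto

lemma etale_facts_closed: "z \<in> topspace Z \<Longrightarrow> closed (etale_facts z)"
  unfolding etale_facts_def by (rule etale_closed[OF Diag_closed[OF RS_T0] PF_true_facts]) auto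

lemma PF_etale_facts: "PF (h z) \<subseteq> etale_facts z"
  unfolding etale_facts_def by (rule etale_base)

lemma km_homom: "z \<in> topspace Z \<Longrightarrow> homom L (TM (etale_facts z)) (RS z) (km z)"
  by (intro eval_map_homom etale_facts_closed RS_T0 etale_facts_true_facts)

lemma km_admissible: "z \<in> topspace Z \<Longrightarrow> admissible \<Lambda> (TM (etale_facts z)) (RS z) (km z)"
  unfolding etale_facts_def by (intro etale_admissible RS_T0 PF_true_facts)

lemma km_jj: assumes "z \<in> topspace Z" "g \<in> univ (stalk Y Q (h z))" shows "km z (jj (h z) (etale_facts z) g) = H.sm \<eta> z g"
proof -
  obtain W t where W: "openin Y W" "h z \<in> W" "t \<in> univ (sec Q W)" "g = germ Y Q (h z) W t"
    using assms(2) by (rule Q.stalkE)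
  have d: "defd (etale_facts z) (Par (W, t))" using param_defd[OF PF_etale_facts, of "(W, t)" z] W by (simp add: local_params_def)
  show ?thesis
    using eval_map_Par[OF etale_facts_closed RS_T0 etale_facts_true_facts d] assms(1) jj_germ[OF etale_facts_closed PF_etale_facts W(1-3)] W(4) by (simp add: param_value)
qed

text \<open>The axioms of \<open>T\<close> are reflected from the stalk of \<open>R\<close> along
  the admissible \<open>km z\<close>. The condition over \<open>P\<close> follows by cancelling
  \<open>km z\<close> from the stalk map of the composite to \<open>(X, P)\<close>, which is
  admissible by \<open>ph\<close>.\<close>

lemma etale_facts_spec_points: assumes z: "z \<in> topspace Z" shows "(h z, etale_facts z) \<in> spec_points"
proof -
  have params: "params_in (Dh z) (etale_facts z)"
    unfolding params_in_def
  proof (intro allI impI)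
    fix c assume "defd (etale_facts z) (Par c)"
    then have "(eq_fm, [Par c, Par c]) \<in> true_facts z" using etale_facts_true_facts[OF z] by blast
    then show "c \<in> Dh z" unfolding Diag_eq_iff[OF RS_T0[OF z]] by blast
  qed
  have et: "etale_facts z \<subseteq> etale (PF (h z)) (etale_facts z)"
    unfolding etale_facts_def using etale_idem[OF Diag_closed[OF RS_T0[OF z]] PF_true_facts[OF z] subset_refl] by simp
  note TT = TM_model[OF etale_facts_closed[OF z]]
  note hz = H.f_top[OF z]
  have mod: "model L T (TM (etale_facts z))"
    by (rule admissible_reflects_T[OF km_homom[OF z] TT ZR(2)[OF z] km_admissible[OF z]])
  note pm = stalk_map_homom[OF YQ XP p hz]
  note param_map = jj_homom[OF hz etale_facts_closed[OF z] PF_etale_facts]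
  obtain a \<alpha> where a: "ms_comp (Z, R) (Y, Q) (X, P) (p, \<pi>) (h, \<eta>) = (a, \<alpha>)"
    "(a, \<alpha>) \<in> ms_hom L (Z, R) (X, P)"
    "\<And>x. x \<in> topspace Z \<Longrightarrow> a x = p (h x)"
    "\<And>x g. x \<in> topspace Z \<Longrightarrow> g \<in> univ (stalk X P (p (h x))) \<Longrightarrow>
      stalk_map Z R a X P \<alpha> x g = H.sm \<eta> x (stalk_map Y Q p X P \<pi> (h x) g)"
    using ms_comp_hom[OF ZR(1) YQ XP h p] by blast
  have "admissible \<Lambda> (stalk X P (a z)) (RS z) (stalk_map Z R a X P \<alpha> z)" using ph z unfolding a(1) by simp
  then have ad: "admissible \<Lambda> (stalk X P (p (h z))) (RS z) (stalk_map Z R a X P \<alpha> z)" using a(3)[OF z] by simp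
  have eq: "stalk_map Z R a X P \<alpha> z g = km z (jj (h z) (etale_facts z) (stalk_map Y Q p X P \<pi> (h z) g))"
    if "g \<in> univ (stalk X P (p (h z)))" for g
    using a(4)[OF z that] km_jj[OF z homom_univ[OF pm(1) that]] by simp
  note X0 = stalk_T0[OF XP pm(2)]
  note hom = homom_comp[OF homom_comp[OF pm(1) param_map] km_homom[OF z]]
  have hom': "homom L (stalk X P (p (h z))) (RS z) (stalk_map Z R a X P \<alpha> z)"
    using homom_cong[OF hom] X0 eq by (simp add: model_def)
  have "admissible \<Lambda> (stalk X P (p (h z))) (RS z) (\<lambda>g. km z (jj (h z) (etale_facts z) (stalk_map Y Q p X P \<pi> (h z) g)))"
    by (rule admissible_cong[OF ad hom' X0 RS_T0[OF z] eq])
  then have "admissible \<Lambda> (stalk X P (p (h z))) (TM (etale_facts z)) (\<lambda>g. jj (h z) (etale_facts z) (stalk_map Y Q p X P \<pi> (h z) g))"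
    by (rule admissible_cancel[OF homom_comp[OF pm(1) param_map] km_homom[OF z] X0 TT RS_T0[OF z]])
  then show ?thesis
    unfolding spec_points_def using hz etale_facts_closed[OF z] params PF_etale_facts et mod by simp
qed

subsection \<open>Facts hold on open sets\<close>

lemma nbhd_list:
  assumes "z \<in> topspace Z" "list_all2 (\<lambda>u b. \<exists>N r. openin Z N \<and> z \<in> N \<and> r \<in> univ (sec R N) \<and> b = germ Z R z N r \<and>
      (\<forall>z'\<in>N. E z' u (germ Z R z' N r))) us bs"
  shows "\<exists>N rs. openin Z N \<and> z \<in> N \<and> rs \<in> tuples (length us) (univ (sec R N)) \<and> bs = map (germ Z R z N) rs \<and>
      (\<forall>z'\<in>N. list_all2 (E z') us (map (germ Z R z' N) rs))"
  using assms(2)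
proof (induction us bs rule: list_all2_induct)
  case Nil
  then show ?case using assms(1) by (intro exI[of _ "topspace Z"] exI[of _ "[]"]) (auto simp: tuples_def)
next
  case (Cons u us b bs)
  from Cons(1) obtain N r where N: "openin Z N" "z \<in> N" "r \<in> univ (sec R N)" "b = germ Z R z N r"
      "\<forall>z'\<in>N. E z' u (germ Z R z' N r)" by blast
  from Cons(3) obtain N' rs where N': "openin Z N'" "z \<in> N'" "rs \<in> tuples (length us) (univ (sec R N'))"
    "bs = map (germ Z R z N') rs" "\<forall>z'\<in>N'. list_all2 (E z') us (map (germ Z R z' N') rs)" by blast
  let ?O = "N \<inter> N'"
  have O: "openin Z ?O" "?O \<subseteq> N" "?O \<subseteq> N'" using N N' by auto
  have g: "map (germ Z R z' ?O) (res R N ?O r # map (res R N' ?O) rs) = germ Z R z' N r # map (germ Z R z' N') rs"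
    if "z' \<in> ?O" for z'
    using H.dom.map_germ_res[OF N'(1) O(1,3) that N'(3)] H.dom.germ_res[OF N(1) O(1,2) that N(3)] by simp
  show ?case
    apply (rule exI[of _ ?O], rule exI[of _ "res R N ?O r # map (res R N' ?O) rs"])
    using O N N' g H.dom.res_univ[OF N(1) O(1,2) N(3)] H.dom.res_tuples[OF N'(1) O(1,3) N'(3)]
    by (simp del: map_map list.map(2))
qed

text \<open>Near \<open>z\<close> the value of a word is given by a single section of
  \<open>R\<close>. A parameter is a section of \<open>Q\<close>, which \<eta> carries to a section
  of \<open>R\<close>; a witness in the stalk is the germ of a section.\<close>

lemma ev_local:
  assumes z: "z \<in> topspace Z" and e: "ev (RS z) (Dh z) (param_value z) u b"
  shows "\<exists>N r. openin Z N \<and> z \<in> N \<and> r \<in> univ (sec R N) \<and> b = germ Z R z N r \<and>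
    (\<forall>z'\<in>N. ev (RS z') (Dh z') (param_value z') u (germ Z R z' N r))"
  using e
proof (induction rule: ev.induct)
  case (ev_Par c)
  obtain W t where c: "c = (W, t)" by force
  then have W: "openin Y W" "h z \<in> W" "t \<in> univ (sec Q W)" using ev_Par by (auto simp: local_params_def)
  let ?N = "{z \<in> topspace Z. h z \<in> W}"
  obtain r where r: "r \<in> univ (sec R ?N)"
    "\<forall>z\<in>topspace Z. h z \<in> W \<longrightarrow> H.sm \<eta> z (germ Y Q (h z) W t) = germ Z R z ?N r"
    using H.sm_germ[OF eta W(1,3)] .
  have N: "openin Z ?N" using H.openin_preimage[OF W(1)] .
  have "ev (RS z') (Dh z') (param_value z') (Par c) (germ Z R z' ?N r)" if "z' \<in> ?N" for z'
  proof -
    have "param_value z' c = germ Z R z' ?N r" using r(2) that unfolding c by (simp add: param_value)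
    moreover have "c \<in> Dh z'" using W that by (simp add: c local_params_def)
    ultimately show ?thesis
      using ev.ev_Par[of c "Dh z'" "param_value z'" "RS z'"] H.dom.germ_in_stalk[OF N that r(1)] by simp
  qed
  moreover have "param_value z c = germ Z R z ?N r" using r(2) z W unfolding c by (simp add: param_value)
  moreover have "z \<in> ?N" using z W by simp
  ultimately show ?case using N r(1) by blast
next
  case (ev_Wit us \<chi> bs b)
  have "list_all2 (\<lambda>u b. \<exists>N r. openin Z N \<and> z \<in> N \<and> r \<in> univ (sec R N) \<and> b = germ Z R z N r \<and>
      (\<forall>z'\<in>N. ev (RS z') (Dh z') (param_value z') u (germ Z R z' N r))) us bs"
    using ev_Wit.IH by (rule list_all2_mono) blast
  from nbhd_list[OF z this] obtain N rs where N: "openin Z N" "z \<in> N" "rs \<in> tuples (length us) (univ (sec R N))"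
    "bs = map (germ Z R z N) rs" "\<forall>z'\<in>N. list_all2 (ev (RS z') (Dh z') (param_value z')) us (map (germ Z R z' N) rs)"
    by blast
  obtain V t where V: "openin Z V" "z \<in> V" "t \<in> univ (sec R V)" "b = germ Z R z V t"
    using ev_Wit.hyps(2) by (rule H.dom.stalkE)
  let ?O = "N \<inter> V"
  have O: "openin Z ?O" "?O \<subseteq> N" "?O \<subseteq> V" "z \<in> ?O" using N V by auto
  let ?ts = "res R V ?O t # map (res R N ?O) rs"
  have ts: "?ts \<in> tuples (Suc (length us)) (univ (sec R ?O))"
    using H.dom.res_univ[OF V(1) O(1,3) V(3)] H.dom.res_tuples[OF N(1) O(1,2) N(3)] by simp
  have g: "map (germ Z R z' ?O) ?ts = germ Z R z' V t # map (germ Z R z' N) rs" if "z' \<in> ?O" for z'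
    using H.dom.map_germ_res[OF N(1) O(1,2) that N(3)] H.dom.germ_res[OF V(1) O(1,3) that V(3)] by simp
  note wf = K_wf[OF K_Exi[OF ev_Wit.hyps(1)]]
  have "sat (RS z) (map (germ Z R z ?O) ?ts) \<chi>"
    using ev_Wit.hyps(3) unfolding g[OF O(4)] using N(4) V(4) by simp
  \<comment> \<open>That this germ is a witness spreads to a neighbourhood; at each nearby point the
    section therefore gives the value of the same word.\<close>
  then obtain W where W: "openin Z W" "z \<in> W" "W \<subseteq> ?O" "sat (sec R W) (map (res R ?O W) ?ts) \<chi>"
    using H.dom.stalk_sat[OF z wf O(1,4) ts] by blast
  have WV: "W \<subseteq> V" using W(3) by blast
  have "ev (RS z') (Dh z') (param_value z') (Wit \<chi> us) (germ Z R z' V t)" if z': "z' \<in> W" for z'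
  proof -
    have zO: "z' \<in> ?O" using z' W(3) by blast
    have top: "z' \<in> topspace Z" using z' openin_subset[OF W(1)] by blast
    have "sat (RS z') (map (germ Z R z' ?O) ?ts) \<chi>"
      using H.dom.stalk_sat[OF top wf O(1) zO ts] W z' by blast
    then have "sat (RS z') (germ Z R z' V t # map (germ Z R z' N) rs) \<chi>" unfolding g[OF zO] .
    moreover have "list_all2 (ev (RS z') (Dh z') (param_value z')) us (map (germ Z R z' N) rs)" using N(5) zO by blast
    moreover have "germ Z R z' V t \<in> univ (RS z')" using H.dom.germ_in_stalk[OF V(1) _ V(3)] zO by blast
    ultimately show ?thesis using ev_Wit.hyps(1) by (intro ev.ev_Wit)
  qed
  moreover have "germ Z R z' W (res R V W t) = germ Z R z' V t" if "z' \<in> W" for z'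
    using H.dom.germ_res[OF V(1) W(1) WV that V(3)] .
  ultimately show ?case
    using W(1,2) H.dom.res_univ[OF V(1) W(1) WV V(3)] V(4) by (intro exI[of _ W] exI[of _ "res R V W t"]) simp
qed

lemma true_facts_open:
  assumes z: "z \<in> topspace Z" and f: "f \<in> true_facts z"
  shows "\<exists>N. openin Z N \<and> z \<in> N \<and> (\<forall>z'\<in>N. f \<in> true_facts z')"
proof -
  obtain \<theta> us where fu: "f = (\<theta>, us)" by force
  then obtain bs where b: "K (length us) \<theta>" "list_all2 (ev (RS z) (Dh z) (param_value z)) us bs" "sat (RS z) bs \<theta>"
    using f by (auto elim: DiagE)
  have "list_all2 (\<lambda>u b. \<exists>N r. openin Z N \<and> z \<in> N \<and> r \<in> univ (sec R N) \<and> b = germ Z R z N r \<and>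
      (\<forall>z'\<in>N. ev (RS z') (Dh z') (param_value z') u (germ Z R z' N r))) us bs"
    using b(2) by (rule list_all2_mono) (rule ev_local[OF z])
  from nbhd_list[OF z this] obtain N rs where N: "openin Z N" "z \<in> N" "rs \<in> tuples (length us) (univ (sec R N))"
    "bs = map (germ Z R z N) rs" "\<forall>z'\<in>N. list_all2 (ev (RS z') (Dh z') (param_value z')) us (map (germ Z R z' N) rs)"
    by blast
  obtain W where W: "openin Z W" "z \<in> W" "W \<subseteq> N" "sat (sec R W) (map (res R N W) rs) \<theta>"
    using H.dom.stalk_sat[OF z K_wf[OF b(1)] N(1-3)] b(3) N(4) by blast
  have "f \<in> true_facts z'" if z': "z' \<in> W" for z'
  proof -
    have zN: "z' \<in> N" using z' W(3) by blast
    have top: "z' \<in> topspace Z" using z' openin_subset[OF W(1)] by blast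
    have "sat (RS z') (map (germ Z R z' N) rs) \<theta>"
      using H.dom.stalk_sat[OF top K_wf[OF b(1)] N(1) zN N(3)] W z' by blast
    then show ?thesis unfolding fu using N(5) zN b(1) by (intro DiagI) auto
  qed
  then show ?thesis using W by blast
qed

lemma PF_open:
  assumes z: "z \<in> topspace Z" and f: "f \<in> PF (h z)"
  shows "\<exists>N. openin Z N \<and> z \<in> N \<and> (\<forall>z'\<in>N. f \<in> PF (h z'))"
proof -
  obtain \<theta> cs where c: "f = (\<theta>, map Par cs)" "set cs \<subseteq> Dh z" "K (length cs) \<theta>"
    "sat (stalk Y Q (h z)) (map (param_germ Y Q (h z)) cs) \<theta>"
    using f by (auto simp: param_facts_def)
  \<comment> \<open>The finitely many parameters are sections, so they can be restricted to one
    neighbourhood and read as germs at all of its points.\<close>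
  have "\<exists>W ts. openin Y W \<and> h z \<in> W \<and> ts \<in> tuples (length cs) (univ (sec Q W)) \<and>
      (\<forall>y\<in>W. set cs \<subseteq> local_params Y Q y \<and> map (param_germ Y Q y) cs = map (germ Y Q y W) ts)"
    using c(2)
  proof (induction cs)
    case Nil
    then show ?case using H.f_top[OF z] by (intro exI[of _ "topspace Y"] exI[of _ "[]"]) auto
  next
    case (Cons a cs)
    then obtain W ts where W: "openin Y W" "h z \<in> W" "ts \<in> tuples (length cs) (univ (sec Q W))"
      "\<forall>y\<in>W. set cs \<subseteq> local_params Y Q y \<and> map (param_germ Y Q y) cs = map (germ Y Q y W) ts" by auto
    obtain U q where a: "a = (U, q)" by force
    have U: "openin Y U" "h z \<in> U" "q \<in> univ (sec Q U)" using Cons.prems a by (auto simp: local_params_def)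
    let ?O = "U \<inter> W"
    have O: "openin Y ?O" "?O \<subseteq> U" "?O \<subseteq> W" using U W by auto
    let ?ts = "res Q U ?O q # map (res Q W ?O) ts"
    have "set (a # cs) \<subseteq> local_params Y Q y \<and> map (param_germ Y Q y) (a # cs) = map (germ Y Q y ?O) ?ts" if y: "y \<in> ?O" for y
    proof -
      have "map (germ Y Q y ?O) (map (res Q W ?O) ts) = map (param_germ Y Q y) cs" "set cs \<subseteq> local_params Y Q y"
        using Q.map_germ_res[OF W(1) O(1,3) y W(3)] W(4) y by auto
      moreover have "germ Y Q y ?O (res Q U ?O q) = param_germ Y Q y a" "a \<in> local_params Y Q y"
        using Q.germ_res[OF U(1) O(1,2) y U(3)] U y by (auto simp: a param_germ_def local_params_def)
      ultimately show ?thesis by (simp del: map_map)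
    qed
    moreover have "?ts \<in> tuples (length (a # cs)) (univ (sec Q ?O))"
      using Q.res_univ[OF U(1) O(1,2) U(3)] Q.res_tuples[OF W(1) O(1,3) W(3)] by simp
    ultimately show ?case using O U W by (intro exI[of _ ?O] exI[of _ ?ts]) simp
  qed
  then obtain W ts where W: "openin Y W" "h z \<in> W" "ts \<in> tuples (length cs) (univ (sec Q W))"
    "\<forall>y\<in>W. set cs \<subseteq> local_params Y Q y \<and> map (param_germ Y Q y) cs = map (germ Y Q y W) ts" by blast
  note wf = K_wf[OF c(3)]
  have "sat (stalk Y Q (h z)) (map (germ Y Q (h z) W) ts) \<theta>" using c(4) W(2,4) by simp
  then obtain V where V: "openin Y V" "h z \<in> V" "V \<subseteq> W" "sat (sec Q V) (map (res Q W V) ts) \<theta>"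
    using Q.stalk_sat[OF H.f_top[OF z] wf W(1-3)] by blast
  have "f \<in> PF y" if y: "y \<in> V" for y
  proof -
    have yW: "y \<in> W" and top: "y \<in> topspace Y" using y V(3) openin_subset[OF V(1)] by auto
    have "sat (stalk Y Q y) (map (germ Y Q y W) ts) \<theta>" using Q.stalk_sat[OF top wf W(1) yW W(3)] V y by blast
    then show ?thesis unfolding c(1) using W(4) yW c(3) by (intro param_factsI) auto
  qed
  then show ?thesis using H.openin_preimage[OF V(1)] z V(2)
    by (intro exI[of _ "{z \<in> topspace Z. h z \<in> V}"]) auto
qed

text \<open>Derivations are finite, so a fact in the etale part at \<open>z\<close> persists near \<open>z\<close>.\<close>

lemma etale_facts_open:
  assumes z: "z \<in> topspace Z" and f: "f \<in> etale_facts z"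
  shows "\<exists>N. openin Z N \<and> z \<in> N \<and> (\<forall>z'\<in>N. f \<in> etale_facts z')"
  using f[unfolded etale_facts_def]
proof induction
  case (et_rule ps c)
  \<comment> \<open>The neighbourhoods of the premises are intersected, which
    \<open>rule_finite\<close> makes a finite intersection.\<close>
  have "\<exists>N. openin Z N \<and> z \<in> N \<and> (\<forall>z'\<in>N. ps' \<subseteq> etale_facts z')" if "finite ps'" "ps' \<subseteq> ps" for ps'
    using that
  proof (induction ps')
    case empty
    then show ?case using z by (intro exI[of _ "topspace Z"]) auto
  next
    case (insert q ps')
    then obtain N where N: "openin Z N" "z \<in> N" "\<forall>z'\<in>N. ps' \<subseteq> etale_facts z'" by auto
    obtain N' where N': "openin Z N'" "z \<in> N'" "\<forall>z'\<in>N'. q \<in> etale_facts z'" using et_rule.IH[of q] insert.prems by auto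
    show ?case using N N' by (intro exI[of _ "N \<inter> N'"]) auto
  qed
  from this[OF rule_finite[OF et_rule.hyps(1)] subset_refl] obtain N where
    N: "openin Z N" "z \<in> N" "\<forall>z'\<in>N. ps \<subseteq> etale_facts z'" by blast
  then have "\<forall>z'\<in>N. c \<in> etale_facts z'" unfolding etale_facts_def using etale.et_rule[OF et_rule.hyps(1)] by blast
  then show ?case using N by blast
next
  case (et_base f)
  from PF_open[OF z et_base] show ?case using PF_etale_facts by blast
next
  case (et_pair us \<phi> m \<psi>)
  from et_pair.IH obtain N where N: "openin Z N" "z \<in> N" "\<forall>z'\<in>N. (\<phi>, us) \<in> etale_facts z'" by blast
  from true_facts_open[OF z et_pair.hyps(3)] obtain N' where
    N': "openin Z N'" "z \<in> N'" "\<forall>z'\<in>N'. ((Exi ^^ m) \<psi>, us) \<in> true_facts z'" by blast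
  have "\<forall>z'\<in>N \<inter> N'. ((Exi ^^ m) \<psi>, us) \<in> etale_facts z'"
    using N(3) N'(3) unfolding etale_facts_def by (blast intro: etale.et_pair[OF et_pair.hyps(1)])
  then show ?case using N N' by (intro exI[of _ "N \<inter> N'"]) auto
qed

subsection \<open>Existence and uniqueness of the factorization\<close>

definition lift_point :: "'u \<Rightarrow> 'u" where
  "lift_point = (\<lambda>z\<in>topspace Z. THE w. w \<in> codes \<and> yy w = h z \<and> SS w = etale_facts z)"

lemma codes_inj: "w \<in> codes \<Longrightarrow> w' \<in> codes \<Longrightarrow> yy w = yy w' \<Longrightarrow> SS w = SS w' \<Longrightarrow> w = w'"
  using code by (auto simp: bij_betw_def inj_on_def)

lemma lift_point: assumes "z \<in> topspace Z" shows "lift_point z \<in> codes" "yy (lift_point z) = h z" "SS (lift_point z) = etale_facts z"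
proof -
  have "(h z, etale_facts z) \<in> (\<lambda>w. (yy w, SS w)) ` codes" using code etale_facts_spec_points[OF assms] by (simp add: bij_betw_def)
  then have "\<exists>!w. w \<in> codes \<and> yy w = h z \<and> SS w = etale_facts z" using codes_inj by auto
  from theI'[OF this] show "lift_point z \<in> codes" "yy (lift_point z) = h z" "SS (lift_point z) = etale_facts z" using assms by (simp_all add: lift_point_def)
qed

text \<open>A basic open set prescribes an open part of \<open>Y\<close> and finitely many facts.
  The first pulls back along \<open>h\<close>, and each fact persists by
  \<open>etale_facts_open\<close>.\<close>

lemma lift_point_cont: "continuous_map Z sptop lift_point"
  unfolding continuous_map_def
proof (intro HOL.conjI allI impI)
  show "lift_point \<in> topspace Z \<rightarrow> topspace sptop" using lift_point(1) by simp
  fix W assume W: "openin sptop W"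
  have "\<exists>N. openin Z N \<and> z \<in> N \<and> N \<subseteq> {z \<in> topspace Z. lift_point z \<in> W}" if z: "z \<in> topspace Z" "lift_point z \<in> W" for z
  proof -
    obtain V F where V: "openin Y V" "finite F" "lift_point z \<in> basic_open V F" "basic_open V F \<subseteq> W" using W z(2) unfolding openin_sptop by blast
    have hz: "h z \<in> V" "F \<subseteq> etale_facts z" using V(3) lift_point[OF z(1)] by (auto simp: basic_open_def)
    have "\<exists>N. openin Z N \<and> z \<in> N \<and> (\<forall>z'\<in>N. F' \<subseteq> etale_facts z')" if "finite F'" "F' \<subseteq> F" for F'
      using that
    proof (induction F')
      case empty
      then show ?case using z by (intro exI[of _ "topspace Z"]) auto
    next
      case (insert q F')
      then obtain N where N: "openin Z N" "z \<in> N" "\<forall>z'\<in>N. F' \<subseteq> etale_facts z'" by auto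
      have "q \<in> etale_facts z" using insert.prems hz(2) by blast
      from etale_facts_open[OF z(1) this] obtain N' where N': "openin Z N'" "z \<in> N'" "\<forall>z'\<in>N'. q \<in> etale_facts z'" by blast
      show ?case using N N' by (intro exI[of _ "N \<inter> N'"]) auto
    qed
    from this[OF V(2) subset_refl] obtain N where N: "openin Z N" "z \<in> N" "\<forall>z'\<in>N. F \<subseteq> etale_facts z'" by blast
    let ?N = "N \<inter> {z \<in> topspace Z. h z \<in> V}"
    have "openin Z ?N" "z \<in> ?N" using N H.openin_preimage[OF V(1)] z hz by auto
    moreover have "lift_point z' \<in> W" if "z' \<in> ?N" for z'
    proof (rule subsetD[OF V(4)])
      show "lift_point z' \<in> basic_open V F" using lift_point[of z'] that N(3) by (simp add: basic_open_def)
    qed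
    ultimately show ?thesis by (intro exI[of _ ?N]) auto
  qed
  then show "openin Z {z \<in> topspace Z. lift_point z \<in> W}" by (subst openin_subopen) auto
qed

lemma sm_eps: assumes "w \<in> codes" "g \<in> univ (stalk Y Q (yy w))"
  shows "stalk_map sptop spsh epf Y Q \<epsilon> w g = value_germ w (jj (yy w) (SS w) g)"
  using eps assms by (simp add: counit_comorphism_def)

lemma eps_hom: "(epf, \<epsilon>) \<in> ms_hom L (sptop, spsh) (Y, Q)"
  using eps by (simp add: counit_comorphism_def)

lemma lift_exists:
  "\<exists>\<kappa>. (lift_point, \<kappa>) \<in> ms_hom L (Z, R) (sptop, spsh) \<and> ms_admissible \<Lambda> (Z, R) (sptop, spsh) (lift_point, \<kappa>) \<and>
    ms_comp (Z, R) (sptop, spsh) (Y, Q) (epf, \<epsilon>) (lift_point, \<kappa>) = (h, \<eta>)"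
proof -
  interpret HM: ms_map L T0 Z R sptop spsh lift_point by (rule ms_mapI[OF ZR(1) spsh_sheaf lift_point_cont])
  let ?k = "\<lambda>z g. km z (stalk_value (lift_point z) g)"
  have vmh: "homom L (stalk sptop spsh (lift_point z)) (TM (etale_facts z)) (stalk_value (lift_point z))" if z: "z \<in> topspace Z" for z
    using stalk_isom[OF lift_point(1)[OF z]] lift_point(3)[OF z] by (simp add: isom_def)
  have k: "homom L (stalk sptop spsh (lift_point z)) (RS z) (?k z)" if z: "z \<in> topspace Z" for z
    using homom_comp[OF vmh[OF z] km_homom[OF z]] .
  have loc: "\<exists>V r. openin Z V \<and> z \<in> V \<and> lift_point ` V \<subseteq> W \<and> r \<in> univ (sec R V) \<and>
        (\<forall>z'\<in>V. ?k z' (germ sptop spsh (lift_point z') W t) = germ Z R z' V r)"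
    if a: "z \<in> topspace Z" "openin sptop W" "lift_point z \<in> W" "t \<in> univ (sec spsh W)" for z W t
  proof -
    \<comment> \<open>The section \<open>t\<close> is named by a word \<open>u\<close> near the
      lifted point. \<open>ev_local\<close> provides a section of \<open>R\<close> whose germs are
      the values of \<open>u\<close>, and \<open>ev_det\<close> identifies these germs with the
      images of \<open>t\<close> under \<open>?k\<close>.\<close>
    obtain N u where N: "openin sptop N" "lift_point z \<in> N" "N \<subseteq> W" "\<forall>w'\<in>N. defd (SS w') u \<and> dec W t w' = cls (SS w') u"
      using SecsE[OF dec_Secs[OF a(4)] a(3)] .
    have d: "defd (etale_facts z') u" if "z' \<in> topspace Z" "lift_point z' \<in> N" for z' using N(4) lift_point(3)[OF that(1)] that(2) by metis
    have "ev (RS z) (Dh z) (param_value z) u (km z (cls (etale_facts z) u))"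
      using eval_map_ev[OF etale_facts_closed RS_T0 etale_facts_true_facts d[OF a(1) N(2)]] a(1) by simp
    from ev_local[OF a(1) this] obtain V r where V: "openin Z V" "z \<in> V" "r \<in> univ (sec R V)"
      "\<forall>z'\<in>V. ev (RS z') (Dh z') (param_value z') u (germ Z R z' V r)" by blast
    let ?V = "V \<inter> {z \<in> topspace Z. lift_point z \<in> N}"
    have oV: "openin Z ?V" "z \<in> ?V" "?V \<subseteq> V" using V HM.openin_preimage[OF N(1)] a(1) N(2) by auto
    have "?k z' (germ sptop spsh (lift_point z') W t) = germ Z R z' ?V (res R V ?V r)" if z': "z' \<in> ?V" for z'
    proof -
      have zz: "z' \<in> topspace Z" "lift_point z' \<in> N" "z' \<in> V" using z' by auto
      have "stalk_value (lift_point z') (germ sptop spsh (lift_point z') W t) = cls (etale_facts z') u"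
        using stalk_value_germ[OF a(2) subsetD[OF N(3) zz(2)] a(4)] N(4) zz(2) lift_point(3)[OF zz(1)] by metis
      moreover have "ev (RS z') (Dh z') (param_value z') u (km z' (cls (etale_facts z') u))"
        using eval_map_ev[OF etale_facts_closed RS_T0 etale_facts_true_facts d[OF zz(1,2)]] zz(1) by simp
      ultimately have "?k z' (germ sptop spsh (lift_point z') W t) = germ Z R z' V r"
        using ev_det[OF RS_T0[OF zz(1)]] V(4) zz(3) by metis
      then show ?thesis using H.dom.germ_res[OF V(1) oV(1,3) z' V(3)] by simp
    qed
    then show ?thesis using oV N(3) H.dom.res_univ[OF V(1) oV(1,3) V(3)]
      by (intro exI[of _ ?V] exI[of _ "res R V ?V r"]) auto
  qed
  let ?\<kappa> = "HM.mk_mor ?k"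
  have mk: "sheaf_mor L Z (pullback Z lift_point sptop spsh) R ?\<kappa>"
    "\<And>z g. z \<in> topspace Z \<Longrightarrow> g \<in> univ (stalk sptop spsh (lift_point z)) \<Longrightarrow> HM.sm ?\<kappa> z g = ?k z g"
    using HM.mk_mor[OF k loc] by simp_all
  have hom: "(lift_point, ?\<kappa>) \<in> ms_hom L (Z, R) (sptop, spsh)" using mk(1) lift_point_cont by (simp add: lift_point_def)
  have ad: "ms_admissible \<Lambda> (Z, R) (sptop, spsh) (lift_point, ?\<kappa>)"
  proof (simp, intro ballI)
    fix z assume z: "z \<in> topspace Z"
    have st: "model L T0 (stalk sptop spsh (lift_point z))" using stalk_T0[OF spsh_sheaf] lift_point(1)[OF z] by simp
    have i: "isom L (stalk sptop spsh (lift_point z)) (TM (etale_facts z)) (stalk_value (lift_point z)) (value_germ (lift_point z))"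
      using stalk_isom[OF lift_point(1)[OF z]] lift_point(3)[OF z] by simp
    note TT = TM_model[OF etale_facts_closed[OF z]]
    have "admissible \<Lambda> (stalk sptop spsh (lift_point z)) (RS z) (?k z)"
      by (rule admissible_comp[OF vmh[OF z] km_homom[OF z] st TT RS_T0[OF z] admissible_isom[OF i st TT] km_admissible[OF z]])
    from this k[OF z] st RS_T0[OF z] mk(2)[OF z, symmetric]
    show "admissible \<Lambda> (stalk sptop spsh (lift_point z)) (RS z) (stalk_map Z R lift_point sptop spsh ?\<kappa> z)"
      by (rule admissible_cong)
  qed
  obtain a \<alpha> where a: "ms_comp (Z, R) (sptop, spsh) (Y, Q) (epf, \<epsilon>) (lift_point, ?\<kappa>) = (a, \<alpha>)"
    "(a, \<alpha>) \<in> ms_hom L (Z, R) (Y, Q)"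
    "\<And>x. x \<in> topspace Z \<Longrightarrow> a x = epf (lift_point x)"
    "\<And>x g. x \<in> topspace Z \<Longrightarrow> g \<in> univ (stalk Y Q (epf (lift_point x))) \<Longrightarrow>
      stalk_map Z R a Y Q \<alpha> x g = HM.sm ?\<kappa> x (stalk_map sptop spsh epf Y Q \<epsilon> (lift_point x) g)"
    using ms_comp_hom[OF ZR(1) spsh_sheaf YQ hom eps_hom] by blast
  have "(a, \<alpha>) = (h, \<eta>)"
  proof (rule ms_hom_eqI[OF ZR(1) YQ a(2) h])
    fix z assume z: "z \<in> topspace Z"
    show az: "a z = h z" using a(3)[OF z] lift_point[OF z] by simp
    fix g assume "g \<in> univ (stalk Y Q (a z))"
    then have g: "g \<in> univ (stalk Y Q (h z))" "g \<in> univ (stalk Y Q (yy (lift_point z)))" "g \<in> univ (stalk Y Q (epf (lift_point z)))"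
      using az lift_point[OF z] by simp_all
    have e: "stalk_map sptop spsh epf Y Q \<epsilon> (lift_point z) g = value_germ (lift_point z) (jj (h z) (etale_facts z) g)"
      using sm_eps[OF lift_point(1)[OF z] g(2)] lift_point[OF z] by simp
    have j: "jj (h z) (etale_facts z) g \<in> univ (M (lift_point z))"
      using homom_univ[OF jj_homom[OF H.f_top[OF z] etale_facts_closed[OF z] PF_etale_facts] g(1)] lift_point(3)[OF z] by simp
    have gs: "value_germ (lift_point z) (jj (h z) (etale_facts z) g) \<in> univ (stalk sptop spsh (lift_point z))"
      "stalk_value (lift_point z) (value_germ (lift_point z) (jj (h z) (etale_facts z) g)) = jj (h z) (etale_facts z) g"
      using stalk_isom[OF lift_point(1)[OF z]] j by (auto simp: isom_def intro: homom_univ)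
    show "stalk_map Z R a Y Q \<alpha> z g = H.sm \<eta> z g"
      using a(4)[OF z g(3)] e mk(2)[OF z gs(1)] gs(2) km_jj[OF z g(1)] by simp
  qed
  then show ?thesis using hom ad a(1) by auto
qed

text \<open>At \<open>z\<close> the stalk map of \<kappa> is an admissible homomorphism out of an
  etale set of facts. \<open>etale_unique\<close> forces that set, hence the point
  \<open>k z\<close>; \<open>TM_homom_unique\<close> then forces the stalk map.\<close>

lemma lift_unique:
  assumes k: "(k, \<kappa>) \<in> ms_hom L (Z, R) (sptop, spsh)" "ms_admissible \<Lambda> (Z, R) (sptop, spsh) (k, \<kappa>)"
      "ms_comp (Z, R) (sptop, spsh) (Y, Q) (epf, \<epsilon>) (k, \<kappa>) = (h, \<eta>)"
    and z: "z \<in> topspace Z"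
  shows "k z = lift_point z"
    "g \<in> univ (stalk sptop spsh (k z)) \<Longrightarrow> stalk_map Z R k sptop spsh \<kappa> z g = km z (stalk_value (lift_point z) g)"
proof -
  obtain a \<alpha> where a: "ms_comp (Z, R) (sptop, spsh) (Y, Q) (epf, \<epsilon>) (k, \<kappa>) = (a, \<alpha>)"
    "(a, \<alpha>) \<in> ms_hom L (Z, R) (Y, Q)"
    "\<And>x. x \<in> topspace Z \<Longrightarrow> a x = epf (k x)"
    "\<And>x g. x \<in> topspace Z \<Longrightarrow> g \<in> univ (stalk Y Q (epf (k x))) \<Longrightarrow>
      stalk_map Z R a Y Q \<alpha> x g = stalk_map Z R k sptop spsh \<kappa> x (stalk_map sptop spsh epf Y Q \<epsilon> (k x) g)"
    using ms_comp_hom[OF ZR(1) spsh_sheaf YQ k(1) eps_hom] by blast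
  have ah: "a = h" "\<alpha> = \<eta>" using a(1) k(3) by (simp_all del: ms_comp.simps)
  note km' = stalk_map_homom[OF ZR(1) spsh_sheaf k(1) z]
  let ?sm = "stalk_map Z R k sptop spsh \<kappa> z"
  have kz: "k z \<in> codes" using km'(2) by simp
  have y: "yy (k z) = h z" using a(3)[OF z] ah kz by simp
  note pk = pt[OF kz, unfolded y]
  have st: "model L T0 (stalk sptop spsh (k z))" using stalk_T0[OF spsh_sheaf km'(2)] .
  note i = stalk_isom[OF kz]
  have gmh: "homom L (M (k z)) (stalk sptop spsh (k z)) (value_germ (k z))" using i by (simp add: isom_def)
  let ?f = "\<lambda>x. ?sm (value_germ (k z) x)"
  have fh: "homom L (M (k z)) (RS z) ?f" by (rule homom_comp[OF gmh km'(1)])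
  have fa: "admissible \<Lambda> (M (k z)) (RS z) ?f"
    using k(2) z by (intro admissible_comp[OF gmh km'(1) M_T0[OF kz] st RS_T0[OF z] admissible_isom[OF isom_sym[OF i] M_T0[OF kz] st]]) auto
  \<comment> \<open>Parameters are images of germs of \<open>Q\<close> under the counit, so the
    given composite with the counit fixes their values.\<close>
  have fp: "?f (cpar (SS (k z)) c) = param_value z c" if d: "defd (SS (k z)) (Par c)" for c
  proof -
    obtain W t where c: "c = (W, t)" by force
    have "c \<in> Dh z" using pk(3) d unfolding params_in_def by blast
    then have W: "openin Y W" "h z \<in> W" "t \<in> univ (sec Q W)" by (auto simp: c local_params_def)
    let ?g = "germ Y Q (h z) W t"
    have g: "?g \<in> univ (stalk Y Q (h z))" using Q.germ_in_stalk[OF W] .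
    have "?f (cpar (SS (k z)) c) = ?sm (value_germ (k z) (jj (h z) (SS (k z)) ?g))"
      unfolding c using jj_germ[OF pk(2,4) W] by simp
    also have "\<dots> = ?sm (stalk_map sptop spsh epf Y Q \<epsilon> (k z) ?g)" using sm_eps[OF kz] g y by simp
    also have "\<dots> = H.sm \<eta> z ?g" using a(4)[OF z, of ?g] g y kz ah by simp
    finally show ?thesis by (simp add: c param_value)
  qed
  have S: "SS (k z) = etale_facts z"
    unfolding etale_facts_def by (rule etale_unique[OF pk(2,3,4,5) RS_T0[OF z] fh fa fp])
  show eq: "k z = lift_point z" by (rule codes_inj) (use lift_point[OF z] kz y S in auto)
  assume g: "g \<in> univ (stalk sptop spsh (k z))"
  have x: "stalk_value (k z) g \<in> univ (M (k z))" "value_germ (k z) (stalk_value (k z) g) = g"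
    using i g by (auto simp: isom_def intro: homom_univ)
  have "?f (stalk_value (k z) g) = km z (stalk_value (k z) g)"
  proof (rule TM_homom_unique[OF pk(2,3) RS_T0[OF z] fh _ _ x(1)])
    show "homom L (M (k z)) (RS z) (km z)" using km_homom[OF z] S by simp
    show "?f (cpar (SS (k z)) c) = km z (cpar (SS (k z)) c)" if "defd (SS (k z)) (Par c)" for c
      using fp[OF that] eval_map_Par[OF etale_facts_closed[OF z] RS_T0[OF z] etale_facts_true_facts[OF z]] that S by simp
  qed
  then show "?sm g = km z (stalk_value (lift_point z) g)" using x(2) eq by simp
qed

lemma universal:
  "\<exists>!\<kappa>. \<kappa> \<in> ms_hom L (Z, R) (sptop, spsh) \<and> ms_admissible \<Lambda> (Z, R) (sptop, spsh) \<kappa> \<and>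
    ms_comp (Z, R) (sptop, spsh) (Y, Q) (epf, \<epsilon>) \<kappa> = (h, \<eta>)"
proof -
  obtain \<kappa> where \<kappa>: "(lift_point, \<kappa>) \<in> ms_hom L (Z, R) (sptop, spsh)" "ms_admissible \<Lambda> (Z, R) (sptop, spsh) (lift_point, \<kappa>)"
    "ms_comp (Z, R) (sptop, spsh) (Y, Q) (epf, \<epsilon>) (lift_point, \<kappa>) = (h, \<eta>)"
    using lift_exists by blast
  show ?thesis
  proof (rule ex1I[of _ "(lift_point, \<kappa>)"])
    fix \<mu> assume m: "\<mu> \<in> ms_hom L (Z, R) (sptop, spsh) \<and> ms_admissible \<Lambda> (Z, R) (sptop, spsh) \<mu> \<and>
      ms_comp (Z, R) (sptop, spsh) (Y, Q) (epf, \<epsilon>) \<mu> = (h, \<eta>)"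
    obtain k \<nu> where \<mu>: "\<mu> = (k, \<nu>)" by force
    note u = lift_unique[of k \<nu>] lift_unique[OF \<kappa>]
    have "(k, \<nu>) = (lift_point, \<kappa>)"
      by (rule ms_hom_eqI[OF ZR(1) spsh_sheaf _ \<kappa>(1)]) (use m u in \<open>auto simp del: ms_comp.simps ms_hom.simps ms_admissible.simps simp: \<mu>\<close>)
    then show "\<mu> = (lift_point, \<kappa>)" by (simp add: \<mu>)
  qed (use \<kappa> in blast)
qed

end

section \<open>Size\<close>

lemma lepoll_linear: "A \<lesssim> B \<or> B \<lesssim> A"
  using ordLeq_total[OF card_of_Well_order card_of_Well_order, of A B]
  by (simp add: lepoll_def card_of_ordLeq)

lemma Pow_lepoll_mono: "A \<lesssim> B \<Longrightarrow> Pow A \<lesssim> Pow B"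
  unfolding lepoll_def by (metis image_Pow_mono inj_on_image_Pow)

lemma times_lepoll_infinite:
  assumes "infinite A" "B \<lesssim> A" "C \<lesssim> A"
  shows "B \<times> C \<lesssim> A"
proof -
  have "A \<times> A \<approx> A" using card_of_Times_same_infinite[OF assms(1)] by (simp add: eqpoll_iff_card_of_ordIso)
  then show ?thesis using times_lepoll_mono[OF assms(2,3)] lepoll_trans2 by blast
qed

lemma UN_lepoll_infinite:
  fixes B :: "nat \<Rightarrow> 'b set"
  assumes A: "infinite A" and B: "\<And>n. B n \<lesssim> A"
  shows "(\<Union>n. B n) \<lesssim> A"
proof -
  obtain f where f: "\<And>n. inj_on (f n) (B n) \<and> f n ` B n \<subseteq> A" using B unfolding lepoll_def by metis
  \<comment> \<open>The least index of a set containing \<open>x\<close>, paired with the code of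
    \<open>x\<close> in that set, gives an injection into \<open>UNIV \<times> A\<close>.\<close>
  define i where "i x = (LEAST n. x \<in> B n)" for x
  have i: "x \<in> B (i x)" if "x \<in> (\<Union>n. B n)" for x using that unfolding i_def by (auto intro: LeastI)
  have "inj_on (\<lambda>x. (i x, f (i x) x)) (\<Union>n. B n)"
    by (rule inj_onI) (metis (no_types, lifting) Pair_inject f i inj_onD)
  moreover have "(\<lambda>x. (i x, f (i x) x)) ` (\<Union>n. B n) \<subseteq> UNIV \<times> A" using f i by blast
  ultimately have "(\<Union>n. B n) \<lesssim> (UNIV :: nat set) \<times> A" unfolding lepoll_def by blast
  also have "\<dots> \<lesssim> A" using A infinite_le_lepoll by (intro times_lepoll_infinite) auto
  finally show ?thesis .
qed

lemma lists_lepoll_infinite: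
  assumes A: "infinite A" and B: "B \<lesssim> A"
  shows "lists B \<lesssim> A"
proof -
  have "{xs \<in> lists B. length xs = n} \<lesssim> A" for n
  proof (induction n)
    case 0
    have "{xs \<in> lists B. length xs = 0} = {[]}" by auto
    then show ?case using A by (simp add: finite_lepoll_infinite)
  next
    case (Suc n)
    have "{xs \<in> lists B. length xs = Suc n} \<subseteq> (\<lambda>(x, xs). x # xs) ` (B \<times> {xs \<in> lists B. length xs = n})"
    proof
      fix xs assume "xs \<in> {xs \<in> lists B. length xs = Suc n}"
      then show "xs \<in> (\<lambda>(x, xs). x # xs) ` (B \<times> {xs \<in> lists B. length xs = n})"
        by (cases xs) auto
    qed
    then have "{xs \<in> lists B. length xs = Suc n} \<lesssim> B \<times> {xs \<in> lists B. length xs = n}"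
      by (rule subset_image_lepoll)
    also have "\<dots> \<lesssim> A" using times_lepoll_infinite[OF A B Suc] .
    finally show ?case .
  qed
  from UN_lepoll_infinite[OF A this] have "(\<Union>n. {xs \<in> lists B. length xs = n}) \<lesssim> A" .
  moreover have "(\<Union>n. {xs \<in> lists B. length xs = n}) = lists B" by blast
  ultimately show ?thesis by simp
qed

lemma Plus_lepoll_infinite:
  assumes A: "infinite A" and "B \<lesssim> A" "C \<lesssim> A"
  shows "B <+> C \<lesssim> A"
proof -
  have 1: "(\<Union>n::nat. if n = 0 then Inl ` B else Inr ` C) \<lesssim> A"
    by (rule UN_lepoll_infinite) (use assms in auto)
  have 2: "B <+> C \<subseteq> (\<Union>n::nat. if n = 0 then Inl ` B else Inr ` C)"
    by (auto split: if_splits)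
  show ?thesis by (rule lepoll_trans[OF subset_imp_lepoll[OF 2] 1])
qed

text \<open>Terms, formulas and words are all obtained from labels by constructors taking lists, so
  one bound serves the three datatypes.\<close>

inductive_set gen :: "'l set \<Rightarrow> ('l \<Rightarrow> 'w list \<Rightarrow> 'w) \<Rightarrow> 'w set" for Lab c where
  gen: "l \<in> Lab \<Longrightarrow> ws \<in> lists (gen Lab c) \<Longrightarrow> c l ws \<in> gen Lab c"

lemma gen_lepoll:
  assumes A: "infinite A" and L: "Lab \<lesssim> A"
  shows "gen Lab c \<lesssim> A"
proof -
  \<comment> \<open>Elements of nesting depth at most \<open>n\<close>: \<open>W 0\<close> is empty
    and \<open>W 1\<close> consists of the elements \<open>c l []\<close>.\<close>
  define W where "W n = ((\<lambda>S. (\<lambda>(l, ws). c l ws) ` (Lab \<times> lists S)) ^^ n) {}" for n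
  have W0: "W 0 = {}" and WS: "W (Suc n) = (\<lambda>(l, ws). c l ws) ` (Lab \<times> lists (W n))" for n
    by (simp_all add: W_def)
  have small: "W n \<lesssim> A" for n
  proof (induction n)
    case (Suc n)
    then have "Lab \<times> lists (W n) \<lesssim> A" using times_lepoll_infinite[OF A L lists_lepoll_infinite[OF A]] by blast
    then show ?case unfolding WS using image_lepoll lepoll_trans by blast
  qed (simp add: W0)
  have mono1: "W n \<subseteq> W (Suc n)" for n
  proof (induction n)
    case (Suc n)
    then have "lists (W n) \<subseteq> lists (W (Suc n))" by (rule lists_mono)
    then show ?case unfolding WS[of "Suc n"] unfolding WS[of n] by blast
  qed (simp add: W0)
  have mono: "W m \<subseteq> W n" if "m \<le> n" for m n using lift_Suc_mono_le[of W, OF mono1 that] .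
  have sub: "gen Lab c \<subseteq> (\<Union>n. W n)"
  proof
    fix w assume "w \<in> gen Lab c"
    then show "w \<in> (\<Union>n. W n)"
    proof induction
      case (gen l ws)
      have "\<exists>n. ws \<in> lists (W n)"
        using gen(2)
      proof (induction ws)
        case (Cons a ws)
        then obtain m n where mn: "a \<in> W m" "ws \<in> lists (W n)" by auto
        have "a \<in> W (max m n)" by (rule subsetD[OF mono mn(1)]) simp
        moreover have "ws \<in> lists (W (max m n))" by (rule subsetD[OF lists_mono[OF mono] mn(2)]) simp
        ultimately have "a # ws \<in> lists (W (max m n))" by (rule lists.Cons)
        then show ?case by (rule exI)
      qed auto
      then obtain n where "ws \<in> lists (W n)" by blast
      then have "c l ws \<in> W (Suc n)" unfolding WS using gen(1) by blast
      then show ?case by blast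
    qed
  qed
  show ?thesis by (rule lepoll_trans[OF subset_imp_lepoll[OF sub] UN_lepoll_infinite[OF A small]])
qed

fun tm_con :: "nat + 'f \<Rightarrow> 'f tm list \<Rightarrow> 'f tm" where
  "tm_con (Inl i) ts = Var i"
| "tm_con (Inr F) ts = Fun F ts"

text \<open>A surjection onto the well-formed formulas is enough for an upper bound. The number in
  the label separates connectives, relations and equations, and the length of the argument list
  tells the connectives apart.\<close>

fun fm_con :: "nat \<times> 'r option \<times> 'f tm list \<Rightarrow> ('f, 'r) fm list \<Rightarrow> ('f, 'r) fm" where
  "fm_con (Suc 0, Some R, ts) _ = Rel R ts"
| "fm_con (Suc (Suc 0), _, [s, t]) _ = Eqn s t"
| "fm_con (_, _, []) [\<phi>, \<psi>] = Conj \<phi> \<psi>"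
| "fm_con (0, _, _) [\<phi>] = Exi \<phi>"
| "fm_con (0, _, _) [\<phi>, \<psi>, \<chi>] = Disj \<phi> \<psi>"
| "fm_con (0, _, _) _ = Truth"
| "fm_con _ _ = Falsity"

fun word_con :: "'c + ('f, 'r) fm \<Rightarrow> ('f, 'r, 'c) word list \<Rightarrow> ('f, 'r, 'c) word" where
  "word_con (Inl c) ws = Par c"
| "word_con (Inr \<chi>) ws = Wit \<chi> ws"

lemma tms_lepoll:
  assumes A: "infinite A" and F: "funs L \<lesssim> A"
  shows "{t. \<exists>n. wf_tm L n t} \<lesssim> A"
proof -
  have "t \<in> gen (UNIV <+> funs L) tm_con" if "wf_tm L n t" for t n
    using that
  proof (induction t)
    case (Var i)
    show ?case using gen.gen[of "Inl i" "UNIV <+> funs L" "[]" tm_con] InlI[of i UNIV "funs L"] by simp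
  next
    case (Fun F ts)
    then have "ts \<in> lists (gen (UNIV <+> funs L) tm_con)" by auto
    then show ?case using gen.gen[of "Inr F" "UNIV <+> funs L" ts tm_con] InrI[of F "funs L" UNIV] Fun.prems by simp
  qed
  then have sub: "{t. \<exists>n. wf_tm L n t} \<subseteq> gen (UNIV <+> funs L) tm_con" by blast
  have N: "(UNIV :: nat set) \<lesssim> A" using A infinite_le_lepoll by blast
  show ?thesis
    by (rule lepoll_trans[OF subset_imp_lepoll[OF sub] gen_lepoll[OF A Plus_lepoll_infinite[OF A N F]]])
qed

lemma fms_lepoll:
  fixes L :: "('f, 'r) lang"
  assumes A: "infinite A" and F: "funs L \<lesssim> A" and R: "rels L \<lesssim> A"
  shows "{\<phi>. \<exists>n. wf_fm L n \<phi>} \<lesssim> A"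
proof -
  let ?T = "{t. \<exists>n. wf_tm L n t}"
  let ?O = "insert None (Some ` rels L)"
  let ?Lab = "(UNIV :: nat set) \<times> ?O \<times> lists ?T"
  have N: "(UNIV :: nat set) \<lesssim> A" using A infinite_le_lepoll by blast
  have "?O = (\<Union>n::nat. if n = 0 then {None} else Some ` rels L)" by (auto split: if_splits)
  also have "\<dots> \<lesssim> A"
    by (rule UN_lepoll_infinite) (use A R in \<open>auto simp: finite_lepoll_infinite\<close>)
  finally have O: "?O \<lesssim> A" .
  have Lab: "?Lab \<lesssim> A"
    by (intro times_lepoll_infinite A N O lists_lepoll_infinite tms_lepoll F)
  let ?G = "gen ?Lab (fm_con :: _ \<Rightarrow> ('f, 'r) fm list \<Rightarrow> _)"
  have "\<phi> \<in> ?G" if "wf_fm L n \<phi>" for \<phi> n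
    using that
  proof (induction \<phi> arbitrary: n)
    case Truth
    then show ?case using gen.gen[of "(0, None, [])" ?Lab "[]" fm_con] by simp
  next
    case (Rel R ts)
    then have "ts \<in> lists ?T" by auto
    then show ?case using gen.gen[of "(1, Some R, ts)" ?Lab "[]" fm_con] Rel by simp
  next
    case (Eqn s t)
    then have "[s, t] \<in> lists ?T" by auto
    then show ?case using gen.gen[of "(2, None, [s, t])" ?Lab "[]" fm_con] by (simp add: numeral_2_eq_2)
  next
    case (Conj \<phi> \<psi>)
    then have "[\<phi>, \<psi>] \<in> lists ?G" by auto
    then show ?case using gen.gen[of "(0, None, [])" ?Lab "[\<phi>, \<psi>]" fm_con] by simp
  next
    case (Exi \<phi>)
    then have "[\<phi>] \<in> lists ?G" by auto
    then show ?case using gen.gen[of "(0, None, [])" ?Lab "[\<phi>]" fm_con] by simp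
  next
    case Falsity
    then show ?case using gen.gen[of "(Suc 0, None, [])" ?Lab "[]" fm_con] by simp
  next
    case (Disj \<phi> \<psi>)
    \<comment> \<open>The argument is doubled because two arguments already encode
      \<open>Conj\<close>.\<close>
    then have "[\<phi>, \<psi>, \<psi>] \<in> lists ?G" by auto
    then show ?case using gen.gen[of "(0, None, [])" ?Lab "[\<phi>, \<psi>, \<psi>]" fm_con] by simp
  qed
  then have sub: "{\<phi>. \<exists>n. wf_fm L n \<phi>} \<subseteq> ?G" by blast
  show ?thesis by (rule lepoll_trans[OF subset_imp_lepoll[OF sub] gen_lepoll[OF A Lab]])
qed

text \<open>Cardinalities are linearly ordered, so among finitely many members of \<U> one dominates
  the others.\<close>

lemma universe_bound:
  assumes "\<exists>A\<in>\<U>. infinite A" "small \<U> B" "small \<U> C" "small \<U> D" "small \<U> E"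
  obtains A where "A \<in> \<U>" "infinite A" "B \<lesssim> A" "C \<lesssim> A" "D \<lesssim> A" "E \<lesssim> A"
proof -
  have max: "\<exists>C\<in>\<U>. A \<lesssim> C \<and> B \<lesssim> C" if "A \<in> \<U>" "B \<in> \<U>" for A B using lepoll_linear that by blast
  obtain A1 A2 A3 A4 A5 where A: "A1 \<in> \<U>" "infinite A1" "A2 \<in> \<U>" "B \<lesssim> A2" "A3 \<in> \<U>" "C \<lesssim> A3"
    "A4 \<in> \<U>" "D \<lesssim> A4" "A5 \<in> \<U>" "E \<lesssim> A5" using assms unfolding small_def by blast
  obtain C1 where C1: "C1 \<in> \<U>" "A1 \<lesssim> C1" "A2 \<lesssim> C1" using max[OF A(1,3)] by blast
  obtain C2 where C2: "C2 \<in> \<U>" "C1 \<lesssim> C2" "A3 \<lesssim> C2" using max[OF C1(1) A(5)] by blast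
  obtain C3 where C3: "C3 \<in> \<U>" "C2 \<lesssim> C3" "A4 \<lesssim> C3" using max[OF C2(1) A(7)] by blast
  obtain C4 where C4: "C4 \<in> \<U>" "C3 \<lesssim> C4" "A5 \<lesssim> C4" using max[OF C3(1) A(9)] by blast
  have c: "C1 \<lesssim> C4" "C2 \<lesssim> C4" using C2 C3 C4 lepoll_trans by blast+
  have "infinite C4"
    using A(2) lepoll_trans[OF C1(2) c(1)] infinite_le_lepoll lepoll_trans by metis
  moreover have "B \<lesssim> C4" using lepoll_trans[OF A(4) lepoll_trans[OF C1(3) c(1)]] .
  moreover have "C \<lesssim> C4" using lepoll_trans[OF A(6) lepoll_trans[OF C2(3) c(2)]] .
  moreover have "D \<lesssim> C4" using lepoll_trans[OF A(8) lepoll_trans[OF C3(3) C4(2)]] .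
  moreover have "E \<lesssim> C4" using lepoll_trans[OF A(10) C4(3)] .
  ultimately show ?thesis using that C4(1) by blast
qed

context over_base
begin

definition legal :: "('f, 'r, 'u) gword set" where
  "legal = gen ({(U, q). openin Y U \<and> q \<in> univ (sec Q U)} <+> {\<phi>. \<exists>n. wf_fm L n \<phi>}) word_con"

lemma ev_legal: "ev B D \<alpha> w b \<Longrightarrow> D \<subseteq> {(U, q). openin Y U \<and> q \<in> univ (sec Q U)} \<Longrightarrow> w \<in> legal"
proof (induction rule: ev.induct)
  case (ev_Par c)
  then have c: "c \<in> {(U, q). openin Y U \<and> q \<in> univ (sec Q U)}" by blast
  show ?case unfolding legal_def
    using gen.gen[OF InlI[OF c] lists.Nil, where c = word_con] by simp
next
  case (ev_Wit ws \<chi> bs b)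
  have "ws \<in> lists legal" using ev_Wit.IH ev_Wit.prems by (auto simp: list_all2_conv_all_nth in_set_conv_nth)
  then have ws: "ws \<in> lists (gen ({(U, q). openin Y U \<and> q \<in> univ (sec Q U)} <+> {\<phi>. \<exists>n. wf_fm L n \<phi>}) word_con)"
    unfolding legal_def .
  have x: "\<chi> \<in> {\<phi>. \<exists>n. wf_fm L n \<phi>}" using K_wf[OF ev_Wit.hyps(1)] by auto
  show ?case unfolding legal_def using gen.gen[OF InrI[OF x] ws] by simp
qed

lemma spec_points_defd_legal:
  assumes "(y, S) \<in> spec_points" "defd S w"
  shows "w \<in> legal"
proof -
  have S: "closed S" "params_in (local_params Y Q y) S" using assms by (auto simp: spec_points_def)
  show ?thesis by (rule ev_legal[OF TM_ev[OF S assms(2)]]) (auto simp: local_params_def)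
qed

lemma spec_points_legal:
  assumes "(y, S) \<in> spec_points"
  shows "S \<subseteq> {\<phi>. \<exists>n. wf_fm L n \<phi>} \<times> lists legal"
proof
  fix f assume f: "f \<in> S"
  obtain \<theta> ws where [simp]: "f = (\<theta>, ws)" by force
  have S: "closed S" using assms by (simp add: spec_points_def)
  have "ws \<in> lists legal" using closed_def1[OF S, of \<theta> ws] spec_points_defd_legal[OF assms] f by auto
  moreover have "wf_fm L (length ws) \<theta>" using K_wf[OF closed_K[OF S]] f by simp
  ultimately show "f \<in> {\<phi>. \<exists>n. wf_fm L n \<phi>} \<times> lists legal" by auto
qed

lemma ex_spectrum:
  fixes A :: "'a set" and B :: "'u set"
  assumes A: "infinite A" "topspace Y \<lesssim> A" "{(U, q). openin Y U \<and> q \<in> univ (sec Q U)} \<lesssim> A"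
      "funs L \<lesssim> A" "rels L \<lesssim> A"
    and B: "Pow (Pow A) \<lesssim> B"
  obtains codes yy SS enc where "coded_spectrum L T0 T \<Lambda> X P Y Q p \<pi> codes yy SS enc"
    "codes \<lesssim> B" "{(U, e). openin (spectrum.sptop Y codes yy SS) U \<and> e \<in> univ (sec (spectrum.spsh L Y codes yy SS enc) U)} \<lesssim> B"
proof -
  let ?F = "{\<phi>. \<exists>n. wf_fm L n \<phi>}"
  have F: "?F \<lesssim> A" using fms_lepoll[OF A(1,4,5)] .
  have leg: "legal \<lesssim> A" unfolding legal_def
    using gen_lepoll[OF A(1) Plus_lepoll_infinite[OF A(1,3) F]] .
  have P1: "A \<lesssim> Pow A" "Pow A \<lesssim> Pow (Pow A)" using lepoll_Pow_self by blast+
  have inf: "infinite (Pow A)" "infinite (Pow (Pow A))" using A(1) by simp_all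
  have sub: "spec_points \<subseteq> topspace Y \<times> Pow (?F \<times> lists legal)"
  proof
    fix a assume a: "a \<in> spec_points"
    obtain y S where [simp]: "a = (y, S)" by force
    have "y \<in> topspace Y" using a by (simp add: spec_points_def)
    then show "a \<in> topspace Y \<times> Pow (?F \<times> lists legal)" using spec_points_legal[of y S] a by auto
  qed
  have "topspace Y \<times> Pow (?F \<times> lists legal) \<lesssim> Pow A"
    by (rule times_lepoll_infinite[OF inf(1) lepoll_trans[OF A(2) P1(1)]
          Pow_lepoll_mono[OF times_lepoll_infinite[OF A(1) F lists_lepoll_infinite[OF A(1) leg]]]])
  with subset_imp_lepoll[OF sub] have spec_points: "spec_points \<lesssim> Pow A" by (rule lepoll_trans)
  have "spec_points \<lesssim> B" by (rule lepoll_trans[OF spec_points lepoll_trans[OF P1(2) B]])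
  then obtain f where f: "inj_on f spec_points" "f ` spec_points \<subseteq> B" by (auto simp: lepoll_def)
  define codes where "codes = f ` spec_points"
  define yy where "yy = fst \<circ> inv_into spec_points f"
  define SS where "SS = snd \<circ> inv_into spec_points f"
  have "bij_betw (\<lambda>w. (yy w, SS w)) codes spec_points"
    using inj_on_imp_bij_betw[OF f(1)] by (simp add: yy_def SS_def codes_def bij_betw_inv_into)
  \<comment> \<open>Points, topology and sections are formed before any coding of sections, so a
    dummy \<open>undefined\<close> stands for \<open>enc\<close> until the sections have been
    counted.\<close>
  then interpret S0: spectrum L T0 T \<Lambda> X P Y Q p \<pi> codes yy SS undefined
    by unfold_locales
  let ?W = "{(U, s). openin S0.sptop U \<and> s \<in> S0.Secs U}"
  \<comment> \<open>The values of a section are sets of words, so it is recorded by the pairs of a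
    point and a word in the value there. This is a subset of
    \<open>codes \<times> legal\<close>.\<close>
  let ?g = "\<lambda>(U, s). (U, {(w, x). w \<in> U \<and> x \<in> s w})"
  have pcA: "codes \<lesssim> Pow A" unfolding codes_def using lepoll_trans[OF image_lepoll spec_points] .
  have inj: "inj_on ?g ?W"
  proof (rule inj_onI)
    fix a b assume ab: "a \<in> ?W" "b \<in> ?W" "?g a = ?g b"
    obtain U s U' s' where [simp]: "a = (U, s)" "b = (U', s')" by (metis surj_pair)
    have U: "U' = U" and eq: "{(w, x). w \<in> U \<and> x \<in> s w} = {(w, x). w \<in> U' \<and> x \<in> s' w}" using ab(3) by auto
    have "s w = s' w" if "w \<in> U" for w using eq that U by (auto simp: set_eq_iff)
    moreover have "s \<in> extensional U" "s' \<in> extensional U" using ab(1,2) U by (simp_all add: S0.Secs_def)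
    ultimately have "s = s'" by (intro extensionalityI)
    then show "a = b" using U by simp
  qed
  have img: "?g ` ?W \<subseteq> Pow codes \<times> Pow (codes \<times> legal)"
  proof (rule image_subsetI)
    fix a assume a: "a \<in> ?W"
    obtain U s where [simp]: "a = (U, s)" by force
    have U: "openin S0.sptop U" and s: "s \<in> S0.Secs U" using a by simp_all
    have sub: "U \<subseteq> codes" using S0.openin_codes[OF U] by blast
    have "x \<in> legal" if w: "w \<in> U" "x \<in> s w" for w x
    proof -
      have wp: "(yy w, SS w) \<in> spec_points" using S0.code w(1) sub by (auto simp: bij_betw_def)
      obtain u where "s w = cls (SS w) u" using S0.SecsE[OF s w(1)] by metis
      then have "(eq_fm, [u, x]) \<in> SS w" using w(2) by (simp add: cls_def)
      then have "defd (SS w) x" using closed_def1[OF S0.pt(2)] w(1) sub by fastforce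
      then show ?thesis using spec_points_defd_legal[OF wp] by blast
    qed
    then show "?g a \<in> Pow codes \<times> Pow (codes \<times> legal)" using sub by auto
  qed
  have "?W \<lesssim> Pow codes \<times> Pow (codes \<times> legal)" using inj img unfolding lepoll_def by blast
  also have "\<dots> \<lesssim> Pow (Pow A)"
    by (rule times_lepoll_infinite[OF inf(2) Pow_lepoll_mono[OF pcA]
          Pow_lepoll_mono[OF times_lepoll_infinite[OF inf(1) pcA lepoll_trans[OF leg P1(1)]]]])
  also have "\<dots> \<lesssim> B" by (rule B)
  finally have W: "?W \<lesssim> B" .
  then obtain j :: "'u set \<times> ('u \<Rightarrow> ('f, 'r, 'u) gword set) \<Rightarrow> 'u" where j: "inj_on j ?W" by (auto simp: lepoll_def)
  define enc where "enc U s = j (U, s)" for U s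
  interpret S1: coded_spectrum L T0 T \<Lambda> X P Y Q p \<pi> codes yy SS enc
  proof unfold_locales
    fix U assume "openin S0.sptop U"
    then show "inj_on (enc U) (S0.Secs U)" using j by (auto simp: enc_def inj_on_def)
  qed
  have "{(U, e). openin S0.sptop U \<and> e \<in> univ (sec S1.spsh U)} \<subseteq> (\<lambda>(U, s). (U, enc U s)) ` ?W"
    by (auto simp: S1.sec_univ)
  then have "{(U, e). openin S0.sptop U \<and> e \<in> univ (sec S1.spsh U)} \<lesssim> B"
    by (rule lepoll_trans[OF subset_image_lepoll W])
  then show ?thesis
    by (rule that[OF S1.coded_spectrum_axioms lepoll_trans[OF pcA lepoll_trans[OF P1(2) B]]])
qed

end

section \<open>The right adjoint\<close>

context coste
begin

text \<open>\<open>A\<close> bounds the data of the base and the language, \<open>B\<close> bounds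
  the spectrum, and membership of \<open>B\<close> in \<V> makes the spectrum an object of the
  category.\<close>

lemma universal_arrow:
  fixes \<V> :: "'u set set" and A :: "'a set" and B :: "'u set"
  assumes XP: "T_modelled_space L T0 T (X, P)"
    and d: "((Y, Q), (p, \<pi>)) \<in> Obj (slice (T0_ModSp \<V> L T0) (X, P))"
    and A: "infinite A" "topspace Y \<lesssim> A" "{(U, q). openin Y U \<and> q \<in> univ (sec Q U)} \<lesssim> A"
      "funs L \<lesssim> A" "rels L \<lesssim> A"
    and B: "Pow (Pow A) \<lesssim> B" "B \<in> \<V>"
  defines "CA \<equiv> slice (A_ModSp \<V> L T0 T \<Lambda>) (X, P)" and "CT \<equiv> slice (T0_ModSp \<V> L T0) (X, P)"
  shows "\<exists>g e. g \<in> Obj CA \<and> e \<in> Hom CT g ((Y, Q), (p, \<pi>)) \<and>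
    (\<forall>c\<in>Obj CA. \<forall>k\<in>Hom CT c ((Y, Q), (p, \<pi>)).
      \<exists>!h. h \<in> Hom CA c g \<and> Comp CT c g ((Y, Q), (p, \<pi>)) e h = k)"
proof -
  have sh: "sheaf_of_models L T0 X P" "sheaf_of_models L T0 Y Q" and p: "(p, \<pi>) \<in> ms_hom L (Y, Q) (X, P)"
    using XP d by (auto simp: slice_def T0_ModSp_def)
  interpret over_base L T0 T \<Lambda> X P Y Q p \<pi>
    by unfold_locales (fact sh p)+
  obtain codes yy SS enc where cs: "coded_spectrum L T0 T \<Lambda> X P Y Q p \<pi> codes yy SS enc"
    and small: "codes \<lesssim> B" "{(U, e). openin (spectrum.sptop Y codes yy SS) U \<and> e \<in> univ (sec (spectrum.spsh L Y codes yy SS enc) U)} \<lesssim> B"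
    using ex_spectrum[OF A B(1)] by blast
  interpret coded_spectrum L T0 T \<Lambda> X P Y Q p \<pi> codes yy SS enc by (rule cs)
  obtain \<epsilon> where \<epsilon>: "counit_comorphism \<epsilon>" using ex_counit by blast
  then have eh: "(epf, \<epsilon>) \<in> ms_hom L (sptop, spsh) (Y, Q)" by (simp add: counit_comorphism_def)
  let ?S = "(sptop, spsh)"
  let ?q = "ms_comp ?S (Y, Q) (X, P) (p, \<pi>) (epf, \<epsilon>)"
  have qh: "?q \<in> ms_hom L ?S (X, P)" using ms_comp_hom[OF spsh_sheaf YQ sh(1) eh p] by metis
  have Ssm: "small_space \<V> ?S" using small B(2) by (auto simp: small_def)
  have gO: "(?S, ?q) \<in> Obj CA"
    using spec_T_modelled Ssm qh counit_admissible[OF \<epsilon>]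
    by (simp add: CA_def slice_def A_ModSp_def del: ms_comp.simps ms_hom.simps ms_admissible.simps small_space.simps
        T_modelled_space.simps)
  moreover have eH: "(epf, \<epsilon>) \<in> Hom CT (?S, ?q) ((Y, Q), (p, \<pi>))"
    using eh by (simp add: CT_def slice_def T0_ModSp_def del: ms_comp.simps ms_hom.simps)
  moreover have "\<exists>!h. h \<in> Hom CA c (?S, ?q) \<and> Comp CT c (?S, ?q) ((Y, Q), (p, \<pi>)) (epf, \<epsilon>) h = k"
    if c: "c \<in> Obj CA" and k: "k \<in> Hom CT c ((Y, Q), (p, \<pi>))" for c k
  proof -
    obtain Z R r where cr: "c = ((Z, R), r)" by (metis surj_pair)
    obtain h \<eta> where kh: "k = (h, \<eta>)" by force
    have Z: "T_modelled_space L T0 T (Z, R)" "ms_admissible \<Lambda> (Z, R) (X, P) r"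
      using c by (simp_all add: cr CA_def slice_def A_ModSp_def del: ms_admissible.simps T_modelled_space.simps)
    have kH: "(h, \<eta>) \<in> ms_hom L (Z, R) (Y, Q)" and kr: "ms_comp (Z, R) (Y, Q) (X, P) (p, \<pi>) (h, \<eta>) = r"
      using k by (simp_all add: cr kh CT_def slice_def T0_ModSp_def del: ms_comp.simps ms_hom.simps)
    have Zs: "sheaf_of_models L T0 Z R" "\<And>z. z \<in> topspace Z \<Longrightarrow> model L T (stalk Z R z)" using Z(1) by auto
    interpret lifting L T0 T \<Lambda> X P Y Q p \<pi> codes yy SS enc \<epsilon> Z R h \<eta>
      by unfold_locales (use \<epsilon> Zs kH Z(2) kr in \<open>auto simp del: ms_comp.simps ms_hom.simps ms_admissible.simps\<close>)
    have "h' \<in> Hom CA c (?S, ?q) \<and> Comp CT c (?S, ?q) ((Y, Q), (p, \<pi>)) (epf, \<epsilon>) h' = k \<longleftrightarrow>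
        h' \<in> ms_hom L (Z, R) ?S \<and> ms_admissible \<Lambda> (Z, R) ?S h' \<and> ms_comp (Z, R) ?S (Y, Q) (epf, \<epsilon>) h' = (h, \<eta>)" for h'
    proof -
      obtain h1 h2 where h': "h' = (h1, h2)" by force
      \<comment> \<open>By associativity, a factorization through the counit is automatically a
        morphism over \<open>(X, P)\<close>.\<close>
      have "ms_comp (Z, R) ?S (X, P) ?q h' = r"
        if "h' \<in> ms_hom L (Z, R) ?S" "ms_comp (Z, R) ?S (Y, Q) (epf, \<epsilon>) h' = (h, \<eta>)"
        using ms_comp_assoc[OF Zs(1) spsh_sheaf YQ sh(1) that(1)[unfolded h'] eh p] that(2) kr unfolding h' by metis
      then show ?thesis
        by (auto simp: cr kh CA_def CT_def slice_def A_ModSp_def T0_ModSp_def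
            simp del: ms_comp.simps ms_hom.simps ms_admissible.simps)
    qed
    then show ?thesis using universal by simp
  qed
  ultimately show ?thesis by blast
qed

lemma right_adjoint:
  fixes \<V> :: "'u set set"
  assumes XP: "T_modelled_space L T0 T XP" "small_space \<V> XP"
    and S: "S \<subseteq> Obj (slice (T0_ModSp \<V> L T0) XP)"
    and size: "\<And>Y Q a. ((Y, Q), a) \<in> S \<Longrightarrow> \<exists>(A :: 'u set). \<exists>B\<in>\<V>. infinite A \<and> topspace Y \<lesssim> A \<and>
      {(U, q). openin Y U \<and> q \<in> univ (sec Q U)} \<lesssim> A \<and> funs L \<lesssim> A \<and> rels L \<lesssim> A \<and> Pow (Pow A) \<lesssim> B"
  shows "has_right_adjoint_on (slice (A_ModSp \<V> L T0 T \<Lambda>) XP) (slice (T0_ModSp \<V> L T0) XP) forgetful S"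
proof (rule right_adjoint_onI[OF forgetful_functor S])
  show "XP \<in> Obj (A_ModSp \<V> L T0 T \<Lambda>)" using XP by (simp add: A_ModSp_def)
  fix d assume d: "d \<in> S"
  obtain Y Q p \<pi> where dd: "d = ((Y, Q), (p, \<pi>))" by (metis surj_pair)
  obtain X P where xp: "XP = (X, P)" by force
  obtain A :: "'u set" and B where AB: "B \<in> \<V>" "infinite A" "topspace Y \<lesssim> A"
      "{(U, q). openin Y U \<and> q \<in> univ (sec Q U)} \<lesssim> A" "funs L \<lesssim> A" "rels L \<lesssim> A" "Pow (Pow A) \<lesssim> B"
    using size[of Y Q "(p, \<pi>)"] d dd by blast
  have "((Y, Q), (p, \<pi>)) \<in> Obj (slice (T0_ModSp \<V> L T0) (X, P))" using S d dd xp by blast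
  from universal_arrow[OF XP(1)[unfolded xp] this AB(2-7) AB(1)]
  show "\<exists>g e. g \<in> Obj (slice (A_ModSp \<V> L T0 T \<Lambda>) XP) \<and>
       e \<in> Hom (slice (T0_ModSp \<V> L T0) XP) (fst forgetful g) d \<and>
       (\<forall>c\<in>Obj (slice (A_ModSp \<V> L T0 T \<Lambda>) XP).
           \<forall>k\<in>Hom (slice (T0_ModSp \<V> L T0) XP) (fst forgetful c) d.
              \<exists>!h. h \<in> Hom (slice (A_ModSp \<V> L T0 T \<Lambda>) XP) c g \<and>
                   Comp (slice (T0_ModSp \<V> L T0) XP) (fst forgetful c) (fst forgetful g) d e (snd forgetful c g h) = k)"
    unfolding forgetful_def dd xp by simp
qed

end

(* The first conjunct is the theorem for the categories of spaces in a universe. The second one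
   needs no universe: it provides the right adjoint on the U-small objects, in the categories of
   V-small objects. *)
theorem theorem4p1:
  fixes L :: "('f, 'r) lang"
    and T0 T :: "('f, 'r) sequent set"
    and \<Lambda> :: "('f, 'r) horn_pair set"
  assumes "spatial_coste_context L T0 T \<Lambda>"
  shows
    "(\<forall>(\<U> :: 'u set set) (XP :: ('f, 'r, 'u, 'u) mspace).
        universe \<U> \<and> small_lang \<U> L \<and> small_space \<U> XP \<and> T_modelled_space L T0 T XP \<longrightarrow>
        has_right_adjoint
          (slice (A_ModSp \<U> L T0 T \<Lambda>) XP) (slice (T0_ModSp \<U> L T0) XP) forgetful) \<and>
     (\<forall>(\<U> :: 'u set set) (\<V> :: 'u set set) (XP :: ('f, 'r, 'u, 'u) mspace).
        enlargement \<U> \<V> \<and> small_lang \<U> L \<and> small_space \<V> XP \<and> T_modelled_space L T0 T XP \<longrightarrow>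
        has_right_adjoint_on
          (slice (A_ModSp \<V> L T0 T \<Lambda>) XP) (slice (T0_ModSp \<V> L T0) XP) forgetful
          {(YQ, p) \<in> Obj (slice (T0_ModSp \<V> L T0) XP). small_space \<U> YQ})"
proof (rule HOL.conjI, intro allI impI)
  interpret coste L T0 T \<Lambda> by unfold_locales (fact assms)
  fix \<U> :: "'u set set" and XP :: "('f, 'r, 'u, 'u) mspace"
  assume U: "universe \<U> \<and> small_lang \<U> L \<and> small_space \<U> XP \<and> T_modelled_space L T0 T XP"
  show "has_right_adjoint (slice (A_ModSp \<U> L T0 T \<Lambda>) XP) (slice (T0_ModSp \<U> L T0) XP) forgetful"
    unfolding has_right_adjoint_def
  proof (rule right_adjoint)
    fix Y Q a assume "((Y, Q), a) \<in> Obj (slice (T0_ModSp \<U> L T0) XP)"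
    then have sm: "small \<U> (topspace Y)" "small \<U> {(U, q). openin Y U \<and> q \<in> univ (sec Q U)}"
      by (auto simp: slice_def T0_ModSp_def)
    have inf: "\<exists>A\<in>\<U>. infinite A" using U by (simp add: universe_def)
    obtain A where A: "A \<in> \<U>" "infinite A" "topspace Y \<lesssim> A"
      "{(U, q). openin Y U \<and> q \<in> univ (sec Q U)} \<lesssim> A" "funs L \<lesssim> A" "rels L \<lesssim> A"
      using universe_bound[OF inf sm, of "funs L" "rels L"] U by (auto simp: small_lang_def)
    \<comment> \<open>A universe is closed under power sets, so the two that the spectrum requires
      are taken one after the other inside \<U>.\<close>
    obtain B where B: "B \<in> \<U>" "Pow A \<lesssim> B" using U A(1) unfolding universe_def small_def by blast
    obtain C where C: "C \<in> \<U>" "Pow B \<lesssim> C" using U B(1) unfolding universe_def small_def by blast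
    have "Pow (Pow A) \<lesssim> C" using lepoll_trans[OF Pow_lepoll_mono[OF B(2)] C(2)] .
    then show "\<exists>A::'u set. \<exists>B\<in>\<U>. infinite A \<and> topspace Y \<lesssim> A \<and>
      {(U, q). openin Y U \<and> q \<in> univ (sec Q U)} \<lesssim> A \<and> funs L \<lesssim> A \<and> rels L \<lesssim> A \<and> Pow (Pow A) \<lesssim> B"
      using A C(1) by blast
  qed (use U in auto)
next
  interpret coste L T0 T \<Lambda> by unfold_locales (fact assms)
  show "\<forall>(\<U> :: 'u set set) (\<V> :: 'u set set) (XP :: ('f, 'r, 'u, 'u) mspace).
        enlargement \<U> \<V> \<and> small_lang \<U> L \<and> small_space \<V> XP \<and> T_modelled_space L T0 T XP \<longrightarrow>
        has_right_adjoint_on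
          (slice (A_ModSp \<V> L T0 T \<Lambda>) XP) (slice (T0_ModSp \<V> L T0) XP) forgetful
          {(YQ, p) \<in> Obj (slice (T0_ModSp \<V> L T0) XP). small_space \<U> YQ}"
  proof (intro allI impI)
    fix \<U> \<V> :: "'u set set" and XP :: "('f, 'r, 'u, 'u) mspace"
    assume U: "enlargement \<U> \<V> \<and> small_lang \<U> L \<and> small_space \<V> XP \<and> T_modelled_space L T0 T XP"
    let ?S = "{(YQ, p) \<in> Obj (slice (T0_ModSp \<V> L T0) XP). small_space \<U> YQ}"
    show "has_right_adjoint_on (slice (A_ModSp \<V> L T0 T \<Lambda>) XP) (slice (T0_ModSp \<V> L T0) XP) forgetful ?S"
    proof (rule right_adjoint)
      fix Y Q a assume "((Y, Q), a) \<in> ?S"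
      then have sm: "small \<U> (topspace Y)" "small \<U> {(U, q). openin Y U \<and> q \<in> univ (sec Q U)}" by auto
      have inf: "\<exists>A\<in>\<U>. infinite A" using U by (simp add: enlargement_def)
      obtain A where A: "A \<in> \<U>" "infinite A" "topspace Y \<lesssim> A"
        "{(U, q). openin Y U \<and> q \<in> univ (sec Q U)} \<lesssim> A" "funs L \<lesssim> A" "rels L \<lesssim> A"
        using universe_bound[OF inf sm, of "funs L" "rels L"] U by (auto simp: small_lang_def)
      \<comment> \<open>Here both power sets are absorbed by the passage from \<U> to \<V>.\<close>
      obtain C where C: "C \<in> \<V>" "Pow (Pow A) \<lesssim> C" using U A(1) unfolding enlargement_def small_def by blast
      then show "\<exists>A::'u set. \<exists>B\<in>\<V>. infinite A \<and> topspace Y \<lesssim> A \<and>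
        {(U, q). openin Y U \<and> q \<in> univ (sec Q U)} \<lesssim> A \<and> funs L \<lesssim> A \<and> rels L \<lesssim> A \<and> Pow (Pow A) \<lesssim> B"
        using A by blast
    qed (use U in auto)
  qed
qed

end
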